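(* Fix a monadic second-order (MSO) query $\Psi(X_1, X_2, \ldots, X_k)$ with free set variables $X_1,\dots,X_k$ over the signature of unranked $\Sigma$-labelled forests. For an unranked forest $F$ that is given in compressed form by a forest straight-line program (f-SLP) $\mathcal{F}$, one can enumerate the result set $\Psi[F]$ after linear preprocessing $\mathcal{O}(|\mathcal{F}|)$ and with output-linear delay.
   Context: All complexity bounds are in data complexity: the query $\Psi$ is fixed and regarded as having constant size; the input is the f-SLP. Forests. $\Sigma$ is a finite alphabet. A forest is a finite ordered sequence of finite rooted ordered $\Sigma$-labelled trees (vertices may have arbitrarily many, linearly ordered, children), viewed as a structure $F=(V,E,R,\lambda)$: $E$ is the parent-child relation, $(u,v)\in R$ iff $v$ is the right sibling of $u$ (the roots are also chained by $R$), and $\lambda:V\to\Sigma$. The preorder number of a vertex is its position (starting with $0$) in the depth-first left-to-right preorder of $F$. For an MSO formula $\Psi(X_1,\dots,X_k)$ over this signature, $\Psi[F]=\{(S_1,\dots,S_k): S_i\subseteq V,\ (F,S_1,\dots,S_k)\models\Psi\}$. In the output, vertices of $F$ are represented by their preorder numbers. Forest algebra. Let $\ast\notin\Sigma$. A forest context is a forest over $\Sigma\cup\{\ast\}$ with exactly one occurrence of $\ast$, at a leaf. Horizontal concatenation $F_1\ominus F_2$ (defined if at most one of $F_1,F_2$ is a context) concatenates the two sequences of trees. Vertical concatenation $F_1\odot F_2$ (defined if $F_1$ is a context) replaces the unique $\ast$ in $F_1$ by $F_2$. For $a\in\Sigma$, $a$ also denotes the one-vertex tree, and $a_\ast$ the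 context $a(\ast)$. A forest algebra expression is a binary tree with inner vertices labelled $\ominus$ or $\odot$ and leaves labelled $a$ or $a_\ast$ ($a\in\Sigma$). It is valid if all operations are defined on evaluation; it then evaluates to a forest (type $0$) or a forest context (type $1$). f-SLP. A binary DAG is a vertex-labelled acyclic directed graph $(V,E,\lambda)$ with $E\subseteq V\times\{\ell,r\}\times V$ in which every vertex is either a leaf (no outgoing edges) or has exactly one outgoing $\ell$-edge (to its left child) and exactly one outgoing $r$-edge (to its right child); its size is $|V|+|E|$. Its unfolding from a vertex $A$ is the binary tree whose vertices are the paths starting in $A$, each path being labelled with the label of its terminal vertex. An f-SLP is a binary DAG $\mathcal{F}$ such that for every vertex $A$ the unfolding from $A$ is a valid forest algebra expression; $[\![A]\!]_{\mathcal F}$ denotes the value of this expression. An f-SLP for $F$ is an f-SLP with a distinguished vertex $S$ such that $[\![S]\!]_{\mathcal F}=F$. Enumeration. The machine model is the RAM with registers of word length $\mathcal{O}(|\mathcal{F}|)$ (so that preorder numbers fit in a register). An enumeration algorithm outputs, without repetition, a sequence $s_1,\dots,s_m,s_{m+1}$, where $s_1,\dots,s_m$ are exactly the elements of the set to be enumerated and $s_{m+1}$ is an end-of-enumeration marker (outputs are terminated by a separator symbol, so even an empty output has size at least $1$). The preprocessing time is the time until the algorithm starts outputting $s_1$. The delay is output-linear if, with $t_i$ the time when the algorithm starts outputting $s_i$, $t_{i+1}-t_i=\mathcal{O}(|s_i|)$ for all $1\le i\le m$, where $|s_i|$ is the number of registers occupied by $s_i$. *)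

theory Defs
  imports Main
begin

definition index_of :: "'b list \<Rightarrow> 'b \<Rightarrow> nat" where
  "index_of xs x = length (takeWhile (\<lambda>y. y \<noteq> x) xs)"


section \<open>Forests as relational structures\<close>

datatype 'a tree = Node 'a "'a tree list"

type_synonym 'a forest = "'a tree list"

text \<open>A vertex is given by its address: \<open>[i]\<close> is the root of the \<open>i\<close>-th tree, and \<open>p @ [j]\<close> is the
  \<open>j\<close>-th child of \<open>p\<close> (counting from 0).  \<open>preorder F\<close> lists all vertices with their labels in
  depth-first left-to-right order.\<close>

type_synonym vertex = "nat list"

fun preorder_tree :: "'a tree \<Rightarrow> (vertex \<times> 'a) list"
and preorder_from :: "nat \<Rightarrow> 'a forest \<Rightarrow> (vertex \<times> 'a) list" where
  "preorder_tree (Node a ts) = ([], a) # preorder_from 0 ts"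
| "preorder_from i [] = []"
| "preorder_from i (t # ts) =
     map (\<lambda>(p, a). (i # p, a)) (preorder_tree t) @ preorder_from (Suc i) ts"

definition preorder :: "'a forest \<Rightarrow> (vertex \<times> 'a) list" where
  "preorder F = preorder_from 0 F"

definition vertices :: "'a forest \<Rightarrow> vertex set" where
  "vertices F = fst ` set (preorder F)"

definition child_rel :: "'a forest \<Rightarrow> (vertex \<times> vertex) set" where
  "child_rel F = {(u, v). u \<in> vertices F \<and> v \<in> vertices F \<and> (\<exists>j. v = u @ [j])}"

text \<open>With \<open>p = []\<close> the following also chains the roots.\<close>

definition sibling_rel :: "'a forest \<Rightarrow> (vertex \<times> vertex) set" where
  "sibling_rel F = {(u, v). u \<in> vertices F \<and> v \<in> vertices F \<and>
     (\<exists>p j. u = p @ [j] \<and> v = p @ [Suc j])}"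

definition vertex_label :: "'a forest \<Rightarrow> vertex \<Rightarrow> 'a" where
  "vertex_label F v = the (map_of (preorder F) v)"

definition preorder_number :: "'a forest \<Rightarrow> vertex \<Rightarrow> nat" where
  "preorder_number F v = index_of (map fst (preorder F)) v"


section \<open>MSO queries\<close>

text \<open>Element variables and set variables are named by natural numbers, in separate name spaces.\<close>

datatype 'a mso =
    EqF nat nat
  | ChildF nat nat
  | SiblingF nat nat
  | LabelF 'a nat
  | MemF nat nat        \<comment> \<open>element variable first, set variable second\<close>
  | NotF "'a mso"
  | AndF "'a mso" "'a mso"
  | ExElem nat "'a mso"
  | ExSet nat "'a mso"

primrec free_elem :: "'a mso \<Rightarrow> nat set" where
  "free_elem (EqF x y) = {x, y}"
| "free_elem (ChildF x y) = {x, y}"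
| "free_elem (SiblingF x y) = {x, y}"
| "free_elem (LabelF a x) = {x}"
| "free_elem (MemF x X) = {x}"
| "free_elem (NotF \<phi>) = free_elem \<phi>"
| "free_elem (AndF \<phi> \<psi>) = free_elem \<phi> \<union> free_elem \<psi>"
| "free_elem (ExElem x \<phi>) = free_elem \<phi> - {x}"
| "free_elem (ExSet X \<phi>) = free_elem \<phi>"

primrec free_set :: "'a mso \<Rightarrow> nat set" where
  "free_set (EqF x y) = {}"
| "free_set (ChildF x y) = {}"
| "free_set (SiblingF x y) = {}"
| "free_set (LabelF a x) = {}"
| "free_set (MemF x X) = {X}"
| "free_set (NotF \<phi>) = free_set \<phi>"
| "free_set (AndF \<phi> \<psi>) = free_set \<phi> \<union> free_set \<psi>"
| "free_set (ExElem x \<phi>) = free_set \<phi>"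
| "free_set (ExSet X \<phi>) = free_set \<phi> - {X}"

primrec sat :: "'a forest \<Rightarrow> (nat \<Rightarrow> vertex) \<Rightarrow> (nat \<Rightarrow> vertex set) \<Rightarrow> 'a mso \<Rightarrow> bool" where
  "sat F e s (EqF x y) \<longleftrightarrow> e x = e y"
| "sat F e s (ChildF x y) \<longleftrightarrow> (e x, e y) \<in> child_rel F"
| "sat F e s (SiblingF x y) \<longleftrightarrow> (e x, e y) \<in> sibling_rel F"
| "sat F e s (LabelF a x) \<longleftrightarrow> vertex_label F (e x) = a"
| "sat F e s (MemF x X) \<longleftrightarrow> e x \<in> s X"
| "sat F e s (NotF \<phi>) \<longleftrightarrow> \<not> sat F e s \<phi>"
| "sat F e s (AndF \<phi> \<psi>) \<longleftrightarrow> sat F e s \<phi> \<and> sat F e s \<psi>"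
| "sat F e s (ExElem x \<phi>) \<longleftrightarrow> (\<exists>v \<in> vertices F. sat F (e(x := v)) s \<phi>)"
| "sat F e s (ExSet X \<phi>) \<longleftrightarrow> (\<exists>A. A \<subseteq> vertices F \<and> sat F e (s(X := A)) \<phi>)"

text \<open>The free set variables of a \<open>k\<close>-ary query are \<open>0, \<dots>, k - 1\<close>, and a \<open>k\<close>-tuple of sets is a list
  of length \<open>k\<close>.  The values given to all other variables below are irrelevant for a query.\<close>

definition mso_query :: "nat \<Rightarrow> 'a mso \<Rightarrow> bool" where
  "mso_query k \<Psi> \<longleftrightarrow> free_elem \<Psi> = {} \<and> free_set \<Psi> \<subseteq> {..<k}"

definition query_result :: "nat \<Rightarrow> 'a mso \<Rightarrow> 'a forest \<Rightarrow> vertex set list set" where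
  "query_result k \<Psi> F = {Ss. length Ss = k \<and> (\<forall>S \<in> set Ss. S \<subseteq> vertices F) \<and>
     sat F (\<lambda>_. []) (\<lambda>X. if X < k then Ss ! X else {}) \<Psi>}"


section \<open>Forest algebra expressions\<close>

text \<open>\<open>None\<close> plays the role of the symbol \<open>*\<close>, so values of expressions are forests over \<open>'a option\<close>.\<close>

fun holes :: "'a option tree \<Rightarrow> nat" where
  "holes (Node a ts) = (if a = None then 1 else 0) + sum_list (map holes ts)"

fun holes_at_leaves :: "'a option tree \<Rightarrow> bool" where
  "holes_at_leaves (Node a ts) \<longleftrightarrow> (a = None \<longrightarrow> ts = []) \<and> (\<forall>t \<in> set ts. holes_at_leaves t)"

definition is_context :: "'a option forest \<Rightarrow> bool" where
  "is_context f \<longleftrightarrow> sum_list (map holes f) = 1 \<and> (\<forall>t \<in> set f. holes_at_leaves t)"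

fun plug_tree :: "'a option forest \<Rightarrow> 'a option tree \<Rightarrow> 'a option forest" where
  "plug_tree g (Node None ts) = g"
| "plug_tree g (Node (Some a) ts) = [Node (Some a) (concat (map (plug_tree g) ts))]"

definition hconcat :: "'a option forest \<Rightarrow> 'a option forest \<Rightarrow> 'a option forest option" where
  "hconcat f g = (if is_context f \<and> is_context g then None else Some (f @ g))"

definition vconcat :: "'a option forest \<Rightarrow> 'a option forest \<Rightarrow> 'a option forest option" where
  "vconcat f g = (if is_context f then Some (concat (map (plug_tree g) f)) else None)"

datatype 'l btree = Leaf 'l | Branch 'l "'l btree" "'l btree"

datatype 'a symb = HConcat | VConcat | Letter 'a | LetterCtx 'a

text \<open>The value is \<open>None\<close> if some operation is undefined, or if the labels of inner vertices and
  leaves are not of the kind required in a forest algebra expression.\<close>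

fun expr_value :: "'a symb btree \<Rightarrow> 'a option forest option" where
  "expr_value (Leaf (Letter a)) = Some [Node (Some a) []]"
| "expr_value (Leaf (LetterCtx a)) = Some [Node (Some a) [Node None []]]"
| "expr_value (Branch HConcat s t) =
     Option.bind (expr_value s) (\<lambda>f. Option.bind (expr_value t) (\<lambda>g. hconcat f g))"
| "expr_value (Branch VConcat s t) =
     Option.bind (expr_value s) (\<lambda>f. Option.bind (expr_value t) (\<lambda>g. vconcat f g))"
| "expr_value _ = None"


section \<open>Binary DAGs and forest straight-line programs\<close>

datatype side = LeftSide | RightSide

record ('v, 'l) bdag =
  dag_verts :: "'v set"
  dag_edges :: "('v \<times> side \<times> 'v) set"
  dag_label :: "'v \<Rightarrow> 'l"

definition is_leaf :: "('v, 'l) bdag \<Rightarrow> 'v \<Rightarrow> bool" where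
  "is_leaf G v \<longleftrightarrow> (\<forall>d u. (v, d, u) \<notin> dag_edges G)"

definition binary_dag :: "('v, 'l) bdag \<Rightarrow> bool" where
  "binary_dag G \<longleftrightarrow>
     finite (dag_verts G) \<and>
     dag_edges G \<subseteq> dag_verts G \<times> UNIV \<times> dag_verts G \<and>
     acyclic {(u, v). \<exists>d. (u, d, v) \<in> dag_edges G} \<and>
     (\<forall>v \<in> dag_verts G. is_leaf G v \<or> (\<forall>d. \<exists>!u. (v, d, u) \<in> dag_edges G))"

definition dag_size :: "('v, 'l) bdag \<Rightarrow> nat" where
  "dag_size G = card (dag_verts G) + card (dag_edges G)"

text \<open>\<open>unfolds_to G v t\<close>: the unfolding of \<open>G\<close> from \<open>v\<close> is \<open>t\<close>.  In a binary DAG every vertex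
  unfolds to exactly one tree.\<close>

inductive unfolds_to :: "('v, 'l) bdag \<Rightarrow> 'v \<Rightarrow> 'l btree \<Rightarrow> bool" for G where
  unfolds_leaf: "v \<in> dag_verts G \<Longrightarrow> is_leaf G v \<Longrightarrow> unfolds_to G v (Leaf (dag_label G v))"
| unfolds_branch: "(v, LeftSide, u1) \<in> dag_edges G \<Longrightarrow> (v, RightSide, u2) \<in> dag_edges G \<Longrightarrow>
    unfolds_to G u1 t1 \<Longrightarrow> unfolds_to G u2 t2 \<Longrightarrow>
    unfolds_to G v (Branch (dag_label G v) t1 t2)"

definition fslp :: "('v, 'a symb) bdag \<Rightarrow> bool" where
  "fslp G \<longleftrightarrow> binary_dag G \<and>
     (\<forall>v \<in> dag_verts G. \<exists>t. unfolds_to G v t \<and> expr_value t \<noteq> None)"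

definition fslp_for :: "('v, 'a symb) bdag \<Rightarrow> 'v \<Rightarrow> 'a forest \<Rightarrow> bool" where
  "fslp_for G S F \<longleftrightarrow> fslp G \<and> S \<in> dag_verts G \<and>
     (\<exists>t. unfolds_to G S t \<and> expr_value t = Some (map (map_tree Some) F))"


section \<open>Random access machines\<close>

text \<open>A RAM with uniform cost measure whose registers hold words of \<open>w\<close> bits, with a read-only
  randomly accessible input array and a write-only output stream.  Addition wraps around,
  subtraction is cut off at zero.  All registers are initially zero, and the machine halts when its
  program counter leaves the program.\<close>

datatype osym = Word nat | Comma | Separator | EndOfEnum

datatype instr =
    Const nat nat
  | Copy nat nat
  | Load nat nat        \<comment> \<open>indirect read: \<open>Load i j\<close> is \<open>r[i] := r[r[j]]\<close>\<close>
  | Store nat nat       \<comment> \<open>indirect write: \<open>Store i j\<close> is \<open>r[r[i]] := r[j]\<close>\<close>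
  | Input nat nat       \<comment> \<open>\<open>Input i j\<close> is \<open>r[i] := input[r[j]]\<close>\<close>
  | Add nat nat nat
  | Sub nat nat nat
  | Jump nat
  | JumpZero nat nat    \<comment> \<open>\<open>JumpZero i l\<close> jumps to \<open>l\<close> if \<open>r[i] = 0\<close>\<close>
  | OutReg nat
  | OutComma
  | OutSeparator
  | OutEnd

type_synonym program = "instr list"
type_synonym config = "nat \<times> (nat \<Rightarrow> nat)"

fun exec :: "nat \<Rightarrow> nat list \<Rightarrow> instr \<Rightarrow> config \<Rightarrow> config" where
  "exec w inp (Const i n) (pc, r) = (Suc pc, r(i := n mod 2 ^ w))"
| "exec w inp (Copy i j) (pc, r) = (Suc pc, r(i := r j))"
| "exec w inp (Load i j) (pc, r) = (Suc pc, r(i := r (r j)))"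
| "exec w inp (Store i j) (pc, r) = (Suc pc, r(r i := r j))"
| "exec w inp (Input i j) (pc, r) =
     (Suc pc, r(i := (if r j < length inp then inp ! r j else 0) mod 2 ^ w))"
| "exec w inp (Add i j l) (pc, r) = (Suc pc, r(i := (r j + r l) mod 2 ^ w))"
| "exec w inp (Sub i j l) (pc, r) = (Suc pc, r(i := r j - r l))"
| "exec w inp (Jump l) (pc, r) = (l, r)"
| "exec w inp (JumpZero i l) (pc, r) = (if r i = 0 then l else Suc pc, r)"
| "exec w inp (OutReg i) (pc, r) = (Suc pc, r)"
| "exec w inp OutComma (pc, r) = (Suc pc, r)"
| "exec w inp OutSeparator (pc, r) = (Suc pc, r)"
| "exec w inp OutEnd (pc, r) = (Suc pc, r)"

fun instr_output :: "instr \<Rightarrow> (nat \<Rightarrow> nat) \<Rightarrow> osym option" where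
  "instr_output (OutReg i) r = Some (Word (r i))"
| "instr_output OutComma r = Some Comma"
| "instr_output OutSeparator r = Some Separator"
| "instr_output OutEnd r = Some EndOfEnum"
| "instr_output _ r = None"

definition halted :: "program \<Rightarrow> config \<Rightarrow> bool" where
  "halted P c \<longleftrightarrow> length P \<le> fst c"

definition step :: "nat \<Rightarrow> program \<Rightarrow> nat list \<Rightarrow> config \<Rightarrow> config" where
  "step w P inp c = (if halted P c then c else exec w inp (P ! fst c) c)"

definition config_at :: "nat \<Rightarrow> program \<Rightarrow> nat list \<Rightarrow> nat \<Rightarrow> config" where
  "config_at w P inp t = (step w P inp ^^ t) (0, \<lambda>_. 0)"

definition output_at :: "nat \<Rightarrow> program \<Rightarrow> nat list \<Rightarrow> nat \<Rightarrow> osym option" where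
  "output_at w P inp t = (let c = config_at w P inp t in
     if halted P c then None else instr_output (P ! fst c) (snd c))"

text \<open>The symbols output during the first \<open>T\<close> steps, each with the time at which it is output.\<close>

definition timed_output :: "nat \<Rightarrow> program \<Rightarrow> nat list \<Rightarrow> nat \<Rightarrow> (nat \<times> osym) list" where
  "timed_output w P inp T =
     List.map_filter (\<lambda>t. map_option (Pair t) (output_at w P inp t)) [0..<T]"


section \<open>Enumeration algorithms\<close>

text \<open>\<open>rep x s\<close> says that the symbol sequence \<open>s\<close> is an admissible way of writing the object \<open>x\<close>.
  The objects of \<open>A\<close> are written one after the other, without repetition, followed by the
  end-of-enumeration marker; \<open>start i\<close> is the time when the output of the \<open>i\<close>-th of these
  (from 0, including the marker) starts.\<close>

definition enumerates ::
  "nat \<Rightarrow> program \<Rightarrow> nat list \<Rightarrow> ('o \<Rightarrow> osym list \<Rightarrow> bool) \<Rightarrow> 'o set \<Rightarrow> nat \<Rightarrow> nat \<Rightarrow> bool" where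
  "enumerates w P inp rep A preproc d \<longleftrightarrow>
     (\<exists>T xs outs.
        halted P (config_at w P inp T) \<and>
        distinct xs \<and> set xs = A \<and> list_all2 rep xs outs \<and>
        (let out = timed_output w P inp T;
             start = (\<lambda>i. fst (out ! length (concat (take i outs))))
         in map snd out = concat outs @ [EndOfEnum] \<and>
            start 0 \<le> preproc \<and>
            (\<forall>i < length outs. start (Suc i) \<le> start i + d * length (outs ! i))))"

text \<open>A tuple of vertex sets is written by listing, for each component in turn, the preorder numbers
  of its elements (in any order) followed by \<open>Comma\<close>, and finally \<open>Separator\<close>.\<close>

definition tuple_output :: "'a forest \<Rightarrow> vertex set list \<Rightarrow> osym list \<Rightarrow> bool" where
  "tuple_output F Ss out \<longleftrightarrow>
     (\<exists>nss. list_all2 (\<lambda>S ns. distinct ns \<and> set ns = preorder_number F ` S) Ss nss \<and>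
        out = concat (map (\<lambda>ns. map Word ns @ [Comma]) nss) @ [Separator])"

text \<open>The input array for an f-SLP, given a numbering of the letters and a list \<open>vs\<close> of its vertices:
  vertices are referred to by their positions in \<open>vs\<close>, and each vertex takes three words, holding
  its label and its two children (0 for leaves).\<close>

fun symb_code :: "('a \<Rightarrow> nat) \<Rightarrow> 'a symb \<Rightarrow> nat" where
  "symb_code code HConcat = 0"
| "symb_code code VConcat = 1"
| "symb_code code (Letter a) = 2 + 2 * code a"
| "symb_code code (LetterCtx a) = 3 + 2 * code a"

definition child_code :: "('v, 'l) bdag \<Rightarrow> 'v list \<Rightarrow> side \<Rightarrow> 'v \<Rightarrow> nat" where
  "child_code G vs d v =
     (if is_leaf G v then 0 else index_of vs (THE u. (v, d, u) \<in> dag_edges G))"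

definition encode_fslp ::
  "('a \<Rightarrow> nat) \<Rightarrow> 'v list \<Rightarrow> ('v, 'a symb) bdag \<Rightarrow> 'v \<Rightarrow> nat list" where
  "encode_fslp code vs G S = length vs # index_of vs S #
     concat (map (\<lambda>v. [symb_code code (dag_label G v),
                       child_code G vs LeftSide v, child_code G vs RightSide v]) vs)"

end

theory Submission
  imports Defs "HOL-Library.Countable"
begin

text \<open>The query is recognized by a finite forest algebra, the set quantifiers being handled by the powerset
  construction.  A tuple is described by the list of the vertices that belong to some component, each with the
  set of its components, in preorder.  For a vertex of the f-SLP and a state \<open>q\<close> of the algebra, the set of the
  nonempty lists that lead to \<open>q\<close> is a disjoint union of a constant number of products of such sets for the children.  So a
  depth-first traversal of the f-SLP builds, in linear time, circuits of disjoint unions and products for all these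
  sets.  They do not depend on the occurrence of the vertex: the value of an expression of type 1 occupies two intervals of
  preorder numbers, and the left ends of the intervals of the parts are obtained from those of the whole by selecting
  one of them and adding a constant.  These substitutions label the edges and are closed under composition.

  A circuit is enumerated by backtracking, with goals, current solution and choices in a persistent heap.  A pointer
  from every union to the leftmost product or item below it makes the number of steps linear in the number of new items, and the first
  symbol of a solution is known in advance from a second pointer, to the first vertex of component 0.\<close>

section \<open>A structured language for the RAM\<close>

text \<open>The delay runs from the first symbol of one output to the first symbol of the next and
  is charged to the earlier output. So the work done before the first symbol of a solution must not
  depend on its own length, which can exceed that of its predecessor by far, although finding it
  takes time proportional to that length. This is why the first symbol is predicted and printed
  before the solution is assembled; component 0 is then completed without the vertex already
  printed. A solution can have exponentially many items. As the word length is linear in the size of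
  the f-SLP, an exponentially large heap can still be addressed. The tuple of empty sets has an
  empty list of items. It is kept out of all circuits and printed separately: every list in a
  circuit is then nonempty, so that a list with \<open>l\<close> items is composed by exactly
  \<open>l - 1\<close> products and the search time can be charged to items. Steps are counted in a
  small structured language. Compilation stretches a run by a constant factor, which changes neither
  the linear preprocessing nor the output-linear delay.\<close>

datatype 'n rexp = Cn nat | Ar 'n "'n rexp" | Pl "'n rexp" "'n rexp" | Mi "'n rexp" "'n rexp" | In "'n rexp"

datatype 'n rcom = Skip | Set 'n "'n rexp" "'n rexp" | Sq "'n rcom" "'n rcom"
  | Cond "'n rexp" "'n rcom" "'n rcom" | Loop "'n rexp" "'n rcom" | Out "'n rexp" | Emit osym

type_synonym 'n mem = "'n \<Rightarrow> nat \<Rightarrow> nat"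

definition upd :: "'n \<Rightarrow> nat \<Rightarrow> nat \<Rightarrow> 'n mem \<Rightarrow> 'n mem" where
  "upd j i v s = (\<lambda>j' i'. if j' = j \<and> i' = i then v else s j' i')"

text \<open>\<open>N\<close> limits the indices of every array. It is a parameter of the semantics
  and not of programs, so that one program serves inputs of all sizes.\<close>

locale ram_env =
  fixes w N :: nat and inp :: "nat list"
begin

fun aval :: "'n rexp \<Rightarrow> 'n mem \<Rightarrow> nat" where
  "aval (Cn n) s = n"
| "aval (Ar j e) s = s j (aval e s)"
| "aval (Pl a b) s = (aval a s + aval b s) mod 2 ^ w"
| "aval (Mi a b) s = aval a s - aval b s"
| "aval (In e) s = (if aval e s < length inp then inp ! aval e s else 0) mod 2 ^ w"

fun ok :: "'n rexp \<Rightarrow> 'n mem \<Rightarrow> bool" where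
  "ok (Cn n) s \<longleftrightarrow> True"
| "ok (Ar j e) s \<longleftrightarrow> ok e s \<and> aval e s < N"
| "ok (Pl a b) s \<longleftrightarrow> ok a s \<and> ok b s"
| "ok (Mi a b) s \<longleftrightarrow> ok a s \<and> ok b s"
| "ok (In e) s \<longleftrightarrow> ok e s"

text \<open>The list is a trace with one entry per abstract step, \<open>Some x\<close> if the step
  outputs \<open>x\<close>. Runs that leave the index range or do not terminate have no derivation.
  The closing \<open>None\<close> of a conditional stands for the jump over the else branch; both
  branches carry it, so that they are counted alike.\<close>

inductive bs :: "'n rcom \<Rightarrow> 'n mem \<Rightarrow> osym option list \<Rightarrow> 'n mem \<Rightarrow> bool" where
  bs_Skip: "bs Skip s [] s"
| bs_Set: "ok i s \<Longrightarrow> ok e s \<Longrightarrow> aval i s < N \<Longrightarrow> bs (Set j i e) s [None] (upd j (aval i s) (aval e s) s)"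
| bs_Sq: "bs c1 s tr1 s1 \<Longrightarrow> bs c2 s1 tr2 s2 \<Longrightarrow> bs (Sq c1 c2) s (tr1 @ tr2) s2"
| bs_CondT: "ok e s \<Longrightarrow> aval e s \<noteq> 0 \<Longrightarrow> bs c1 s tr s' \<Longrightarrow> bs (Cond e c1 c2) s (None # tr @ [None]) s'"
| bs_CondF: "ok e s \<Longrightarrow> aval e s = 0 \<Longrightarrow> bs c2 s tr s' \<Longrightarrow> bs (Cond e c1 c2) s (None # tr @ [None]) s'"
| bs_LoopF: "ok e s \<Longrightarrow> aval e s = 0 \<Longrightarrow> bs (Loop e c) s [None] s"
| bs_LoopT: "ok e s \<Longrightarrow> aval e s \<noteq> 0 \<Longrightarrow> bs c s tr1 s1 \<Longrightarrow> bs (Loop e c) s1 tr2 s2 \<Longrightarrow>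
    bs (Loop e c) s (None # tr1 @ None # tr2) s2"
| bs_Out: "ok e s \<Longrightarrow> bs (Out e) s [Some (Word (aval e s))] s"
| bs_Emit: "bs (Emit x) s [Some x] s"

end

section \<open>Names and constants occurring in programs\<close>

primrec exp_names :: "'n rexp \<Rightarrow> 'n set" where
  "exp_names (Cn n) = {}"
| "exp_names (Ar j e) = insert j (exp_names e)"
| "exp_names (Pl a b) = exp_names a \<union> exp_names b"
| "exp_names (Mi a b) = exp_names a \<union> exp_names b"
| "exp_names (In e) = exp_names e"

text \<open>One number does two jobs: it bounds the temporaries that the compiled expression
  occupies from its target register on, and it exceeds every constant \<open>Cn n\<close>, so that
  constants fit into a word.\<close>

primrec exp_bound :: "'n rexp \<Rightarrow> nat" where
  "exp_bound (Cn n) = Suc n"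
| "exp_bound (Ar j e) = exp_bound e + 2"
| "exp_bound (Pl a b) = exp_bound a + exp_bound b + 1"
| "exp_bound (Mi a b) = exp_bound a + exp_bound b + 1"
| "exp_bound (In e) = exp_bound e"

fun com_names :: "'n rcom \<Rightarrow> 'n set" where
  "com_names (Set j i e) = insert j (exp_names i \<union> exp_names e)"
| "com_names (Sq a b) = com_names a \<union> com_names b"
| "com_names (Cond e a b) = exp_names e \<union> com_names a \<union> com_names b"
| "com_names (Loop e a) = exp_names e \<union> com_names a"
| "com_names (Out e) = exp_names e"
| "com_names _ = {}"

fun com_bound :: "'n rcom \<Rightarrow> nat" where
  "com_bound (Set j i e) = exp_bound i + exp_bound e + 3"
| "com_bound (Sq a b) = com_bound a + com_bound b"
| "com_bound (Cond e a b) = exp_bound e + com_bound a + com_bound b"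
| "com_bound (Loop e a) = exp_bound e + com_bound a"
| "com_bound (Out e) = exp_bound e"
| "com_bound (Emit (Word n)) = Suc n"
| "com_bound _ = 1"

text \<open>Cell \<open>i\<close> of array \<open>j\<close> lives in register \<open>B + m * i + enc j\<close>; the registers below \<open>B\<close> are
  used to evaluate expressions.\<close>

locale layout =
  fixes m B :: nat and enc :: "'n \<Rightarrow> nat"
begin

fun comp_exp :: "'n rexp \<Rightarrow> nat \<Rightarrow> instr list" where
  "comp_exp (Cn n) d = [Const d n]"
| "comp_exp (Ar j e) d = comp_exp e d @
     Const (Suc d) (B + enc j) # replicate m (Add (Suc d) (Suc d) d) @ [Load d (Suc d)]"
| "comp_exp (Pl a b) d = comp_exp a d @ comp_exp b (Suc d) @ [Add d d (Suc d)]"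
| "comp_exp (Mi a b) d = comp_exp a d @ comp_exp b (Suc d) @ [Sub d d (Suc d)]"
| "comp_exp (In e) d = comp_exp e d @ [Input d d]"

fun comp_osym :: "osym \<Rightarrow> instr list" where
  "comp_osym (Word n) = [Const 0 n, OutReg 0]"
| "comp_osym Comma = [OutComma]"
| "comp_osym Separator = [OutSeparator]"
| "comp_osym EndOfEnum = [OutEnd]"

fun comp :: "'n rcom \<Rightarrow> nat \<Rightarrow> instr list" where
  "comp Skip pc = []"
| "comp (Set j i e) pc = comp_exp i 0 @ comp_exp e 1 @
     Const 2 (B + enc j) # replicate m (Add 2 2 0) @ [Store 2 1]"
| "comp (Sq a b) pc = (let ca = comp a pc in ca @ comp b (pc + length ca))"
| "comp (Cond e a b) pc = (let ce = comp_exp e 0; ca = comp a (pc + length ce + 1);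
     p = pc + length ce + length ca + 2; cb = comp b p in
     ce @ JumpZero 0 p # ca @ Jump (p + length cb) # cb)"
| "comp (Loop e a) pc = (let ce = comp_exp e 0; ca = comp a (pc + length ce + 1) in
     ce @ JumpZero 0 (pc + length ce + length ca + 2) # ca @ [Jump pc])"
| "comp (Out e) pc = comp_exp e 0 @ [OutReg 0]"
| "comp (Emit x) pc = comp_osym x"

end

section \<open>Code fragments and machine runs\<close>

definition code_at :: "program \<Rightarrow> nat \<Rightarrow> instr list \<Rightarrow> bool" where
  "code_at P pc xs \<longleftrightarrow> (\<exists>pre post. P = pre @ xs @ post \<and> length pre = pc)"

lemma code_at_append [simp]:
  "code_at P pc (xs @ ys) \<longleftrightarrow> code_at P pc xs \<and> code_at P (pc + length xs) ys"
proof
  assume "code_at P pc (xs @ ys)"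
  then obtain pre post where "P = pre @ (xs @ ys) @ post" "length pre = pc"
    by (auto simp: code_at_def)
  then have "P = pre @ xs @ (ys @ post)" "P = (pre @ xs) @ ys @ post" "length (pre @ xs) = pc + length xs"
    by auto
  then show "code_at P pc xs \<and> code_at P (pc + length xs) ys"
    using \<open>length pre = pc\<close> unfolding code_at_def by metis
next
  assume a: "code_at P pc xs \<and> code_at P (pc + length xs) ys"
  from a obtain pre post where *: "P = pre @ xs @ post" "length pre = pc"
    unfolding code_at_def by blast
  from a obtain pre' post' where **: "P = pre' @ ys @ post'" "length pre' = pc + length xs"
    unfolding code_at_def by blast
  have "(pre @ xs) @ post = pre' @ (ys @ post')" using * **(1) by simp
  then have "pre @ xs = pre'" using *(2) **(2) by (subst (asm) append_eq_append_conv) auto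
  then have "P = pre @ (xs @ ys) @ post'" using **(1) by simp
  then show "code_at P pc (xs @ ys)" using *(2) unfolding code_at_def by blast
qed

lemma code_at_Cons [simp]:
  "code_at P pc (x # xs) \<longleftrightarrow> pc < length P \<and> P ! pc = x \<and> code_at P (Suc pc) xs"
proof -
  have 1: "code_at P pc [x] \<longleftrightarrow> pc < length P \<and> P ! pc = x"
  proof
    assume "pc < length P \<and> P ! pc = x"
    then have "P = take pc P @ [x] @ drop (Suc pc) P" "length (take pc P) = pc"
      by (auto simp: id_take_nth_drop)
    then show "code_at P pc [x]" unfolding code_at_def by blast
  qed (auto simp: code_at_def nth_append)
  have "code_at P pc ([x] @ xs) \<longleftrightarrow> code_at P pc [x] \<and> code_at P (pc + length [x]) xs"
    by (rule code_at_append)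
  then show ?thesis using 1 by simp
qed

lemma code_at_Nil [simp]: "code_at P pc [] \<longleftrightarrow> pc \<le> length P"
proof
  assume "pc \<le> length P"
  then have "P = take pc P @ [] @ drop pc P" "length (take pc P) = pc" by auto
  then show "code_at P pc []" unfolding code_at_def by blast
qed (auto simp: code_at_def)

context ram_env
begin

definition reaches :: "program \<Rightarrow> config \<Rightarrow> osym option list \<Rightarrow> config \<Rightarrow> bool" where
  "reaches P c tr c' \<longleftrightarrow> (step w P inp ^^ length tr) c = c' \<and>
     tr = map (\<lambda>t. let c = (step w P inp ^^ t) c in
       if halted P c then None else instr_output (P ! fst c) (snd c)) [0..<length tr]"

lemma reaches_Nil [simp]: "reaches P c [] c' \<longleftrightarrow> c = c'"
  by (simp add: reaches_def)

lemma reaches_trans: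
  assumes "reaches P c tr c'" "reaches P c' tr' c''" shows "reaches P c (tr @ tr') c''"
proof -
  let ?o = "\<lambda>c. if halted P c then None else instr_output (P ! fst c) (snd c)"
  let ?s = "step w P inp"
  have a: "(?s ^^ length tr) c = c'" "tr = map (\<lambda>t. ?o ((?s ^^ t) c)) [0..<length tr]"
    and b: "(?s ^^ length tr') c' = c''" "tr' = map (\<lambda>t. ?o ((?s ^^ t) c')) [0..<length tr']"
    using assms by (simp_all add: reaches_def Let_def)
  have s: "(?s ^^ (t + length tr)) c = (?s ^^ t) c'" for t
    using a(1) by (simp add: funpow_add)
  have split: "map f [0..<i + j] = map f [0..<i] @ map (\<lambda>t. f (t + i)) [0..<j]" for i j and f :: "nat \<Rightarrow> 'x"
    by (induction j) (auto simp: add.commute)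
  have "map (\<lambda>t. ?o ((?s ^^ t) c)) [0..<length tr + length tr']
      = map (\<lambda>t. ?o ((?s ^^ t) c)) [0..<length tr] @
        map (\<lambda>t. ?o ((?s ^^ (t + length tr)) c)) [0..<length tr']"
    by (rule split)
  also have "\<dots> = tr @ tr'" unfolding s a(2)[symmetric] b(2)[symmetric] ..
  finally have "map (\<lambda>t. ?o ((?s ^^ t) c)) [0..<length (tr @ tr')] = tr @ tr'" by simp
  moreover have "(?s ^^ length (tr @ tr')) c = c''"
    using b(1) s[of "length tr'"] by (simp add: add.commute)
  ultimately show ?thesis by (simp add: reaches_def Let_def)
qed

lemma reaches_step:
  "pc < length P \<Longrightarrow> P ! pc = i \<Longrightarrow> reaches P (pc, r) [instr_output i r] (exec w inp i (pc, r))"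
  by (simp add: reaches_def step_def halted_def)

lemma reaches_Cons:
  "pc < length P \<Longrightarrow> P ! pc = i \<Longrightarrow> reaches P (exec w inp i (pc, r)) tr c' \<Longrightarrow>
   reaches P (pc, r) (instr_output i r # tr) c'"
  using reaches_trans[OF reaches_step, of pc P i r tr c'] by simp

end

text \<open>The first trace belongs to a source program, the second to its compiled code: each
  source step becomes at most \<open>K\<close> machine steps, of which only the last may output. So
  outputs agree and times grow by at most the factor \<open>K\<close>.\<close>

inductive dilated :: "nat \<Rightarrow> 'o option list \<Rightarrow> 'o option list \<Rightarrow> bool" for K where
  dilated_Nil: "dilated K [] []"
| dilated_None: "length b \<le> K \<Longrightarrow> set b \<subseteq> {None} \<Longrightarrow> dilated K tr tr' \<Longrightarrow> dilated K (None # tr) (b @ tr')"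
| dilated_Some: "length b < K \<Longrightarrow> set b \<subseteq> {None} \<Longrightarrow> dilated K tr tr' \<Longrightarrow>
    dilated K (Some x # tr) (b @ Some x # tr')"

lemma dilated_append: "dilated K a a' \<Longrightarrow> dilated K b b' \<Longrightarrow> dilated K (a @ b) (a' @ b')"
  by (induction rule: dilated.induct) (auto intro: dilated.intros)

lemma dilated_silent: "length b \<le> K \<Longrightarrow> set b \<subseteq> {None} \<Longrightarrow> dilated K [None] b"
  using dilated_None[of b K "[]" "[]"] by (simp add: dilated_Nil)

lemma dilated_emit: "length b < K \<Longrightarrow> set b \<subseteq> {None} \<Longrightarrow> dilated K [Some x] (b @ [Some x])"
  using dilated_Some[of b K "[]" "[]"] by (simp add: dilated_Nil)

locale compile = ram_env w N inp + layout m B enc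
  for w N :: nat and inp :: "nat list" and m B :: nat and enc :: "'n \<Rightarrow> nat" +
  fixes J :: "'n set" and P :: program and K :: nat
  assumes enc_inj: "inj_on enc J" and enc_less: "j \<in> J \<Longrightarrow> enc j < m"
    and fits: "B + m * N \<le> 2 ^ w" and B_pos: "3 \<le> B"
begin

definition agrees :: "(nat \<Rightarrow> nat) \<Rightarrow> 'n mem \<Rightarrow> bool" where
  "agrees r s \<longleftrightarrow> (\<forall>j\<in>J. \<forall>i<N. r (B + m * i + enc j) = s j i)"

lemma agrees_temp: "agrees r s \<Longrightarrow> (\<And>x. B \<le> x \<Longrightarrow> r' x = r x) \<Longrightarrow> agrees r' s"
  by (auto simp: agrees_def)

lemma address_less: "j \<in> J \<Longrightarrow> i < N \<Longrightarrow> B + m * i + enc j < 2 ^ w"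
proof -
  assume "j \<in> J" "i < N"
  then have "enc j < m" "m * Suc i \<le> m * N" using enc_less by (auto intro: mult_le_mono2 simp del: mult_Suc_right)
  then show ?thesis using fits by simp
qed

lemma address_eqD:
  assumes "j \<in> J" "j' \<in> J" "B + m * i + enc j = B + m * i' + enc j'" shows "i = i' \<and> j = j'"
proof -
  have *: "m * i + enc j = m * i' + enc j'" "enc j < m" "enc j' < m" using assms enc_less by auto
  then have "(m * i + enc j) div m = (m * i' + enc j') div m" by simp
  then have "i = i'" using *(2,3) by simp
  then show ?thesis using * assms enc_inj by (auto dest: inj_onD)
qed

lemma exp_bound_pos: "0 < exp_bound e"
  by (induction e) auto

text \<open>The RAM has no multiplication. An address is formed by repeated addition of the index,
  \<open>m\<close> times for \<open>m\<close> array slots, and \<open>m\<close> depends on the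
  program alone.\<close>

lemma reaches_address:
  assumes "code_at P pc (replicate n (Add t t d))" "t \<noteq> d" "r t + n * r d < 2 ^ w"
  shows "reaches P (pc, r) (replicate n None) (pc + n, r(t := r t + n * r d))"
  using assms
proof (induction n arbitrary: pc r)
  case (Suc n)
  let ?r = "r(t := r t + r d)"
  have "reaches P (Suc pc, ?r) (replicate n None) (Suc pc + n, ?r(t := ?r t + n * ?r d))"
    using Suc.prems by (intro Suc.IH) (auto simp: add.assoc)
  moreover have "exec w inp (Add t t d) (pc, r) = (Suc pc, ?r)" using Suc.prems by simp
  moreover have "?r(t := ?r t + n * ?r d) = r(t := r t + Suc n * r d)" using Suc.prems by auto
  ultimately show ?case
    using Suc.prems reaches_Cons[of pc P "Add t t d" r] by (simp del: fun_upd_apply)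
qed simp

text \<open>The code leaves the value in register \<open>d\<close> and does not touch the registers below \<open>d\<close>.\<close>

definition evaluates :: "nat \<Rightarrow> (nat \<Rightarrow> nat) \<Rightarrow> instr list \<Rightarrow> nat \<Rightarrow> nat \<Rightarrow> (nat \<Rightarrow> nat) \<Rightarrow> bool" where
  "evaluates pc r code d v r' \<longleftrightarrow>
     reaches P (pc, r) (replicate (length code) None) (pc + length code, r') \<and>
     r' d = v \<and> (\<forall>x. x < d \<or> B \<le> x \<longrightarrow> r' x = r x)"

lemma evaluates_snoc:
  assumes "evaluates pc r code d v r1" "code_at P (pc + length code) [i]"
    "instr_output i r1 = None" "exec w inp i (pc + length code, r1) = (Suc (pc + length code), r')"
    "r' d = v'" "\<And>x. x < d \<or> B \<le> x \<Longrightarrow> r' x = r1 x"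
  shows "evaluates pc r (code @ [i]) d v' r'"
proof -
  have "reaches P (pc + length code, r1) [None] (Suc (pc + length code), r')"
    using assms(2-4) reaches_step[of "pc + length code" P i r1] by simp
  from reaches_trans[OF _ this] have "reaches P (pc, r) (replicate (length code) None @ [None])
     (Suc (pc + length code), r')" using assms(1) by (simp add: evaluates_def)
  then show ?thesis using assms(1,5,6) by (simp add: evaluates_def replicate_append_same)
qed

lemma evaluates_append:
  assumes "evaluates pc r c1 d v1 r1" "evaluates (pc + length c1) r1 c2 d' v2 r2" "d < d'"
  shows "evaluates pc r (c1 @ c2) d v1 r2 \<and> r2 d' = v2"
proof -
  have "reaches P (pc, r) (replicate (length c1) None @ replicate (length c2) None)
     (pc + length c1 + length c2, r2)"
    using assms reaches_trans by (auto simp: evaluates_def)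
  then show ?thesis using assms by (auto simp: evaluates_def replicate_add add.assoc)
qed

text \<open>Operands are evaluated into increasing registers, so the left value survives the
  evaluation of the right one. Temporaries stay below \<open>B\<close>, while \<open>agrees\<close>
  looks only at registers from \<open>B\<close> on and is never disturbed.\<close>

lemma comp_exp_correct:
  assumes "code_at P pc (comp_exp e d)" "ok e s" "agrees r s" "exp_names e \<subseteq> J"
    "d + exp_bound e \<le> B" "exp_bound e \<le> 2 ^ w"
  shows "\<exists>r'. evaluates pc r (comp_exp e d) d (aval e s) r'"
  using assms
proof (induction e arbitrary: pc d r)
  case (Cn n)
  then have "n < 2 ^ w" by simp
  with Cn show ?case
    using reaches_step[of pc P "Const d n" r] by (auto simp: evaluates_def)
next
  case (Ar j e)
  let ?a = "aval e s" and ?c = "comp_exp e d" and ?t = "Suc d"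
  from Ar obtain r1 where r1: "evaluates pc r ?c d ?a r1" by fastforce
  have a: "?a < N" and j: "j \<in> J" using Ar.prems by auto
  let ?p = "pc + length ?c"
  let ?r2 = "r1(?t := B + enc j)"
  let ?r3 = "?r2(?t := ?r2 ?t + m * ?r2 d)"
  let ?r4 = "?r3(d := s j ?a)"
  have r1d: "r1 d = ?a" "\<And>x. B \<le> x \<Longrightarrow> r1 x = r x" using r1 by (auto simp: evaluates_def)
  have adr: "B + m * ?a + enc j < 2 ^ w" using address_less[OF j a] .
  have cod: "?p < length P" "P ! ?p = Const ?t (B + enc j)"
    "code_at P (Suc ?p) (replicate m (Add ?t ?t d))"
    "Suc ?p + m < length P" "P ! (Suc ?p + m) = Load d ?t" using Ar.prems(1) by auto
  have 1: "reaches P (?p, r1) [None] (Suc ?p, ?r2)"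
    using reaches_step[OF cod(1,2)] adr by simp
  have 2: "reaches P (Suc ?p, ?r2) (replicate m None) (Suc ?p + m, ?r3)"
    using cod(3) adr r1d by (intro reaches_address) (auto simp: algebra_simps)
  have dB: "d < B" using Ar.prems by simp
  have "?r3 (?r3 ?t) = s j ?a"
  proof -
    have 1: "?r3 ?t = B + m * ?a + enc j" by (simp add: r1d(1))
    have "B + m * ?a + enc j \<noteq> ?t" using Ar.prems(5) by simp
    moreover have "r (B + m * ?a + enc j) = s j ?a" using Ar.prems(3) a j by (simp add: agrees_def)
    ultimately show ?thesis unfolding 1 using r1d(2)[of "B + m * ?a + enc j"] by simp
  qed
  then have 3: "reaches P (Suc ?p + m, ?r3) [None] (Suc (Suc ?p + m), ?r4)"
    using reaches_step[OF cod(4,5), of ?r3] by (simp del: fun_upd_apply)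
  have "reaches P (pc, r) (replicate (length ?c) None) (?p, r1)"
    using r1 by (simp add: evaluates_def)
  note reaches_trans[OF reaches_trans[OF reaches_trans[OF this 1] 2] 3]
  moreover have "((replicate (length ?c) None @ [None]) @ replicate m None) @ [None]
      = replicate (length (comp_exp (Ar j e) d)) (None :: osym option)"
    by (rule replicate_eqI) auto
  ultimately have "reaches P (pc, r) (replicate (length (comp_exp (Ar j e) d)) None)
      (pc + length (comp_exp (Ar j e) d), ?r4)" by (simp add: add.assoc)
  moreover have "?r4 d = aval (Ar j e) s" by simp
  moreover have "\<forall>x. x < d \<or> B \<le> x \<longrightarrow> ?r4 x = r x"
    using r1 Ar.prems(5) by (auto simp: evaluates_def)
  ultimately show ?case unfolding evaluates_def by blast
next
  case (Pl a b)
  then obtain r1 where r1: "evaluates pc r (comp_exp a d) d (aval a s) r1" by fastforce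
  then have "agrees r1 s" using agrees_temp[OF Pl.prems(3)] by (auto simp: evaluates_def)
  with Pl obtain r2 where "evaluates (pc + length (comp_exp a d)) r1 (comp_exp b (Suc d)) (Suc d) (aval b s) r2"
    by fastforce
  from evaluates_append[OF r1 this] have "evaluates pc r (comp_exp a d @ comp_exp b (Suc d)) d (aval a s) r2"
    "r2 (Suc d) = aval b s" by auto
  note * = this
  have "evaluates pc r ((comp_exp a d @ comp_exp b (Suc d)) @ [Add d d (Suc d)]) d
      (aval (Pl a b) s) (r2(d := (aval a s + aval b s) mod 2 ^ w))"
    by (rule evaluates_snoc[OF *(1)])
      (use * Pl.prems in \<open>auto simp: evaluates_def add.assoc\<close>)
  then show ?case by auto
next
  case (Mi a b)
  then obtain r1 where r1: "evaluates pc r (comp_exp a d) d (aval a s) r1" by fastforce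
  then have "agrees r1 s" using agrees_temp[OF Mi.prems(3)] by (auto simp: evaluates_def)
  with Mi obtain r2 where "evaluates (pc + length (comp_exp a d)) r1 (comp_exp b (Suc d)) (Suc d) (aval b s) r2"
    by fastforce
  from evaluates_append[OF r1 this] have "evaluates pc r (comp_exp a d @ comp_exp b (Suc d)) d (aval a s) r2"
    "r2 (Suc d) = aval b s" by auto
  note * = this
  have "evaluates pc r ((comp_exp a d @ comp_exp b (Suc d)) @ [Sub d d (Suc d)]) d
      (aval (Mi a b) s) (r2(d := aval a s - aval b s))"
    by (rule evaluates_snoc[OF *(1)])
      (use * Mi.prems in \<open>auto simp: evaluates_def add.assoc\<close>)
  then show ?case by auto
next
  case (In e)
  then obtain r1 where r1: "evaluates pc r (comp_exp e d) d (aval e s) r1" by fastforce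
  have "evaluates pc r (comp_exp e d @ [Input d d]) d (aval (In e) s) (r1(d := aval (In e) s))"
    by (rule evaluates_snoc[OF r1]) (use r1 In.prems exp_bound_pos[of e] in \<open>auto simp: evaluates_def\<close>)
  then show ?case by auto
qed

lemma agrees_store:
  assumes "agrees r s" "j \<in> J" "i < N"
  shows "agrees (r(B + m * i + enc j := v)) (upd j i v s)"
  unfolding agrees_def
proof (intro ballI allI impI)
  fix j' i' assume "j' \<in> J" "i' < N"
  then show "(r(B + m * i + enc j := v)) (B + m * i' + enc j') = upd j i v s j' i'"
    using assms address_eqD[of j' j i' i]
    by (cases "j' = j \<and> i' = i") (auto simp: agrees_def upd_def fun_upd_def)
qed

lemma comp_exp_test:
  assumes "code_at P pc (comp_exp e 0)" "code_at P (pc + length (comp_exp e 0)) [JumpZero 0 l]"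
    "ok e s" "agrees r s" "exp_names e \<subseteq> J" "exp_bound e \<le> B" "exp_bound e \<le> 2 ^ w"
  obtains r' where "agrees r' s" "reaches P (pc, r) (replicate (length (comp_exp e 0) + 1) None)
    (if aval e s = 0 then l else pc + length (comp_exp e 0) + 1, r')"
proof -
  have "\<exists>r'. evaluates pc r (comp_exp e 0) 0 (aval e s) r'"
    using assms by (intro comp_exp_correct) auto
  then obtain r' where r': "evaluates pc r (comp_exp e 0) 0 (aval e s) r'" by blast
  let ?p = "pc + length (comp_exp e 0)"
  have "reaches P (?p, r') [None] (if aval e s = 0 then l else ?p + 1, r')"
    using reaches_step[of ?p P "JumpZero 0 l" r'] assms(2) r'
    by (cases "aval e s = 0") (auto simp: evaluates_def)
  then have "reaches P (pc, r) (replicate (length (comp_exp e 0)) None @ [None])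
     (if aval e s = 0 then l else ?p + 1, r')"
    using r' reaches_trans by (auto simp: evaluates_def)
  moreover have "replicate n None @ [None] = replicate (n + 1) (None :: osym option)" for n
    by (rule replicate_eqI) auto
  ultimately show ?thesis
    using that[of r'] agrees_temp[OF assms(4)] r' by (auto simp: evaluates_def)
qed

text \<open>Within one source step no machine instruction is executed twice. Hence the length of the
  code bounds the number of machine steps per source step, and \<open>K\<close> has to exceed only
  that length.\<close>

theorem comp_correct:
  assumes "bs c s tr s'" "code_at P pc (comp c pc)" "agrees r s" "com_names c \<subseteq> J"
    "com_bound c \<le> B" "com_bound c \<le> 2 ^ w" "length (comp c pc) < K"
  shows "\<exists>tr' r'. reaches P (pc, r) tr' (pc + length (comp c pc), r') \<and> dilated K tr tr' \<and> agrees r' s'"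
  using assms
proof (induction arbitrary: pc r rule: bs.induct)
  case (bs_Skip s)
  then show ?case by (intro exI[of _ "[]"] exI[of _ r]) (auto intro: dilated_Nil)
next
  case (bs_Set i s e j)
  let ?ci = "comp_exp i 0" and ?ce = "comp_exp e 1"
  obtain r1 where r1: "evaluates pc r ?ci 0 (aval i s) r1"
    using comp_exp_correct[of pc i 0 s r] bs_Set by auto
  then have "agrees r1 s" using agrees_temp[OF bs_Set.prems(2)] by (auto simp: evaluates_def)
  then obtain r2 where r2: "evaluates (pc + length ?ci) r1 ?ce 1 (aval e s) r2"
    using comp_exp_correct[of "pc + length ?ci" e 1 s r1] bs_Set by auto
  have 12: "evaluates pc r (?ci @ ?ce) 0 (aval i s) r2" "r2 1 = aval e s"
    using evaluates_append[OF r1 r2] by auto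
  have j: "j \<in> J" using bs_Set.prems by auto
  let ?p = "pc + length (?ci @ ?ce)"
  let ?r3 = "r2(2 := B + enc j)"
  let ?r4 = "?r3(2 := ?r3 2 + m * ?r3 0)"
  let ?r5 = "?r4(?r4 2 := ?r4 1)"
  have cod: "?p < length P" "P ! ?p = Const 2 (B + enc j)"
    "code_at P (Suc ?p) (replicate m (Add 2 2 0))"
    "Suc ?p + m < length P" "P ! (Suc ?p + m) = Store 2 1" using bs_Set.prems(1) by (auto simp: add.assoc)
  have r20: "r2 0 = aval i s" using 12 by (simp add: evaluates_def)
  have adr: "B + m * aval i s + enc j < 2 ^ w" using address_less[OF j bs_Set.hyps(3)] .
  have 3: "reaches P (?p, r2) [None] (Suc ?p, ?r3)"
    using reaches_step[OF cod(1,2)] adr by simp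
  have 4: "reaches P (Suc ?p, ?r3) (replicate m None) (Suc ?p + m, ?r4)"
    using cod(3) adr r20 by (intro reaches_address) (auto simp: algebra_simps)
  have 5: "reaches P (Suc ?p + m, ?r4) [None] (Suc (Suc ?p + m), ?r5)"
    using reaches_step[OF cod(4,5), of ?r4] by simp
  have "reaches P (pc, r) (replicate (length (?ci @ ?ce)) None) (?p, r2)"
    using 12 by (simp add: evaluates_def)
  note reaches_trans[OF reaches_trans[OF reaches_trans[OF this 3] 4] 5]
  moreover have "((replicate (length (?ci @ ?ce)) None @ [None]) @ replicate m None) @ [None]
      = replicate (length (comp (Set j i e) pc)) (None :: osym option)"
    by (rule replicate_eqI) auto
  ultimately have "reaches P (pc, r) (replicate (length (comp (Set j i e) pc)) None)
      (pc + length (comp (Set j i e) pc), ?r5)" by (simp add: add.assoc)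
  moreover have "dilated K [None] (replicate (length (comp (Set j i e) pc)) None)"
    using bs_Set.prems by (intro dilated_silent) auto
  moreover have "agrees ?r5 (upd j (aval i s) (aval e s) s)"
  proof -
    have "agrees r2 s" using agrees_temp[OF bs_Set.prems(2)] 12 by (auto simp: evaluates_def)
    then have "agrees ?r4 s" by (rule agrees_temp) (use B_pos in auto)
    from agrees_store[OF this j bs_Set.hyps(3)] show ?thesis
      using r20 12(2) by (simp add: add_ac)
  qed
  ultimately show ?case by blast
next
  case (bs_Sq c1 s tr1 s1 c2 tr2 s2)
  obtain tr1' r1 where 1: "reaches P (pc, r) tr1' (pc + length (comp c1 pc), r1)"
    "dilated K tr1 tr1'" "agrees r1 s1"
    using bs_Sq.IH(1)[of pc r] bs_Sq.prems by (auto simp: Let_def)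
  let ?p = "pc + length (comp c1 pc)"
  obtain tr2' r2 where 2: "reaches P (?p, r1) tr2' (?p + length (comp c2 ?p), r2)"
    "dilated K tr2 tr2'" "agrees r2 s2" using bs_Sq.IH(2)[of ?p r1] bs_Sq.prems 1(3) by (auto simp: Let_def)
  show ?case using reaches_trans[OF 1(1) 2(1)] dilated_append[OF 1(2) 2(2)] 2(3)
    by (auto simp: Let_def add.assoc)
next
  case (bs_CondT e s c1 tr s' c2)
  define ce where "ce = comp_exp e 0"
  define p where "p = pc + length ce + 1"
  define ca where "ca = comp c1 p"
  define p2 where "p2 = p + length ca + 1"
  define cb where "cb = comp c2 p2"
  have c: "comp (Cond e c1 c2) pc = ce @ JumpZero 0 p2 # ca @ Jump (p2 + length cb) # cb"
    by (simp add: Let_def ce_def ca_def p_def p2_def cb_def)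
  note cod = bs_CondT.prems(1)[unfolded c]
  have p2: "pc + length (comp (Cond e c1 c2) pc) = p2 + length cb" unfolding c p_def p2_def by simp
  obtain r1 where r1: "agrees r1 s" "reaches P (pc, r) (replicate (length ce + 1) None) (p, r1)"
    unfolding ce_def
    by (rule comp_exp_test[where pc = pc and e = e and s = s and r = r])
       (use cod bs_CondT.prems bs_CondT.hyps in \<open>auto simp: ce_def p_def\<close>)
  have "code_at P p (comp c1 p)" using cod by (simp add: p_def ca_def)
  moreover have "length (comp c1 p) < K" using bs_CondT.prems(6) unfolding c by (simp add: ca_def)
  ultimately obtain tr1 r2 where 2: "reaches P (p, r1) tr1 (p + length ca, r2)"
    "dilated K tr tr1" "agrees r2 s'"
    using bs_CondT.IH[of p r1] r1(1) bs_CondT.prems(3-5) by (auto simp: ca_def)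
  have 3: "reaches P (p + length ca, r2) [None] (p2 + length cb, r2)"
    using cod reaches_step[OF _ refl, of "p + length ca" P r2] by (simp add: p_def)
  have "dilated K ([None] @ tr @ [None]) (replicate (length ce + 1) None @ tr1 @ [None])"
    using bs_CondT.prems(6) unfolding c by (intro dilated_append dilated_silent 2) auto
  with reaches_trans[OF r1(2) reaches_trans[OF 2(1) 3]] 2(3) show ?case unfolding p2 by auto
next
  case (bs_CondF e s c2 tr s' c1)
  define ce where "ce = comp_exp e 0"
  define ca where "ca = comp c1 (pc + length ce + 1)"
  define p where "p = pc + length ce + length ca + 2"
  define cb where "cb = comp c2 p"
  have c: "comp (Cond e c1 c2) pc = ce @ JumpZero 0 p # ca @ Jump (p + length cb) # cb"
    by (simp add: Let_def ce_def ca_def p_def cb_def)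
  note cod = bs_CondF.prems(1)[unfolded c]
  have p: "pc + length (comp (Cond e c1 c2) pc) = p + length cb" unfolding c p_def by simp
  obtain r1 where r1: "agrees r1 s" "reaches P (pc, r) (replicate (length ce + 1) None) (p, r1)"
    unfolding ce_def
    by (rule comp_exp_test[where pc = pc and e = e and s = s and r = r])
       (use cod bs_CondF.prems bs_CondF.hyps in \<open>auto simp: ce_def\<close>)
  have "code_at P p (comp c2 p)" using cod by (simp add: p_def cb_def)
  moreover have "length (comp c2 p) < K" using bs_CondF.prems(6) unfolding c by (simp add: cb_def)
  ultimately obtain tr1 r2 where 2: "reaches P (p, r1) tr1 (p + length cb, r2)"
    "dilated K tr tr1" "agrees r2 s'"
    using bs_CondF.IH[of p r1] r1(1) bs_CondF.prems(3-5) by (auto simp: cb_def)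
  \<comment> \<open>The else branch ends without a jump; its closing source step is matched by no
    machine step at all.\<close>
  have "dilated K ([None] @ tr @ [None]) (replicate (length ce + 1) None @ tr1 @ [])"
    using bs_CondF.prems(6) unfolding c by (intro dilated_append dilated_silent 2) auto
  with reaches_trans[OF r1(2) 2(1)] 2(3) show ?case unfolding p by auto
next
  case (bs_LoopF e s c)
  let ?ce = "comp_exp e 0"
  note cod = bs_LoopF.prems(1)[unfolded comp.simps Let_def]
  obtain r1 where r1: "agrees r1 s" "reaches P (pc, r) (replicate (length ?ce + 1) None)
     (pc + length (comp (Loop e c) pc), r1)"
    by (rule comp_exp_test[where pc = pc and e = e and s = s and r = r])
       (use cod bs_LoopF.prems bs_LoopF.hyps in \<open>auto simp: Let_def add_ac\<close>)
  have "dilated K [None] (replicate (length ?ce + 1) None)"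
    using bs_LoopF.prems(6) by (intro dilated_silent) (auto simp: Let_def)
  with r1 show ?case by blast
next
  case (bs_LoopT e s c tr1 s1 tr2 s2)
  define ce where "ce = comp_exp e 0"
  define p where "p = pc + length ce + 1"
  define ca where "ca = comp c p"
  have c: "comp (Loop e c) pc = ce @ JumpZero 0 (p + length ca + 1) # ca @ [Jump pc]"
    by (simp add: Let_def ce_def ca_def p_def)
  note cod = bs_LoopT.prems(1)[unfolded c]
  obtain r1 where r1: "agrees r1 s" "reaches P (pc, r) (replicate (length ce + 1) None) (p, r1)"
    unfolding ce_def
    by (rule comp_exp_test[where pc = pc and e = e and s = s and r = r])
       (use cod bs_LoopT.prems bs_LoopT.hyps in \<open>auto simp: ce_def p_def\<close>)
  have "code_at P p (comp c p)" using cod by (simp add: p_def ca_def)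
  moreover have "length (comp c p) < K" using bs_LoopT.prems(6) unfolding c by (simp add: ca_def)
  ultimately obtain tr1' r2 where 2: "reaches P (p, r1) tr1' (p + length ca, r2)"
    "dilated K tr1 tr1'" "agrees r2 s1"
    using bs_LoopT.IH(1)[of p r1] r1(1) bs_LoopT.prems(3-5) by (auto simp: ca_def)
  have 3: "reaches P (p + length ca, r2) [None] (pc, r2)"
    using cod reaches_step[OF _ refl, of "p + length ca" P r2] by (simp add: p_def)
  obtain tr2' r3 where 4: "reaches P (pc, r2) tr2' (pc + length (comp (Loop e c) pc), r3)"
    "dilated K tr2 tr2'" "agrees r3 s2"
    using bs_LoopT.IH(2)[of pc r2] 2(3) bs_LoopT.prems by blast
  have "dilated K ([None] @ tr1 @ [None] @ tr2) (replicate (length ce + 1) None @ tr1' @ [None] @ tr2')"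
    using bs_LoopT.prems(6) unfolding c by (intro dilated_append dilated_silent 2 4) auto
  with reaches_trans[OF r1(2) reaches_trans[OF 2(1) reaches_trans[OF 3 4(1)]]] 4(3) show ?case
    by auto
next
  case (bs_Out e s)
  let ?ce = "comp_exp e 0"
  obtain r1 where r1: "evaluates pc r ?ce 0 (aval e s) r1"
    using comp_exp_correct[of pc e 0 s r] bs_Out by auto
  then have "reaches P (pc + length ?ce, r1) [Some (Word (aval e s))] (Suc (pc + length ?ce), r1)"
    using reaches_step[of "pc + length ?ce" P "OutReg 0" r1] bs_Out.prems by (simp add: evaluates_def)
  then have "reaches P (pc, r) (replicate (length ?ce) None @ [Some (Word (aval e s))])
     (pc + length (comp (Out e) pc), r1)" using r1 reaches_trans by (auto simp: evaluates_def)
  moreover have "dilated K [Some (Word (aval e s))] (replicate (length ?ce) None @ [Some (Word (aval e s))])"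
    using bs_Out.prems(6) by (intro dilated_emit) auto
  moreover have "agrees r1 s" using agrees_temp[OF bs_Out.prems(2)] r1 by (auto simp: evaluates_def)
  ultimately show ?case by blast
next
  case (bs_Emit x s)
  show ?case
  proof (cases x)
    case (Word n)
    let ?r = "r(0 := n)"
    have "n < 2 ^ w" using bs_Emit.prems Word by simp
    then have "reaches P (pc, r) ([None] @ [Some x]) (Suc (Suc pc), ?r)"
      using reaches_step[of pc P "Const 0 n" r] reaches_step[of "Suc pc" P "OutReg 0" ?r] bs_Emit.prems(1) Word
      by (intro reaches_trans) auto
    moreover have "dilated K [Some x] ([None] @ [Some x])"
      using bs_Emit.prems(6) Word by (intro dilated_emit) auto
    moreover have "agrees ?r s" by (rule agrees_temp[OF bs_Emit.prems(2)]) (use B_pos in auto)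
    ultimately show ?thesis using Word by (auto simp: numeral_2_eq_2)
  next
    case Comma
    then show ?thesis using reaches_step[of pc P OutComma r] bs_Emit.prems dilated_emit[of "[]" K x]
      by auto
  next
    case Separator
    then show ?thesis using reaches_step[of pc P OutSeparator r] bs_Emit.prems dilated_emit[of "[]" K x]
      by auto
  next
    case EndOfEnum
    then show ?thesis using reaches_step[of pc P OutEnd r] bs_Emit.prems dilated_emit[of "[]" K x]
      by auto
  qed
qed

end

lemma finite_exp_names: "finite (exp_names e)"
  by (induction e) auto

lemma finite_com_names: "finite (com_names c)"
  by (induction c rule: com_names.induct) (auto simp: finite_exp_names)

text \<open>\<open>P\<close> and \<open>K\<close> are chosen before word length, memory bound and
  input. \<open>K\<close> is both the slowdown and the factor by which \<open>N\<close> cells per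
  array grow into machine registers.\<close>

theorem compilation:
  fixes c :: "'n::countable rcom"
  shows "\<exists>P K. \<forall>w N inp tr s'. K * (N + 1) \<le> 2 ^ w \<longrightarrow> ram_env.bs w N inp c (\<lambda>_ _. 0) tr s' \<longrightarrow>
    (\<exists>tr'. dilated K tr tr' \<and> halted P (config_at w P inp (length tr')) \<and>
       tr' = map (output_at w P inp) [0..<length tr'])"
proof -
  \<comment> \<open>Exceeds the codes of all array names in \<open>c\<close>, so that the remainder
    of an address (less \<open>B\<close>) modulo \<open>m\<close> identifies the array.\<close>
  define m where "m = Suc (Max (insert 0 (to_nat ` com_names c)))"
  define B where "B = com_bound c + 3"
  define P where "P = layout.comp m B to_nat c 0"
  \<comment> \<open>The part \<open>B + m\<close> yields \<open>B + m * N \<le> K * (N + 1)\<close>;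
    the rest makes \<open>K\<close> exceed the length of the code.\<close>
  define K where "K = B + m + length P + 1"
  have "\<exists>tr'. dilated K tr tr' \<and> halted P (config_at w P inp (length tr')) \<and>
       tr' = map (output_at w P inp) [0..<length tr']"
    if fits: "K * (N + 1) \<le> 2 ^ w" and bs: "ram_env.bs w N inp c (\<lambda>_ _. 0) tr s'" for w N inp tr s'
  proof -
    have *: "B + m * N \<le> K * (N + 1)" "B \<le> K * (N + 1)" by (auto simp: K_def algebra_simps)
    interpret compile w N inp m B to_nat "com_names c" P K
    proof
      show "inj_on to_nat (com_names c)" by (metis inj_on_def to_nat_split)
      show "to_nat j < m" if "j \<in> com_names c" for j
        using that finite_com_names[of c] by (auto simp: m_def less_Suc_eq_le intro!: Max_ge)
      show "B + m * N \<le> 2 ^ w" using * fits by simp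
      show "3 \<le> B" by (simp add: B_def)
    qed
    have "code_at P 0 (comp c 0)" by (auto simp: code_at_def P_def)
    moreover have "agrees (\<lambda>_. 0) (\<lambda>_ _. 0)" by (simp add: agrees_def)
    moreover have "com_bound c \<le> B" "com_bound c \<le> 2 ^ w" using * fits by (auto simp: B_def)
    ultimately obtain tr' r' where "reaches P (0, \<lambda>_. 0) tr' (0 + length (comp c 0), r')"
      "dilated K tr tr'"
      using comp_correct[OF bs, of 0 "\<lambda>_. 0"] by (auto simp: K_def P_def)
    then have 1: "(step w P inp ^^ length tr') (0, \<lambda>_. 0) = (length P, r')"
      and 2: "tr' = map (\<lambda>t. let c = (step w P inp ^^ t) (0, \<lambda>_. 0) in
        if halted P c then None else instr_output (P ! fst c) (snd c)) [0..<length tr']"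
      unfolding reaches_def by (simp_all only: P_def add_0)
    have "halted P (config_at w P inp (length tr'))"
      unfolding config_at_def 1 by (simp add: halted_def)
    moreover have "tr' = map (output_at w P inp) [0..<length tr']"
      by (rule trans[OF 2]) (simp add: output_at_def config_at_def)
    ultimately show ?thesis using \<open>dilated K tr tr'\<close> by blast
  qed
  then show ?thesis by blast
qed

section \<open>Execution traces of enumeration algorithms\<close>

definition outs :: "'o option list \<Rightarrow> 'o list" where
  "outs tr = List.map_filter id tr"

lemma outs_simps [simp]:
  "outs [] = []" "outs (None # tr) = outs tr" "outs (Some x # tr) = x # outs tr"
  "outs (a @ b) = outs a @ outs b"
  by (auto simp: outs_def List.map_filter_def)

lemma outs_silent: "set b \<subseteq> {None} \<Longrightarrow> outs b = []"
  by (induction b) auto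

lemma dilated_length: "dilated K tr tr' \<Longrightarrow> length tr' \<le> K * length tr"
  by (induction rule: dilated.induct) auto

lemma dilated_outs: "dilated K tr tr' \<Longrightarrow> outs tr' = outs tr"
  by (induction rule: dilated.induct) (auto simp: outs_silent)

text \<open>Carries a division of the source trace into segments over to the machine trace.\<close>

lemma dilated_appendD:
  "dilated K (x @ y) tr' \<Longrightarrow> \<exists>x' y'. tr' = x' @ y' \<and> dilated K x x' \<and> dilated K y y'"
proof (induction x arbitrary: tr')
  case Nil
  then show ?case by (intro exI[of _ "[]"] exI[of _ tr']) (auto intro: dilated_Nil)
next
  case (Cons z x)
  from Cons.prems show ?case
  proof (cases rule: dilated.cases)
    case (dilated_None b t t')
    from Cons.IH[of t'] dilated_None obtain x' y' where
      "t' = x' @ y'" "dilated K x x'" "dilated K y y'" by auto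
    with dilated_None show ?thesis
      by (intro exI[of _ "b @ x'"] exI[of _ y']) (auto intro: dilated.intros)
  next
    case (dilated_Some b t t' u)
    from Cons.IH[of t'] dilated_Some obtain x' y' where
      "t' = x' @ y'" "dilated K x x'" "dilated K y y'" by auto
    with dilated_Some show ?thesis
      by (intro exI[of _ "b @ Some u # x'"] exI[of _ y']) (auto intro: dilated.intros)
  qed auto
qed

fun timed :: "nat \<Rightarrow> 'o option list \<Rightarrow> (nat \<times> 'o) list" where
  "timed k [] = []"
| "timed k (None # tr) = timed (Suc k) tr"
| "timed k (Some x # tr) = (k, x) # timed (Suc k) tr"

lemma timed_append: "timed k (a @ b) = timed k a @ timed (k + length a) b"
  by (induction k a rule: timed.induct) auto

lemma snd_timed: "map snd (timed k tr) = outs tr"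
  by (induction k tr rule: timed.induct) auto

lemma length_timed: "length (timed k tr) = length (outs tr)"
  using arg_cong[OF snd_timed, of length k tr] by simp

lemma fst_timed: "p \<in> set (timed k tr) \<Longrightarrow> k \<le> fst p \<and> fst p \<le> k + length tr"
  by (induction k tr rule: timed.induct) force+

lemma timed_output_trace:
  assumes "tr = map (output_at w P inp) [0..<length tr]"
  shows "timed_output w P inp (length tr) = timed 0 tr"
proof -
  have *: "List.map_filter (\<lambda>t. map_option (Pair t) (f t)) [k..<k + n] = timed k (map f [k..<k + n])"
    for f :: "nat \<Rightarrow> 'o option" and k n
  proof (induction n arbitrary: k)
    case (Suc n)
    have u: "[k..<k + Suc n] = k # [Suc k..<Suc k + n]" by (simp add: upt_conv_Cons)
    show ?case unfolding u using Suc[of "Suc k"]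
      by (cases "f k") (auto simp: List.map_filter_def)
  qed (simp add: List.map_filter_def)
  have "timed_output w P inp (length tr) = timed 0 (map (output_at w P inp) [0..<length tr])"
    unfolding timed_output_def using *[of "output_at w P inp" 0 "length tr"] by simp
  with assms show ?thesis by metis
qed

abbreviation joined :: "('b list \<times> 'b list) list \<Rightarrow> 'b list" where
  "joined segs \<equiv> concat (map (\<lambda>(a, b). a @ b) segs)"

text \<open>A pair \<open>(a, b)\<close> is the part of the run that belongs to one output, cut so
  that the first symbol falls into the short piece \<open>a\<close>. Each output thus starts within
  \<open>c\<close> steps of the beginning of its segment, and consecutive starts are at most
  \<open>length a + length b + c\<close> apart. The stray \<open>c\<close> is absorbed because every
  output has at least one symbol.\<close>

lemma enumerates_undilated:
  assumes run: "halted P (config_at w P inp (length tr))" "tr = map (output_at w P inp) [0..<length tr]"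
    and tr: "tr = pre @ joined segs @ fin"
    and pre: "outs pre = []" "length pre \<le> p"
    and segs: "\<And>a b. (a, b) \<in> set segs \<Longrightarrow>
      outs a \<noteq> [] \<and> length a \<le> c \<and> length a + length b \<le> d * length (outs a @ outs b)"
    and fin: "outs fin = [EndOfEnum]" "length fin \<le> c"
    and xs: "distinct xs" "set xs = A" "list_all2 rep xs (map (\<lambda>(a, b). outs a @ outs b) segs)"
  shows "enumerates w P inp rep A (p + c) (d + c)"
proof -
  let ?T = "length tr" and ?os = "map (\<lambda>(a, b). outs a @ outs b) segs"
  let ?S = "\<lambda>i. concat (map (\<lambda>(a, b). a @ b) (take i segs))"
  define out where "out = timed_output w P inp ?T"
  define start where "start = (\<lambda>i. fst (out ! length (concat (take i ?os))))"
  have out: "out = timed 0 tr" unfolding out_def by (rule timed_output_trace[OF run(2)])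
  have outs_concat: "outs (joined ss) = concat (map (\<lambda>(a, b). outs a @ outs b) ss)"
    for ss :: "(osym option list \<times> osym option list) list"
    by (induction ss) auto
  have first: "length pre + length (?S i) \<le> start i \<and> start i \<le> length pre + length (?S i) + c"
    if "tr = (pre @ ?S i) @ a @ r" "outs a \<noteq> []" "length a \<le> c" for i a r
  proof -
    let ?k = "length (pre @ ?S i)"
    have "length (concat (take i ?os)) = length (timed 0 (pre @ ?S i))"
      unfolding length_timed by (simp add: pre(1) outs_concat take_map)
    moreover have "out = timed 0 (pre @ ?S i) @ timed ?k a @ timed (?k + length a) r"
      unfolding out that(1) timed_append by simp
    moreover have a: "timed ?k a \<noteq> []" using that(2) length_timed[of ?k a] by auto
    ultimately have "out ! length (concat (take i ?os)) = hd (timed ?k a)"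
      by (simp add: nth_append hd_conv_nth)
    with fst_timed[OF hd_in_set[OF a]] that(3) show ?thesis by (auto simp: start_def)
  qed
  have start: "length pre + length (?S i) \<le> start i \<and> start i \<le> length pre + length (?S i) + c"
    if "i \<le> length segs" for i
  proof (cases "i < length segs")
    case True
    obtain a b where ab: "segs ! i = (a, b)" by fastforce
    have "segs = take i segs @ (a, b) # drop (Suc i) segs" using True ab by (metis id_take_nth_drop)
    then have "joined segs =
      concat (map (\<lambda>(a, b). a @ b) (take i segs @ (a, b) # drop (Suc i) segs))" by simp
    then have "joined segs = ?S i @ a @ b @ concat (map (\<lambda>(a, b). a @ b) (drop (Suc i) segs))"
      by simp
    with tr have "tr = (pre @ ?S i) @ a @ (b @ concat (map (\<lambda>(a, b). a @ b) (drop (Suc i) segs)) @ fin)"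
      by (simp only: append_assoc)
    from first[OF this] segs[of a b] True ab show ?thesis using nth_mem by fastforce
  next
    case False
    with that have "tr = (pre @ ?S i) @ fin @ []" using tr by simp
    from first[OF this] fin show ?thesis by simp
  qed
  have "start (Suc i) \<le> start i + (d + c) * length (?os ! i)" if i: "i < length ?os" for i
  proof -
    obtain a b where ab: "segs ! i = (a, b)" by fastforce
    with i have "(a, b) \<in> set segs" by (metis length_map nth_mem)
    note s = segs[OF this]
    have "?S (Suc i) = ?S i @ a @ b" using i ab by (simp add: take_Suc_conv_app_nth)
    then have "start (Suc i) \<le> length pre + length (?S i) + (length a + length b) + c"
      using start[of "Suc i"] i by simp
    also have "\<dots> \<le> start i + d * length (?os ! i) + c" using start[of i] s i ab by simp
    also have "c \<le> c * length (?os ! i)" using s i ab by (cases "outs a") auto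
    finally show ?thesis by (simp add: algebra_simps)
  qed
  moreover have "start 0 \<le> p + c" using start[of 0] pre(2) by simp
  moreover have "map snd out = concat ?os @ [EndOfEnum]"
    unfolding out snd_timed tr using pre fin by (simp add: outs_concat)
  ultimately show ?thesis
    unfolding enumerates_def
    by (intro exI[of _ ?T] exI[of _ xs] exI[of _ ?os]) (use run(1) xs in \<open>simp add: Let_def out_def start_def\<close>)
qed

lemma dilated_segments:
  assumes "dilated K (joined segs) tr'"
  shows "\<exists>segs'. tr' = joined segs' \<and>
    list_all2 (\<lambda>(a, b) (a', b'). dilated K a a' \<and> dilated K b b') segs segs'"
  using assms
proof (induction segs arbitrary: tr')
  case Nil
  then show ?case by (auto elim: dilated.cases)
next
  case (Cons ab segs)
  obtain a b where ab: "ab = (a, b)" by fastforce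
  with Cons.prems have "dilated K (a @ b @ joined segs) tr'" by simp
  from dilated_appendD[OF this] obtain a' u where 1: "tr' = a' @ u" "dilated K a a'"
    "dilated K (b @ joined segs) u" by blast
  from dilated_appendD[OF 1(3)] obtain b' t where "u = b' @ t" "dilated K b b'"
    "dilated K (joined segs) t" by blast
  with 1 have *: "tr' = a' @ b' @ t" "dilated K a a'" "dilated K b b'"
    "dilated K (joined segs) t" by auto
  from Cons.IH[OF *(4)] obtain segs' where "t = joined segs'"
    "list_all2 (\<lambda>(a, b) (a', b'). dilated K a a' \<and> dilated K b b') segs segs'" by blast
  with * ab show ?case by (intro exI[of _ "(a', b') # segs'"]) auto
qed

text \<open>All conditions speak of the source trace, where steps are easy to count; the slowdown
  enters only through the factor \<open>K\<close> in the conclusion.\<close>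

lemma enumeratesI:
  assumes run: "halted P (config_at w P inp (length tr'))" "tr' = map (output_at w P inp) [0..<length tr']"
    and dil: "dilated K tr tr'"
    and tr: "tr = pre @ joined segs @ fin"
    and pre: "outs pre = []" "length pre \<le> p"
    and segs: "\<And>a b. (a, b) \<in> set segs \<Longrightarrow>
      outs a \<noteq> [] \<and> length a \<le> c \<and> length a + length b \<le> d * length (outs a @ outs b)"
    and fin: "outs fin = [EndOfEnum]" "length fin \<le> c"
    and xs: "distinct xs" "set xs = A" "list_all2 rep xs (map (\<lambda>(a, b). outs a @ outs b) segs)"
  shows "enumerates w P inp rep A (K * p + K * c) (K * d + K * c)"
proof -
  from dilated_appendD[OF dil[unfolded tr]] obtain pre' u where
    1: "tr' = pre' @ u" "dilated K pre pre'" "dilated K (joined segs @ fin) u"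
    by blast
  from dilated_appendD[OF 1(3)] obtain t fin' where "u = t @ fin'"
    "dilated K (joined segs) t" "dilated K fin fin'" by blast
  with 1 have t: "tr' = pre' @ t @ fin'" "dilated K pre pre'"
    "dilated K (joined segs) t" "dilated K fin fin'" by auto
  from dilated_segments[OF t(3)] obtain segs' where segs':
    "t = joined segs'"
    "list_all2 (\<lambda>(a, b) (a', b'). dilated K a a' \<and> dilated K b b') segs segs'" by blast
  have eq: "map (\<lambda>(a, b). outs a @ outs b) segs' = map (\<lambda>(a, b). outs a @ outs b) segs"
    using segs'(2) by (induction rule: list_all2_induct) (auto simp: dilated_outs)
  show ?thesis
  proof (rule enumerates_undilated[OF run, of pre' segs' fin'])
    show "tr' = pre' @ joined segs' @ fin'" using t segs' by simp
    show "outs pre' = []" "outs fin' = [EndOfEnum]"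
      using t pre fin by (auto simp: dilated_outs)
    show "length pre' \<le> K * p" "length fin' \<le> K * c"
      using dilated_length[OF t(2)] dilated_length[OF t(4)] pre fin
      by (meson le_trans mult_le_mono2)+
    show "list_all2 rep xs (map (\<lambda>(a, b). outs a @ outs b) segs')" unfolding eq by fact
  next
    fix a' b' assume "(a', b') \<in> set segs'"
    then obtain i where i: "i < length segs'" "segs' ! i = (a', b')" by (auto simp: in_set_conv_nth)
    obtain a b where "segs ! i = (a, b)" by fastforce
    with i segs'(2) have ab: "(a, b) \<in> set segs" "dilated K a a'" "dilated K b b'"
      using nth_mem[of i segs] by (auto simp: list_all2_conv_all_nth)
    note s = segs[OF ab(1)]
    have "length a' + length b' \<le> K * (length a + length b)"
      using dilated_length[OF ab(2)] dilated_length[OF ab(3)] by (simp add: algebra_simps)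
    also have "\<dots> \<le> K * (d * length (outs a @ outs b))" using s by (intro mult_le_mono2) simp
    finally have 1: "length a' + length b' \<le> K * d * length (outs a @ outs b)" by (simp add: mult.assoc)
    have "length a' \<le> K * c" using dilated_length[OF ab(2)] s by (meson le_trans mult_le_mono2)
    with 1 s show "outs a' \<noteq> [] \<and> length a' \<le> K * c \<and> length a' + length b' \<le> K * d * length (outs a' @ outs b')"
      by (simp add: dilated_outs[OF ab(2)] dilated_outs[OF ab(3)])
  qed (use xs in auto)
qed

section \<open>Forest algebra expressions\<close>

text \<open>The Boolean of \<open>Lf\<close> marks a leaf of the form \<open>LetterCtx\<close>, that
  of \<open>Op\<close> a vertical concatenation. Leaf labels are polymorphic: the same expression is
  used with letters and with letters paired with vertex numbers.\<close>

datatype 'b ex = Lf bool 'b | Op bool "'b ex" "'b ex"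

primrec leaves :: "'b ex \<Rightarrow> 'b list" where
  "leaves (Lf c b) = [b]"
| "leaves (Op o' t u) = leaves t @ leaves u"

primrec isctx :: "'b ex \<Rightarrow> bool" where
  "isctx (Lf c b) = c"
| "isctx (Op v t u) = (if v then isctx u else isctx t \<or> isctx u)"

primrec wfx :: "'b ex \<Rightarrow> bool" where
  "wfx (Lf c b) = True"
| "wfx (Op v t u) = (wfx t \<and> wfx u \<and> (if v then isctx t else \<not> (isctx t \<and> isctx u)))"

definition plug :: "'b option forest \<Rightarrow> 'b option forest \<Rightarrow> 'b option forest" where
  "plug g f = concat (map (plug_tree g) f)"

primrec val :: "'b ex \<Rightarrow> 'b option forest" where
  "val (Lf c b) = [Node (Some b) (if c then [Node None []] else [])]"
| "val (Op v t u) = (if v then plug (val u) (val t) else val t @ val u)"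

text \<open>Arbitrary on trees without a value; it is applied to unfoldings in an f-SLP, which
  always have one.\<close>

fun ex_of :: "'a symb btree \<Rightarrow> 'a ex" where
  "ex_of (Leaf (Letter a)) = Lf False a"
| "ex_of (Leaf (LetterCtx a)) = Lf True a"
| "ex_of (Branch VConcat s t) = Op True (ex_of s) (ex_of t)"
| "ex_of (Branch x s t) = Op False (ex_of s) (ex_of t)"
| "ex_of (Leaf x) = undefined"

section \<open>Holes in the values of expressions\<close>

definition hleaf :: "'b option forest \<Rightarrow> bool" where
  "hleaf f \<longleftrightarrow> (\<forall>t\<in>set f. holes_at_leaves t)"

definition hcount :: "'b option forest \<Rightarrow> nat" where
  "hcount f = sum_list (map holes f)"

lemma hleaf_plug_tree: "hleaf g \<Longrightarrow> holes_at_leaves t \<Longrightarrow> hleaf (plug_tree g t)"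
proof (induction g t rule: plug_tree.induct)
  case (2 g a ts)
  then have "hleaf (plug_tree g t)" if "t \<in> set ts" for t using that by simp
  then show ?case by (simp add: hleaf_def)
qed simp

lemma hcount_plug_tree: "holes_at_leaves t \<Longrightarrow> hcount (plug_tree g t) = holes t * hcount g"
proof (induction g t rule: plug_tree.induct)
  case (2 g a ts)
  have "sum_list (map holes (concat (map (plug_tree g) ts))) = sum_list (map holes ts) * hcount g"
    using 2 by (induction ts) (auto simp: hcount_def algebra_simps)
  then show ?case by (simp add: hcount_def)
qed (simp add: hcount_def)

lemma hcount_plug: "hleaf f \<Longrightarrow> hcount (plug g f) = hcount f * hcount g"
proof (induction f)
  case (Cons t f)
  then show ?case using hcount_plug_tree[of t g] by (simp add: plug_def hcount_def hleaf_def algebra_simps)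
qed (simp add: plug_def hcount_def)

text \<open>Numbers of holes multiply under \<open>plug\<close> and add under concatenation. So the
  syntactic type \<open>isctx\<close> decides whether the value is a context, without evaluating
  anything.\<close>

lemma val_holes: "wfx t \<Longrightarrow> hleaf (val t) \<and> hcount (val t) = (if isctx t then 1 else 0)"
proof (induction t)
  case (Op v t u)
  then show ?case
  proof (cases v)
    case True
    then have "hleaf (plug (val u) (val t))"
      using Op hleaf_plug_tree[of "val u"] by (fastforce simp: hleaf_def plug_def)
    then show ?thesis using True Op hcount_plug[of "val t" "val u"] by auto
  qed (auto simp: hleaf_def hcount_def)
qed (auto simp: hleaf_def hcount_def)

lemma is_context_val: "wfx t \<Longrightarrow> is_context (val t) \<longleftrightarrow> isctx t"
  using val_holes[of t] by (auto simp: is_context_def hleaf_def hcount_def)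

lemma expr_value_ex: "expr_value e = Some f \<Longrightarrow> wfx (ex_of e) \<and> val (ex_of e) = f"
proof (induction e arbitrary: f rule: expr_value.induct)
  case (3 s t)
  then obtain f1 f2 where "expr_value s = Some f1" "expr_value t = Some f2" "hconcat f1 f2 = Some f"
    by (auto simp: bind_eq_Some_conv)
  with 3 is_context_val[of "ex_of s"] is_context_val[of "ex_of t"] show ?case
    by (auto simp: hconcat_def split: if_splits)
next
  case (4 s t)
  then obtain f1 f2 where "expr_value s = Some f1" "expr_value t = Some f2" "vconcat f1 f2 = Some f"
    by (auto simp: bind_eq_Some_conv)
  with 4 is_context_val[of "ex_of s"] show ?case
    by (auto simp: vconcat_def plug_def split: if_splits)
qed auto

text \<open>Sibling pairs created by an operation involve a first and a last root, which therefore
  must exist.\<close>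

lemma val_nonempty: "wfx t \<Longrightarrow> val t \<noteq> []"
proof (induction t)
  case (Op v t u)
  have "plug_tree (val u) x \<noteq> []" for x
    using Op by (cases "(val u, x)" rule: plug_tree.cases) auto
  then show ?case using Op by (cases "val t") (auto simp: plug_def)
qed auto

lemma map_tree_plug_tree:
  "map (map_tree (map_option h)) (plug_tree g t) = plug_tree (map (map_tree (map_option h)) g) (map_tree (map_option h) t)"
proof (induction g t rule: plug_tree.induct)
  case (2 g a ts)
  then have "map (map_tree (map_option h)) (concat (map (plug_tree g) ts)) =
    concat (map (plug_tree (map (map_tree (map_option h)) g)) (map (map_tree (map_option h)) ts))"
    by (induction ts) auto
  then show ?case by simp
qed simp

lemma val_map: "val (map_ex h t) = map (map_tree (map_option h)) (val t)"
  by (induction t) (auto simp: plug_def map_concat map_tree_plug_tree o_def)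

lemma isctx_map [simp]: "isctx (map_ex h t) = isctx t" by (induction t) auto
lemma wfx_map [simp]: "wfx (map_ex h t) = wfx t" by (induction t) auto
lemma leaves_map [simp]: "leaves (map_ex h t) = map h (leaves t)" by (induction t) auto

section \<open>Child and sibling pairs of labels\<close>

fun root :: "'b tree \<Rightarrow> 'b" where "root (Node a ts) = a"

abbreviation roots :: "'b forest \<Rightarrow> 'b list" where "roots f \<equiv> map root f"

definition adjacent :: "'b list \<Rightarrow> ('b \<times> 'b) set" where
  "adjacent xs = set (zip xs (tl xs))"

lemma adjacent_Nil [simp]: "adjacent [] = {}" by (simp add: adjacent_def)
lemma adjacent_single [simp]: "adjacent [x] = {}" by (simp add: adjacent_def)
lemma adjacent_Cons [simp]: "adjacent (x # y # ys) = insert (x, y) (adjacent (y # ys))"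
  by (simp add: adjacent_def)

lemma adjacent_append:
  "xs \<noteq> [] \<Longrightarrow> ys \<noteq> [] \<Longrightarrow> adjacent (xs @ ys) = adjacent xs \<union> adjacent ys \<union> {(last xs, hd ys)}"
proof (induction xs)
  case (Cons x xs)
  then show ?case by (cases xs; cases ys) auto
qed simp

lemma adjacent_nth: "(a, b) \<in> adjacent xs \<longleftrightarrow> (\<exists>j. Suc j < length xs \<and> a = xs ! j \<and> b = xs ! Suc j)"
  unfolding adjacent_def set_zip by (cases xs) (auto simp: nth_tl)

lemma adjacent_map: "adjacent (map h xs) = map_prod h h ` adjacent xs"
  by (induction xs rule: induct_list012) auto

lemma adjacent_concat:
  assumes "\<And>x. x \<in> set xs \<Longrightarrow> G x \<noteq> []"
  shows "adjacent (concat (map G xs)) = (\<Union>x\<in>set xs. adjacent (G x)) \<union> (\<lambda>(a, b). (last (G a), hd (G b))) ` adjacent xs"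
  using assms
proof (induction xs)
  case (Cons x xs)
  show ?case
  proof (cases xs)
    case (Cons y ys)
    then have "hd (concat (map G xs)) = hd (G y)" "concat (map G xs) \<noteq> []" "G x \<noteq> []"
      using Cons.prems by auto
    then show ?thesis using Cons.IH Cons.prems Cons by (auto simp: adjacent_append)
  qed simp
qed simp

text \<open>Relations between labels, unlike relations between addresses, can be computed along an
  expression. They become relations between vertices again once labels are unique.\<close>

primrec child_labels :: "'b tree \<Rightarrow> ('b \<times> 'b) set" where
  "child_labels (Node a ts) = Pair a ` set (roots ts) \<union> \<Union> (set (map child_labels ts))"

definition chF :: "'b forest \<Rightarrow> ('b \<times> 'b) set" where
  "chF f = (\<Union>t\<in>set f. child_labels t)"

primrec sib_labels :: "'b tree \<Rightarrow> ('b \<times> 'b) set" where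
  "sib_labels (Node a ts) = adjacent (roots ts) \<union> \<Union> (set (map sib_labels ts))"

definition sbF :: "'b forest \<Rightarrow> ('b \<times> 'b) set" where
  "sbF f = adjacent (roots f) \<union> (\<Union>t\<in>set f. sib_labels t)"

lemma chF_simps [simp]: "chF [] = {}" "chF (t # f) = child_labels t \<union> chF f" "chF (f @ g) = chF f \<union> chF g"
  by (auto simp: chF_def)

lemma child_labels_Node: "child_labels (Node a ts) = Pair a ` set (roots ts) \<union> chF ts"
  by (auto simp: chF_def)

lemma sib_labels_Node: "sib_labels (Node a ts) = sbF ts"
  by (auto simp: sbF_def)

lemma sbF_append: "f \<noteq> [] \<Longrightarrow> g \<noteq> [] \<Longrightarrow> sbF (f @ g) = sbF f \<union> sbF g \<union> {(last (roots f), hd (roots g))}"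
  by (auto simp: sbF_def adjacent_append)

lemma chF_concat: "chF (concat (map G f)) = (\<Union>t\<in>set f. chF (G t))"
  by (auto simp: chF_def)

lemma sbF_concat:
  assumes "\<And>t. t \<in> set f \<Longrightarrow> G t \<noteq> []"
  shows "sbF (concat (map G f)) = (\<Union>t\<in>set f. sbF (G t)) \<union>
    (\<lambda>(s, t). (last (roots (G s)), hd (roots (G t)))) ` adjacent f"
proof -
  have "adjacent (roots (concat (map G f))) = (\<Union>x\<in>set f. adjacent (roots (G x))) \<union>
    (\<lambda>(a, b). (last (roots (G a)), hd (roots (G b)))) ` adjacent f"
    using adjacent_concat[of f "\<lambda>t. roots (G t)"] assms by (simp add: map_concat o_def)
  then show ?thesis by (auto simp: sbF_def)
qed

text \<open>What takes the place of a vertex labelled \<open>x\<close> in its row of siblings when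
  \<open>g\<close> is plugged in.\<close>

definition subst_roots :: "'b option forest \<Rightarrow> 'b option \<Rightarrow> 'b option list" where
  "subst_roots g x = (case x of None \<Rightarrow> roots g | Some a \<Rightarrow> [Some a])"

lemma subst_roots_simps [simp]: "subst_roots g None = roots g" "subst_roots g (Some a) = [Some a]"
  by (auto simp: subst_roots_def)

lemma roots_plug_tree: "holes_at_leaves t \<Longrightarrow> roots (plug_tree g t) = subst_roots g (root t)"
  by (cases "(g, t)" rule: plug_tree.cases) auto

lemma roots_plug: "hleaf f \<Longrightarrow> roots (plug g f) = concat (map (subst_roots g) (roots f))"
  unfolding plug_def hleaf_def
proof (induction f)
  case (Cons t f)
  then show ?case using roots_plug_tree[of t g] by simp
qed simp

lemma UN_Un_if: "(\<Union>t\<in>S. A t \<union> (if P t then B else {})) = (\<Union>t\<in>S. A t) \<union> (if \<exists>t\<in>S. P t then B else {})"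
  by (auto split: if_splits)

lemma hcount_pos: "0 < hcount f \<longleftrightarrow> (\<exists>t\<in>set f. 0 < holes t)"
  by (induction f) (auto simp: hcount_def)

lemma chF_plug_tree:
  "holes_at_leaves t \<Longrightarrow> chF (plug_tree g t) =
    {(a, b'). \<exists>b. (a, b) \<in> child_labels t \<and> b' \<in> set (subst_roots g b)} \<union> (if 0 < holes t then chF g else {})"
proof (induction g t rule: plug_tree.induct)
  case (2 g a ts)
  have "chF (plug g ts) = (\<Union>t\<in>set ts. chF (plug_tree g t))" by (simp add: plug_def chF_concat)
  also have "\<dots> = (\<Union>t\<in>set ts. {(a, b'). \<exists>b. (a, b) \<in> child_labels t \<and> b' \<in> set (subst_roots g b)} \<union> (if 0 < holes t then chF g else {}))"
    using 2 by (intro SUP_cong) auto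
  also have "\<dots> = {(a, b'). \<exists>b. (a, b) \<in> chF ts \<and> b' \<in> set (subst_roots g b)} \<union>
      (if 0 < sum_list (map holes ts) then chF g else {})"
    unfolding UN_Un_if hcount_pos[unfolded hcount_def, symmetric] by (auto simp: chF_def)
  finally have *: "chF (plug g ts) = \<dots>" .
  have "set (roots (plug g ts)) = (\<Union>b\<in>set (roots ts). set (subst_roots g b))"
    using roots_plug[of ts g] 2(2) by (simp add: hleaf_def del: map_map)
  then show ?case
    using * by (auto simp: plug_def[symmetric] child_labels_Node simp del: child_labels.simps)
qed simp

lemma plug_tree_nonempty: "g \<noteq> [] \<Longrightarrow> plug_tree g t \<noteq> []"
  by (cases "(g, t)" rule: plug_tree.cases) auto

lemma adjacent_in_set: "(a, b) \<in> adjacent xs \<Longrightarrow> a \<in> set xs \<and> b \<in> set xs"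
  by (auto simp: adjacent_nth)

text \<open>A pair with the hole on its left becomes a pair with the last root of \<open>g\<close>,
  one with the hole on its right a pair with the first root. The claim for trees is a premise, so
  that the lemma serves inside the induction on trees and afterwards for forests.\<close>

lemma sbF_plug_aux:
  assumes "\<And>t. t \<in> set f \<Longrightarrow> sbF (plug_tree g t) =
    (\<lambda>(a, b). (last (subst_roots g a), hd (subst_roots g b))) ` sib_labels t \<union> (if 0 < holes t then sbF g else {})"
    and "hleaf f" "g \<noteq> []"
  shows "sbF (plug g f) =
    (\<lambda>(a, b). (last (subst_roots g a), hd (subst_roots g b))) ` sbF f \<union> (if 0 < hcount f then sbF g else {})"
proof -
  let ?h = "\<lambda>(a, b). (last (subst_roots g a), hd (subst_roots g b))"
  have "sbF (plug g f) = (\<Union>t\<in>set f. sbF (plug_tree g t)) \<union>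
    (\<lambda>(s, t). (last (roots (plug_tree g s)), hd (roots (plug_tree g t)))) ` adjacent f"
    unfolding plug_def by (rule sbF_concat) (rule plug_tree_nonempty[OF assms(3)])
  also have "(\<Union>t\<in>set f. sbF (plug_tree g t)) = (\<Union>t\<in>set f. ?h ` sib_labels t \<union> (if 0 < holes t then sbF g else {}))"
    using assms(1) by (intro SUP_cong) auto
  also have "(\<lambda>(s, t). (last (roots (plug_tree g s)), hd (roots (plug_tree g t)))) ` adjacent f = ?h ` adjacent (roots f)"
    unfolding adjacent_map image_image using assms(2)
    by (intro image_cong) (auto simp: hleaf_def roots_plug_tree dest!: adjacent_in_set)
  finally show ?thesis unfolding UN_Un_if hcount_pos by (auto simp: sbF_def)
qed

lemma sbF_plug_tree:
  "holes_at_leaves t \<Longrightarrow> g \<noteq> [] \<Longrightarrow> sbF (plug_tree g t) =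
    (\<lambda>(a, b). (last (subst_roots g a), hd (subst_roots g b))) ` sib_labels t \<union> (if 0 < holes t then sbF g else {})"
proof (induction g t rule: plug_tree.induct)
  case (2 g a ts)
  then have "sbF (plug g ts) =
    (\<lambda>(a, b). (last (subst_roots g a), hd (subst_roots g b))) ` sbF ts \<union> (if 0 < hcount ts then sbF g else {})"
    by (intro sbF_plug_aux) (auto simp: hleaf_def)
  moreover have "sbF [Node x f] = sbF f" for x :: "'a option" and f by (simp add: sbF_def)
  ultimately show ?case by (simp add: plug_def hcount_def sib_labels_Node del: sib_labels.simps)
qed (simp add: sbF_def)

lemma sbF_plug:
  "hleaf f \<Longrightarrow> g \<noteq> [] \<Longrightarrow> sbF (plug g f) =
    (\<lambda>(a, b). (last (subst_roots g a), hd (subst_roots g b))) ` sbF f \<union> (if 0 < hcount f then sbF g else {})"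
  by (rule sbF_plug_aux) (auto simp: hleaf_def sbF_plug_tree)

lemma chF_plug:
  "hleaf f \<Longrightarrow> chF (plug g f) =
    {(a, b'). \<exists>b. (a, b) \<in> chF f \<and> b' \<in> set (subst_roots g b)} \<union> (if 0 < hcount f then chF g else {})"
proof -
  assume "hleaf f"
  then have "chF (plug g f) = (\<Union>t\<in>set f. {(a, b'). \<exists>b. (a, b) \<in> child_labels t \<and> b' \<in> set (subst_roots g b)} \<union> (if 0 < holes t then chF g else {}))"
    unfolding plug_def chF_concat by (intro SUP_cong) (auto simp: hleaf_def chF_plug_tree)
  then show ?thesis unfolding UN_Un_if hcount_pos by (auto simp: chF_def)
qed

lemma map_subst_roots: "None \<notin> set xs \<Longrightarrow> concat (map (subst_roots g) xs) = xs"
  by (induction xs) (auto simp: subst_roots_def split: option.splits)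

text \<open>A hole enters only through \<open>LetterCtx\<close>, that is below a letter, and
  plugging never lifts it to the root. Hence a vertical concatenation has the roots of its upper
  operand.\<close>

lemma roots_val_hole: "wfx t \<Longrightarrow> None \<notin> set (roots (val t))"
proof (induction t)
  case (Op v t u)
  then have "roots (plug (val u) (val t)) = roots (val t)"
    using val_holes[of t] by (simp add: roots_plug map_subst_roots del: map_map set_map)
  then show ?case using Op by (auto simp del: set_map)
qed auto

lemma roots_val_Op:
  "wfx (Op v t u) \<Longrightarrow> roots (val (Op v t u)) = (if v then roots (val t) else roots (val t) @ roots (val u))"
  using val_holes[of t] roots_val_hole[of t] by (simp add: roots_plug map_subst_roots del: map_map)

lemma chF_val_Op:
  "wfx (Op v t u) \<Longrightarrow> chF (val (Op v t u)) = (if v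
     then {(a, b'). \<exists>b. (a, b) \<in> chF (val t) \<and> b' \<in> set (subst_roots (val u) b)} \<union> chF (val u)
     else chF (val t) \<union> chF (val u))"
  using val_holes[of t] by (simp add: chF_plug)

lemma sbF_val_Op:
  "wfx (Op v t u) \<Longrightarrow> sbF (val (Op v t u)) = (if v
     then (\<lambda>(a, b). (last (subst_roots (val u) a), hd (subst_roots (val u) b))) ` sbF (val t) \<union> sbF (val u)
     else sbF (val t) \<union> sbF (val u) \<union> {(last (roots (val t)), hd (roots (val u)))})"
  using val_holes[of t] by (simp add: sbF_plug sbF_append val_nonempty)

section \<open>Finite forest algebras for MSO formulas\<close>

type_synonym 'b valuation = "nat + nat \<Rightarrow> 'b set"

text \<open>Element variables are \<open>Inl\<close>, set variables are \<open>Inr\<close>; an element variable is a singleton set.\<close>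

primrec msat :: "('a \<times> 'i) ex \<Rightarrow> ('a \<times> 'i) valuation \<Rightarrow> 'a mso \<Rightarrow> bool" where
  "msat t s (EqF x y) \<longleftrightarrow> (\<exists>a\<in>set (leaves t). a \<in> s (Inl x) \<and> a \<in> s (Inl y))"
| "msat t s (ChildF x y) \<longleftrightarrow> (\<exists>a b. (Some a, Some b) \<in> chF (val t) \<and> a \<in> s (Inl x) \<and> b \<in> s (Inl y))"
| "msat t s (SiblingF x y) \<longleftrightarrow> (\<exists>a b. (Some a, Some b) \<in> sbF (val t) \<and> a \<in> s (Inl x) \<and> b \<in> s (Inl y))"
| "msat t s (LabelF l x) \<longleftrightarrow> (\<exists>a\<in>set (leaves t). a \<in> s (Inl x) \<and> fst a = l)"
| "msat t s (MemF x X) \<longleftrightarrow> (\<exists>a\<in>set (leaves t). a \<in> s (Inl x) \<and> a \<in> s (Inr X))"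
| "msat t s (NotF \<phi>) \<longleftrightarrow> \<not> msat t s \<phi>"
| "msat t s (AndF \<phi> \<psi>) \<longleftrightarrow> msat t s \<phi> \<and> msat t s \<psi>"
| "msat t s (ExElem x \<phi>) \<longleftrightarrow> (\<exists>a\<in>set (leaves t). msat t (s(Inl x := {a})) \<phi>)"
| "msat t s (ExSet X \<phi>) \<longleftrightarrow> (\<exists>A. A \<subseteq> set (leaves t) \<and> msat t (s(Inr X := A)) \<phi>)"

text \<open>The algebra sees the type of a leaf, its letter, and which variables contain it. The
  second component of a label only tells leaves apart and is invisible to the algebra.\<close>

primrec run :: "(bool \<Rightarrow> 'a \<Rightarrow> (nat + nat \<Rightarrow> bool) \<Rightarrow> 's) \<Rightarrow> (bool \<Rightarrow> 's \<Rightarrow> 's \<Rightarrow> 's) \<Rightarrow>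
    ('a \<times> 'i) ex \<Rightarrow> ('a \<times> 'i) valuation \<Rightarrow> 's" where
  "run lf op (Lf c b) s = lf c (fst b) (\<lambda>v. b \<in> s v)"
| "run lf op (Op v t u) s = op v (run lf op t s) (run lf op u s)"

lemma run_Lf_upd: "run lf op (Lf c b) (s(x := A)) = lf c (fst b) ((\<lambda>v. b \<in> s v)(x := b \<in> A))"
  by (auto intro!: arg_cong[of _ _ "lf c (fst b)"])

lemma run_cong:
  "(\<And>v. s v \<inter> set (leaves t) = s' v \<inter> set (leaves t)) \<Longrightarrow> run lf op t s = run lf op t s'"
proof (induction t)
  case (Lf c b)
  then have "b \<in> s v \<longleftrightarrow> b \<in> s' v" for v by auto
  then show ?case by simp
next
  case (Op v t u)
  then have "run lf op t s = run lf op t s'" "run lf op u s = run lf op u s'"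
    by (auto simp: set_eq_iff)
  then show ?case by simp
qed

section \<open>Recognizable properties and their closure under connectives and quantifiers\<close>

definition closed_alg :: "'s set \<Rightarrow> (bool \<Rightarrow> 'a \<Rightarrow> (nat + nat \<Rightarrow> bool) \<Rightarrow> 's) \<Rightarrow> (bool \<Rightarrow> 's \<Rightarrow> 's \<Rightarrow> 's) \<Rightarrow> bool" where
  "closed_alg Q lf op \<longleftrightarrow> finite Q \<and> (\<forall>c a f. lf c a f \<in> Q) \<and> (\<forall>v. \<forall>p\<in>Q. \<forall>q\<in>Q. op v p q \<in> Q)"

lemma run_closed: "closed_alg Q lf op \<Longrightarrow> run lf op t s \<in> Q"
  by (induction t) (auto simp: closed_alg_def)

text \<open>Distinct leaves are assumed because a valuation consists of sets of labels: quantifiers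
  range over vertices only if labels identify leaves.\<close>

definition recognizable :: "(('a \<times> 'i) ex \<Rightarrow> ('a \<times> 'i) valuation \<Rightarrow> bool) \<Rightarrow> bool" where
  "recognizable L \<longleftrightarrow> (\<exists>n lf op acc. closed_alg {..<n::nat} lf op \<and>
     (\<forall>t s. wfx t \<longrightarrow> distinct (leaves t) \<longrightarrow> (L t s \<longleftrightarrow> run lf op t s \<in> acc)))"

text \<open>The constructions below use Booleans, tuples and sets of states; a bijection with an
  initial segment of the naturals turns them into numbers, which a program can store.\<close>

lemma recognizableI:
  fixes L :: "('a \<times> 'i) ex \<Rightarrow> ('a \<times> 'i) valuation \<Rightarrow> bool"
  assumes "closed_alg Q lf op"
    and L: "\<And>t s. wfx t \<Longrightarrow> distinct (leaves t) \<Longrightarrow> L t s \<longleftrightarrow> run lf op t s \<in> acc"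
  shows "recognizable L"
proof -
  have "finite Q" using assms(1) by (simp add: closed_alg_def)
  then obtain h where "bij_betw h Q {0..<card Q}" using ex_bij_betw_finite_nat by blast
  then have h: "inj_on h Q" "h ` Q = {..<card Q}" by (auto simp: bij_betw_def lessThan_atLeast0)
  define g where "g = inv_into Q h"
  define lf' where "lf' = (\<lambda>c a f. h (lf c a f))"
  define op' where "op' = (\<lambda>v p q. h (op v (g p) (g q)))"
  have g: "q \<in> Q \<Longrightarrow> g (h q) = q" "p < card Q \<Longrightarrow> g p \<in> Q" for p q
    using h by (auto simp: g_def) (metis inv_into_into lessThan_iff)
  have cl: "closed_alg {..<card Q} lf' op'"
    using assms(1) h(2) g(2) unfolding closed_alg_def lf'_def op'_def by blast
  have "run lf' op' t s = h (run lf op t s)" for t and s :: "('a \<times> 'i) valuation"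
  proof (induction t)
    case (Op v t u)
    then show ?case using g(1)[OF run_closed[OF assms(1), of t s]] g(1)[OF run_closed[OF assms(1), of u s]] by (simp add: lf'_def op'_def)
  qed (simp add: lf'_def)
  then have "run lf' op' t s \<in> h ` (acc \<inter> Q) \<longleftrightarrow> run lf op t s \<in> acc"
    for t and s :: "('a \<times> 'i) valuation"
    using inj_on_image_mem_iff[OF h(1) run_closed[OF assms(1), of t s], of "acc \<inter> Q"]
      run_closed[OF assms(1), of t s] by simp
  then show ?thesis unfolding recognizable_def using cl L
    by (intro exI[of _ "card Q"] exI[of _ lf'] exI[of _ op'] exI[of _ "h ` (acc \<inter> Q)"]) simp
qed

lemma recognizable_not:
  assumes "recognizable L" shows "recognizable (\<lambda>t s. \<not> L t s)"
proof -
  obtain n lf op acc where "closed_alg {..<n::nat} lf op"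
    "\<forall>t s. wfx t \<longrightarrow> distinct (leaves t) \<longrightarrow> (L t s \<longleftrightarrow> run lf op t s \<in> acc)"
    using assms unfolding recognizable_def by blast
  then show ?thesis unfolding recognizable_def
    by (intro exI[of _ n] exI[of _ lf] exI[of _ op] exI[of _ "- acc"]) simp
qed

lemma recognizable_and:
  fixes L L' :: "('a \<times> 'i) ex \<Rightarrow> ('a \<times> 'i) valuation \<Rightarrow> bool"
  assumes "recognizable L" "recognizable L'" shows "recognizable (\<lambda>t s. L t s \<and> L' t s)"
proof -
  obtain n lf op acc where 1: "closed_alg {..<n::nat} lf op"
    "\<And>t s. wfx t \<Longrightarrow> distinct (leaves t) \<Longrightarrow> L t s \<longleftrightarrow> run lf op t s \<in> acc"
    using assms(1) unfolding recognizable_def by blast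
  obtain n' lf' op' acc' where 2: "closed_alg {..<n'::nat} lf' op'"
    "\<And>t s. wfx t \<Longrightarrow> distinct (leaves t) \<Longrightarrow> L' t s \<longleftrightarrow> run lf' op' t s \<in> acc'"
    using assms(2) unfolding recognizable_def by blast
  let ?lf = "\<lambda>c a f. (lf c a f, lf' c a f)" and ?op = "\<lambda>v p q. (op v (fst p) (fst q), op' v (snd p) (snd q))"
  have "run ?lf ?op t s = (run lf op t s, run lf' op' t s)"
    for t and s :: "('a \<times> 'i) valuation" by (induction t) auto
  moreover have "closed_alg ({..<n} \<times> {..<n'}) ?lf ?op" using 1(1) 2(1) by (auto simp: closed_alg_def)
  ultimately show ?thesis using 1(2) 2(2)
    by (intro recognizableI[of "{..<n} \<times> {..<n'}" ?lf ?op _ "acc \<times> acc'"]) auto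
qed

text \<open>A state is the set of all runs over the choices of the quantified set. The operands have
  disjoint leaves, so a choice for the whole is a pair of independent choices for the
  operands.\<close>

lemma recognizable_ex_set:
  fixes L :: "('a \<times> 'i) ex \<Rightarrow> ('a \<times> 'i) valuation \<Rightarrow> bool"
  assumes "recognizable L"
  shows "recognizable (\<lambda>t s. \<exists>A. A \<subseteq> set (leaves t) \<and> L t (s(Inr X := A)))"
proof -
  obtain n lf op acc where 1: "closed_alg {..<n::nat} lf op"
    "\<And>t s. wfx t \<Longrightarrow> distinct (leaves t) \<Longrightarrow> L t s \<longleftrightarrow> run lf op t s \<in> acc"
    using assms(1) unfolding recognizable_def by blast
  let ?lf = "\<lambda>c a f. {lf c a (f(Inr X := False)), lf c a (f(Inr X := True))}"
  let ?op = "\<lambda>v P Q. {op v p q | p q. p \<in> P \<and> q \<in> Q}"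
  have run: "run ?lf ?op t s = {run lf op t (s(Inr X := A)) | A. A \<subseteq> set (leaves t)}"
    if "distinct (leaves t)" for t and s :: "('a \<times> 'i) valuation"
    using that
  proof (induction t)
    case (Lf c b)
    have eq: "{run lf op (Lf c b) (s(Inr X := A)) | A. A \<subseteq> set (leaves (Lf c b))} =
      {run lf op (Lf c b) (s(Inr X := {})), run lf op (Lf c b) (s(Inr X := {b}))}"
      by (auto simp del: run.simps simp: subset_singleton_iff)
    show ?case unfolding eq unfolding run_Lf_upd
      by (simp only: run.simps empty_iff singleton_iff simp_thms)
  next
    case (Op v t u)
    have d: "set (leaves t) \<inter> set (leaves u) = {}" using Op.prems by auto
    have r: "run lf op t (s(Inr X := A \<union> B)) = run lf op t (s(Inr X := A))"
      "run lf op u (s(Inr X := A \<union> B)) = run lf op u (s(Inr X := B))"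
      if "A \<subseteq> set (leaves t)" "B \<subseteq> set (leaves u)" for A B
    proof -
      have "(A \<union> B) \<inter> set (leaves t) = A \<inter> set (leaves t)" "(A \<union> B) \<inter> set (leaves u) = B \<inter> set (leaves u)"
        using that d by blast+
      then show "run lf op t (s(Inr X := A \<union> B)) = run lf op t (s(Inr X := A))"
        "run lf op u (s(Inr X := A \<union> B)) = run lf op u (s(Inr X := B))"
        by (intro run_cong; simp)+
    qed
    have "{run lf op (Op v t u) (s(Inr X := A)) | A. A \<subseteq> set (leaves (Op v t u))} =
      {run lf op (Op v t u) (s(Inr X := A \<union> B)) | A B. A \<subseteq> set (leaves t) \<and> B \<subseteq> set (leaves u)}"
      (is "?l = ?r")
    proof
      show "?l \<subseteq> ?r"
      proof safe
        fix A assume "A \<subseteq> set (leaves (Op v t u))"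
        then have "A = (A \<inter> set (leaves t)) \<union> (A \<inter> set (leaves u))" by auto
        then show "\<exists>A' B. run lf op (Op v t u) (s(Inr X := A)) = run lf op (Op v t u) (s(Inr X := A' \<union> B)) \<and>
            A' \<subseteq> set (leaves t) \<and> B \<subseteq> set (leaves u)" by (metis inf_le2)
      qed
      show "?r \<subseteq> ?l" by (auto simp del: run.simps)
    qed
    also have "\<dots> = ?op v (run ?lf ?op t s) (run ?lf ?op u s)"
    proof -
      have "{run lf op (Op v t u) (s(Inr X := A \<union> B)) | A B. A \<subseteq> set (leaves t) \<and> B \<subseteq> set (leaves u)} =
        {op v (run lf op t (s(Inr X := A))) (run lf op u (s(Inr X := B))) | A B. A \<subseteq> set (leaves t) \<and> B \<subseteq> set (leaves u)}"
        by (intro Collect_cong ex_cong1) (auto simp: r simp del: fun_upd_apply)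
      also have "\<dots> = ?op v (run ?lf ?op t s) (run ?lf ?op u s)"
        using Op.IH Op.prems by (simp del: fun_upd_apply) blast
      finally show ?thesis .
    qed
    finally show ?case by (simp only: run.simps)
  qed
  have *: "lf c a f < n" "p < n \<Longrightarrow> q < n \<Longrightarrow> op v p q < n" for c a f v p q
    using 1(1) by (auto simp: closed_alg_def)
  show ?thesis
  proof (rule recognizableI[of "Pow {..<n}" ?lf ?op _ "{P. P \<inter> acc \<noteq> {}}"])
    show "closed_alg (Pow {..<n}) ?lf ?op"
      unfolding closed_alg_def by (auto simp: *(1) subset_iff intro!: *(2))
  next
    fix t :: "('a \<times> 'i) ex" and s assume "wfx t" "distinct (leaves t)"
    then show "(\<exists>A. A \<subseteq> set (leaves t) \<and> L t (s(Inr X := A))) \<longleftrightarrow> run ?lf ?op t s \<in> {P. P \<inter> acc \<noteq> {}}"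
      unfolding run[OF \<open>distinct (leaves t)\<close>] by (simp add: 1(2) del: fun_upd_apply) blast
  qed
qed

text \<open>A state is the run with the variable empty, together with the set of runs in which it is
  a single leaf. At \<open>Op\<close> this leaf lies in exactly one operand; the other one
  contributes its run with the variable empty.\<close>

lemma recognizable_ex_elem:
  fixes L :: "('a \<times> 'i) ex \<Rightarrow> ('a \<times> 'i) valuation \<Rightarrow> bool"
  assumes "recognizable L"
  shows "recognizable (\<lambda>t s. \<exists>a\<in>set (leaves t). L t (s(Inl x := {a})))"
proof -
  obtain n lf op acc where 1: "closed_alg {..<n::nat} lf op"
    "\<And>t s. wfx t \<Longrightarrow> distinct (leaves t) \<Longrightarrow> L t s \<longleftrightarrow> run lf op t s \<in> acc"
    using assms(1) unfolding recognizable_def by blast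
  let ?lf = "\<lambda>c a f. (lf c a (f(Inl x := False)), {lf c a (f(Inl x := True))})"
  let ?op = "\<lambda>v p q. (op v (fst p) (fst q), (\<lambda>p'. op v p' (fst q)) ` snd p \<union> op v (fst p) ` snd q)"
  have run: "run ?lf ?op t s = (run lf op t (s(Inl x := {})), (\<lambda>a. run lf op t (s(Inl x := {a}))) ` set (leaves t))"
    if "distinct (leaves t)" for t and s :: "('a \<times> 'i) valuation"
    using that
  proof (induction t)
    case (Lf c b)
    show ?case by (simp add: run_Lf_upd del: run.simps(1)) simp
  next
    case (Op v t u)
    have d: "set (leaves t) \<inter> set (leaves u) = {}" using Op.prems by auto
    have r: "a \<in> set (leaves u) \<Longrightarrow> run lf op t (s(Inl x := {a})) = run lf op t (s(Inl x := {}))"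
      "a \<in> set (leaves t) \<Longrightarrow> run lf op u (s(Inl x := {a})) = run lf op u (s(Inl x := {}))" for a
      using d by (auto intro!: run_cong simp: disjoint_iff)
    have "(\<lambda>a. run lf op (Op v t u) (s(Inl x := {a}))) ` set (leaves t) =
        (\<lambda>p'. op v p' (run lf op u (s(Inl x := {})))) ` (\<lambda>a. run lf op t (s(Inl x := {a}))) ` set (leaves t)"
      unfolding image_image by (rule image_cong[OF refl]) (simp only: run.simps r(2))
    moreover have "(\<lambda>a. run lf op (Op v t u) (s(Inl x := {a}))) ` set (leaves u) =
        op v (run lf op t (s(Inl x := {}))) ` (\<lambda>a. run lf op u (s(Inl x := {a}))) ` set (leaves u)"
      unfolding image_image by (rule image_cong[OF refl]) (simp only: run.simps r(1))
    ultimately show ?case using Op by (simp add: image_Un del: fun_upd_apply)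
  qed
  show ?thesis
  proof (rule recognizableI[of "{..<n} \<times> Pow {..<n}" ?lf ?op _ "{p. snd p \<inter> acc \<noteq> {}}"])
    show "closed_alg ({..<n} \<times> Pow {..<n}) ?lf ?op" using 1(1) unfolding closed_alg_def by auto
  qed (use 1(2) in \<open>auto simp: run\<close>)
qed

section \<open>Recognizability of the atomic formulas\<close>

lemma recognizable_ex_leaf:
  "recognizable (\<lambda>t s. \<exists>a\<in>set (leaves t). P (fst a) (\<lambda>v. a \<in> s v))"
proof -
  have "run (\<lambda>c a f. P a f) (\<lambda>_. (\<or>)) t s \<longleftrightarrow> (\<exists>a\<in>set (leaves t). P (fst a) (\<lambda>v. a \<in> s v))"
    for t and s :: "('a \<times> 'i) valuation" by (induction t) auto
  then show ?thesis
    by (intro recognizableI[of UNIV "\<lambda>c a f. P a f" "\<lambda>_. (\<or>)" _ "{True}"]) (auto simp: closed_alg_def)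
qed

text \<open>The triple records whether the parent of the hole is in \<open>x\<close>, whether some
  root is in \<open>y\<close>, and whether a pair has been found. New pairs arise only when roots
  are plugged in below the parent of the hole.\<close>

lemma recognizable_child:
  "recognizable (\<lambda>t s. \<exists>a b. (Some a, Some b) \<in> chF (val t) \<and> a \<in> s x \<and> b \<in> s y)"
proof -
  let ?lf = "\<lambda>c a f. (c \<and> f x, f y, False)"
  let ?op = "\<lambda>v (h1, r1, f1) (h2, r2, f2). if v then (h2, r1, f1 \<or> f2 \<or> h1 \<and> r2) else (h1 \<or> h2, r1 \<or> r2, f1 \<or> f2)"
  have run: "run ?lf ?op t s = ((\<exists>a\<in>s x. (Some a, None) \<in> chF (val t)), (\<exists>b\<in>s y. Some b \<in> set (roots (val t))),
     (\<exists>a b. (Some a, Some b) \<in> chF (val t) \<and> a \<in> s x \<and> b \<in> s y))"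
    if "wfx t" for t and s :: "('a \<times> 'i) valuation"
    using that
  proof (induction t)
    case (Op v t u)
    have nr: "None \<notin> set (roots (val t))" "None \<notin> set (roots (val u))" using Op.prems roots_val_hole by auto
    have ih: "wfx t" "wfx u" using Op.prems by auto
    show ?case
    proof (cases v)
      case True
      have some: "(p, Some b) \<in> chF (val (Op v t u)) \<longleftrightarrow> (p, Some b) \<in> chF (val t) \<or>
          (p, None) \<in> chF (val t) \<and> Some b \<in> set (roots (val u)) \<or> (p, Some b) \<in> chF (val u)" for p b
        unfolding chF_val_Op[OF Op.prems] using True
        by (auto simp: split_option_ex simp del: set_map split_paired_Ex split_paired_All)
      have none: "(p, None) \<in> chF (val (Op v t u)) \<longleftrightarrow> (p, None) \<in> chF (val u)" for p
        unfolding chF_val_Op[OF Op.prems] using True nr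
        by (auto simp: split_option_ex simp del: set_map split_paired_Ex split_paired_All)
      have "roots (val (Op v t u)) = roots (val t)" unfolding roots_val_Op[OF Op.prems] using True by simp
      then show ?thesis unfolding run.simps Op.IH(1)[OF ih(1)] Op.IH(2)[OF ih(2)] some none
        using True by (simp del: val.simps set_map split_paired_Ex) blast
    next
      case False
      have "chF (val (Op v t u)) = chF (val t) \<union> chF (val u)"
        "roots (val (Op v t u)) = roots (val t) @ roots (val u)"
        unfolding chF_val_Op[OF Op.prems] roots_val_Op[OF Op.prems] using False by auto
      then show ?thesis unfolding run.simps Op.IH(1)[OF ih(1)] Op.IH(2)[OF ih(2)]
        using False by (simp del: val.simps set_map split_paired_Ex) blast
    qed
  qed auto
  show ?thesis
    by (rule recognizableI[of UNIV ?lf ?op _ "{p. snd (snd p)}"]) (simp_all add: run closed_alg_def)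
qed

lemma subst_roots_val:
  assumes "wfx u"
  shows "last (subst_roots (val u) a) \<noteq> None" "hd (subst_roots (val u) a) \<noteq> None"
proof -
  have "roots (val u) \<noteq> []" "None \<notin> set (roots (val u))"
    using assms val_nonempty roots_val_hole by auto
  then have "last (roots (val u)) \<noteq> None" "hd (roots (val u)) \<noteq> None"
    by (metis last_in_set, metis hd_in_set)
  then show "last (subst_roots (val u) a) \<noteq> None" "hd (subst_roots (val u) a) \<noteq> None"
    by (cases a; simp add: subst_roots_def)+
qed

text \<open>There is only one hole, so a vertical concatenation replaces at most one end of a
  sibling pair.\<close>

lemma sbF_val_no_hole: "wfx t \<Longrightarrow> (None, None) \<notin> sbF (val t)"
proof (induction t)
  case (Op v t u)
  have "last (roots (val t)) \<noteq> None"
    using subst_roots_val(1)[of t None] Op.prems by simp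
  then show ?case using Op subst_roots_val[of u, THEN not_sym]
    by (auto simp: sbF_val_Op simp del: val.simps not_None_eq split: if_splits)
qed (auto simp: sbF_def)

lemma mem_image_pairs: "(x, y) \<in> (\<lambda>(a, b). (f a, g b)) ` S \<longleftrightarrow> (\<exists>a b. (a, b) \<in> S \<and> x = f a \<and> y = g b)"
  by force

text \<open>The tuple records whether the left neighbour of the hole is in \<open>x\<close>, its
  right neighbour in \<open>y\<close>, the last root in \<open>x\<close>, the first root in
  \<open>y\<close>, and whether a pair has been found. Horizontal concatenation joins a last to a
  first root; vertical concatenation joins the neighbours of the hole to the first and the last root
  of what is plugged in.\<close>

lemma recognizable_sibling:
  "recognizable (\<lambda>t s. \<exists>a b. (Some a, Some b) \<in> sbF (val t) \<and> a \<in> s x \<and> b \<in> s y)"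
proof -
  let ?lf = "\<lambda>c a f. (False, False, f x, f y, False)"
  let ?op = "\<lambda>v (x1, y1, l1, r1, f1) (x2, y2, l2, r2, f2).
    if v then (x2, y2, l1, r1, f1 \<or> f2 \<or> x1 \<and> r2 \<or> l2 \<and> y1)
    else (x1 \<or> x2, y1 \<or> y2, l2, r1, f1 \<or> f2 \<or> l1 \<and> r2)"
  have run: "run ?lf ?op t s = ((\<exists>a\<in>s x. (Some a, None) \<in> sbF (val t)), (\<exists>b\<in>s y. (None, Some b) \<in> sbF (val t)),
     (\<exists>a\<in>s x. last (roots (val t)) = Some a), (\<exists>b\<in>s y. hd (roots (val t)) = Some b),
     (\<exists>a b. (Some a, Some b) \<in> sbF (val t) \<and> a \<in> s x \<and> b \<in> s y))"
    if "wfx t" for t and s :: "('a \<times> 'i) valuation"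
    using that
  proof (induction t)
    case (Lf c b)
    then show ?case by (auto simp: sbF_def)
  next
    case (Op v t u)
    have w: "wfx t" "wfx u" using Op.prems by auto
    have ne: "roots (val t) \<noteq> []" "roots (val u) \<noteq> []" using w val_nonempty by auto
    obtain lt ht lu hu where l: "last (roots (val t)) = Some lt" "hd (roots (val t)) = Some ht"
      "last (roots (val u)) = Some lu" "hd (roots (val u)) = Some hu"
      using subst_roots_val[OF w(1), of None] subst_roots_val[OF w(2), of None] by auto
    show ?case
    proof (cases v)
      case False
      have r: "last (roots (val (Op v t u))) = Some lu" "hd (roots (val (Op v t u))) = Some ht"
        unfolding roots_val_Op[OF Op.prems] using False ne l by auto
      have some: "(a, b) \<in> sbF (val (Op v t u)) \<longleftrightarrow> (a, b) \<in> sbF (val t) \<or> (a, b) \<in> sbF (val u) \<or>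
          a = Some lt \<and> b = Some hu" for a b
        unfolding sbF_val_Op[OF Op.prems] using False l by auto
      show ?thesis unfolding run.simps Op.IH(1)[OF w(1)] Op.IH(2)[OF w(2)] r l some
        using False by (auto simp: bex_disj_distrib ex_disj_distrib conj_disj_distribR simp del: val.simps set_map split_paired_Ex)
    next
      case True
      have sb: "sbF (val (Op v t u)) = (\<lambda>(a, b). (Some (case a of None \<Rightarrow> lu | Some a \<Rightarrow> a),
          Some (case b of None \<Rightarrow> hu | Some b \<Rightarrow> b))) ` sbF (val t) \<union> sbF (val u)"
      proof -
        have "last (subst_roots (val u) a) = Some (case a of None \<Rightarrow> lu | Some a \<Rightarrow> a)"
          "hd (subst_roots (val u) a) = Some (case a of None \<Rightarrow> hu | Some a \<Rightarrow> a)" for a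
          using l by (auto simp: subst_roots_def split: option.splits)
        then show ?thesis unfolding sbF_val_Op[OF Op.prems] using True by simp
      qed
      have some: "(Some a, Some b) \<in> sbF (val (Op v t u)) \<longleftrightarrow> (Some a, Some b) \<in> sbF (val t) \<or>
          (None, Some b) \<in> sbF (val t) \<and> a = lu \<or> (Some a, None) \<in> sbF (val t) \<and> b = hu \<or>
          (Some a, Some b) \<in> sbF (val u)" for a b
        unfolding sb Un_iff mem_image_pairs using sbF_val_no_hole[OF w(1)]
        by (simp add: split_option_ex del: split_paired_Ex) blast
      have none: "(Some a, None) \<in> sbF (val (Op v t u)) \<longleftrightarrow> (Some a, None) \<in> sbF (val u)"
        "(None, Some a) \<in> sbF (val (Op v t u)) \<longleftrightarrow> (None, Some a) \<in> sbF (val u)" for a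
        unfolding sb by auto
      have r: "roots (val (Op v t u)) = roots (val t)" unfolding roots_val_Op[OF Op.prems] using True by simp
      show ?thesis unfolding run.simps Op.IH(1)[OF w(1)] Op.IH(2)[OF w(2)] some none r l
        using True by (auto simp: bex_disj_distrib ex_disj_distrib conj_disj_distribR simp del: val.simps set_map split_paired_Ex)
    qed
  qed
  show ?thesis
    by (rule recognizableI[of UNIV ?lf ?op _ "{p. snd (snd (snd (snd p)))}"]) (simp_all add: run closed_alg_def)
qed

theorem recognizable_msat: "recognizable (\<lambda>t s. msat t s \<phi>)"
proof (induction \<phi>)
  case (EqF x y)
  show ?case using recognizable_ex_leaf[of "\<lambda>_ f. f (Inl x) \<and> f (Inl y)"] by simp
next
  case (LabelF l x)
  show ?case using recognizable_ex_leaf[of "\<lambda>a f. f (Inl x) \<and> a = l"] by simp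
next
  case (MemF x X)
  show ?case using recognizable_ex_leaf[of "\<lambda>_ f. f (Inl x) \<and> f (Inr X)"] by simp
next
  case (ExElem x \<phi>)
  then show ?case using recognizable_ex_elem[of "\<lambda>t s. msat t s \<phi>" x] by simp
next
  case (ExSet x \<phi>)
  then show ?case using recognizable_ex_set[of "\<lambda>t s. msat t s \<phi>" x] by simp
next
  case (NotF \<phi>)
  then show ?case unfolding msat.simps by (rule recognizable_not)
next
  case (AndF \<phi> \<psi>)
  then show ?case unfolding msat.simps by (rule recognizable_and)
next
  case (ChildF x y)
  show ?case unfolding msat.simps by (rule recognizable_child)
next
  case (SiblingF x y)
  show ?case unfolding msat.simps by (rule recognizable_sibling)
qed

section \<open>Preorder numbers\<close>

text \<open>\<open>rsz\<close> counts the vertices behind the hole of a context, \<open>lsz\<close> all the others.\<close>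

primrec lsz :: "'b ex \<Rightarrow> nat" where
  "lsz (Lf c b) = 1"
| "lsz (Op v t u) = (if v then (if isctx u then lsz t + lsz u else length (leaves t) + length (leaves u))
     else if isctx t then lsz t else lsz t + lsz u)"

primrec rsz :: "'b ex \<Rightarrow> nat" where
  "rsz (Lf c b) = 0"
| "rsz (Op v t u) = (if v then (if isctx u then rsz u + rsz t else 0)
     else if isctx t then rsz t + lsz u else rsz u)"

lemma rsz_forest: "\<not> isctx t \<Longrightarrow> rsz t = 0"
  by (induction t) (auto split: if_splits)

lemma lsz_rsz: "wfx t \<Longrightarrow> lsz t + rsz t = length (leaves t)"
  by (induction t) (auto simp: rsz_forest split: if_splits)

text \<open>A part of a forest with a hole occupies two intervals of preorder numbers; a position consists of
  their left ends.  A weight computes each component of the position of a subexpression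
  as one of the two components plus a constant.\<close>

type_synonym pos = "nat \<times> nat"
type_synonym ptr = "bool \<times> nat"
type_synonym weight = "ptr \<times> ptr"

definition sel :: "'x \<times> 'x \<Rightarrow> bool \<Rightarrow> 'x" where
  "sel p b = (if b then snd p else fst p)"

text \<open>\<open>M\<close> will be the number of machine words. Reducing modulo \<open>M\<close>
  mirrors the wrap-around of machine addition, so that weights compose exactly, whatever their
  offsets.\<close>

definition follow :: "nat \<Rightarrow> ptr \<Rightarrow> pos \<Rightarrow> nat" where
  "follow M p x = (sel x (fst p) + snd p) mod M"

definition app :: "nat \<Rightarrow> weight \<Rightarrow> pos \<Rightarrow> pos" where
  "app M w x = (follow M (fst w) x, follow M (snd w) x)"

text \<open>The left operand starts where the whole starts. In a vertical concatenation its second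
  interval lies behind the second interval of \<open>u\<close> if \<open>u\<close> has a hole, and
  otherwise behind all of \<open>u\<close>, which follows the first interval of
  \<open>t\<close>.\<close>

definition wleft :: "bool \<Rightarrow> 'b ex \<Rightarrow> 'b ex \<Rightarrow> weight" where
  "wleft v t u = ((False, 0), if v then (if isctx u then (True, rsz u) else (False, lsz t + lsz u)) else (True, 0))"

text \<open>The right operand starts behind the first interval of the left one, except in a
  horizontal concatenation with the hole on the left, where it lies behind the second
  interval.\<close>

definition wright :: "bool \<Rightarrow> 'b ex \<Rightarrow> 'b ex \<Rightarrow> weight" where
  "wright v t u = (if \<not> v \<and> isctx t then (True, rsz t) else (False, lsz t), (True, 0))"

primrec num :: "nat \<Rightarrow> 'a ex \<Rightarrow> pos \<Rightarrow> ('a \<times> nat) ex" where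
  "num M (Lf c a) x = Lf c (a, fst x)"
| "num M (Op v t u) x = Op v (num M t (app M (wleft v t u) x)) (num M u (app M (wright v t u) x))"

text \<open>The gap between the intervals leaves room for whatever fills the hole. The strict bound
  by \<open>M\<close> keeps the left ends of all parts from wrapping around.\<close>

definition validpos :: "nat \<Rightarrow> 'b ex \<Rightarrow> pos \<Rightarrow> bool" where
  "validpos M t x \<longleftrightarrow> (if isctx t then fst x + lsz t \<le> snd x \<and> snd x + rsz t < M else fst x + lsz t < M)"

lemma map_num [simp]: "map_ex fst (num M t x) = t" by (induction t arbitrary: x) auto

lemma isctx_num [simp]: "isctx (num M t x) = isctx t"
  using isctx_map[of fst "num M t x"] by simp

lemma wfx_num [simp]: "wfx (num M t x) = wfx t"
  using wfx_map[of fst "num M t x"] by simp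

lemma leaves_num: "map fst (leaves (num M t x)) = leaves t"
  using leaves_map[of fst "num M t x"] by simp

lemma app_wleft:
  assumes "wfx (Op v t u)" "validpos M (Op v t u) x"
  shows "validpos M t (app M (wleft v t u) x)" "fst (app M (wleft v t u) x) = fst x"
    "isctx t \<Longrightarrow> snd (app M (wleft v t u) x) =
       (if v then (if isctx u then snd x + rsz u else fst x + lsz t + lsz u) else snd x)"
  using assms lsz_rsz[of t] lsz_rsz[of u]
  by (auto simp: validpos_def app_def follow_def wleft_def sel_def rsz_forest split: if_splits)

lemma app_wright:
  assumes "wfx (Op v t u)" "validpos M (Op v t u) x"
  shows "validpos M u (app M (wright v t u) x)"
    "fst (app M (wright v t u) x) = (if \<not> v \<and> isctx t then snd x + rsz t else fst x + lsz t)"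
    "isctx u \<Longrightarrow> snd (app M (wright v t u) x) = snd x"
  using assms lsz_rsz[of t] lsz_rsz[of u]
  by (auto simp: validpos_def app_def follow_def wright_def sel_def rsz_forest split: if_splits)

definition interval_set :: "'b ex \<Rightarrow> pos \<Rightarrow> nat set" where
  "interval_set t x = {fst x..<fst x + lsz t} \<union> (if isctx t then {snd x..<snd x + rsz t} else {})"

text \<open>This partition is what later makes lists of items decomposable: the items of the two
  operands can be told apart by their numbers.\<close>

lemma interval_set_Op:
  assumes "wfx (Op v t u)" "validpos M (Op v t u) x"
  defines "I \<equiv> interval_set t (app M (wleft v t u) x)" and "J \<equiv> interval_set u (app M (wright v t u) x)"
  shows "interval_set (Op v t u) x = I \<union> J" "I \<inter> J = {}"
  using assms(1,2) lsz_rsz[of t] lsz_rsz[of u] app_wleft[OF assms(1,2)] app_wright[OF assms(1,2)]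
  unfolding I_def J_def interval_set_def
  by (auto simp: validpos_def rsz_forest split: if_splits)

lemma leaves_num_interval:
  "wfx t \<Longrightarrow> validpos M t x \<Longrightarrow>
    distinct (map snd (leaves (num M t x))) \<and> snd ` set (leaves (num M t x)) = interval_set t x"
proof (induction t arbitrary: x)
  case (Lf c a)
  then show ?case by (auto simp: interval_set_def)
next
  case (Op v t u)
  have "wfx t" "wfx u" using Op.prems by auto
  with Op.IH app_wleft(1)[OF Op.prems] app_wright(1)[OF Op.prems] interval_set_Op[OF Op.prems]
  show ?case by (auto simp: image_Un)
qed

section \<open>Labels in preorder\<close>

fun labT :: "'b tree \<Rightarrow> 'b list" where
  "labT (Node a ts) = a # concat (map labT ts)"

definition labs :: "'b forest \<Rightarrow> 'b list" where
  "labs f = concat (map labT f)"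

lemma labs_simps [simp]: "labs [] = []" "labs (t # f) = labT t @ labs f" "labs (f @ g) = labs f @ labs g"
  by (auto simp: labs_def)

lemma preorder_labels:
  fixes t :: "'b tree" and f :: "'b forest"
  shows "map snd (preorder_tree t) = labT t" "map snd (preorder_from i f) = labs f"
  by (induction t and i f rule: preorder_tree_preorder_from.induct) (auto simp: labs_def o_def case_prod_beta)

definition subst_labs :: "'b option forest \<Rightarrow> 'b option \<Rightarrow> 'b option list" where
  "subst_labs g x = (case x of None \<Rightarrow> labs g | Some a \<Rightarrow> [Some a])"

lemma labs_concat: "labs (concat (map G f)) = concat (map (\<lambda>t. labs (G t)) f)"
  by (induction f) auto

lemma labs_plug_tree: "holes_at_leaves t \<Longrightarrow> labs (plug_tree g t) = concat (map (subst_labs g) (labT t))"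
proof (induction g t rule: plug_tree.induct)
  case (2 g a ts)
  then have "concat (map (\<lambda>t. labs (plug_tree g t)) ts) = concat (map (\<lambda>t. concat (map (subst_labs g) (labT t))) ts)"
    by (intro arg_cong[of _ _ concat] map_cong) auto
  moreover have "labs (plug_tree g (Node (Some a) ts)) = Some a # labs (concat (map (plug_tree g) ts))"
    by (simp add: labs_def)
  moreover have "concat (map (subst_labs g) (labs ts)) = concat (map (\<lambda>t. concat (map (subst_labs g) (labT t))) ts)"
    by (induction ts) auto
  moreover have "labT (Node (Some a) ts) = Some a # labs ts" by (simp add: labs_def)
  moreover have "subst_labs g (Some a) = [Some a]" by (simp add: subst_labs_def)
  ultimately show ?case by (simp add: labs_concat del: plug_tree.simps labT.simps)
qed (simp add: subst_labs_def)

lemma labs_plug: "hleaf f \<Longrightarrow> labs (plug g f) = concat (map (subst_labs g) (labs f))"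
proof (induction f)
  case (Cons t f)
  then show ?case using labs_plug_tree[of t g] by (simp add: plug_def hleaf_def)
qed (simp add: plug_def)

lemma map_labs_plug:
  "hleaf f \<Longrightarrow> map (map_option h) (labs (plug g f)) =
    concat (map (\<lambda>y. case y of None \<Rightarrow> map (map_option h) (labs g) | Some i \<Rightarrow> [Some i]) (map (map_option h) (labs f)))"
  by (simp add: labs_plug map_concat o_def)
     (intro arg_cong[of _ _ concat] map_cong; auto simp: subst_labs_def split: option.splits)

lemma upt_split: "a \<le> b \<Longrightarrow> b \<le> c \<Longrightarrow> [a..<c] = [a..<b] @ [b..<c]"
  using upt_add_eq_append[of a b "c - b"] by simp

text \<open>Justifies the weights: for a forest at position \<open>(0, 0)\<close> it says that the
  numbers given by \<open>num\<close> are the preorder numbers. The version with a hole is what the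
  induction needs.\<close>

lemma labs_val_num:
  "wfx t \<Longrightarrow> validpos M t x \<Longrightarrow> map (map_option snd) (labs (val (num M t x))) =
    map Some [fst x..<fst x + lsz t] @ (if isctx t then None # map Some [snd x..<snd x + rsz t] else [])"
proof (induction t arbitrary: x)
  case (Op v t u)
  have w: "wfx t" "wfx u" using Op.prems by auto
  have cm: "concat (map (case_option ys (\<lambda>i. [Some i])) (map Some zs)) = map Some zs" for zs :: "nat list" and ys
    by (induction zs) auto
  note ih = Op.IH(1)[OF w(1) app_wleft(1)[OF Op.prems]] Op.IH(2)[OF w(2) app_wright(1)[OF Op.prems]]
  show ?case
  proof (cases v)
    case True
    then have c: "isctx t" using Op.prems by simp
    have l: "lsz t + rsz t = length (leaves t)" "lsz u + rsz u = length (leaves u)"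
      using w lsz_rsz by auto
    have "map (map_option snd) (labs (val (num M (Op v t u) x))) =
       concat (map (case_option (map (map_option snd) (labs (val (num M u (app M (wright v t u) x))))) (\<lambda>i. [Some i]))
         (map (map_option snd) (labs (val (num M t (app M (wleft v t u) x))))))"
      using True w val_holes[of "num M t (app M (wleft v t u) x)"] by (simp add: map_labs_plug del: map_map)
    also have "\<dots> = map Some [fst x..<fst x + lsz t] @
        (map Some [fst x + lsz t..<fst x + lsz t + lsz u] @ (if isctx u then None # map Some [snd x..<snd x + rsz u] else [])) @
        map Some [if isctx u then snd x + rsz u else fst x + lsz t + lsz u..<(if isctx u then snd x + rsz u else fst x + lsz t + lsz u) + rsz t]"
      unfolding ih using True c app_wleft(2,3)[OF Op.prems] app_wright(2,3)[OF Op.prems]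
      by (simp add: cm del: map_map)
    also have "\<dots> = map Some [fst x..<fst x + lsz (Op v t u)] @ (if isctx (Op v t u) then None # map Some [snd x..<snd x + rsz (Op v t u)] else [])"
    proof (cases "isctx u")
      case False
      then have "lsz (Op v t u) = lsz t + lsz u + rsz t" using True l rsz_forest[OF False] by simp
      then have "[fst x..<fst x + lsz (Op v t u)] = [fst x..<fst x + lsz t] @
          [fst x + lsz t..<fst x + lsz t + lsz u] @ [fst x + lsz t + lsz u..<fst x + lsz t + lsz u + rsz t]"
        using upt_split[of "fst x" "fst x + lsz t" "fst x + lsz (Op v t u)"]
          upt_split[of "fst x + lsz t" "fst x + lsz t + lsz u" "fst x + lsz (Op v t u)"] by (simp add: add.assoc)
      then show ?thesis using True False by simp
    next
      case True
      then show ?thesis using \<open>v\<close>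
        upt_split[of "fst x" "fst x + lsz t" "fst x + lsz t + lsz u"]
        upt_split[of "snd x" "snd x + rsz u" "snd x + rsz u + rsz t"] by (simp add: add.assoc)
    qed
    finally show ?thesis .
  next
    case False
    then have "\<not> (isctx t \<and> isctx u)" using Op.prems by simp
    with False show ?thesis using ih app_wleft(2,3)[OF Op.prems] app_wright(2,3)[OF Op.prems]
        upt_split[of "fst x" "fst x + lsz t" "fst x + lsz t + lsz u"]
        upt_split[of "snd x" "snd x + rsz t" "snd x + rsz t + lsz u"]
      by (cases "isctx t"; cases "isctx u") (simp_all add: add.assoc)
  qed
qed auto

section \<open>Addresses of vertices and pairs of labels\<close>

abbreviation PT :: "'b tree \<Rightarrow> (vertex \<times> 'b) set" where "PT t \<equiv> set (preorder_tree t)"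
abbreviation PF :: "'b forest \<Rightarrow> (vertex \<times> 'b) set" where "PF f \<equiv> set (preorder f)"

lemma set_preorder_from:
  "(q, b) \<in> set (preorder_from i ts) \<longleftrightarrow> (\<exists>j p. q = (i + j) # p \<and> j < length ts \<and> (p, b) \<in> PT (ts ! j))"
proof (induction ts arbitrary: i)
  case (Cons t ts)
  have "(q, b) \<in> set (preorder_from i (t # ts)) \<longleftrightarrow> (\<exists>p. q = i # p \<and> (p, b) \<in> PT t) \<or> (q, b) \<in> set (preorder_from (Suc i) ts)"
    by force
  also have "\<dots> \<longleftrightarrow> (\<exists>p. q = i # p \<and> (p, b) \<in> PT t) \<or> (\<exists>j p. q = (Suc i + j) # p \<and> j < length ts \<and> (p, b) \<in> PT (ts ! j))"
    unfolding Cons.IH ..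
  also have "\<dots> \<longleftrightarrow> (\<exists>j p. q = (i + j) # p \<and> j < length (t # ts) \<and> (p, b) \<in> PT ((t # ts) ! j))"
    (is "?a \<or> ?b \<longleftrightarrow> ?c")
  proof
    assume "?a \<or> ?b"
    then show ?c
    proof
      assume ?b
      then obtain j p where "q = (Suc i + j) # p" "j < length ts" "(p, b) \<in> PT (ts ! j)" by blast
      then show ?c by (intro exI[of _ "Suc j"] exI[of _ p]) simp
    qed (force intro: exI[of _ 0])
  next
    assume ?c
    then obtain j p where *: "q = (i + j) # p" "j < length (t # ts)" "(p, b) \<in> PT ((t # ts) ! j)" by blast
    then show "?a \<or> ?b" by (cases j) auto
  qed
  finally show ?case .
qed simp

lemma PF_iff: "(q, b) \<in> PF f \<longleftrightarrow> (\<exists>j p. q = j # p \<and> j < length f \<and> (p, b) \<in> PT (f ! j))"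
  by (simp add: preorder_def set_preorder_from)

lemma PT_Nil: "([], b) \<in> PT t \<longleftrightarrow> b = root t"
  by (cases t) (auto simp: set_preorder_from)

lemma PT_Cons: "(j # p, b) \<in> PT (Node a ts) \<longleftrightarrow> j < length ts \<and> (p, b) \<in> PT (ts ! j)"
  by (simp add: set_preorder_from)

lemma PF_Cons: "(j # p, b) \<in> PF f \<longleftrightarrow> j < length f \<and> (p, b) \<in> PT (f ! j)"
  by (simp add: PF_iff)

lemma bex_nth: "(\<exists>i<length xs. P (xs ! i)) \<longleftrightarrow> (\<exists>x\<in>set xs. P x)"
  by (metis in_set_conv_nth)

lemma child_labels_addr: "(a, b) \<in> child_labels t \<longleftrightarrow> (\<exists>p j. (p, a) \<in> PT t \<and> (p @ [j], b) \<in> PT t)"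
proof (induction t)
  case (Node c ts)
  have "(\<exists>p j. (p, a) \<in> PT (Node c ts) \<and> (p @ [j], b) \<in> PT (Node c ts)) \<longleftrightarrow>
    (a = c \<and> (\<exists>j<length ts. b = root (ts ! j))) \<or>
    (\<exists>i<length ts. \<exists>p j. (p, a) \<in> PT (ts ! i) \<and> (p @ [j], b) \<in> PT (ts ! i))" (is "?l \<longleftrightarrow> ?r")
  proof
    assume ?l
    then obtain p j where *: "(p, a) \<in> PT (Node c ts)" "(p @ [j], b) \<in> PT (Node c ts)" by blast
    then show ?r
    proof (cases p)
      case Nil
      then show ?thesis using * PT_Cons[of j "[]" b c ts] by (auto simp: PT_Nil simp del: preorder_tree.simps)
    next
      case (Cons i p')
      then show ?thesis using * PT_Cons[of i p' a c ts] PT_Cons[of i "p' @ [j]" b c ts] by auto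
    qed
  next
    assume ?r
    then show ?l
    proof
      assume "a = c \<and> (\<exists>j<length ts. b = root (ts ! j))"
      then obtain j where "a = c" "j < length ts" "b = root (ts ! j)" by blast
      then show ?l using PT_Cons[of j "[]" b c ts] PT_Nil[of a "Node c ts"]
        by (intro exI[of _ "[]"] exI[of _ j]) (simp add: PT_Nil del: preorder_tree.simps)
    next
      assume "\<exists>i<length ts. \<exists>p j. (p, a) \<in> PT (ts ! i) \<and> (p @ [j], b) \<in> PT (ts ! i)"
      then obtain i p j where "i < length ts" "(p, a) \<in> PT (ts ! i)" "(p @ [j], b) \<in> PT (ts ! i)" by blast
      then show ?l using PT_Cons[of i p a c ts] PT_Cons[of i "p @ [j]" b c ts]
        by (intro exI[of _ "i # p"] exI[of _ j]) (simp del: preorder_tree.simps)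
    qed
  qed
  moreover have "(a, b) \<in> child_labels (Node c ts) \<longleftrightarrow>
    (a = c \<and> (\<exists>j<length ts. b = root (ts ! j))) \<or> (\<exists>i<length ts. (a, b) \<in> child_labels (ts ! i))"
    unfolding bex_nth[of ts "\<lambda>t. b = root t"] bex_nth[of ts "\<lambda>t. (a, b) \<in> child_labels t"] by auto
  moreover have "(\<exists>i<length ts. (a, b) \<in> child_labels (ts ! i)) \<longleftrightarrow>
      (\<exists>i<length ts. \<exists>p j. (p, a) \<in> PT (ts ! i) \<and> (p @ [j], b) \<in> PT (ts ! i))"
    using Node[OF nth_mem] by (simp cong: conj_cong)
  ultimately show ?case by (simp only:)
qed

lemma chF_addr: "(a, b) \<in> chF f \<longleftrightarrow> (\<exists>p j. (p, a) \<in> PF f \<and> (p @ [j], b) \<in> PF f)"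
proof -
  have "(\<exists>p j. (p, a) \<in> PF f \<and> (p @ [j], b) \<in> PF f) \<longleftrightarrow>
    (\<exists>i<length f. \<exists>p j. (p, a) \<in> PT (f ! i) \<and> (p @ [j], b) \<in> PT (f ! i))" (is "?l \<longleftrightarrow> ?r")
  proof
    assume ?l
    then obtain p j where *: "(p, a) \<in> PF f" "(p @ [j], b) \<in> PF f" by blast
    then obtain i p' where "p = i # p'" by (auto simp: PF_iff)
    with * show ?r by (auto simp: PF_Cons)
  next
    assume ?r
    then obtain i p j where "i < length f" "(p, a) \<in> PT (f ! i)" "(p @ [j], b) \<in> PT (f ! i)" by blast
    then show ?l by (intro exI[of _ "i # p"] exI[of _ j]) (simp add: PF_Cons)
  qed
  then show ?thesis unfolding bex_nth[of f "\<lambda>t. \<exists>p j. (p, a) \<in> PT t \<and> (p @ [j], b) \<in> PT t"]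
    by (simp add: chF_def child_labels_addr)
qed

lemma sib_labels_addr: "(a, b) \<in> sib_labels t \<longleftrightarrow> (\<exists>p j. (p @ [j], a) \<in> PT t \<and> (p @ [Suc j], b) \<in> PT t)"
  and sbF_addr: "(a, b) \<in> sbF f \<longleftrightarrow> (\<exists>p j. (p @ [j], a) \<in> PF f \<and> (p @ [Suc j], b) \<in> PF f)"
proof -
  \<comment> \<open>The claim for forests, relative to the claim for their trees. It is used inside
    the induction on trees, since the sibling pairs of a tree are those of the forest of its
    subtrees.\<close>
  have F: "(a, b) \<in> sbF f \<longleftrightarrow> (\<exists>p j. (p @ [j], a) \<in> PF f \<and> (p @ [Suc j], b) \<in> PF f)"
    if "\<And>t. t \<in> set f \<Longrightarrow> (a, b) \<in> sib_labels t \<longleftrightarrow> (\<exists>p j. (p @ [j], a) \<in> PT t \<and> (p @ [Suc j], b) \<in> PT t)" for f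
  proof -
    have "(\<exists>p j. (p @ [j], a) \<in> PF f \<and> (p @ [Suc j], b) \<in> PF f) \<longleftrightarrow>
      (\<exists>j. Suc j < length f \<and> a = root (f ! j) \<and> b = root (f ! Suc j)) \<or>
      (\<exists>i<length f. \<exists>p j. (p @ [j], a) \<in> PT (f ! i) \<and> (p @ [Suc j], b) \<in> PT (f ! i))" (is "?l \<longleftrightarrow> ?r")
    proof
      assume ?l
      then obtain p j where *: "(p @ [j], a) \<in> PF f" "(p @ [Suc j], b) \<in> PF f" by blast
      then show ?r
      proof (cases p)
        case Nil
        then show ?thesis using * by (auto simp: PF_Cons PT_Nil)
      next
        case (Cons i p')
        then show ?thesis using * by (auto simp: PF_Cons)
      qed
    next
      assume ?r
      then show ?l
      proof
        assume "\<exists>j. Suc j < length f \<and> a = root (f ! j) \<and> b = root (f ! Suc j)"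
        then obtain j where "Suc j < length f" "a = root (f ! j)" "b = root (f ! Suc j)" by blast
        then show ?l by (intro exI[of _ "[]"] exI[of _ j]) (simp add: PF_Cons PT_Nil)
      next
        assume "\<exists>i<length f. \<exists>p j. (p @ [j], a) \<in> PT (f ! i) \<and> (p @ [Suc j], b) \<in> PT (f ! i)"
        then obtain i p j where "i < length f" "(p @ [j], a) \<in> PT (f ! i)" "(p @ [Suc j], b) \<in> PT (f ! i)" by blast
        then show ?l by (intro exI[of _ "i # p"] exI[of _ j]) (simp add: PF_Cons)
      qed
    qed
    moreover have "(a, b) \<in> sbF f \<longleftrightarrow> (\<exists>j. Suc j < length f \<and> a = root (f ! j) \<and> b = root (f ! Suc j)) \<or>
      (\<exists>i<length f. (a, b) \<in> sib_labels (f ! i))"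
      unfolding bex_nth[of f "\<lambda>t. (a, b) \<in> sib_labels t"] by (auto simp: sbF_def adjacent_nth)
    moreover have "(\<exists>i<length f. (a, b) \<in> sib_labels (f ! i)) \<longleftrightarrow>
        (\<exists>i<length f. \<exists>p j. (p @ [j], a) \<in> PT (f ! i) \<and> (p @ [Suc j], b) \<in> PT (f ! i))"
      using that[OF nth_mem] by (simp cong: conj_cong)
    ultimately show ?thesis by (simp only:)
  qed
  show T: "(a, b) \<in> sib_labels t \<longleftrightarrow> (\<exists>p j. (p @ [j], a) \<in> PT t \<and> (p @ [Suc j], b) \<in> PT t)" for t
  proof (induction t)
    case (Node c ts)
    have "(p @ [j], x) \<in> PT (Node c ts) \<longleftrightarrow> (p @ [j], x) \<in> PF ts" for p j x
      by (cases p) (auto simp: preorder_def)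
    with F[of ts] Node show ?case by (simp only: sib_labels_Node)
  qed
  show "(a, b) \<in> sbF f \<longleftrightarrow> (\<exists>p j. (p @ [j], a) \<in> PF f \<and> (p @ [Suc j], b) \<in> PF f)"
    using F T by blast
qed

lemma distinct_preorder:
  fixes t :: "'b tree" and f :: "'b forest"
  shows "distinct (map fst (preorder_tree t))" "distinct (map fst (preorder_from i f))"
proof (induction t and i f rule: preorder_tree_preorder_from.induct)
  case (1 a ts)
  have "[] \<notin> fst ` set (preorder_from 0 ts)" by (force simp: set_preorder_from)
  with 1 show ?case by simp
next
  case (3 i t ts)
  have e: "map fst (map (\<lambda>(p, a). (i # p, a)) (preorder_tree t)) = map ((#) i) (map fst (preorder_tree t))"
    by (simp add: o_def case_prod_beta)
  moreover have "distinct (map ((#) i) (map fst (preorder_tree t)))"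
    using 3 by (simp add: distinct_map inj_on_def)
  moreover have "i # p \<notin> fst ` set (preorder_from (Suc i) ts)" for p
    by (force simp: set_preorder_from)
  ultimately show ?case using 3
    unfolding preorder_tree.simps preorder_from.simps map_append e distinct_append by (auto simp del: map_map)
qed simp

lemma preorder_map:
  fixes t :: "'b tree" and f :: "'b forest"
  shows "preorder_tree (map_tree h t) = map (apsnd h) (preorder_tree t)"
    "preorder_from i (map (map_tree h) f) = map (apsnd h) (preorder_from i f)"
  by (induction t and i f rule: preorder_tree_preorder_from.induct) (auto simp: o_def case_prod_beta apsnd_def)

lemma set_labs_val:
  "wfx t \<Longrightarrow> set (labs (val t)) = Some ` set (leaves t) \<union> (if isctx t then {None} else {})"
proof (induction t)
  case (Op v t u)
  show ?case
  proof (cases v)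
    case True
    then have "set (labs (val (Op v t u))) = (\<Union>x\<in>set (labs (val t)). set (subst_labs (val u) x))"
      using Op.prems val_holes[of t] by (simp add: labs_plug)
    also have "\<dots> = Some ` set (leaves t) \<union> set (labs (val u))"
      using Op True by (auto simp: subst_labs_def)
    finally show ?thesis using Op True by (auto simp del: val.simps)
  qed (use Op in auto)
qed (auto simp: labs_def)

lemma index_of_nth: "distinct xs \<Longrightarrow> i < length xs \<Longrightarrow> index_of xs (xs ! i) = i"
proof (induction xs arbitrary: i)
  case (Cons x xs)
  then show ?case by (cases i) (auto simp: index_of_def)
qed simp

section \<open>The numbered expression of a forest and its vertices\<close>

locale numbered_forest =
  fixes F :: "'a forest" and t :: "'a ex" and M :: nat
  assumes wf: "wfx t" "\<not> isctx t" and val_t: "val t = map (map_tree Some) F"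
    and size_t: "length (leaves t) < M"
begin

definition T where "T = num M t (0, 0)"

text \<open>The leaves of \<open>T\<close> are such pairs, and \<open>name\<close> turns out to be a
  bijection from the vertices onto them.\<close>

definition name :: "vertex \<Rightarrow> 'a \<times> nat" where
  "name v = (vertex_label F v, preorder_number F v)"

lemma valid_T: "validpos M t (0, 0)"
  using wf size_t lsz_rsz[of t] rsz_forest[of t] by (simp add: validpos_def)

lemma wfx_T: "wfx T" "\<not> isctx T" using wf by (auto simp: T_def)

lemma lsz_t: "lsz t = length (leaves t)"
  using wf lsz_rsz[of t] rsz_forest[of t] by simp

lemma leaves_T: "distinct (map snd (leaves T))" "snd ` set (leaves T) = {0..<length (leaves t)}"
  using leaves_num_interval[OF wf(1) valid_T] wf(2) by (auto simp: T_def interval_set_def lsz_t)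

lemma distinct_leaves_T: "distinct (leaves T)"
  using leaves_T(1) by (simp add: distinct_map)

lemma preorder_T_eq: "map (apsnd (map_option fst)) (preorder (val T)) = map (apsnd Some) (preorder F)"
proof -
  have "map (map_tree (map_option fst)) (val T) = map (map_tree Some) F"
    unfolding val_t[symmetric] T_def using val_map[of fst "num M t (0, 0)"] by simp
  then have "preorder (map (map_tree (map_option fst)) (val T)) = preorder (map (map_tree Some) F)" by simp
  then show ?thesis by (simp only: preorder_def preorder_map)
qed

lemma labs_T: "map (map_option snd) (labs (val T)) = map Some [0..<length (leaves t)]"
  using labs_val_num[OF wf(1) valid_T] wf(2) by (simp add: T_def lsz_t)

lemma length_preorder: "length (preorder F) = length (leaves t)" "length (preorder (val T)) = length (leaves t)"
  using arg_cong[OF preorder_T_eq, of length] arg_cong[OF labs_T, of length]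
    arg_cong[OF preorder_labels(2)[of 0 "val T"], of length] by (auto simp: preorder_def)

lemma preorder_T_nth:
  assumes "i < length (leaves t)"
  shows "preorder (val T) ! i = (fst (preorder F ! i), Some (snd (preorder F ! i), i))"
proof -
  have "map snd (preorder (val T)) = labs (val T)" by (simp add: preorder_def preorder_labels)
  moreover have "map (map_option snd) (labs (val T)) ! i = Some i" unfolding labs_T using assms by simp
  ultimately have "map_option snd (snd (preorder (val T) ! i)) = Some i"
    using assms length_preorder by (metis length_map nth_map)
  moreover have "map (apsnd (map_option fst)) (preorder (val T)) ! i = map (apsnd Some) (preorder F) ! i"
    unfolding preorder_T_eq ..
  then have "apsnd (map_option fst) (preorder (val T) ! i) = apsnd Some (preorder F ! i)"
    using assms length_preorder by simp
  ultimately show ?thesis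
    by (cases "preorder (val T) ! i"; cases "preorder F ! i") auto
qed

lemma distinct_preorder_F: "distinct (map fst (preorder F))"
  by (simp add: preorder_def distinct_preorder)

lemma name_nth:
  assumes "i < length (leaves t)"
  shows "name (fst (preorder F ! i)) = (snd (preorder F ! i), i)"
proof -
  let ?v = "fst (preorder F ! i)"
  have i: "i < length (preorder F)" using assms length_preorder by simp
  then have "(?v, snd (preorder F ! i)) \<in> set (preorder F)" by simp
  then have "map_of (preorder F) ?v = Some (snd (preorder F ! i))"
    using distinct_preorder_F by (simp add: map_of_eq_Some_iff)
  moreover have "index_of (map fst (preorder F)) ?v = i"
    using index_of_nth[OF distinct_preorder_F, of i] i by simp
  ultimately show ?thesis by (simp add: name_def vertex_label_def preorder_number_def)
qed

lemma vertices_nth: "v \<in> vertices F \<longleftrightarrow> (\<exists>i<length (leaves t). v = fst (preorder F ! i))"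
  unfolding vertices_def length_preorder(1)[symmetric] set_map[symmetric] in_set_conv_nth by auto

lemma PF_T: "(v, b) \<in> PF (val T) \<longleftrightarrow> v \<in> vertices F \<and> b = Some (name v)"
proof -
  have "(v, b) \<in> PF (val T) \<longleftrightarrow> (\<exists>i<length (leaves t). preorder (val T) ! i = (v, b))"
    unfolding length_preorder(2)[symmetric] by (auto simp: in_set_conv_nth)
  also have "\<dots> \<longleftrightarrow> (\<exists>i<length (leaves t). v = fst (preorder F ! i) \<and> b = Some (name v))"
    by (auto simp: preorder_T_nth name_nth) blast?
  finally show ?thesis unfolding vertices_nth by blast
qed

lemma name_inj: "inj_on name (vertices F)"
proof
  fix u v assume "u \<in> vertices F" "v \<in> vertices F" "name u = name v"
  then show "u = v" by (auto simp: vertices_nth name_nth)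
qed

lemma name_image: "name ` vertices F = set (leaves T)"
proof -
  have "Some ` set (leaves T) = set (labs (val T))" using set_labs_val[of T] wfx_T by simp
  also have "\<dots> = snd ` PF (val T)"
    using arg_cong[OF preorder_labels(2)[of 0 "val T"], of set] by (simp add: preorder_def)
  also have "\<dots> = {b. \<exists>v. (v, b) \<in> PF (val T)}" by force
  also have "\<dots> = Some ` name ` vertices F" by (auto simp: PF_T)
  finally show ?thesis by (simp add: inj_image_eq_iff)
qed

lemma child_T: "u \<in> vertices F \<Longrightarrow> v \<in> vertices F \<Longrightarrow> (Some (name u), Some (name v)) \<in> chF (val T) \<longleftrightarrow> (u, v) \<in> child_rel F"
  unfolding chF_addr PF_T child_rel_def using name_inj by (auto dest: inj_onD)

lemma sibling_T: "u \<in> vertices F \<Longrightarrow> v \<in> vertices F \<Longrightarrow> (Some (name u), Some (name v)) \<in> sbF (val T) \<longleftrightarrow> (u, v) \<in> sibling_rel F"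
  unfolding sbF_addr PF_T sibling_rel_def using name_inj by (auto dest: inj_onD)

text \<open>Only free variables are constrained, so that the dummy values that
  \<open>query_result\<close> gives to all other variables are admissible. Bound sets translate by
  taking images and preimages under the bijection \<open>name\<close>.\<close>

lemma sat_msat:
  assumes "\<And>x. x \<in> free_elem \<phi> \<Longrightarrow> e x \<in> vertices F \<and> \<sigma> (Inl x) = {name (e x)}"
    and "\<And>X. X \<in> free_set \<phi> \<Longrightarrow> s X \<subseteq> vertices F \<and> \<sigma> (Inr X) = name ` s X"
  shows "sat F e s \<phi> \<longleftrightarrow> msat T \<sigma> \<phi>"
  using assms
proof (induction \<phi> arbitrary: e s \<sigma>)
  case (EqF x y)
  then have "e x \<in> vertices F" "e y \<in> vertices F" "\<sigma> (Inl x) = {name (e x)}" "\<sigma> (Inl y) = {name (e y)}" by auto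
  then show ?case using name_inj name_image by (auto dest: inj_onD)
next
  case (ChildF x y)
  then have "e x \<in> vertices F" "e y \<in> vertices F" "\<sigma> (Inl x) = {name (e x)}" "\<sigma> (Inl y) = {name (e y)}" by auto
  then show ?case by (simp add: child_T del: split_paired_Ex)
next
  case (SiblingF x y)
  then have "e x \<in> vertices F" "e y \<in> vertices F" "\<sigma> (Inl x) = {name (e x)}" "\<sigma> (Inl y) = {name (e y)}" by auto
  then show ?case by (simp add: sibling_T del: split_paired_Ex)
next
  case (LabelF a x)
  then have "e x \<in> vertices F" "\<sigma> (Inl x) = {name (e x)}" by auto
  moreover then have "name (e x) \<in> set (leaves T)" using name_image by blast
  ultimately show ?case by (auto simp: name_def)
next
  case (MemF x X)
  then have *: "e x \<in> vertices F" "\<sigma> (Inl x) = {name (e x)}" "s X \<subseteq> vertices F" "\<sigma> (Inr X) = name ` s X" by auto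
  then have "name (e x) \<in> name ` s X \<longleftrightarrow> e x \<in> s X" using inj_on_image_mem_iff[OF name_inj] by blast
  moreover have "name (e x) \<in> set (leaves T)" using *(1) name_image by blast
  ultimately show ?case using * by simp
next
  case (NotF \<phi>)
  then show ?case by simp
next
  case (AndF \<phi> \<psi>)
  have "sat F e s \<phi> \<longleftrightarrow> msat T \<sigma> \<phi>" by (rule AndF.IH(1)) (use AndF.prems in auto)
  moreover have "sat F e s \<psi> \<longleftrightarrow> msat T \<sigma> \<psi>" by (rule AndF.IH(2)) (use AndF.prems in auto)
  ultimately show ?case by simp
next
  case (ExElem x \<phi>)
  have "sat F (e(x := v)) s \<phi> \<longleftrightarrow> msat T (\<sigma>(Inl x := {name v})) \<phi>" if "v \<in> vertices F" for v
    by (rule ExElem.IH) (use that ExElem.prems in \<open>auto split: if_splits\<close>)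
  then show ?case unfolding sat.simps msat.simps name_image[symmetric] by simp
next
  case (ExSet X \<phi>)
  have IH: "sat F e (s(X := A)) \<phi> \<longleftrightarrow> msat T (\<sigma>(Inr X := name ` A)) \<phi>" if "A \<subseteq> vertices F" for A
    by (rule ExSet.IH) (use that ExSet.prems in \<open>auto split: if_splits\<close>)
  show ?case unfolding sat.simps msat.simps name_image[symmetric]
  proof
    assume "\<exists>A\<subseteq>vertices F. sat F e (s(X := A)) \<phi>"
    then obtain A where A: "A \<subseteq> vertices F" "sat F e (s(X := A)) \<phi>" by blast
    then show "\<exists>A\<subseteq>name ` vertices F. msat T (\<sigma>(Inr X := A)) \<phi>"
      by (intro exI[of _ "name ` A"]) (simp add: IH[OF A(1)] image_mono)
  next
    assume "\<exists>A\<subseteq>name ` vertices F. msat T (\<sigma>(Inr X := A)) \<phi>"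
    then obtain A where A: "A \<subseteq> vertices F" "msat T (\<sigma>(Inr X := name ` A)) \<phi>" by (auto simp: subset_image_iff)
    then show "\<exists>A\<subseteq>vertices F. sat F e (s(X := A)) \<phi>"
      by (intro exI[of _ A]) (simp add: IH[OF A(1)])
  qed
qed

end

section \<open>Solutions as lists of items\<close>

type_synonym item = "nat \<times> nat set"

text \<open>Only selected vertices are listed, so that the length of the list is bounded by the size
  of the output for the tuple.\<close>

definition items :: "(nat \<Rightarrow> nat set) \<Rightarrow> nat list \<Rightarrow> item list" where
  "items \<alpha> xs = filter (\<lambda>p. snd p \<noteq> {}) (map (\<lambda>i. (i, \<alpha> i)) xs)"

lemma items_append [simp]: "items \<alpha> (xs @ ys) = items \<alpha> xs @ items \<alpha> ys"
  by (simp add: items_def)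

lemma set_items: "(i, A) \<in> set (items \<alpha> xs) \<longleftrightarrow> i \<in> set xs \<and> A = \<alpha> i \<and> A \<noteq> {}"
  by (auto simp: items_def)

lemma items_ids: "fst ` set (items \<alpha> xs) \<subseteq> set xs"
  by (auto simp: items_def)

lemma items_empty: "items \<alpha> xs = [] \<longleftrightarrow> (\<forall>i\<in>set xs. \<alpha> i = {})"
  by (auto simp: items_def filter_empty_conv)

lemma items_cong: "(\<And>i. i \<in> set xs \<Longrightarrow> \<alpha> i = \<beta> i) \<Longrightarrow> items \<alpha> xs = items \<beta> xs"
  unfolding items_def by (intro arg_cong[of _ _ "filter _"] map_cong) auto

lemma items_eqD: 
  assumes "items \<alpha> xs = items \<beta> xs" "i \<in> set xs" shows "\<alpha> i = \<beta> i"
proof (rule ccontr)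
  assume ne: "\<alpha> i \<noteq> \<beta> i"
  have *: "(i, A) \<in> set (items \<alpha> xs) \<longleftrightarrow> (i, A) \<in> set (items \<beta> xs)" for A using assms(1) by simp
  show False using *[of "\<alpha> i"] *[of "\<beta> i"] ne assms(2) by (auto simp: set_items)
qed

abbreviation ids :: "('a \<times> nat) ex \<Rightarrow> nat list" where "ids T \<equiv> map snd (leaves T)"

text \<open>The free variables of a query are set variables, so a leaf is annotated with the set of
  components containing its vertex instead of a full valuation.\<close>

locale forest_alg =
  fixes k :: nat and la :: "bool \<Rightarrow> 'a \<Rightarrow> nat set \<Rightarrow> nat" and op :: "bool \<Rightarrow> nat \<Rightarrow> nat \<Rightarrow> nat" and M :: nat
begin

primrec arun :: "('a \<times> nat) ex \<Rightarrow> (nat \<Rightarrow> nat set) \<Rightarrow> nat" where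
  "arun (Lf c b) \<alpha> = la c (fst b) (\<alpha> (snd b))"
| "arun (Op v t u) \<alpha> = op v (arun t \<alpha>) (arun u \<alpha>)"

text \<open>The state of a subexpression in which nothing is selected. Such a subexpression
  influences a solution only through this state and needs no circuit.\<close>

primrec qe :: "'a ex \<Rightarrow> nat" where
  "qe (Lf c a) = la c a {}"
| "qe (Op v t u) = op v (qe t) (qe u)"

text \<open>The three sets are the cases of items only on the left, only on the right, or on both
  sides. Within a list the items of the left operand precede those of the right one, in the order of
  the leaves of the expression.\<close>

primrec RR :: "'a ex \<Rightarrow> pos \<Rightarrow> nat \<Rightarrow> item list set" where
  "RR (Lf c a) x q = {[(fst x, A)] | A. A \<subseteq> {..<k} \<and> A \<noteq> {} \<and> la c a A = q}"
| "RR (Op v t u) x q =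
     {z. \<exists>p. z \<in> RR t (app M (wleft v t u) x) p \<and> op v p (qe u) = q} \<union>
     {z. \<exists>p. z \<in> RR u (app M (wright v t u) x) p \<and> op v (qe t) p = q} \<union>
     {y @ z | y z. \<exists>p p'. y \<in> RR t (app M (wleft v t u) x) p \<and> z \<in> RR u (app M (wright v t u) x) p' \<and> op v p p' = q}"

lemma arun_cong: "(\<And>i. i \<in> set (ids T) \<Longrightarrow> \<alpha> i = \<beta> i) \<Longrightarrow> arun T \<alpha> = arun T \<beta>"
proof (induction T)
  case (Op v t u)
  then have "arun t \<alpha> = arun t \<beta>" "arun u \<alpha> = arun u \<beta>" by auto
  then show ?case by simp
qed auto

lemma arun_empty: "arun (num M t x) (\<lambda>_. {}) = qe t"
  by (induction t arbitrary: x) auto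

lemma arun_no_items: "items \<alpha> (ids (num M t x)) = [] \<Longrightarrow> arun (num M t x) \<alpha> = qe t"
  unfolding arun_empty[of t x, symmetric] by (rule arun_cong) (auto simp: items_empty)

definition bounded :: "(nat \<Rightarrow> nat set) \<Rightarrow> bool" where
  "bounded \<alpha> \<longleftrightarrow> (\<forall>i. \<alpha> i \<subseteq> {..<k})"

text \<open>Annotations of the two operands are independent and can be glued together because their
  numbers are disjoint. An operand without items runs to its state \<open>qe\<close>.\<close>

lemma RR_items:
  assumes "wfx t" "validpos M t x"
  shows "z \<in> RR t x q \<longleftrightarrow> z \<noteq> [] \<and> (\<exists>\<alpha>. bounded \<alpha> \<and> arun (num M t x) \<alpha> = q \<and> z = items \<alpha> (ids (num M t x)))"
  using assms
proof (induction t arbitrary: x z q)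
  case (Lf c a)
  show ?case
  proof
    assume "z \<in> RR (Lf c a) x q"
    then obtain A where "z = [(fst x, A)]" "A \<subseteq> {..<k}" "A \<noteq> {}" "la c a A = q" by auto
    then show "z \<noteq> [] \<and> (\<exists>\<alpha>. bounded \<alpha> \<and> arun (num M (Lf c a) x) \<alpha> = q \<and> z = items \<alpha> (ids (num M (Lf c a) x)))"
      by (intro conjI exI[of _ "\<lambda>_. A"]) (auto simp: bounded_def items_def)
  next
    assume "z \<noteq> [] \<and> (\<exists>\<alpha>. bounded \<alpha> \<and> arun (num M (Lf c a) x) \<alpha> = q \<and> z = items \<alpha> (ids (num M (Lf c a) x)))"
    then show "z \<in> RR (Lf c a) x q" by (auto simp: bounded_def items_def split: if_splits)
  qed
next
  case (Op v t u)
  have w: "wfx t" "wfx u" using Op.prems by auto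
  define xl where "xl = app M (wleft v t u) x"
  define xr where "xr = app M (wright v t u) x"
  have v: "validpos M t xl" "validpos M u xr"
    using app_wleft(1)[OF Op.prems] app_wright(1)[OF Op.prems] by (auto simp: xl_def xr_def)
  define I where "I = ids (num M t xl)"
  define J where "J = ids (num M u xr)"
  have ids: "ids (num M (Op v t u) x) = I @ J" by (simp add: I_def J_def xl_def xr_def)
  have disj: "set I \<inter> set J = {}"
    using leaves_num_interval[OF w(1) v(1)] leaves_num_interval[OF w(2) v(2)] interval_set_Op(2)[OF Op.prems]
    by (simp add: I_def J_def xl_def xr_def)
  note IH = Op.IH(1)[OF w(1) v(1), folded I_def] Op.IH(2)[OF w(2) v(2), folded J_def]
  have ar: "arun (num M (Op v t u) x) \<alpha> = op v (arun (num M t xl) \<alpha>) (arun (num M u xr) \<alpha>)" for \<alpha>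
    by (simp add: xl_def xr_def)
  define glue where "glue = (\<lambda>(\<alpha> :: nat \<Rightarrow> nat set) \<beta> i. if i \<in> set I then \<alpha> i else \<beta> i)"
  have glue: "items (glue \<alpha> \<beta>) I = items \<alpha> I" "items (glue \<alpha> \<beta>) J = items \<beta> J"
    "arun (num M t xl) (glue \<alpha> \<beta>) = arun (num M t xl) \<alpha>" "arun (num M u xr) (glue \<alpha> \<beta>) = arun (num M u xr) \<beta>"
    "bounded \<alpha> \<Longrightarrow> bounded \<beta> \<Longrightarrow> bounded (glue \<alpha> \<beta>)" for \<alpha> \<beta>
  proof -
    have I: "i \<in> set I \<Longrightarrow> glue \<alpha> \<beta> i = \<alpha> i" and J: "i \<in> set J \<Longrightarrow> glue \<alpha> \<beta> i = \<beta> i" for i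
      using disj by (auto simp: glue_def)
    show "items (glue \<alpha> \<beta>) I = items \<alpha> I" "items (glue \<alpha> \<beta>) J = items \<beta> J"
      using I J by (simp_all cong: items_cong)
    show "arun (num M t xl) (glue \<alpha> \<beta>) = arun (num M t xl) \<alpha>" by (rule arun_cong) (rule I, simp add: I_def)
    show "arun (num M u xr) (glue \<alpha> \<beta>) = arun (num M u xr) \<beta>" by (rule arun_cong) (rule J, simp add: J_def)
  qed (auto simp: bounded_def glue_def)
  have nil: "items (\<lambda>_. {}) K = []" "bounded (\<lambda>_. {})" for K by (auto simp: items_empty bounded_def)
  show ?case
  proof
    assume "z \<in> RR (Op v t u) x q"
    then consider (l) p where "z \<in> RR t xl p" "op v p (qe u) = q" | (r) p where "z \<in> RR u xr p" "op v (qe t) p = q"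
      | (b) y y' p p' where "z = y @ y'" "y \<in> RR t xl p" "y' \<in> RR u xr p'" "op v p p' = q"
      unfolding RR.simps xl_def xr_def by blast
    then show "z \<noteq> [] \<and> (\<exists>\<alpha>. bounded \<alpha> \<and> arun (num M (Op v t u) x) \<alpha> = q \<and> z = items \<alpha> (ids (num M (Op v t u) x)))"
    proof cases
      case l
      then obtain \<alpha> where "z \<noteq> []" "bounded \<alpha>" "arun (num M t xl) \<alpha> = p" "z = items \<alpha> I"
        unfolding IH by blast
      then show ?thesis using l(2) nil unfolding ids ar
        by (intro conjI exI[of _ "glue \<alpha> (\<lambda>_. {})"]) (auto simp: glue arun_empty)
    next
      case r
      then obtain \<alpha> where "z \<noteq> []" "bounded \<alpha>" "arun (num M u xr) \<alpha> = p" "z = items \<alpha> J"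
        unfolding IH by blast
      then show ?thesis using r(2) nil unfolding ids ar
        by (intro conjI exI[of _ "glue (\<lambda>_. {}) \<alpha>"]) (auto simp: glue arun_empty)
    next
      case b
      then obtain \<alpha> \<beta> where "y \<noteq> []" "bounded \<alpha>" "arun (num M t xl) \<alpha> = p" "y = items \<alpha> I"
        "bounded \<beta>" "arun (num M u xr) \<beta> = p'" "y' = items \<beta> J"
        unfolding IH by blast
      then show ?thesis using b(1,4) unfolding ids ar
        by (intro conjI exI[of _ "glue \<alpha> \<beta>"]) (auto simp: glue)
    qed
  next
    assume "z \<noteq> [] \<and> (\<exists>\<alpha>. bounded \<alpha> \<and> arun (num M (Op v t u) x) \<alpha> = q \<and> z = items \<alpha> (ids (num M (Op v t u) x)))"
    then obtain \<alpha> where a: "z \<noteq> []" "bounded \<alpha>" "op v (arun (num M t xl) \<alpha>) (arun (num M u xr) \<alpha>) = q"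
      "z = items \<alpha> I @ items \<alpha> J" unfolding ids ar by auto
    have l: "items \<alpha> I \<noteq> [] \<Longrightarrow> items \<alpha> I \<in> RR t xl (arun (num M t xl) \<alpha>)"
      and r: "items \<alpha> J \<noteq> [] \<Longrightarrow> items \<alpha> J \<in> RR u xr (arun (num M u xr) \<alpha>)"
      using IH a(2) by blast+
    have el: "items \<alpha> I = [] \<Longrightarrow> arun (num M t xl) \<alpha> = qe t" and er: "items \<alpha> J = [] \<Longrightarrow> arun (num M u xr) \<alpha> = qe u"
      unfolding I_def J_def by (auto intro: arun_no_items)
    show "z \<in> RR (Op v t u) x q"
    proof (cases "items \<alpha> I = []")
      case True
      then show ?thesis using a r el by (auto simp: xl_def xr_def)
    next
      case False
      show ?thesis
      proof (cases "items \<alpha> J = []")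
        case True
        then show ?thesis using a l False er by (auto simp: xl_def xr_def)
      next
        case F2: False
        then show ?thesis using a l r False unfolding RR.simps xl_def[symmetric] xr_def[symmetric] by blast
      qed
    qed
  qed
qed

lemma RR_ids: "wfx t \<Longrightarrow> validpos M t x \<Longrightarrow> z \<in> RR t x q \<Longrightarrow> z \<noteq> [] \<and> fst ` set z \<subseteq> interval_set t x"
proof -
  assume *: "wfx t" "validpos M t x" and "z \<in> RR t x q"
  then obtain \<alpha> where z: "z \<noteq> []" "z = items \<alpha> (ids (num M t x))" unfolding RR_items[OF *] by blast
  have "set (ids (num M t x)) = interval_set t x" using leaves_num_interval[OF *] by simp
  moreover have "fst ` set z \<subseteq> set (ids (num M t x))" unfolding z(2) by (rule items_ids)
  ultimately show ?thesis using z(1) by blast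
qed

text \<open>A list determines the annotation of every leaf, the unlisted ones being empty, and
  thereby the state. So the sets for different states are disjoint.\<close>

lemma RR_det: "wfx t \<Longrightarrow> validpos M t x \<Longrightarrow> z \<in> RR t x q \<Longrightarrow> z \<in> RR t x q' \<Longrightarrow> q = q'"
proof -
  assume *: "wfx t" "validpos M t x" and "z \<in> RR t x q" "z \<in> RR t x q'"
  then obtain \<alpha> \<beta> where **: "q = arun (num M t x) \<alpha>" "z = items \<alpha> (ids (num M t x))"
    "q' = arun (num M t x) \<beta>" "z = items \<beta> (ids (num M t x))"
    unfolding RR_items[OF *] by blast
  show "q = q'" unfolding **(1,3)
    by (rule arun_cong) (rule items_eqD[OF trans[OF **(2)[symmetric] **(4)]])
qed

lemma RR_item: "wfx t \<Longrightarrow> validpos M t x \<Longrightarrow> z \<in> RR t x q \<Longrightarrow> (i, A) \<in> set z \<Longrightarrow> A \<noteq> {} \<and> A \<subseteq> {..<k}"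
  by (auto simp: RR_items set_items bounded_def subset_iff)

lemma RR_distinct: "wfx t \<Longrightarrow> validpos M t x \<Longrightarrow> z \<in> RR t x q \<Longrightarrow> distinct (map fst z) \<and> length z \<le> length (leaves t)"
proof -
  assume *: "wfx t" "validpos M t x" "z \<in> RR t x q"
  then obtain \<alpha> where z: "z = items \<alpha> (ids (num M t x))" by (auto simp: RR_items)
  have "map fst z = filter (\<lambda>i. \<alpha> i \<noteq> {}) (ids (num M t x))"
    unfolding z items_def filter_map by (simp add: o_def)
  moreover have "length (leaves (num M t x)) = length (leaves t)"
    using arg_cong[OF leaves_num, of length M t x] by simp
  ultimately show ?thesis
    using leaves_num_interval[OF *(1,2)] arg_cong[of "map fst z" _ length]
    by (metis distinct_filter length_filter_le length_map)
qed

end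

section \<open>Solutions and the result of the query\<close>

definition decode :: "'a forest \<Rightarrow> nat \<Rightarrow> item list \<Rightarrow> vertex set list" where
  "decode F k z = map (\<lambda>j. {v \<in> vertices F. \<exists>A. (preorder_number F v, A) \<in> set z \<and> j \<in> A}) [0..<k]"

locale query_forest = numbered_forest F t M + forest_alg k "\<lambda>c a A. lf c a (case_sum (\<lambda>_. False) (\<lambda>j. j \<in> A))" op M
  for F :: "'a forest" and t M k and lf :: "bool \<Rightarrow> 'a \<Rightarrow> (nat + nat \<Rightarrow> bool) \<Rightarrow> nat" and op +
  fixes \<Psi> :: "'a mso" and acc :: "nat set"
  assumes query: "mso_query k \<Psi>"
    and recognizes: "\<And>(T :: ('a \<times> nat) ex) s. wfx T \<Longrightarrow> distinct (leaves T) \<Longrightarrow> msat T s \<Psi> \<longleftrightarrow> run lf op T s \<in> acc"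
begin

definition tuple :: "(nat \<Rightarrow> nat set) \<Rightarrow> vertex set list" where
  "tuple \<alpha> = map (\<lambda>j. {v \<in> vertices F. j \<in> \<alpha> (preorder_number F v)}) [0..<k]"

lemma preorder_number_image: "preorder_number F ` vertices F = set (ids T)"
  using name_image by (force simp: name_def simp flip: image_image[of snd name])

lemma preorder_number_nth: "i < length (leaves t) \<Longrightarrow> preorder_number F (fst (preorder F ! i)) = i"
  using name_nth[of i] by (simp add: name_def)

lemma preorder_number_inj: "inj_on (preorder_number F) (vertices F)"
proof
  fix u v assume "u \<in> vertices F" "v \<in> vertices F" "preorder_number F u = preorder_number F v"
  then show "u = v" by (auto simp: vertices_nth preorder_number_nth)
qed

lemma tuple_in_query:
  assumes "bounded \<alpha>"
  shows "tuple \<alpha> \<in> query_result k \<Psi> F \<longleftrightarrow> arun T \<alpha> \<in> acc"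
proof -
  let ?s = "\<lambda>X. if X < k then tuple \<alpha> ! X else {}"
  let ?\<sigma> = "case_sum (\<lambda>_. {}) (\<lambda>X. if X < k then name ` (tuple \<alpha> ! X) else {})"
  have tup: "X < k \<Longrightarrow> tuple \<alpha> ! X = {v \<in> vertices F. X \<in> \<alpha> (preorder_number F v)}" for X
    by (simp add: tuple_def)
  have "tuple \<alpha> \<in> query_result k \<Psi> F \<longleftrightarrow> sat F (\<lambda>_. []) ?s \<Psi>"
  proof -
    have "length (tuple \<alpha>) = k" "\<forall>S\<in>set (tuple \<alpha>). S \<subseteq> vertices F" by (auto simp: tuple_def)
    then show ?thesis by (simp add: query_result_def)
  qed
  also have "\<dots> \<longleftrightarrow> msat T ?\<sigma> \<Psi>"
    using query by (intro sat_msat) (auto simp: mso_query_def tup)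
  also have "\<dots> \<longleftrightarrow> run lf op T ?\<sigma> \<in> acc"
    by (rule recognizes[OF wfx_T(1) distinct_leaves_T])
  \<comment> \<open>The valuation interprets set variables from \<open>k\<close> on as empty, whence
    the intersection; it has no effect on a bounded annotation.\<close>
  also have "run lf op T ?\<sigma> = arun T (\<lambda>i. \<alpha> i \<inter> {..<k})"
  proof -
    have "(\<lambda>v :: nat + nat. b \<in> ?\<sigma> v) = case_sum (\<lambda>_. False) (\<lambda>j. j \<in> \<alpha> (snd b) \<inter> {..<k})" if "b \<in> set (leaves T)" for b
    proof
      fix v :: "nat + nat"
      from that obtain u where u: "u \<in> vertices F" "b = name u" using name_image by auto
      show "(b \<in> ?\<sigma> v) = case_sum (\<lambda>_. False) (\<lambda>j. j \<in> \<alpha> (snd b) \<inter> {..<k}) v"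
      proof (cases v)
        case (Inr j)
        have "j < k \<Longrightarrow> name u \<in> name ` (tuple \<alpha> ! j) \<longleftrightarrow> u \<in> tuple \<alpha> ! j"
          using u inj_on_image_mem_iff[OF name_inj, of u "tuple \<alpha> ! j"] tup by auto
        then show ?thesis using Inr u tup by (auto simp: name_def)
      qed simp
    qed
    moreover have "(\<And>b. b \<in> set (leaves T') \<Longrightarrow> (\<lambda>v :: nat + nat. b \<in> ?\<sigma> v) = case_sum (\<lambda>_. False) (\<lambda>j. j \<in> \<alpha> (snd b) \<inter> {..<k})) \<Longrightarrow>
      run lf op T' ?\<sigma> = arun T' (\<lambda>i. \<alpha> i \<inter> {..<k})" for T'
      by (induction T') simp_all
    ultimately show ?thesis by blast
  qed
  also have "(\<lambda>i. \<alpha> i \<inter> {..<k}) = \<alpha>" using assms by (auto simp: bounded_def)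
  finally show ?thesis .
qed

lemma in_query_tuple:
  assumes "Ss \<in> query_result k \<Psi> F"
  shows "\<exists>\<alpha>. bounded \<alpha> \<and> Ss = tuple \<alpha>"
proof -
  let ?\<alpha> = "\<lambda>i. {j. j < k \<and> i \<in> preorder_number F ` (Ss ! j)}"
  have l: "length Ss = k" "\<And>j. j < k \<Longrightarrow> Ss ! j \<subseteq> vertices F"
    using assms by (auto simp: query_result_def)
  have "Ss ! j = {v \<in> vertices F. j \<in> ?\<alpha> (preorder_number F v)}" if "j < k" for j
    using l(2)[OF that] that inj_on_image_mem_iff[OF preorder_number_inj _ l(2)[OF that]] by auto
  then have "Ss = tuple ?\<alpha>" using l(1) by (auto simp: tuple_def intro: nth_equalityI)
  moreover have "bounded ?\<alpha>" by (auto simp: bounded_def)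
  ultimately show ?thesis by blast
qed

lemma decode_items: "decode F k (items \<alpha> (ids T)) = tuple \<alpha>"
proof -
  have "(\<exists>A. (preorder_number F v, A) \<in> set (items \<alpha> (ids T)) \<and> j \<in> A) \<longleftrightarrow> j \<in> \<alpha> (preorder_number F v)"
    if "v \<in> vertices F" for v j
  proof -
    have "preorder_number F v \<in> set (ids T)" using preorder_number_image that by blast
    then show ?thesis unfolding set_items by auto
  qed
  then show ?thesis unfolding decode_def tuple_def by (intro map_cong) auto
qed

lemma RR_T: "z \<in> RR t (0, 0) q \<longleftrightarrow> z \<noteq> [] \<and> (\<exists>\<alpha>. bounded \<alpha> \<and> arun T \<alpha> = q \<and> z = items \<alpha> (ids T))"
  unfolding T_def by (rule RR_items[OF wf(1) valid_T])

lemma tuple_eqD: 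
  assumes "tuple \<alpha> = tuple \<beta>" "bounded \<alpha>" "bounded \<beta>" "i \<in> set (ids T)" shows "\<alpha> i = \<beta> i"
proof -
  obtain v where v: "v \<in> vertices F" "i = preorder_number F v" using assms(4) preorder_number_image by blast
  have "j \<in> \<alpha> i \<longleftrightarrow> j \<in> \<beta> i" if "j < k" for j
  proof -
    have "tuple \<alpha> ! j = tuple \<beta> ! j" using assms(1) by simp
    then have "{v \<in> vertices F. j \<in> \<alpha> (preorder_number F v)} = {v \<in> vertices F. j \<in> \<beta> (preorder_number F v)}"
      using that by (simp add: tuple_def)
    then show ?thesis using v by auto
  qed
  then show ?thesis using assms(2,3) unfolding bounded_def by blast
qed

lemma tuple_empty: "tuple (\<lambda>_. {}) = replicate k {}"
  by (auto simp: tuple_def intro: nth_equalityI)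

definition solutions :: "item list set" where
  "solutions = (\<Union>q\<in>acc. RR t (0, 0) q)"

lemma solutions_iff: "z \<in> solutions \<longleftrightarrow> z \<noteq> [] \<and> (\<exists>\<alpha>. bounded \<alpha> \<and> arun T \<alpha> \<in> acc \<and> z = items \<alpha> (ids T))"
  unfolding solutions_def by (auto simp: RR_T)

lemma bounded_empty: "bounded (\<lambda>_. {})" by (simp add: bounded_def)

text \<open>The tuple of empty sets has no items and so is not among the \<open>solutions\<close>.
  Whether it belongs to the result is decided by the state \<open>qe t\<close> alone.\<close>

theorem query_result_solutions:
  "query_result k \<Psi> F = decode F k ` solutions \<union> (if qe t \<in> acc then {replicate k {}} else {})"
proof (intro set_eqI iffI)
  fix Ss assume Ss: "Ss \<in> query_result k \<Psi> F"
  then obtain \<alpha> where a: "bounded \<alpha>" "Ss = tuple \<alpha>" using in_query_tuple by blast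
  then have acc: "arun T \<alpha> \<in> acc" using Ss tuple_in_query by blast
  show "Ss \<in> decode F k ` solutions \<union> (if qe t \<in> acc then {replicate k {}} else {})"
  proof (cases "items \<alpha> (ids T) = []")
    case True
    then have "arun T \<alpha> = qe t" unfolding T_def by (rule arun_no_items)
    moreover have "Ss = replicate k {}"
    proof -
      have "items \<alpha> (ids T) = items (\<lambda>_. {}) (ids T)"
        using True unfolding items_empty by (intro items_cong) blast
      then show ?thesis unfolding a(2) tuple_empty[symmetric] decode_items[symmetric] by simp
    qed
    ultimately show ?thesis using acc by simp
  next
    case False
    then have "items \<alpha> (ids T) \<in> solutions" using a acc solutions_iff by blast
    moreover have "Ss = decode F k (items \<alpha> (ids T))" by (simp add: a decode_items)
    ultimately show ?thesis by blast
  qed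
next
  fix Ss assume "Ss \<in> decode F k ` solutions \<union> (if qe t \<in> acc then {replicate k {}} else {})"
  then consider z where "Ss = decode F k z" "z \<in> solutions" | "Ss = replicate k {}" "qe t \<in> acc"
    by (auto split: if_splits)
  then show "Ss \<in> query_result k \<Psi> F"
  proof cases
    case 1
    then obtain \<alpha> where "bounded \<alpha>" "arun T \<alpha> \<in> acc" "z = items \<alpha> (ids T)" unfolding solutions_iff by blast
    then show ?thesis using tuple_in_query[of \<alpha>] 1(1) by (simp add: decode_items)
  next
    case 2
    then show ?thesis using tuple_in_query[OF bounded_empty] arun_empty[of t "(0, 0)"] tuple_empty
      by (simp add: T_def)
  qed
qed

text \<open>All solutions follow one fixed order of the leaves. Hence equal tuples come from equal
  lists, not just from equal sets of items.\<close>

lemma decode_inj: "inj_on (decode F k) solutions"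
proof
  fix y z assume "y \<in> solutions" "z \<in> solutions" and eq: "decode F k y = decode F k z"
  then obtain \<alpha> \<beta> where ab: "bounded \<alpha>" "y = items \<alpha> (ids T)" "bounded \<beta>" "z = items \<beta> (ids T)"
    unfolding solutions_iff by blast
  have "tuple \<alpha> = tuple \<beta>" using eq unfolding ab decode_items .
  then show "y = z" unfolding ab by (intro items_cong tuple_eqD) (use ab in auto)
qed

lemma decode_nonempty: "z \<in> solutions \<Longrightarrow> decode F k z \<noteq> replicate k {}"
proof
  assume "z \<in> solutions" and eq: "decode F k z = replicate k {}"
  then obtain \<alpha> where a: "bounded \<alpha>" "z = items \<alpha> (ids T)" "z \<noteq> []" unfolding solutions_iff by blast
  have "tuple \<alpha> = tuple (\<lambda>_. {})" using eq unfolding a decode_items tuple_empty .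
  then have "items \<alpha> (ids T) = []" unfolding items_empty using tuple_eqD[OF _ a(1) bounded_empty] by auto
  then show False using a by simp
qed

lemma decode_output:
  assumes "z \<in> solutions" "length nss = k"
    and "\<And>j. j < k \<Longrightarrow> distinct (nss ! j) \<and> set (nss ! j) = {i. \<exists>A. (i, A) \<in> set z \<and> j \<in> A}"
  shows "tuple_output F (decode F k z) (concat (map (\<lambda>ns. map Word ns @ [Comma]) nss) @ [Separator])"
proof -
  obtain \<alpha> where a: "z = items \<alpha> (ids T)" using assms(1) unfolding solutions_iff by blast
  have "preorder_number F ` (decode F k z ! j) = set (nss ! j)" if "j < k" for j
  proof -
    have "fst ` set z \<subseteq> preorder_number F ` vertices F"
      unfolding a preorder_number_image by (rule items_ids)
    then have "{i. \<exists>A. (i, A) \<in> set z \<and> j \<in> A} = preorder_number F ` {v \<in> vertices F. \<exists>A. (preorder_number F v, A) \<in> set z \<and> j \<in> A}"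
      by force
    then show ?thesis using assms(3)[OF that] that by (simp add: decode_def)
  qed
  then have "list_all2 (\<lambda>S ns. distinct ns \<and> set ns = preorder_number F ` S) (decode F k z) nss"
    using assms(2,3) by (auto simp: list_all2_conv_all_nth decode_def)
  then show ?thesis unfolding tuple_output_def by blast
qed

lemma empty_output: "tuple_output F (replicate k {}) (replicate k Comma @ [Separator])"
proof -
  have "list_all2 (\<lambda>S ns. distinct ns \<and> set ns = preorder_number F ` S) (replicate k {}) (replicate k [])"
    by (simp add: list_all2_conv_all_nth)
  moreover have "concat (map (\<lambda>ns. map Word ns @ [Comma]) (replicate k [])) = replicate k Comma"
    by (induction k) auto
  ultimately show ?thesis unfolding tuple_output_def by (intro exI[of _ "replicate k []"]) simp
qed

end

section \<open>Circuits for sets of solutions\<close>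

declare split_paired_All [simp del] split_paired_Ex [simp del]

text \<open>A circuit stands for a sequence of item lists: a single item, a disjoint union, or a product.  The
  weights turn the position of a vertex of the f-SLP into the positions of its parts, so that circuits can be
  shared between the occurrences of a vertex.\<close>

datatype circ = Item "nat set" | Alt weight circ weight circ | Prd weight circ weight circ

text \<open>Lexicographic order, which is the order in which backtracking finds the lists of a
  product.\<close>

definition cross :: "'x list list \<Rightarrow> 'x list list \<Rightarrow> 'x list list" where
  "cross X Y = concat (map (\<lambda>y. map ((@) y) Y) X)"

lemma cross_simps [simp]: "cross [] Y = []" "cross (y # X) Y = map ((@) y) Y @ cross X Y"
  "cross (X @ X') Y = cross X Y @ cross X' Y"
  by (auto simp: cross_def)

lemma map_append_cross: "map ((@) y) (cross X Y) = cross (map ((@) y) X) Y"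
  by (induction X) (auto simp: o_def)

lemma cross_assoc: "cross (cross X Y) Z = cross X (cross Y Z)"
  by (induction X) (auto simp: map_append_cross)

lemma set_cross: "set (cross X Y) = {y @ z | y z. y \<in> set X \<and> z \<in> set Y}"
  by (auto simp: cross_def)

text \<open>The lists of a union \<open>a \<union> b\<close> come in the order \<open>Ef a\<close>, \<open>b\<close>, \<open>Er a\<close>, where \<open>Ef a\<close> are the lists
  of the leftmost circuit below \<open>a\<close> that is not a union.  With a pointer to the latter, chains of unions need
  not be followed before the next list is found.\<close>

fun Ef :: "nat \<Rightarrow> circ \<Rightarrow> pos \<Rightarrow> item list list" and Er :: "nat \<Rightarrow> circ \<Rightarrow> pos \<Rightarrow> item list list" where
  "Ef M (Item A) x = [[(fst x, A)]]"
| "Ef M (Alt w1 a w2 b) x = Ef M a (app M w1 x)"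
| "Ef M (Prd w1 a w2 b) x = cross (Ef M a (app M w1 x) @ Er M a (app M w1 x)) (Ef M b (app M w2 x) @ Er M b (app M w2 x))"
| "Er M (Alt w1 a w2 b) x = (Ef M b (app M w2 x) @ Er M b (app M w2 x)) @ Er M a (app M w1 x)"
| "Er M (Item A) x = []"
| "Er M (Prd w1 a w2 b) x = []"

definition E :: "nat \<Rightarrow> circ \<Rightarrow> pos \<Rightarrow> item list list" where
  "E M c x = Ef M c x @ Er M c x"

lemma E_simps: "E M (Item A) x = [[(fst x, A)]]"
  "E M (Alt w1 a w2 b) x = Ef M a (app M w1 x) @ E M b (app M w2 x) @ Er M a (app M w1 x)"
  "E M (Prd w1 a w2 b) x = cross (E M a (app M w1 x)) (E M b (app M w2 x))"
  by (simp_all add: E_def)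

lemma set_E_Alt: "set (E M (Alt w1 a w2 b) x) = set (E M a (app M w1 x)) \<union> set (E M b (app M w2 x))"
  unfolding E_simps by (auto simp: E_def)

lemma distinct_E_Alt: "distinct (E M (Alt w1 a w2 b) x) \<longleftrightarrow> distinct (E M a (app M w1 x)) \<and> distinct (E M b (app M w2 x)) \<and>
    set (E M a (app M w1 x)) \<inter> set (E M b (app M w2 x)) = {}"
  unfolding E_simps by (auto simp: E_def)

primrec first :: "nat \<Rightarrow> circ \<Rightarrow> pos \<Rightarrow> item list" where
  "first M (Item A) x = [(fst x, A)]"
| "first M (Alt w1 a w2 b) x = first M a (app M w1 x)"
| "first M (Prd w1 a w2 b) x = first M a (app M w1 x) @ first M b (app M w2 x)"

text \<open>In particular no circuit denotes the empty sequence. The search therefore never runs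
  into a dead end and can commit to the first symbol of a list before the list is known.\<close>

lemma Ef_first: "\<exists>zs. Ef M c x = first M c x # zs"
proof (induction c arbitrary: x)
  case (Prd w1 a w2 b)
  obtain ys zs where "Ef M a (app M w1 x) = first M a (app M w1 x) # ys"
    "Ef M b (app M w2 x) = first M b (app M w2 x) # zs" using Prd by metis
  then show ?case by auto
qed auto

lemma E_first: "\<exists>zs. E M c x = first M c x # zs"
  using Ef_first[of M c x] by (auto simp: E_def)

text \<open>\<open>p\<close> selects a component of the intermediate position, which
  \<open>w\<close> in turn obtains from the outer position: selectors chain and offsets add
  up.\<close>

definition compp :: "nat \<Rightarrow> weight \<Rightarrow> ptr \<Rightarrow> ptr" where
  "compp M w p = (fst (sel w (fst p)), (snd (sel w (fst p)) + snd p) mod M)"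

definition compw :: "nat \<Rightarrow> weight \<Rightarrow> weight \<Rightarrow> weight" where
  "compw M w w' = (compp M w (fst w'), compp M w (snd w'))"

lemma follow_compp: "follow M (compp M w p) x = follow M p (app M w x)"
  by (auto simp: follow_def compp_def app_def sel_def mod_simps add.assoc)

lemma app_compw: "app M (compw M w w') x = app M w' (app M w x)"
  unfolding app_def[of M "compw M w w'"] app_def[of M w'] by (simp add: compw_def follow_compp)

text \<open>The identity only on reduced positions, because \<open>follow\<close> reduces modulo
  \<open>M\<close>. This is why several facts are stated for positions of the form
  \<open>app M w x\<close>.\<close>

definition idw :: weight where "idw = ((False, 0), (True, 0))"

lemma app_app_idw: "app M w (app M idw x) = app M w x"
  by (auto simp: app_def follow_def idw_def sel_def mod_simps)

primrec leftmost :: "nat \<Rightarrow> circ \<Rightarrow> circ \<times> weight" where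
  "leftmost M (Item A) = (Item A, idw)"
| "leftmost M (Alt w1 a w2 b) = (fst (leftmost M a), compw M w1 (snd (leftmost M a)))"
| "leftmost M (Prd w1 a w2 b) = (Prd w1 a w2 b, idw)"

lemma Ef_mod: "Ef M c (app M idw (app M w x)) = Ef M c (app M w x)"
  by (cases c) (simp_all add: app_app_idw, simp add: app_def follow_def idw_def sel_def)

lemma Ef_leftmost: "Ef M c (app M w x) = Ef M (fst (leftmost M c)) (app M (snd (leftmost M c)) (app M w x))"
proof (induction c arbitrary: w x)
  case (Alt w1 a w2 b)
  then show ?case unfolding leftmost.simps fst_conv snd_conv app_compw Ef.simps by blast
qed (simp_all only: leftmost.simps fst_conv snd_conv Ef_mod)

lemma leftmost_terminal: "fst (leftmost M c) \<noteq> Alt w1 a w2 b"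
  by (induction c) auto

lemma Er_leftmost: "Er M (fst (leftmost M c)) x = []"
proof (cases "fst (leftmost M c)")
  case (Alt w1 a w2 b)
  then show ?thesis using leftmost_terminal[of M c w1 a w2 b] by simp
qed auto

text \<open>Which vertex of component 0, if any, is written first when the first list is output: with it the
  output of a solution starts before the solution is known.\<close>

primrec fx :: "nat \<Rightarrow> circ \<Rightarrow> ptr option" where
  "fx M (Item A) = (if 0 \<in> A then Some (False, 0) else None)"
| "fx M (Alt w1 a w2 b) = map_option (compp M w1) (fx M a)"
| "fx M (Prd w1 a w2 b) = (case fx M a of Some p \<Rightarrow> Some (compp M w1 p) | None \<Rightarrow> map_option (compp M w2) (fx M b))"

fun zeroth :: "item list \<Rightarrow> nat option" where
  "zeroth [] = None"
| "zeroth ((i, A) # z) = (if 0 \<in> A then Some i else zeroth z)"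

lemma zeroth_append: "zeroth (y @ z) = (case zeroth y of None \<Rightarrow> zeroth z | Some i \<Rightarrow> Some i)"
  by (induction y rule: zeroth.induct) auto

lemma zeroth_None: "zeroth z = None \<longleftrightarrow> (\<forall>(i, A)\<in>set z. 0 \<notin> A)"
  by (induction z rule: zeroth.induct) auto

lemma zeroth_Some: "zeroth z = Some i \<Longrightarrow> \<exists>A. (i, A) \<in> set z \<and> 0 \<in> A"
  by (induction z rule: zeroth.induct) (auto split: if_splits)

lemma fx_first: "map_option (\<lambda>p. follow M p (app M w x)) (fx M c) = zeroth (first M c (app M w x))"
proof (induction c arbitrary: w x)
  case (Item A)
  then show ?case by (simp add: follow_def app_def sel_def)
next
  case (Alt w1 a w2 b)
  then show ?case by (simp add: option.map_comp o_def follow_compp)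
next
  case (Prd w1 a w2 b)
  from Prd(1)[of w1 "app M w x"] Prd(2)[of w2 "app M w x"] show ?case
    by (auto simp: zeroth_append follow_compp option.map_comp o_def simp flip: Prd split: option.splits)
qed

text \<open>The length of a longest list. As it is attained, it is at most the number of vertices if
  the circuit describes actual solutions; this will bound the heap.\<close>

primrec mx :: "circ \<Rightarrow> nat" where
  "mx (Item A) = 1"
| "mx (Alt w1 a w2 b) = max (mx a) (mx b)"
| "mx (Prd w1 a w2 b) = mx a + mx b"

lemma mx_attained: "\<exists>z\<in>set (E M c x). length z = mx c"
proof (induction c arbitrary: x)
  case (Alt w1 a w2 b)
  obtain y z where "y \<in> set (E M a (app M w1 x))" "length y = mx a" "z \<in> set (E M b (app M w2 x))" "length z = mx b"
    using Alt by metis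
  then show ?case unfolding set_E_Alt mx.simps max_def by (cases "mx a \<le> mx b") auto
next
  case (Prd w1 a w2 b)
  obtain y z where "y \<in> set (E M a (app M w1 x))" "length y = mx a" "z \<in> set (E M b (app M w2 x))" "length z = mx b"
    using Prd by metis
  then show ?case unfolding E_simps set_cross by (intro bexI[of _ "y @ z"]) auto
qed (auto simp: E_simps)

lemma mx_pos: "0 < mx c" by (induction c) auto

lemma length_first_pos: "0 < length (first M c x)"
  by (induction c arbitrary: x) auto

text \<open>\<open>None\<close> is the empty set, which no circuit denotes. Otherwise the weight
  tells how to read the circuit, so that no new node is needed to change positions.\<close>

type_synonym ref = "(circ \<times> weight) option"

definition refE :: "nat \<Rightarrow> ref \<Rightarrow> pos \<Rightarrow> item list list" where
  "refE M r x = (case r of None \<Rightarrow> [] | Some (c, w) \<Rightarrow> E M c (app M w x))"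

definition add_ref :: "ref \<Rightarrow> ref \<Rightarrow> ref" where
  "add_ref r r' = (case r of None \<Rightarrow> r' | Some (c, w) \<Rightarrow>
     (case r' of None \<Rightarrow> r | Some (c', w') \<Rightarrow> Some (Alt w c w' c', idw)))"

definition comp_ref :: "nat \<Rightarrow> weight \<Rightarrow> ref \<Rightarrow> ref" where
  "comp_ref M w r = map_option (\<lambda>(c, w'). (c, compw M w w')) r"

definition prod_ref :: "ref \<Rightarrow> ref \<Rightarrow> ref" where
  "prod_ref r r' = (case r of None \<Rightarrow> None | Some (c, w) \<Rightarrow>
     (case r' of None \<Rightarrow> None | Some (c', w') \<Rightarrow> Some (Prd w c w' c', idw)))"

lemma refE_comp: "refE M (comp_ref M w r) x = refE M r (app M w x)"
  by (auto simp: refE_def comp_ref_def app_compw split: option.splits)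

lemma refE_prod: "refE M (prod_ref r r') x = cross (refE M r x) (refE M r' x)"
proof -
  have "cross X [] = []" for X :: "item list list" by (induction X) auto
  then show ?thesis by (auto simp: refE_def prod_ref_def E_simps app_app_idw split: option.splits)
qed

lemma refE_add:
  "set (refE M (add_ref r r') x) = set (refE M r x) \<union> set (refE M r' x)"
  "distinct (refE M (add_ref r r') x) \<longleftrightarrow> distinct (refE M r x) \<and> distinct (refE M r' x) \<and>
     set (refE M r x) \<inter> set (refE M r' x) = {}"
proof -
  have "set (refE M (add_ref r r') x) = set (refE M r x) \<union> set (refE M r' x) \<and>
    (distinct (refE M (add_ref r r') x) \<longleftrightarrow> distinct (refE M r x) \<and> distinct (refE M r' x) \<and>
     set (refE M r x) \<inter> set (refE M r' x) = {})"
  proof (cases "r = None \<or> r' = None")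
    case True
    then show ?thesis by (auto simp: refE_def add_ref_def split: option.splits)
  next
    case False
    then obtain c w c' w' where "r = Some (c, w)" "r' = Some (c', w')" by auto
    then show ?thesis by (simp add: refE_def add_ref_def set_E_Alt distinct_E_Alt app_app_idw)
  qed
  then show "set (refE M (add_ref r r') x) = set (refE M r x) \<union> set (refE M r' x)"
    "distinct (refE M (add_ref r r') x) \<longleftrightarrow> distinct (refE M r x) \<and> distinct (refE M r' x) \<and>
     set (refE M r x) \<inter> set (refE M r' x) = {}" by blast+
qed

definition good :: "nat \<Rightarrow> 'a ex \<Rightarrow> (pos \<Rightarrow> item list set) \<Rightarrow> ref \<Rightarrow> bool" where
  "good M t U r \<longleftrightarrow> (\<forall>x. validpos M t x \<longrightarrow> distinct (refE M r x) \<and> set (refE M r x) = U x)"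

text \<open>The invariant for filling a table key by key: \<open>S \<kappa>\<close> is the
  contribution of the key \<open>\<kappa>\<close>, \<open>\<tau> \<kappa>\<close> the row to which
  it is added, and \<open>K\<close> the set of keys treated so far.\<close>

definition good_table :: "nat \<Rightarrow> 'a ex \<Rightarrow> ('k \<Rightarrow> pos \<Rightarrow> item list set) \<Rightarrow> ('k \<Rightarrow> nat) \<Rightarrow> 'k set \<Rightarrow> (nat \<Rightarrow> ref) \<Rightarrow> bool" where
  "good_table M t S \<tau> K tab \<longleftrightarrow> (\<forall>q. good M t (\<lambda>x. \<Union>\<kappa>\<in>{\<kappa>\<in>K. \<tau> \<kappa> = q}. S \<kappa> x) (tab q))"

lemma good_table_empty: "good_table M t S \<tau> {} (\<lambda>_. None)"
  by (simp add: good_table_def good_def refE_def)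

lemma good_table_insert:
  assumes "good_table M t S \<tau> K tab" "good M t (S \<kappa>) r" "\<kappa> \<notin> K"
    and disj: "\<And>\<kappa>' x. \<kappa>' \<in> K \<Longrightarrow> validpos M t x \<Longrightarrow> S \<kappa> x \<inter> S \<kappa>' x = {}"
  shows "good_table M t S \<tau> (insert \<kappa> K) (tab(\<tau> \<kappa> := add_ref r (tab (\<tau> \<kappa>))))"
  unfolding good_table_def
proof
  fix q
  show "good M t (\<lambda>x. \<Union>\<kappa>'\<in>{\<kappa>'\<in>insert \<kappa> K. \<tau> \<kappa>' = q}. S \<kappa>' x) ((tab(\<tau> \<kappa> := add_ref r (tab (\<tau> \<kappa>)))) q)"
  proof (cases "q = \<tau> \<kappa>")
    case True
    have *: "{\<kappa>'\<in>insert \<kappa> K. \<tau> \<kappa>' = q} = insert \<kappa> {\<kappa>'\<in>K. \<tau> \<kappa>' = q}" using True by auto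
    have g: "good M t (\<lambda>x. \<Union>\<kappa>'\<in>{\<kappa>'\<in>K. \<tau> \<kappa>' = q}. S \<kappa>' x) (tab q)"
      using assms(1) by (simp add: good_table_def)
    show ?thesis unfolding * good_def
    proof (intro allI impI)
      fix x assume x: "validpos M t x"
      have "S \<kappa> x \<inter> (\<Union>\<kappa>'\<in>{\<kappa>'\<in>K. \<tau> \<kappa>' = q}. S \<kappa>' x) = {}" using disj[OF _ x] by auto
      then show "distinct (refE M ((tab(\<tau> \<kappa> := add_ref r (tab (\<tau> \<kappa>)))) q) x) \<and>
        set (refE M ((tab(\<tau> \<kappa> := add_ref r (tab (\<tau> \<kappa>)))) q) x) =
        (\<Union>\<kappa>'\<in>insert \<kappa> {\<kappa>'\<in>K. \<tau> \<kappa>' = q}. S \<kappa>' x)"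
        using True g[unfolded good_def, rule_format, OF x] assms(2)[unfolded good_def, rule_format, OF x]
        by (simp add: refE_add)
    qed
  next
    case False
    then have "{\<kappa>'\<in>insert \<kappa> K. \<tau> \<kappa>' = q} = {\<kappa>'\<in>K. \<tau> \<kappa>' = q}" by auto
    then show ?thesis using False assms(1) by (simp add: good_table_def)
  qed
qed

lemma good_comp:
  assumes "good M t U r" "\<And>x. validpos M t' x \<Longrightarrow> validpos M t (app M w x)"
  shows "good M t' (\<lambda>x. U (app M w x)) (comp_ref M w r)"
  using assms by (simp add: good_def refE_comp)

lemma good_None: "good M t (\<lambda>x. {}) None"
  by (simp add: good_def refE_def)

text \<open>Filtering by membership of the vertex number in \<open>I\<close> recovers the left
  factor.\<close>

lemma append_eq_disjoint:
  assumes "y @ z = y' @ z'" "fst ` set y \<subseteq> I" "fst ` set y' \<subseteq> I" "fst ` set z \<subseteq> J" "fst ` set z' \<subseteq> J" "I \<inter> J = {}"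
  shows "y = y' \<and> z = z'"
proof -
  have "filter (\<lambda>p. fst p \<in> I) y = y" "filter (\<lambda>p. fst p \<in> I) y' = y'"
    using assms(2,3) by (auto simp: filter_id_conv)
  moreover have "filter (\<lambda>p. fst p \<in> I) z = []" "filter (\<lambda>p. fst p \<in> I) z' = []"
    using assms(4-6) by (auto simp: filter_empty_conv)
  ultimately have "y = y'" using arg_cong[OF assms(1), of "filter (\<lambda>p. fst p \<in> I)"] by simp
  then show ?thesis using assms(1) by simp
qed

context forest_alg
begin

definition table_ok :: "'a ex \<Rightarrow> (nat \<Rightarrow> ref) \<Rightarrow> bool" where
  "table_ok t tab \<longleftrightarrow> (\<forall>q. good M t (\<lambda>x. RR t x q) (tab q))"

definition leaf_part :: "nat set \<Rightarrow> pos \<Rightarrow> item list set" where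
  "leaf_part A x = {[(fst x, A)]}"

lemma good_item: "good M (Lf c a) (leaf_part A) (Some (Item A, idw))"
  by (auto simp: good_def refE_def E_simps leaf_part_def app_def follow_def idw_def sel_def validpos_def split: if_splits)

lemma table_ok_Lf:
  assumes "good_table M (Lf c a) leaf_part (la c a) {A. A \<subseteq> {..<k} \<and> A \<noteq> {}} tab"
  shows "table_ok (Lf c a) tab"
proof -
  have "(\<Union>A\<in>{A\<in>{A. A \<subseteq> {..<k} \<and> A \<noteq> {}}. la c a A = q}. leaf_part A x) = RR (Lf c a) x q" for x q
    by (auto simp: leaf_part_def)
  with assms show ?thesis by (simp add: table_ok_def good_table_def)
qed

text \<open>In a key \<open>(i, p, p')\<close> the states are those of the two operands, and
  \<open>i\<close> tells where the items are: on the left (0), on the right (1) or on both sides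
  (2). In the first two cases the other operand must be in its state without items.\<close>

definition op_part :: "bool \<Rightarrow> 'a ex \<Rightarrow> 'a ex \<Rightarrow> nat \<times> nat \<times> nat \<Rightarrow> pos \<Rightarrow> item list set" where
  "op_part v t u = (\<lambda>(i, p, p') x.
     if i = 0 then if p' = qe u then RR t (app M (wleft v t u) x) p else {}
     else if i = 1 then if p = qe t then RR u (app M (wright v t u) x) p' else {}
     else {y @ z | y z. y \<in> RR t (app M (wleft v t u) x) p \<and> z \<in> RR u (app M (wright v t u) x) p'})"

definition op_target :: "bool \<Rightarrow> nat \<times> nat \<times> nat \<Rightarrow> nat" where
  "op_target v = (\<lambda>(i, p, p'). op v p p')"

text \<open>Lists of different kinds \<open>i\<close> meet different intervals. For equal kinds the
  factors agree since the intervals are disjoint, and by \<open>RR_det\<close> a factor has only one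
  state, so the keys agree too.\<close>

lemma op_part_disjoint:
  assumes "wfx (Op v t u)" "validpos M (Op v t u) x" "\<kappa> \<noteq> \<kappa>'" "fst \<kappa> < 3" "fst \<kappa>' < 3"
  shows "op_part v t u \<kappa> x \<inter> op_part v t u \<kappa>' x = {}"
proof (rule ccontr)
  define xl where "xl = app M (wleft v t u) x"
  define xr where "xr = app M (wright v t u) x"
  have w: "wfx t" "wfx u" using assms(1) by auto
  have va: "validpos M t xl" "validpos M u xr"
    using app_wleft(1)[OF assms(1,2)] app_wright(1)[OF assms(1,2)] by (auto simp: xl_def xr_def)
  define I where "I = interval_set t xl"
  define J where "J = interval_set u xr"
  have IJ: "I \<inter> J = {}" using interval_set_Op(2)[OF assms(1,2)] by (simp add: I_def J_def xl_def xr_def)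
  have l: "z \<in> RR t xl p \<Longrightarrow> z \<noteq> [] \<and> fst ` set z \<subseteq> I" and r: "z \<in> RR u xr p \<Longrightarrow> z \<noteq> [] \<and> fst ` set z \<subseteq> J" for z p
    using RR_ids w va by (auto simp: I_def J_def)
  have ld: "z \<in> RR t xl p \<Longrightarrow> z \<in> RR t xl p' \<Longrightarrow> p = p'" and rd: "z \<in> RR u xr p \<Longrightarrow> z \<in> RR u xr p' \<Longrightarrow> p = p'" for z p p'
    using RR_det w va by blast+
  have part: "(i = 0 \<and> p' = qe u \<and> z \<in> RR t xl p) \<or> (i = 1 \<and> p = qe t \<and> z \<in> RR u xr p') \<or>
      (i = 2 \<and> (\<exists>y y'. z = y @ y' \<and> y \<in> RR t xl p \<and> y' \<in> RR u xr p'))"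
    if "z \<in> op_part v t u (i, p, p') x" "i < 3" for i p p' z
    using that unfolding xl_def xr_def
    by (auto simp: op_part_def less_Suc_eq numeral_3_eq_3 numeral_2_eq_2 split: if_splits)
  have mixed: False if "z = y @ y'" "y \<in> RR t xl p" "y' \<in> RR u xr p'" "fst ` set z \<subseteq> I \<or> fst ` set z \<subseteq> J" for z y y' p p'
    using that l[of y p] r[of y' p'] IJ by (cases y; cases y') auto
  have sep: False if "z \<in> RR t xl p" "z \<in> RR u xr p'" for z p p'
    using l[OF that(1)] r[OF that(2)] IJ by (cases z) auto
  obtain i p p' j o' o'' where k: "\<kappa> = (i, p, p')" "\<kappa>' = (j, o', o'')" by (metis prod_cases3)
  assume "op_part v t u \<kappa> x \<inter> op_part v t u \<kappa>' x \<noteq> {}"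
  then obtain z where z: "z \<in> op_part v t u (i, p, p') x" "z \<in> op_part v t u (j, o', o'') x"
    unfolding k by blast
  from part[OF z(1)] part[OF z(2)] assms(4,5) k
  have c: "(i = 0 \<and> p' = qe u \<and> z \<in> RR t xl p) \<or> (i = 1 \<and> p = qe t \<and> z \<in> RR u xr p') \<or>
      (i = 2 \<and> (\<exists>y y'. z = y @ y' \<and> y \<in> RR t xl p \<and> y' \<in> RR u xr p'))"
    "(j = 0 \<and> o'' = qe u \<and> z \<in> RR t xl o') \<or> (j = 1 \<and> o' = qe t \<and> z \<in> RR u xr o'') \<or>
      (j = 2 \<and> (\<exists>y y'. z = y @ y' \<and> y \<in> RR t xl o' \<and> y' \<in> RR u xr o''))" by auto
  from c(1) show False
  proof (elim disjE conjE exE)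
    assume 1: "i = 0" "p' = qe u" "z \<in> RR t xl p"
    from c(2) show False
      using 1 assms(3) ld[OF 1(3)] sep[OF 1(3)] mixed[of z] l[OF 1(3)] unfolding k by blast
  next
    assume 1: "i = 1" "p = qe t" "z \<in> RR u xr p'"
    from c(2) show False
      using 1 assms(3) rd[OF 1(3)] sep[OF _ 1(3)] mixed[of z] r[OF 1(3)] unfolding k by blast
  next
    fix y y' assume 1: "i = 2" "z = y @ y'" "y \<in> RR t xl p" "y' \<in> RR u xr p'"
    from c(2) show False
    proof (elim disjE conjE exE)
      assume "z \<in> RR t xl o'" then show False using mixed[OF 1(2-4)] l by blast
    next
      assume "z \<in> RR u xr o''" then show False using mixed[OF 1(2-4)] r by blast
    next
      fix x x' assume 2: "j = 2" "z = x @ x'" "x \<in> RR t xl o'" "x' \<in> RR u xr o''"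
      have "y = x \<and> y' = x'"
        using append_eq_disjoint[of y y' x x' I J] 1 2 l r IJ by auto
      then have "p = o'" "p' = o''" using ld 1(3) 2(3) rd 1(4) 2(4) by blast+
      then show False using assms(3) 1(1) 2(1) k by simp
    qed
  qed
qed

lemma good_left:
  assumes "wfx (Op v t u)" "table_ok t tab"
  shows "good M (Op v t u) (op_part v t u (0, p, p'))
    (if p' = qe u then comp_ref M (wleft v t u) (tab p) else None)"
  using good_comp[of M t "\<lambda>x. RR t x p" "tab p" "Op v t u" "wleft v t u"] assms app_wleft(1)[OF assms(1)]
  by (simp add: op_part_def table_ok_def good_None)

lemma good_right:
  assumes "wfx (Op v t u)" "table_ok u tab"
  shows "good M (Op v t u) (op_part v t u (1, p, p'))
    (if p = qe t then comp_ref M (wright v t u) (tab p') else None)"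
  using good_comp[of M u "\<lambda>x. RR u x p'" "tab p'" "Op v t u" "wright v t u"] assms app_wright(1)[OF assms(1)]
  by (simp add: op_part_def table_ok_def good_None)

lemma distinct_cross:
  assumes "distinct X" "distinct Y" "\<And>y y' z z'. y \<in> set X \<Longrightarrow> y' \<in> set X \<Longrightarrow> z \<in> set Y \<Longrightarrow> z' \<in> set Y \<Longrightarrow>
    y @ z = y' @ z' \<Longrightarrow> y = y'"
  shows "distinct (cross X Y)"
  using assms(1,3)
proof (induction X)
  case (Cons y X)
  have "distinct (map ((@) y) Y)" using assms(2) by (simp add: distinct_map inj_on_def)
  moreover have "set (map ((@) y) Y) \<inter> set (cross X Y) = {}"
    using Cons.prems by (fastforce simp: set_cross)
  moreover have "distinct (cross X Y)"
  proof (rule Cons.IH)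
    show "distinct X" using Cons.prems(1) by simp
    fix x x' z z' assume "x \<in> set X" "x' \<in> set X" "z \<in> set Y" "z' \<in> set Y" "x @ z = x' @ z'"
    then show "x = x'" using Cons.prems(2)[of x x' z z'] by simp
  qed
  ultimately show ?case by simp
qed simp

lemma good_both:
  assumes w: "wfx (Op v t u)" and ok: "table_ok t tab" "table_ok u tab'"
  shows "good M (Op v t u) (op_part v t u (2, p, p'))
    (prod_ref (comp_ref M (wleft v t u) (tab p)) (comp_ref M (wright v t u) (tab' p')))"
  unfolding good_def
proof (intro allI impI)
  fix x assume x: "validpos M (Op v t u) x"
  define xl where "xl = app M (wleft v t u) x"
  define xr where "xr = app M (wright v t u) x"
  have va: "validpos M t xl" "validpos M u xr"
    using app_wleft(1)[OF w x] app_wright(1)[OF w x] by (auto simp: xl_def xr_def)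
  have s: "distinct (refE M (tab p) xl)" "set (refE M (tab p) xl) = RR t xl p"
    "distinct (refE M (tab' p') xr)" "set (refE M (tab' p') xr) = RR u xr p'"
    using ok va by (auto simp: table_ok_def good_def)
  have IJ: "interval_set t xl \<inter> interval_set u xr = {}"
    using interval_set_Op(2)[OF w x] by (simp add: xl_def xr_def)
  have "distinct (cross (refE M (tab p) xl) (refE M (tab' p') xr))"
  proof (rule distinct_cross[OF s(1,3)])
    fix y y' z z' assume "y \<in> set (refE M (tab p) xl)" "y' \<in> set (refE M (tab p) xl)"
      "z \<in> set (refE M (tab' p') xr)" "z' \<in> set (refE M (tab' p') xr)" and eq: "y @ z = y' @ z'"
    then have "fst ` set y \<subseteq> interval_set t xl" "fst ` set y' \<subseteq> interval_set t xl"
      "fst ` set z \<subseteq> interval_set u xr" "fst ` set z' \<subseteq> interval_set u xr"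
      unfolding s using RR_ids w va by auto
    with append_eq_disjoint[OF eq] IJ show "y = y'" by blast
  qed
  moreover have "set (cross (refE M (tab p) xl) (refE M (tab' p') xr)) = op_part v t u (2, p, p') x"
    unfolding set_cross s by (simp add: op_part_def xl_def xr_def)
  ultimately show "distinct (refE M (prod_ref (comp_ref M (wleft v t u) (tab p)) (comp_ref M (wright v t u) (tab' p'))) x) \<and>
    set (refE M (prod_ref (comp_ref M (wleft v t u) (tab p)) (comp_ref M (wright v t u) (tab' p'))) x) = op_part v t u (2, p, p') x"
    by (simp add: refE_prod refE_comp xl_def xr_def)
qed

end

locale finite_forest_alg = forest_alg k la op M for k and la :: "bool \<Rightarrow> 'a \<Rightarrow> nat set \<Rightarrow> nat" and op M +
  fixes Q :: nat
  assumes la_less: "la c a A < Q" and op_less: "p < Q \<Longrightarrow> p' < Q \<Longrightarrow> op v p p' < Q"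
begin

lemma qe_less: "qe t < Q"
  by (induction t) (auto intro: la_less op_less)

lemma RR_less: "z \<in> RR t x q \<Longrightarrow> q < Q"
proof (induction t arbitrary: x z q)
  case (Op v t u)
  from Op.prems show ?case by (auto intro!: op_less qe_less dest: Op.IH)
qed (auto intro: la_less)

definition op_keys :: "(nat \<times> nat \<times> nat) set" where
  "op_keys = {..<3} \<times> {..<Q} \<times> {..<Q}"

lemma table_ok_Op:
  assumes "good_table M (Op v t u) (op_part v t u) (op_target v) op_keys tab"
  shows "table_ok (Op v t u) tab"
proof -
  have "(\<Union>\<kappa>\<in>{\<kappa>\<in>op_keys. op_target v \<kappa> = q}. op_part v t u \<kappa> x) = RR (Op v t u) x q" for x q
  proof
    show "(\<Union>\<kappa>\<in>{\<kappa>\<in>op_keys. op_target v \<kappa> = q}. op_part v t u \<kappa> x) \<subseteq> RR (Op v t u) x q"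
    proof
      fix z assume "z \<in> (\<Union>\<kappa>\<in>{\<kappa>\<in>op_keys. op_target v \<kappa> = q}. op_part v t u \<kappa> x)"
      then obtain i p p' where "z \<in> op_part v t u (i, p, p') x" and q: "op v p p' = q"
        by (auto simp: op_target_def)
      then consider "p' = qe u" "z \<in> RR t (app M (wleft v t u) x) p" | "p = qe t" "z \<in> RR u (app M (wright v t u) x) p'"
        | y y' where "z = y @ y'" "y \<in> RR t (app M (wleft v t u) x) p" "y' \<in> RR u (app M (wright v t u) x) p'"
        by (auto simp: op_part_def split: if_splits)
      then show "z \<in> RR (Op v t u) x q" unfolding RR.simps using q by cases blast+
    qed
    show "RR (Op v t u) x q \<subseteq> (\<Union>\<kappa>\<in>{\<kappa>\<in>op_keys. op_target v \<kappa> = q}. op_part v t u \<kappa> x)"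
    proof
      fix z assume "z \<in> RR (Op v t u) x q"
      then consider p where "z \<in> RR t (app M (wleft v t u) x) p" "op v p (qe u) = q"
        | p where "z \<in> RR u (app M (wright v t u) x) p" "op v (qe t) p = q"
        | y y' p p' where "z = y @ y'" "y \<in> RR t (app M (wleft v t u) x) p" "y' \<in> RR u (app M (wright v t u) x) p'" "op v p p' = q"
        unfolding RR.simps by blast
      then show "z \<in> (\<Union>\<kappa>\<in>{\<kappa>\<in>op_keys. op_target v \<kappa> = q}. op_part v t u \<kappa> x)"
      proof cases
        case 1
        then have "(0, p, qe u) \<in> {\<kappa>\<in>op_keys. op_target v \<kappa> = q}" "z \<in> op_part v t u (0, p, qe u) x"
          using RR_less[OF 1(1)] qe_less[of u] by (auto simp: op_keys_def op_target_def op_part_def)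
        then show ?thesis by blast
      next
        case 2
        then have "(1, qe t, p) \<in> {\<kappa>\<in>op_keys. op_target v \<kappa> = q}" "z \<in> op_part v t u (1, qe t, p) x"
          using RR_less[OF 2(1)] qe_less[of t] by (auto simp: op_keys_def op_target_def op_part_def)
        then show ?thesis by blast
      next
        case 3
        then have "(2, p, p') \<in> {\<kappa>\<in>op_keys. op_target v \<kappa> = q}" "z \<in> op_part v t u (2, p, p') x"
          using RR_less[OF 3(2)] RR_less[OF 3(3)] by (auto simp: op_keys_def op_target_def op_part_def)
        then show ?thesis by blast
      qed
    qed
  qed
  with assms show ?thesis unfolding table_ok_def good_table_def by simp
qed

end

section \<open>Weakest preconditions and running times\<close>

abbreviation Vr :: "'n \<Rightarrow> 'n rexp" where "Vr x \<equiv> Ar x (Cn 0)"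
abbreviation Asg :: "'n \<Rightarrow> 'n rexp \<Rightarrow> 'n rcom" (infix "::=" 62) where "x ::= e \<equiv> Set x (Cn 0) e"

primrec seqs :: "'n rcom list \<Rightarrow> 'n rcom" where
  "seqs [] = Skip"
| "seqs (c # cs) = Sq c (seqs cs)"

text \<open>The distance between two values, by truncated subtraction in both directions: the
  language can only compare with zero.\<close>

definition neq :: "'n rexp \<Rightarrow> nat \<Rightarrow> 'n rexp" where
  "neq e n = Pl (Mi e (Cn n)) (Mi (Cn n) e)"

definition ix :: "'n rexp \<Rightarrow> 'n rexp \<Rightarrow> 'n rexp" where
  "ix e b = Pl (Pl e e) b"

text \<open>Adds up both branches of a conditional, so that the bound depends on the program text
  only. It is meant for code without loops and output.\<close>

fun cost :: "'n rcom \<Rightarrow> nat" where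
  "cost (Set j i e) = 1"
| "cost (Sq a b) = cost a + cost b"
| "cost (Cond e a b) = 2 + cost a + cost b"
| "cost _ = 0"

lemma upd_simps [simp]:
  "upd j i v s j i = v"
  "j' \<noteq> j \<Longrightarrow> upd j i v s j' = s j'"
  "i' \<noteq> i \<Longrightarrow> upd j i v s j' i' = s j' i'"
  by (auto simp: upd_def)

lemma aval_upd [simp]: "j \<notin> exp_names e \<Longrightarrow> ram_env.aval w inp e (upd j i v s) = ram_env.aval w inp e s"
  by (induction e) (auto simp: ram_env.aval.simps)

lemma ok_upd [simp]: "j \<notin> exp_names e \<Longrightarrow> ram_env.ok w N inp e (upd j i v s) = ram_env.ok w N inp e s"
  by (induction e) (auto simp: ram_env.ok.simps)

context ram_env
begin

text \<open>Loops and output get no precondition: silent straight-line code and conditionals are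
  verified here, with \<open>cost\<close> as their running time; everything else is composed by
  means of \<open>runs\<close>.\<close>

fun wp :: "'n rcom \<Rightarrow> ('n mem \<Rightarrow> bool) \<Rightarrow> 'n mem \<Rightarrow> bool" where
  "wp Skip R s \<longleftrightarrow> R s"
| "wp (Set j i e) R s \<longleftrightarrow> ok i s \<and> ok e s \<and> aval i s < N \<and> R (upd j (aval i s) (aval e s) s)"
| "wp (Sq a b) R s \<longleftrightarrow> wp a (wp b R) s"
| "wp (Cond e a b) R s \<longleftrightarrow> ok e s \<and> (if aval e s \<noteq> 0 then wp a R s else wp b R s)"
| "wp _ R s \<longleftrightarrow> False"

lemma wp_mono: "wp c R s \<Longrightarrow> (\<And>s. R s \<Longrightarrow> R' s) \<Longrightarrow> wp c R' s"
proof (induction c arbitrary: R R' s)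
  case (Sq a b)
  have "wp a (wp b R') s"
  proof (rule Sq.IH(1))
    show "wp a (wp b R) s" using Sq.prems(1) by simp
    show "\<And>s. wp b R s \<Longrightarrow> wp b R' s" using Sq.IH(2) Sq.prems(2) by blast
  qed
  then show ?case by simp
next
  case (Cond e a b)
  then show ?case by (auto split: if_splits)
qed auto

definition runs :: "'n rcom \<Rightarrow> 'n mem \<Rightarrow> nat \<Rightarrow> osym list \<Rightarrow> ('n mem \<Rightarrow> bool) \<Rightarrow> bool" where
  "runs c s n out R \<longleftrightarrow> (\<exists>tr s'. bs c s tr s' \<and> length tr \<le> n \<and> outs tr = out \<and> R s')"

lemma runs_Sq:
  assumes "runs a s n out R" "\<And>s'. R s' \<Longrightarrow> runs b s' n' out' R'"
  shows "runs (Sq a b) s (n + n') (out @ out') R'"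
proof -
  obtain tr s' where 1: "bs a s tr s'" "length tr \<le> n" "outs tr = out" "R s'"
    using assms(1) by (auto simp: runs_def)
  obtain tr' s'' where 2: "bs b s' tr' s''" "length tr' \<le> n'" "outs tr' = out'" "R' s''"
    using assms(2)[OF 1(4)] by (auto simp: runs_def)
  show ?thesis unfolding runs_def
    by (rule exI[of _ "tr @ tr'"], rule exI[of _ s'']) (use 1 2 bs_Sq in auto)
qed

lemma runs_Cond:
  assumes "ok e s" "aval e s \<noteq> 0 \<Longrightarrow> runs a s n out R" "aval e s = 0 \<Longrightarrow> runs b s n out R"
  shows "runs (Cond e a b) s (n + 2) out R"
proof -
  have "\<exists>tr s'. bs (Cond e a b) s (None # tr @ [None]) s' \<and> length tr \<le> n \<and> outs tr = out \<and> R s'"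
  proof (cases "aval e s = 0")
    case True
    then obtain tr s' where "bs b s tr s'" "length tr \<le> n" "outs tr = out" "R s'"
      using assms(3) by (auto simp: runs_def)
    then show ?thesis using bs_CondF[OF assms(1) True] by blast
  next
    case False
    then obtain tr s' where "bs a s tr s'" "length tr \<le> n" "outs tr = out" "R s'"
      using assms(2) by (auto simp: runs_def)
    then show ?thesis using bs_CondT[OF assms(1) False] by blast
  qed
  then obtain tr s' where "bs (Cond e a b) s (None # tr @ [None]) s'" "length tr \<le> n" "outs tr = out" "R s'"
    by blast
  then show ?thesis unfolding runs_def by (intro exI[of _ "None # tr @ [None]"] exI[of _ s']) simp
qed

lemma runs_weaken: "runs c s n out R \<Longrightarrow> n \<le> n' \<Longrightarrow> (\<And>s. R s \<Longrightarrow> R' s) \<Longrightarrow> runs c s n' out R'"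
proof -
  assume a: "runs c s n out R" "n \<le> n'" "\<And>s. R s \<Longrightarrow> R' s"
  then obtain tr s' where "bs c s tr s'" "length tr \<le> n" "outs tr = out" "R s'" by (auto simp: runs_def)
  then show "runs c s n' out R'" using a(2,3) unfolding runs_def by (intro exI[of _ tr] exI[of _ s']) auto
qed

lemma wp_runs: "wp c R s \<Longrightarrow> runs c s (cost c) [] R"
proof (induction c arbitrary: R s)
  case Skip
  then show ?case unfolding runs_def by (intro exI[of _ "[]"] exI[of _ s]) (auto intro: bs_Skip)
next
  case (Set j i e)
  then show ?case unfolding runs_def
    by (intro exI[of _ "[None]"] exI[of _ "upd j (aval i s) (aval e s) s"]) (auto intro: bs_Set)
next
  case (Sq a b)
  then have "runs a s (cost a) [] (wp b R)" by simp
  then show ?case using runs_Sq[of a s "cost a" "[]" "wp b R" b "cost b" "[]" R] Sq.IH(2) by simp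
next
  case (Cond e a b)
  have "runs (Cond e a b) s (cost a + cost b + 2) [] R"
  proof (rule runs_Cond)
    show "ok e s" using Cond.prems by simp
    show "runs a s (cost a + cost b) [] R" if "aval e s \<noteq> 0"
      by (rule runs_weaken[OF Cond.IH(1)]) (use Cond.prems that in auto)
    show "runs b s (cost a + cost b) [] R" if "aval e s = 0"
      by (rule runs_weaken[OF Cond.IH(2)]) (use Cond.prems that in auto)
  qed
  then show ?case by (simp add: add.commute)
qed auto

lemma runs_Out: "ok e s \<Longrightarrow> R s \<Longrightarrow> runs (Out e) s 1 [Word (aval e s)] R"
  unfolding runs_def by (intro exI[of _ "[Some (Word (aval e s))]"] exI[of _ s]) (auto intro: bs_Out)

lemma runs_Emit: "R s \<Longrightarrow> runs (Emit y) s 1 [y] R"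
  unfolding runs_def by (intro exI[of _ "[Some y]"] exI[of _ s]) (auto intro: bs_Emit)

lemma runs_LoopF: "ok e s \<Longrightarrow> aval e s = 0 \<Longrightarrow> R s \<Longrightarrow> runs (Loop e c) s 1 [] R"
  unfolding runs_def by (intro exI[of _ "[None]"] exI[of _ s]) (auto intro: bs_LoopF)

lemma runs_LoopT:
  assumes "ok e s" "aval e s \<noteq> 0" "runs c s n out (\<lambda>s'. runs (Loop e c) s' n' out' R)"
  shows "runs (Loop e c) s (n + n' + 2) (out @ out') R"
proof -
  obtain tr s' where 1: "bs c s tr s'" "length tr \<le> n" "outs tr = out" "runs (Loop e c) s' n' out' R"
    using assms(3) by (auto simp: runs_def)
  then obtain tr' s'' where 2: "bs (Loop e c) s' tr' s''" "length tr' \<le> n'" "outs tr' = out'" "R s''"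
    by (auto simp: runs_def)
  show ?thesis unfolding runs_def
    by (intro exI[of _ "None # tr @ None # tr'"] exI[of _ s''])
      (use 1 2 bs_LoopT[OF assms(1,2) 1(1) 2(1)] in auto)
qed

text \<open>The list is known when the program is written, so this is unrolled code and not a loop
  at run time. The invariant is indexed by the part already executed.\<close>

lemma wp_seqs:
  assumes "I [] s" "\<And>xs x ys s. zs = xs @ x # ys \<Longrightarrow> I xs s \<Longrightarrow> wp (f x) (I (xs @ [x])) s"
    "\<And>s. I zs s \<Longrightarrow> R s"
  shows "wp (seqs (map f zs)) R s"
proof -
  have "wp (seqs (map f ys)) R s" if "zs = xs @ ys" "I xs s" for xs ys s
    using that
  proof (induction ys arbitrary: xs s)
    case Nil
    then show ?case using assms(3) by simp
  next
    case (Cons y ys)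
    have "wp (f y) (wp (seqs (map f ys)) R) s"
      by (rule wp_mono[OF assms(2)[OF Cons.prems]]) (rule Cons.IH, use Cons.prems in simp)
    then show ?case by simp
  qed
  then show ?thesis using assms(1) by simp
qed

lemma ok_neq [simp]: "ok (neq e n) s \<longleftrightarrow> ok e s"
  by (auto simp: neq_def)

lemma aval_neq: "aval e s < 2 ^ w \<Longrightarrow> n < 2 ^ w \<Longrightarrow> aval (neq e n) s = 0 \<longleftrightarrow> aval e s = n"
  by (cases "aval e s" n rule: linorder_cases) (auto simp: neq_def)

lemma ok_ix [simp]: "ok (ix e b) s \<longleftrightarrow> ok e s \<and> ok b s"
  by (auto simp: ix_def)

end

text \<open>An encoding of the components of a weight: the cells \<open>2 * n + 1\<close> and \<open>2 * n + 2\<close> of two arrays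
  hold the two pointers of the weight with number \<open>n\<close>.\<close>

definition eb :: "bool \<Rightarrow> nat" where "eb b = (if b then 2 else 1)"

lemma eb_simps [simp]: "eb True = 2" "eb False = 1" "0 < eb b" "eb b \<noteq> 0" "eb b \<le> 2"
  by (auto simp: eb_def)

definition wrep :: "'n mem \<Rightarrow> 'n \<Rightarrow> 'n \<Rightarrow> nat \<Rightarrow> weight \<Rightarrow> bool" where
  "wrep s B C n w \<longleftrightarrow> s B (2 * n + 1) = eb (fst (fst w)) \<and> s C (2 * n + 1) = snd (fst w) \<and>
     s B (2 * n + 2) = eb (fst (snd w)) \<and> s C (2 * n + 2) = snd (snd w)"

definition wupd :: "'n \<Rightarrow> 'n \<Rightarrow> nat \<Rightarrow> weight \<Rightarrow> 'n mem \<Rightarrow> 'n mem" where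
  "wupd B C n w s = upd C (2 * n + 2) (snd (snd w)) (upd B (2 * n + 2) (eb (fst (snd w)))
     (upd C (2 * n + 1) (snd (fst w)) (upd B (2 * n + 1) (eb (fst (fst w))) s)))"

lemma wrep_sel: "wrep s B C n w \<Longrightarrow> s B (2 * n + eb b) = eb (fst (sel w b)) \<and> s C (2 * n + eb b) = snd (sel w b)"
  by (cases b) (auto simp: wrep_def sel_def)

lemma wrep_wupd [simp]: "B \<noteq> C \<Longrightarrow> wrep (wupd B C n w s) B C n w"
  by (simp add: wrep_def wupd_def)

lemma wrep_cong: "s B (2 * n + 1) = s' B (2 * n + 1) \<Longrightarrow> s B (2 * n + 2) = s' B (2 * n + 2) \<Longrightarrow>
    s C (2 * n + 1) = s' C (2 * n + 1) \<Longrightarrow> s C (2 * n + 2) = s' C (2 * n + 2) \<Longrightarrow> wrep s B C n w = wrep s' B C n w"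
  by (simp add: wrep_def)

lemma wupd_other [simp]: "j \<noteq> B \<Longrightarrow> j \<noteq> C \<Longrightarrow> wupd B C n w s j = s j"
  by (simp add: wupd_def)

lemma wupd_other_index: "m \<noteq> n \<Longrightarrow> wupd B C n w s j (2 * m + 1) = s j (2 * m + 1)"
  "m \<noteq> n \<Longrightarrow> wupd B C n w s j (2 * m + 2) = s j (2 * m + 2)"
  by (auto simp: wupd_def upd_def)

lemma wrep_upd [simp]: "j \<noteq> B \<Longrightarrow> j \<noteq> C \<Longrightarrow> wrep (upd j i v s) B C n w = wrep s B C n w"
  by (simp add: wrep_def)

lemma wrep_wupd_other [simp]: "B' \<noteq> B \<Longrightarrow> B' \<noteq> C \<Longrightarrow> C' \<noteq> B \<Longrightarrow> C' \<noteq> C \<Longrightarrow> wrep (wupd B C n w s) B' C' m w' = wrep s B' C' m w'"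
  by (simp add: wrep_def)

text \<open>The selector code read from the inner weight serves directly as index into the outer
  weight, so that no case distinction is needed.\<close>

definition wcomp :: "'n \<Rightarrow> 'n \<Rightarrow> 'n rexp \<Rightarrow> 'n \<Rightarrow> 'n \<Rightarrow> 'n rexp \<Rightarrow> 'n \<Rightarrow> 'n \<Rightarrow> 'n rexp \<Rightarrow> 'n rcom" where
  "wcomp B C d OB OC u IB IC i = seqs [
     Set B (ix d (Cn 1)) (Ar OB (ix u (Ar IB (ix i (Cn 1))))),
     Set C (ix d (Cn 1)) (Pl (Ar OC (ix u (Ar IB (ix i (Cn 1))))) (Ar IC (ix i (Cn 1)))),
     Set B (ix d (Cn 2)) (Ar OB (ix u (Ar IB (ix i (Cn 2))))),
     Set C (ix d (Cn 2)) (Pl (Ar OC (ix u (Ar IB (ix i (Cn 2))))) (Ar IC (ix i (Cn 2))))]"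

definition wcopy :: "'n \<Rightarrow> 'n \<Rightarrow> 'n rexp \<Rightarrow> 'n \<Rightarrow> 'n \<Rightarrow> 'n rexp \<Rightarrow> 'n rcom" where
  "wcopy B C d IB IC i = seqs [
     Set B (ix d (Cn 1)) (Ar IB (ix i (Cn 1))), Set C (ix d (Cn 1)) (Ar IC (ix i (Cn 1))),
     Set B (ix d (Cn 2)) (Ar IB (ix i (Cn 2))), Set C (ix d (Cn 2)) (Ar IC (ix i (Cn 2)))]"

definition wset :: "'n \<Rightarrow> 'n \<Rightarrow> 'n rexp \<Rightarrow> bool \<Rightarrow> 'n rexp \<Rightarrow> bool \<Rightarrow> 'n rexp \<Rightarrow> 'n rcom" where
  "wset B C d b1 c1 b2 c2 = seqs [
     Set B (ix d (Cn 1)) (Cn (eb b1)), Set C (ix d (Cn 1)) c1,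
     Set B (ix d (Cn 2)) (Cn (eb b2)), Set C (ix d (Cn 2)) c2]"

locale big_ram = ram_env +
  assumes N_le: "N \<le> 2 ^ w"
begin

lemma aval_ix: "2 * aval e s + aval b s < N \<Longrightarrow> aval (ix e b) s = 2 * aval e s + aval b s"
  using N_le by (simp add: ix_def)

lemma wp_wcomp:
  assumes "ok d s" "ok u s" "ok i s" "2 * aval d s + 2 < N" "2 * aval u s + 2 < N" "2 * aval i s + 2 < N"
    "wrep s OB OC (aval u s) x" "wrep s IB IC (aval i s) y"
    "B \<noteq> C" "{B, C} \<inter> ({OB, OC, IB, IC} \<union> exp_names d \<union> exp_names u \<union> exp_names i) = {}"
    "R (wupd B C (aval d s) (compw (2 ^ w) x y) s)"
  shows "wp (wcomp B C d OB OC u IB IC i) R s"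
proof -
  have ne': "B \<noteq> OB" "B \<noteq> OC" "B \<noteq> IB" "B \<noteq> IC" "C \<noteq> OB" "C \<noteq> OC" "C \<noteq> IB" "C \<noteq> IC"
    and ne: "B \<notin> exp_names d" "B \<notin> exp_names u" "B \<notin> exp_names i" "C \<notin> exp_names d" "C \<notin> exp_names u" "C \<notin> exp_names i"
    using assms(10) by auto
  have o: "s OB (2 * aval u s + eb b) = eb (fst (sel x b))" "s OC (2 * aval u s + eb b) = snd (sel x b)" for b
    using wrep_sel[OF assms(7)] by auto
  have lt: "2 * aval u s + eb b < N" for b using assms(5) by (cases b) auto
  show ?thesis
    using assms(11) assms(1-6,9) assms(8) ne ne' ne'[THEN not_sym] o lt
    by (simp add: wcomp_def wrep_def aval_ix wupd_def compw_def compp_def)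
qed

lemma wp_wcopy:
  assumes "ok d s" "ok i s" "2 * aval d s + 2 < N" "2 * aval i s + 2 < N" "wrep s IB IC (aval i s) y"
    "B \<noteq> C" "{B, C} \<inter> ({IB, IC} \<union> exp_names d \<union> exp_names i) = {}"
    "R (wupd B C (aval d s) y s)"
  shows "wp (wcopy B C d IB IC i) R s"
proof -
  have ne': "B \<noteq> IB" "B \<noteq> IC" "C \<noteq> IB" "C \<noteq> IC"
    and ne: "B \<notin> exp_names d" "B \<notin> exp_names i" "C \<notin> exp_names d" "C \<notin> exp_names i"
    using assms(7) by auto
  show ?thesis
    using assms(8) assms(1-4,6) assms(5) ne ne' ne'[THEN not_sym]
    by (simp add: wcopy_def wrep_def aval_ix wupd_def)
qed

lemma wp_wset:
  assumes "ok d s" "ok c1 s" "ok c2 s" "2 * aval d s + 2 < N" "B \<noteq> C"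
    "{B, C} \<inter> (exp_names d \<union> exp_names c1 \<union> exp_names c2) = {}"
    "R (wupd B C (aval d s) ((x, aval c1 s), (y, aval c2 s)) s)"
  shows "wp (wset B C d x c1 y c2) R s"
proof -
  have ne: "B \<notin> exp_names d" "B \<notin> exp_names c1" "B \<notin> exp_names c2" "C \<notin> exp_names d" "C \<notin> exp_names c1" "C \<notin> exp_names c2"
    using assms(6) by auto
  show ?thesis
    using assms(7) assms(1-5) ne by (simp add: wset_def aval_ix wupd_def)
qed

end

section \<open>Building the circuits\<close>

text \<open>The names of the arrays of the program: stack and tables of the traversal (0 to 9), nodes of the
  circuits (10 to 22), temporaries, and the heap of the enumeration (42 to 58), whose cells are goals, items
  of the current solution, and choices.  Address 0 is the null pointer.\<close>

datatype nm = Nm nat nat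

abbreviation "STK \<equiv> Nm 0 0"
abbreviation "SP0 \<equiv> Nm 1 0"
abbreviation "DONE \<equiv> Nm 2 0"
abbreviation "CTX \<equiv> Nm 3 0"
abbreviation "SZL \<equiv> Nm 4 0"
abbreviation "SZR \<equiv> Nm 5 0"
abbreviation "QE \<equiv> Nm 6 0"
abbreviation TN :: "nat \<Rightarrow> nm" where "TN \<equiv> Nm 7"
abbreviation TB :: "nat \<Rightarrow> nm" where "TB \<equiv> Nm 8"
abbreviation TC :: "nat \<Rightarrow> nm" where "TC \<equiv> Nm 9"
abbreviation "KIND \<equiv> Nm 10 0"
abbreviation "LN \<equiv> Nm 11 0"
abbreviation "RN \<equiv> Nm 12 0"
abbreviation "LB \<equiv> Nm 13 0"
abbreviation "LC \<equiv> Nm 14 0"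
abbreviation "RB \<equiv> Nm 15 0"
abbreviation "RC \<equiv> Nm 16 0"
abbreviation "MN \<equiv> Nm 17 0"
abbreviation "MB \<equiv> Nm 18 0"
abbreviation "MC \<equiv> Nm 19 0"
abbreviation "FB \<equiv> Nm 20 0"
abbreviation "FC \<equiv> Nm 21 0"
abbreviation MEM :: "nat \<Rightarrow> nm" where "MEM \<equiv> Nm 22"
abbreviation "VV \<equiv> Nm 23 0"
abbreviation "LV \<equiv> Nm 24 0"
abbreviation "RV \<equiv> Nm 25 0"
abbreviation "NX \<equiv> Nm 26 0"
abbreviation "N0 \<equiv> Nm 27 0"
abbreviation "WB \<equiv> Nm 28 0"
abbreviation "WC \<equiv> Nm 29 0"
abbreviation "AB \<equiv> Nm 30 0"
abbreviation "AC \<equiv> Nm 31 0"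
abbreviation "BB \<equiv> Nm 32 0"
abbreviation "BC \<equiv> Nm 33 0"
abbreviation "CUR \<equiv> Nm 34 0"
abbreviation "XY \<equiv> Nm 35 0"
abbreviation "X1 \<equiv> Nm 36 0"
abbreviation "X2 \<equiv> Nm 37 0"
abbreviation "GP \<equiv> Nm 38 0"
abbreviation "TP \<equiv> Nm 39 0"
abbreviation "CP \<equiv> Nm 40 0"
abbreviation "SP \<equiv> Nm 41 0"
abbreviation "GN \<equiv> Nm 42 0"
abbreviation "GX1 \<equiv> Nm 43 0"
abbreviation "GX2 \<equiv> Nm 44 0"
abbreviation "GNX \<equiv> Nm 45 0"
abbreviation "GF \<equiv> Nm 46 0"
abbreviation "GFV \<equiv> Nm 47 0"
abbreviation "RN' \<equiv> Nm 48 0"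
abbreviation "RX \<equiv> Nm 49 0"
abbreviation "RNX \<equiv> Nm 50 0"
abbreviation "RF \<equiv> Nm 51 0"
abbreviation "RFV \<equiv> Nm 52 0"
abbreviation "HN \<equiv> Nm 53 0"
abbreviation "HX1 \<equiv> Nm 54 0"
abbreviation "HX2 \<equiv> Nm 55 0"
abbreviation "HG \<equiv> Nm 56 0"
abbreviation "HT \<equiv> Nm 57 0"
abbreviation "HNX \<equiv> Nm 58 0"
abbreviation "F0 \<equiv> Nm 59 0"
abbreviation "F1 \<equiv> Nm 60 0"
abbreviation "PP \<equiv> Nm 61 0"

instance nm :: countable by countable_datatype

lemma Nm_range [simp]: "Nm i x \<in> range (Nm j) \<longleftrightarrow> i = j"
  by auto

lemma wupd_other_index' [simp]:
  "m \<noteq> n \<Longrightarrow> wupd B C n x s j (Suc (2 * m)) = s j (Suc (2 * m))"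
  "m \<noteq> n \<Longrightarrow> wupd B C n x s j (Suc (Suc (2 * m))) = s j (Suc (Suc (2 * m)))"
  using wupd_other_index[of m n B C x s j] by auto

type_synonym state = "nm mem"

section \<open>Cells that the construction of circuits may change\<close>

definition node_arrays :: "nm set" where "node_arrays = {KIND, LN, RN, MN, FB, FC} \<union> range MEM"
definition weight_arrays :: "nm set" where "weight_arrays = {LB, LC, RB, RC, MB, MC}"
definition build_names :: "nm set" where
  "build_names = node_arrays \<union> weight_arrays \<union> {NX, N0, WB, WC} \<union> range TN \<union> range TB \<union> range TC"

lemmas names_defs = build_names_def node_arrays_def weight_arrays_def

text \<open>Nodes are only appended and existing ones never change. Hence a node that represents a
  circuit does so for good.\<close>

definition node_ext :: "state \<Rightarrow> state \<Rightarrow> bool" where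
  "node_ext s s' \<longleftrightarrow> s NX 0 \<le> s' NX 0 \<and> (\<forall>n<s NX 0. (\<forall>j\<in>node_arrays. s' j n = s j n) \<and>
     (\<forall>j\<in>weight_arrays. s' j (2 * n + 1) = s j (2 * n + 1) \<and> s' j (2 * n + 2) = s j (2 * n + 2)))"

abbreviation (input) same_tabs :: "state \<Rightarrow> state \<Rightarrow> bool" where
  "same_tabs s s' \<equiv> \<forall>q. s' (TN q) = s (TN q) \<and> s' (TB q) = s (TB q) \<and> s' (TC q) = s (TC q)"

definition tab_ext :: "nat \<Rightarrow> state \<Rightarrow> state \<Rightarrow> bool" where
  "tab_ext v s s' \<longleftrightarrow> (\<forall>v' q. v' \<noteq> v \<longrightarrow> s' (TN q) v' = s (TN q) v' \<and> (\<forall>j\<in>{TB q, TC q}.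
     s' j (2 * v' + 1) = s j (2 * v' + 1) \<and> s' j (2 * v' + 2) = s j (2 * v' + 2)))"

definition build_ext :: "nat \<Rightarrow> state \<Rightarrow> state \<Rightarrow> bool" where
  "build_ext v s s' \<longleftrightarrow> node_ext s s' \<and> tab_ext v s s' \<and> (\<forall>j. j \<notin> build_names \<longrightarrow> s' j = s j)"

lemma build_ext_refl: "build_ext v s s"
  by (auto simp: build_ext_def node_ext_def tab_ext_def)

lemma node_ext_trans: "node_ext s s' \<Longrightarrow> node_ext s' s'' \<Longrightarrow> node_ext s s''"
  unfolding node_ext_def by (auto simp: Ball_def)

lemma build_ext_trans: "build_ext v s s' \<Longrightarrow> build_ext v s' s'' \<Longrightarrow> build_ext v s s''"
  unfolding build_ext_def tab_ext_def by (auto intro: node_ext_trans)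

text \<open>The code 0 is available for \<open>None\<close> because selectors are coded by 1 and
  2.\<close>

definition frep :: "state \<Rightarrow> nat \<Rightarrow> ptr option \<Rightarrow> bool" where
  "frep s n p \<longleftrightarrow> (case p of None \<Rightarrow> s FB n = 0 | Some (b, c) \<Rightarrow> s FB n = eb b \<and> s FC n = c)"

definition fxset :: "nm \<Rightarrow> nm \<Rightarrow> nm \<Rightarrow> nm rcom" where
  "fxset B C L = seqs [Set FB (Vr NX) (Ar B (ix (Vr NX) (Ar FB (Ar L (Vr NX))))),
     Set FC (Vr NX) (Pl (Ar C (ix (Vr NX) (Ar FB (Ar L (Vr NX))))) (Ar FC (Ar L (Vr NX))))]"

definition wid :: "nm \<Rightarrow> nm \<Rightarrow> nm rexp \<Rightarrow> nm rcom" where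
  "wid B C d = wset B C d False (Cn 0) True (Cn 0)"

definition finish_node :: "nm rcom" where
  "finish_node = seqs [N0 ::= Vr NX, wid WB WC (Cn 0), NX ::= Pl (Vr NX) (Cn 1)]"

definition new_item :: "nat \<Rightarrow> nat set \<Rightarrow> nm rcom" where
  "new_item k A = seqs [Set KIND (Vr NX) (Cn 0),
     seqs (map (\<lambda>j. Set (MEM j) (Vr NX) (Cn (if j \<in> A then 1 else 0))) [0..<k]),
     Set MN (Vr NX) (Vr NX), wid MB MC (Vr NX),
     Set FB (Vr NX) (Cn (if 0 \<in> A then 1 else 0)), Set FC (Vr NX) (Cn 0), finish_node]"

definition new_prod :: "nat \<Rightarrow> nat \<Rightarrow> nm rcom" where
  "new_prod p p' = seqs [Set KIND (Vr NX) (Cn 2),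
     Set LN (Vr NX) (Ar (TN p) (Vr LV)), Set RN (Vr NX) (Ar (TN p') (Vr RV)),
     wcomp LB LC (Vr NX) AB AC (Cn 0) (TB p) (TC p) (Vr LV),
     wcomp RB RC (Vr NX) BB BC (Cn 0) (TB p') (TC p') (Vr RV),
     Set MN (Vr NX) (Vr NX), wid MB MC (Vr NX),
     Cond (Ar FB (Ar LN (Vr NX))) (fxset LB LC LN)
       (Cond (Ar FB (Ar RN (Vr NX))) (fxset RB RC RN) (Set FB (Vr NX) (Cn 0))), finish_node]"

definition load_ref :: "nat \<Rightarrow> nm \<Rightarrow> nm \<Rightarrow> nm \<Rightarrow> nm rcom" where
  "load_ref p L B C = Cond (Ar (TN p) (Vr L)) (seqs [N0 ::= Ar (TN p) (Vr L),
     wcomp WB WC (Cn 0) B C (Cn 0) (TB p) (TC p) (Vr L)]) (N0 ::= Cn 0)"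

text \<open>Leaves the reference for a key in \<open>N0\<close>, with 0 for none, and its weight in
  \<open>WB\<close> and \<open>WC\<close>. For lists within one operand no node is created: the
  reference of the child is reused with a composed weight.\<close>

definition key_code :: "nat \<times> nat \<times> nat \<Rightarrow> nm rcom" where
  "key_code = (\<lambda>(i, p, p').
     if i = 0 then Cond (neq (Ar QE (Vr RV)) p') (N0 ::= Cn 0) (load_ref p LV AB AC)
     else if i = 1 then Cond (neq (Ar QE (Vr LV)) p) (N0 ::= Cn 0) (load_ref p' RV BB BC)
     else Cond (Ar (TN p) (Vr LV)) (Cond (Ar (TN p') (Vr RV)) (new_prod p p') (N0 ::= Cn 0)) (N0 ::= Cn 0))"

text \<open>A union node is created only if both references exist. The new one becomes its left
  child, from which the pointer to the leftmost circuit is inherited with a composed weight; so that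
  pointer costs constant time.\<close>

definition add_code :: "nat \<Rightarrow> nm rcom" where
  "add_code q = Cond (Vr N0) (Cond (Ar (TN q) (Vr VV))
     (seqs [Set KIND (Vr NX) (Cn 1), Set LN (Vr NX) (Vr N0), Set RN (Vr NX) (Ar (TN q) (Vr VV)),
        wcopy LB LC (Vr NX) WB WC (Cn 0), wcopy RB RC (Vr NX) (TB q) (TC q) (Vr VV),
        Set MN (Vr NX) (Ar MN (Vr N0)), wcomp MB MC (Vr NX) WB WC (Cn 0) MB MC (Vr N0),
        Cond (Ar FB (Ar LN (Vr NX))) (fxset LB LC LN) (Set FB (Vr NX) (Cn 0)),
        Set (TN q) (Vr VV) (Vr NX), wid (TB q) (TC q) (Vr VV), NX ::= Pl (Vr NX) (Cn 1)])
     (seqs [Set (TN q) (Vr VV) (Vr N0), wcopy (TB q) (TC q) (Vr VV) WB WC (Cn 0)])) Skip"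

context ram_env
begin

lemma wp_fun [simp]: "wp Skip R = R" "wp (Sq a b) R = wp a (wp b R)"
  by (rule ext, simp)+

end

context big_ram
begin

lemma wp_wcomp_self:
  assumes "ok d s" "ok u s" "ok i s" "2 * aval d s + 2 < N" "2 * aval u s + 2 < N" "2 * aval i s + 2 < N"
    "wrep s OB OC (aval u s) x" "wrep s B C (aval i s) y" "aval i s \<noteq> aval d s"
    "B \<noteq> C" "{B, C} \<inter> ({OB, OC} \<union> exp_names d \<union> exp_names u \<union> exp_names i) = {}"
    "R (wupd B C (aval d s) (compw (2 ^ w) x y) s)"
  shows "wp (wcomp B C d OB OC u B C i) R s"
proof -
  have ne': "B \<noteq> OB" "B \<noteq> OC" "C \<noteq> OB" "C \<noteq> OC"
    and ne: "B \<notin> exp_names d" "B \<notin> exp_names u" "B \<notin> exp_names i" "C \<notin> exp_names d" "C \<notin> exp_names u" "C \<notin> exp_names i"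
    using assms(11) by auto
  have o: "s OB (2 * aval u s + eb b) = eb (fst (sel x b))" "s OC (2 * aval u s + eb b) = snd (sel x b)" for b
    using wrep_sel[OF assms(7)] by auto
  have lt: "2 * aval u s + eb b < N" for b using assms(5) by (cases b) auto
  show ?thesis
    using assms(12) assms(1-6,9,10) assms(8) ne ne' ne'[THEN not_sym] assms(9)[symmetric] o lt
    by (simp add: wcomp_def wrep_def aval_ix wupd_def compw_def compp_def)
qed

lemma wp_wid:
  assumes "ok d s" "2 * aval d s + 2 < N" "B \<noteq> C" "{B, C} \<inter> exp_names d = {}" "R (wupd B C (aval d s) idw s)"
  shows "wp (wid B C d) R s"
  unfolding wid_def by (rule wp_wset) (use assms in \<open>auto simp: idw_def\<close>)

end

locale mach = big_ram w N inp + finite_forest_alg k la op "2 ^ w" Q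
  for w N inp k and la :: "bool \<Rightarrow> 'a \<Rightarrow> nat set \<Rightarrow> nat" and op Q
begin

abbreviation "M \<equiv> 2 ^ w :: nat"

text \<open>A node stands for a tree-shaped circuit although nodes are shared. Children have smaller
  numbers than their parents, which later bounds the depth of a circuit by the number of its
  node.\<close>

primrec nrep :: "circ \<Rightarrow> state \<Rightarrow> nat \<Rightarrow> bool" where
  "nrep (Item A) s n \<longleftrightarrow> 0 < n \<and> n < s NX 0 \<and> s KIND n = 0 \<and> s MN n = n \<and>
     wrep s MB MC n idw \<and> frep s n (fx M (Item A)) \<and> (\<forall>j<k. s (MEM j) n = (if j \<in> A then 1 else 0))"
| "nrep (Alt x a y b) s n \<longleftrightarrow> 0 < n \<and> n < s NX 0 \<and> s KIND n = 1 \<and> s LN n < n \<and> s RN n < n \<and>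
     wrep s LB LC n x \<and> wrep s RB RC n y \<and> nrep a s (s LN n) \<and> nrep b s (s RN n) \<and>
     s MN n = s MN (s LN n) \<and> wrep s MB MC n (snd (leftmost M (Alt x a y b))) \<and> frep s n (fx M (Alt x a y b))"
| "nrep (Prd x a y b) s n \<longleftrightarrow> 0 < n \<and> n < s NX 0 \<and> s KIND n = 2 \<and> s LN n < n \<and> s RN n < n \<and>
     wrep s LB LC n x \<and> wrep s RB RC n y \<and> nrep a s (s LN n) \<and> nrep b s (s RN n) \<and>
     s MN n = n \<and> wrep s MB MC n idw \<and> frep s n (fx M (Prd x a y b))"

lemma nrep_bounds: "nrep c s n \<Longrightarrow> 0 < n \<and> n < s NX 0"
  by (cases c) auto

lemma nrep_frep: "nrep c s n \<Longrightarrow> frep s n (fx M c)"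
  by (cases c) auto

lemma nrep_leftmost: "nrep c s n \<Longrightarrow> nrep (fst (leftmost M c)) s (s MN n) \<and> s MN n \<le> n \<and> wrep s MB MC n (snd (leftmost M c))"
proof (induction c arbitrary: n)
  case (Alt x a y b)
  then have "nrep a s (s LN n)" "s LN n < n" by auto
  with Alt.IH(1)[of "s LN n"] Alt.prems show ?case by auto
qed auto

lemma node_ext_wrep:
  assumes "node_ext s s'" "n < s NX 0" "B \<in> weight_arrays" "C \<in> weight_arrays"
  shows "wrep s' B C n x = wrep s B C n x"
  by (rule wrep_cong) (use assms in \<open>auto simp: node_ext_def\<close>)

lemma frep_cong: "s' FB n = s FB n \<Longrightarrow> s' FC n = s FC n \<Longrightarrow> frep s' n p = frep s n p"
  by (simp add: frep_def split: option.split prod.split)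

lemma nrep_ext: "node_ext s s' \<Longrightarrow> nrep c s n \<Longrightarrow> nrep c s' n"
proof (induction c arbitrary: n)
  case (Item A)
  then have n: "n < s NX 0" "s NX 0 \<le> s' NX 0" by (auto simp: node_ext_def)
  then have "\<And>j. j \<in> node_arrays \<Longrightarrow> s' j n = s j n" using Item(1) by (auto simp: node_ext_def)
  then have "s' KIND n = s KIND n" "s' MN n = s MN n" "s' FB n = s FB n" "s' FC n = s FC n" "\<And>j. s' (MEM j) n = s (MEM j) n"
    by (auto simp: node_arrays_def)
  then show ?case using Item n node_ext_wrep[OF Item(1) n(1), of MB MC] frep_cong[of s' n s]
    by (simp add: weight_arrays_def)
next
  case (Alt x a y b)
  then have n: "n < s NX 0" "s NX 0 \<le> s' NX 0" "s LN n < s NX 0" by (auto simp: node_ext_def)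
  then have "\<And>j. j \<in> node_arrays \<Longrightarrow> s' j n = s j n" "\<And>j. j \<in> node_arrays \<Longrightarrow> s' j (s LN n) = s j (s LN n)"
    using Alt.prems(1) by (auto simp: node_ext_def)
  then have "s' KIND n = s KIND n" "s' MN n = s MN n" "s' FB n = s FB n" "s' FC n = s FC n" "s' LN n = s LN n" "s' RN n = s RN n"
    "s' MN (s LN n) = s MN (s LN n)" by (auto simp: node_arrays_def)
  then show ?case using Alt n node_ext_wrep[OF Alt.prems(1) n(1), of MB MC] node_ext_wrep[OF Alt.prems(1) n(1), of LB LC]
      node_ext_wrep[OF Alt.prems(1) n(1), of RB RC] frep_cong[of s' n s]
    by (simp add: weight_arrays_def del: fx.simps)
next
  case (Prd x a y b)
  then have n: "n < s NX 0" "s NX 0 \<le> s' NX 0" by (auto simp: node_ext_def)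
  then have "\<And>j. j \<in> node_arrays \<Longrightarrow> s' j n = s j n"
    using Prd.prems(1) by (auto simp: node_ext_def)
  then have "s' KIND n = s KIND n" "s' MN n = s MN n" "s' FB n = s FB n" "s' FC n = s FC n" "s' LN n = s LN n" "s' RN n = s RN n"
    by (auto simp: node_arrays_def)
  then show ?case using Prd n node_ext_wrep[OF Prd.prems(1) n(1), of MB MC] node_ext_wrep[OF Prd.prems(1) n(1), of LB LC]
      node_ext_wrep[OF Prd.prems(1) n(1), of RB RC] frep_cong[of s' n s]
    by (simp add: weight_arrays_def del: fx.simps)
qed

definition rrep :: "state \<Rightarrow> nat \<Rightarrow> nm \<Rightarrow> nm \<Rightarrow> nat \<Rightarrow> ref \<Rightarrow> bool" where
  "rrep s n B C i r \<longleftrightarrow> (case r of None \<Rightarrow> n = 0 | Some (c, x) \<Rightarrow> nrep c s n \<and> wrep s B C i x)"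

definition curr :: "state \<Rightarrow> ref \<Rightarrow> bool" where
  "curr s r \<longleftrightarrow> rrep s (s N0 0) WB WC 0 r"

text \<open>States are below \<open>Q\<close>. The extra row \<open>Q\<close> is reserved for the
  union over all accepting states, which is formed at the start vertex.\<close>

definition tabrep :: "state \<Rightarrow> nat \<Rightarrow> (nat \<Rightarrow> ref) \<Rightarrow> bool" where
  "tabrep s v tab \<longleftrightarrow> (\<forall>q\<le>Q. rrep s (s (TN q) v) (TB q) (TC q) v (tab q))"

lemma tabrep_other:
  assumes "build_ext v s s'" "v' \<noteq> v" "tabrep s v' tab" shows "tabrep s' v' tab"
proof -
  have n: "node_ext s s'" and t: "tab_ext v s s'" using assms(1) by (auto simp: build_ext_def)
  have "wrep s' (TB q) (TC q) v' x = wrep s (TB q) (TC q) v' x" "s' (TN q) v' = s (TN q) v'" for q x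
    using t assms(2) by (simp_all add: tab_ext_def wrep_def)
  then show ?thesis using assms(3) nrep_ext[OF n]
    by (auto simp: tabrep_def rrep_def split: option.splits)
qed

lemma wp_fxset:
  assumes "0 < s L n" "s L n < n" "s NX 0 = n" "2 * n + 2 < N" "wrep s B C n x" "frep s (s L n) (Some p)"
    "B \<notin> {NX, FB, FC, L}" "C \<notin> {NX, FB, FC, L}" "L \<notin> {NX, FB, FC}"
    "R (upd FC n (snd (compp M x p)) (upd FB n (eb (fst (compp M x p))) s))"
  shows "wp (fxset B C L) R s"
proof -
  obtain b c where p: "p = (b, c)" by fastforce
  have f: "s FB (s L n) = eb b" "s FC (s L n) = c" using assms(6) by (auto simp: p frep_def)
  have x: "s B (2 * n + eb b) = eb (fst (sel x b))" "s C (2 * n + eb b) = snd (sel x b)"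
    using wrep_sel[OF assms(5)] by auto
  have lt: "2 * n + eb b < N" "0 < N" using assms(4) by (cases b; simp)+
  show ?thesis using assms(1-4,7-10) f x lt
    by (simp add: fxset_def aval_ix compp_def p)
qed

lemma node_ext_new:
  assumes "s NX 0 = n" "n \<le> s' NX 0" "\<And>j m. j \<in> node_arrays \<Longrightarrow> m < n \<Longrightarrow> s' j m = s j m"
    "\<And>j m. j \<in> weight_arrays \<Longrightarrow> m < n \<Longrightarrow> s' j (2 * m + 1) = s j (2 * m + 1) \<and> s' j (2 * m + 2) = s j (2 * m + 2)"
  shows "node_ext s s'"
  using assms by (auto simp: node_ext_def)

lemma wp_finish_node:
  assumes "2 * s NX 0 + 2 < N"
    "R (upd NX 0 (s NX 0 + 1) (wupd WB WC 0 idw (upd N0 0 (s NX 0) s)))"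
  shows "wp finish_node R s"
  unfolding finish_node_def using assms N_le
  by (auto intro!: wp_wid)

lemma wp_new_item:
  assumes n: "s NX 0 = n" "0 < n" "2 * n + 2 < N"
  shows "wp (new_item k A) (\<lambda>s'. build_ext v s s' \<and> s' NX 0 = n + 1 \<and> curr s' (Some (Item A, idw)) \<and>
     same_tabs s s') s"
proof -
  define I where "I = (\<lambda>xs s'. (\<forall>j i. s' (MEM j) i = (if i = n \<and> j \<in> set xs then if j \<in> A then 1 else 0 else s (MEM j) i)) \<and>
    (\<forall>j. j \<notin> range MEM \<longrightarrow> s' j = (upd KIND n 0 s) j))"
  let ?post = "\<lambda>s'. build_ext v s s' \<and> s' NX 0 = n + 1 \<and> curr s' (Some (Item A, idw)) \<and>
     same_tabs s s'"
  have rest: "wp (seqs [Set MN (Vr NX) (Vr NX), wid MB MC (Vr NX),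
     Set FB (Vr NX) (Cn (if 0 \<in> A then 1 else 0)), Set FC (Vr NX) (Cn 0), finish_node]) ?post s1" if "I [0..<k] s1" for s1
  proof -
    have mem: "s1 (MEM j) i = (if i = n \<and> j < k then if j \<in> A then 1 else 0 else s (MEM j) i)" for j i
      using that by (auto simp: I_def)
    have oth: "j \<notin> range MEM \<Longrightarrow> s1 j = upd KIND n 0 s j" for j using that by (auto simp: I_def)
    have nx: "s1 NX 0 = n" using oth[of NX] n by auto
    define s2 where "s2 = upd NX 0 (n + 1) (wupd WB WC 0 idw (upd N0 0 n (upd FC n 0
      (upd FB n (if 0 \<in> A then 1 else 0) (wupd MB MC n idw (upd MN n n s1))))))"
    have s2: "s2 j m = s1 j m" if "m < n" "j \<in> node_arrays" for j m
      using that by (auto simp: s2_def node_arrays_def)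
    have s2w: "s2 j (2 * m + 1) = s1 j (2 * m + 1) \<and> s2 j (2 * m + 2) = s1 j (2 * m + 2)" if "m < n" "j \<in> weight_arrays" for j m
      using that by (auto simp: s2_def weight_arrays_def wupd_other_index[of m n])
    have "node_ext s s2"
    proof (rule node_ext_new[where s = s and n = n, OF n(1)])
      show "n \<le> s2 NX 0" by (simp add: s2_def)
    next
      fix j m assume "j \<in> node_arrays" "m < n"
      then show "s2 j m = s j m" using s2[of m j] mem oth[of j]
        by (cases "j \<in> range MEM") (auto simp: upd_def)
    next
      fix j m assume "j \<in> weight_arrays" "m < n"
      then show "s2 j (2 * m + 1) = s j (2 * m + 1) \<and> s2 j (2 * m + 2) = s j (2 * m + 2)"
        using s2w[of m j] oth[of j] by (auto simp: weight_arrays_def)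
    qed
    moreover have "tab_ext v s s2" using oth by (auto simp: tab_ext_def s2_def)
    moreover have "s2 j = s j" if "j \<notin> build_names" for j
    proof -
      have "j \<notin> range MEM" "j \<notin> {KIND, MN, FB, FC, MB, MC, NX, N0, WB, WC}"
        using that by (auto simp: names_defs)
      then show ?thesis using oth[of j] by (simp add: s2_def)
    qed
    ultimately have ext: "build_ext v s s2" by (auto simp: build_ext_def)
    have "nrep (Item A) s2 n"
      using n(2) oth[of KIND] mem by (auto simp: s2_def frep_def)
    then have "curr s2 (Some (Item A, idw))" by (simp add: curr_def rrep_def s2_def)
    moreover have "s2 (TN q) = s (TN q) \<and> s2 (TB q) = s (TB q) \<and> s2 (TC q) = s (TC q)" for q
      using oth by (auto simp: s2_def)
    ultimately have "?post s2" using ext by (simp add: s2_def)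
    then show ?thesis using n nx
      by (auto simp: s2_def intro!: wp_wid wp_finish_node)
  qed
  have "wp (seqs (map (\<lambda>j. Set (MEM j) (Vr NX) (Cn (if j \<in> A then 1 else 0))) [0..<k]))
     (wp (seqs [Set MN (Vr NX) (Vr NX), wid MB MC (Vr NX),
     Set FB (Vr NX) (Cn (if 0 \<in> A then 1 else 0)), Set FC (Vr NX) (Cn 0), finish_node]) ?post) (upd KIND n 0 s)"
  proof (rule wp_seqs[of I])
    show "I [] (upd KIND n 0 s)" by (auto simp: I_def)
  next
    fix xs x ys s' assume I: "I xs s'"
    then have "s' NX = s NX" by (auto simp: I_def)
    then have nx: "s' NX 0 = n" using n by simp
    have "I (xs @ [x]) (upd (MEM x) n (if x \<in> A then 1 else 0) s')"
      unfolding I_def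
    proof (intro conjI allI impI)
      fix j i
      show "upd (MEM x) n (if x \<in> A then 1 else 0) s' (MEM j) i =
        (if i = n \<and> j \<in> set (xs @ [x]) then if j \<in> A then 1 else 0 else s (MEM j) i)"
        using I unfolding I_def by (auto simp: upd_def)
    next
      fix j :: nm assume "j \<notin> range MEM"
      then show "upd (MEM x) n (if x \<in> A then 1 else 0) s' j = upd KIND n 0 s j"
        using I unfolding I_def by (cases "j = MEM x") auto
    qed
    then show "wp (Set (MEM x) (Vr NX) (Cn (if x \<in> A then 1 else 0))) (I (xs @ [x])) s'"
      using n nx by simp
  qed (use rest in blast)
  then show ?thesis using n by (simp add: new_item_def)
qed

lemma wp_add_code:
  assumes n: "s NX 0 = n" "0 < n" "2 * n + 2 < N" and v: "s VV 0 = v" "2 * v + 2 < N" and q: "q \<le> Q"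
    and cur: "curr s r" and tab: "tabrep s v tab"
  shows "wp (add_code q) (\<lambda>s'. build_ext v s s' \<and> s' NX 0 \<le> n + 1 \<and> tabrep s' v (tab(q := add_ref r (tab q)))) s"
    (is "wp _ ?post _")
proof -
  have ok: "0 < N" "n < N" "v < N" using n v by auto
  show ?thesis
  proof (cases r)
    case None
    then have "s N0 0 = 0" using cur by (simp add: curr_def rrep_def)
    then show ?thesis using tab None ok by (simp add: add_code_def add_ref_def build_ext_refl n)
  next
    case (Some cx)
    then obtain c x where r: "r = Some (c, x)" by (cases cx) auto
    define m where "m = s N0 0"
    have m: "nrep c s m" "wrep s WB WC 0 x" using cur by (auto simp: curr_def rrep_def r m_def)
    note mb = nrep_bounds[OF m(1)]
    have tq: "rrep s (s (TN q) v) (TB q) (TC q) v (tab q)" using tab q by (simp add: tabrep_def)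
    show ?thesis
    proof (cases "tab q")
      case None
      then have t0: "s (TN q) v = 0" using tq by (simp add: rrep_def)
      define s2 where "s2 = wupd (TB q) (TC q) v x (upd (TN q) v m s)"
      have ne: "node_ext s s2" by (auto simp: node_ext_def s2_def node_arrays_def weight_arrays_def)
      have te: "tab_ext v s s2" by (auto simp: tab_ext_def s2_def wupd_def upd_def)
      have "s2 j = s j" if "j \<notin> build_names" for j
      proof -
        have "j \<noteq> TN q" "j \<noteq> TB q" "j \<noteq> TC q" using that by (auto simp: build_names_def)
        then show ?thesis by (simp add: s2_def)
      qed
      with ne te have ext: "build_ext v s s2" by (auto simp: build_ext_def)
      have "rrep s2 (s2 (TN p) v) (TB p) (TC p) v ((tab(q := add_ref r (tab q))) p)" if "p \<le> Q" for p
      proof (cases "p = q")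
        case True
        then show ?thesis using None r nrep_ext[OF ne m(1)] by (simp add: add_ref_def rrep_def s2_def)
      next
        case False
        then have "s2 (TN p) = s (TN p)" "\<And>y. wrep s2 (TB p) (TC p) v y = wrep s (TB p) (TC p) v y"
          by (auto simp: s2_def)
        then show ?thesis using False tab that nrep_ext[OF ne]
          by (auto simp: tabrep_def rrep_def split: option.splits)
      qed
      then have "?post s2" using ext n by (simp add: tabrep_def s2_def)
      moreover have "wrep (upd (TN q) v m s) WB WC 0 x" using m(2) by simp
      ultimately show ?thesis using t0 m mb ok n v
        by (auto simp: add_code_def s2_def m_def[symmetric] intro!: wp_wcopy)
    next
      case (Some dy)
      then obtain d y where d: "tab q = Some (d, y)" by (cases dy) auto
      define m' where "m' = s (TN q) v"
      have m': "nrep d s m'" "wrep s (TB q) (TC q) v y" using tq by (auto simp: d rrep_def m'_def)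
      note mb' = nrep_bounds[OF m'(1)]
      let ?c = "Alt x c y d"
      \<comment> \<open>\<open>s1\<close> and \<open>s2\<close> are the states before and after the
        pointer to component 0 is set; in \<open>s3\<close> the new node has also been entered into
        the table.\<close>
      define s1 where "s1 = wupd MB MC n (snd (leftmost M ?c)) (upd MN n (s MN m)
         (wupd RB RC n y (wupd LB LC n x (upd RN n m' (upd LN n m (upd KIND n 1 s))))))"
      define s2 where "s2 = (case fx M c of None \<Rightarrow> upd FB n 0 s1
         | Some p \<Rightarrow> upd FC n (snd (compp M x p)) (upd FB n (eb (fst (compp M x p))) s1))"
      define s3 where "s3 = upd NX 0 (n + 1) (wupd (TB q) (TC q) v idw (upd (TN q) v n s2))"
      have s2o: "s2 j = s1 j" if "j \<noteq> FB" "j \<noteq> FC" for j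
        using that by (auto simp: s2_def split: option.splits)
      have s2i: "s2 j i = s1 j i" if "i \<noteq> n" for i j
        using that by (auto simp: s2_def split: option.splits)
      have ne: "node_ext s s3"
      proof (rule node_ext_new[where s = s and n = n, OF n(1)])
        show "n \<le> s3 NX 0" by (simp add: s3_def)
      next
        fix j i assume j: "j \<in> node_arrays" "i < n"
        then have "s3 j i = s1 j i" using s2i[of i j] by (auto simp: s3_def node_arrays_def)
        then show "s3 j i = s j i" using j by (auto simp: s1_def node_arrays_def)
      next
        fix j i assume j: "j \<in> weight_arrays" "i < n"
        then have "s3 j = s1 j" using s2o[of j] by (auto simp: s3_def weight_arrays_def)
        then show "s3 j (2 * i + 1) = s j (2 * i + 1) \<and> s3 j (2 * i + 2) = s j (2 * i + 2)"
          using j by (auto simp: s1_def weight_arrays_def wupd_other_index[of i n])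
      qed
      have te: "tab_ext v s s3"
      proof -
        have "s2 (TN p) = s (TN p)" "s2 (TB p) = s (TB p)" "s2 (TC p) = s (TC p)" for p
          using s2o by (auto simp: s1_def)
        then show ?thesis by (auto simp: tab_ext_def s3_def wupd_def upd_def)
      qed
      have "s3 j = s j" if "j \<notin> build_names" for j
      proof -
        have "j \<noteq> TN q" "j \<noteq> TB q" "j \<noteq> TC q" using that by (auto simp: build_names_def)
        then show ?thesis
          using that s2o[of j] by (auto simp: s3_def s1_def names_defs)
      qed
      with ne te have ext: "build_ext v s s3" by (auto simp: build_ext_def)
      have s2f: "frep s2 n (fx M ?c)"
        by (cases "fx M c") (auto simp: s2_def frep_def)
      have new: "nrep ?c s3 n"
      proof -
        have mn: "m < n" "m' < n" using mb mb' n by auto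
        have a: "s3 KIND n = 1" "s3 LN n = m" "s3 RN n = m'" "s3 MN n = s MN m" "s3 NX 0 = n + 1"
          using s2o by (auto simp: s3_def s1_def)
        have b: "wrep s3 LB LC n x" "wrep s3 RB RC n y" "wrep s3 MB MC n (snd (leftmost M ?c))"
          using s2o by (auto simp: s3_def s1_def wrep_def wupd_def)
        have c: "nrep c s3 m" "nrep d s3 m'" using nrep_ext[OF ne] m(1) m'(1) by auto
        have s3f: "s3 FB n = s2 FB n" "s3 FC n = s2 FC n" by (simp_all add: s3_def)
        have "frep s3 n (fx M ?c)" using s2f unfolding frep_cong[of s3 n s2, OF s3f] .
        moreover have "s3 MN m = s MN m" using s2o[of MN] mn by (simp add: s3_def s1_def)
        ultimately show ?thesis using a b c mn n(2) by (simp del: fx.simps leftmost.simps)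
      qed
      have "rrep s3 (s3 (TN p) v) (TB p) (TC p) v ((tab(q := add_ref r (tab q))) p)" if "p \<le> Q" for p
      proof (cases "p = q")
        case True
        then show ?thesis using d r new by (simp add: add_ref_def rrep_def s3_def del: nrep.simps)
      next
        case False
        have "s3 (TN p) = s (TN p)" "\<And>y. wrep s3 (TB p) (TC p) v y = wrep s (TB p) (TC p) v y"
          using False s2o by (auto simp: s3_def s1_def wrep_def)
        then show ?thesis using False tab that nrep_ext[OF ne]
          by (auto simp: tabrep_def rrep_def split: option.splits)
      qed
      then have post: "?post s3" using ext by (simp add: tabrep_def s3_def)
      have mn: "m < n" "0 < m" "m' < n" "0 < m'" using mb mb' n by auto
      have fin: "wp (seqs [Set (TN q) (Vr VV) (Vr NX), wid (TB q) (TC q) (Vr VV), NX ::= Pl (Vr NX) (Cn 1)]) ?post s2"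
      proof -
        have "s2 NX 0 = n" "s2 VV 0 = v" using s2o n v by (auto simp: s1_def)
        then show ?thesis using post ok n v N_le by (auto simp: s3_def intro!: wp_wid)
      qed
      have fx: "wp (Cond (Ar FB (Ar LN (Vr NX))) (fxset LB LC LN) (Set FB (Vr NX) (Cn 0)))
         (wp (seqs [Set (TN q) (Vr VV) (Vr NX), wid (TB q) (TC q) (Vr VV), NX ::= Pl (Vr NX) (Cn 1)]) ?post) s1"
      proof -
        have l: "s1 LN n = m" "s1 NX 0 = n" "s1 FB m = s FB m" "s1 FC m = s FC m"
          using n mn by (auto simp: s1_def)
        have f: "frep s1 m (fx M c)" using nrep_frep[OF m(1)] unfolding frep_cong[of s1 m s, OF l(3,4)] .
        have lw: "wrep s1 LB LC n x" by (simp add: s1_def wrep_def wupd_def)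
        show ?thesis
        proof (cases "fx M c")
          case None
          then show ?thesis using f l fin ok mn by (simp add: s2_def frep_def)
        next
          case (Some p)
          then have "s1 FB m \<noteq> 0" using f by (cases p) (auto simp: frep_def)
          moreover have "wp (fxset LB LC LN) (wp (seqs [Set (TN q) (Vr VV) (Vr NX), wid (TB q) (TC q) (Vr VV), NX ::= Pl (Vr NX) (Cn 1)]) ?post) s1"
            by (rule wp_fxset[where n = n and x = x and p = p]) (use f l lw fin mn Some n in \<open>auto simp: s2_def\<close>)
          ultimately show ?thesis using l ok mn by simp
        qed
      qed
      have lm: "wrep s MB MC m (snd (leftmost M c))" using nrep_leftmost[OF m(1)] by simp
      show ?thesis
        using fx m mb ok n v mn m' lm m_def m'_def
        by (auto simp: add_code_def s1_def intro!: wp_wcopy wp_wcomp_self)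
    qed
  qed
qed

lemma wp_new_prod:
  assumes n: "s NX 0 = n" "0 < n" "2 * n + 2 < N" and l: "s LV 0 = l" "2 * l + 2 < N" and r: "s RV 0 = r" "2 * r + 2 < N"
    and w: "wrep s AB AC 0 x" "wrep s BB BC 0 y"
    and t: "rrep s (s (TN p) l) (TB p) (TC p) l (Some (c, x'))" "rrep s (s (TN p') r) (TB p') (TC p') r (Some (d, y'))"
  shows "wp (new_prod p p') (\<lambda>s'. build_ext v s s' \<and> s' NX 0 = n + 1 \<and>
     curr s' (Some (Prd (compw M x x') c (compw M y y') d, idw)) \<and>
     same_tabs s s') s"
    (is "wp _ ?post _")
proof -
  let ?c = "Prd (compw M x x') c (compw M y y') d"
  have ok: "0 < N" "n < N" "l < N" "r < N" using n l r by auto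
  define m where "m = s (TN p) l"
  define m' where "m' = s (TN p') r"
  have m: "nrep c s m" "wrep s (TB p) (TC p) l x'" and m': "nrep d s m'" "wrep s (TB p') (TC p') r y'"
    using t by (auto simp: rrep_def m_def m'_def)
  have mn: "0 < m" "m < n" "0 < m'" "m' < n" using nrep_bounds[OF m(1)] nrep_bounds[OF m'(1)] n by auto
  define s1 where "s1 = wupd MB MC n idw (upd MN n n (wupd RB RC n (compw M y y') (wupd LB LC n (compw M x x')
     (upd RN n m' (upd LN n m (upd KIND n 2 s))))))"
  define s2 where "s2 = (case fx M ?c of None \<Rightarrow> upd FB n 0 s1 | Some p \<Rightarrow> upd FC n (snd p) (upd FB n (eb (fst p)) s1))"
  define s3 where "s3 = upd NX 0 (n + 1) (wupd WB WC 0 idw (upd N0 0 n s2))"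
  have s2o: "s2 j = s1 j" if "j \<noteq> FB" "j \<noteq> FC" for j
    using that by (auto simp: s2_def split: option.splits)
  have s2i: "s2 j i = s1 j i" if "i \<noteq> n" for i j
    using that by (auto simp: s2_def split: option.splits)
  have ne: "node_ext s s3"
  proof (rule node_ext_new[where s = s and n = n, OF n(1)])
    show "n \<le> s3 NX 0" by (simp add: s3_def)
  next
    fix j i assume j: "j \<in> node_arrays" "i < n"
    then have "s3 j i = s1 j i" using s2i[of i j] by (auto simp: s3_def node_arrays_def)
    then show "s3 j i = s j i" using j by (auto simp: s1_def node_arrays_def)
  next
    fix j i assume j: "j \<in> weight_arrays" "i < n"
    then have "s3 j = s1 j" using s2o[of j] by (auto simp: s3_def weight_arrays_def)
    then show "s3 j (2 * i + 1) = s j (2 * i + 1) \<and> s3 j (2 * i + 2) = s j (2 * i + 2)"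
      using j by (auto simp: s1_def weight_arrays_def)
  qed
  have tabs: "s3 (TN q) = s (TN q)" "s3 (TB q) = s (TB q)" "s3 (TC q) = s (TC q)" for q
    using s2o by (auto simp: s3_def s1_def)
  then have te: "tab_ext v s s3" by (auto simp: tab_ext_def)
  have "s3 j = s j" if "j \<notin> build_names" for j
    using that s2o[of j] by (auto simp: s3_def s1_def names_defs)
  with ne te have ext: "build_ext v s s3" by (auto simp: build_ext_def)
  have s2f: "frep s2 n (fx M ?c)" unfolding s2_def by (cases "fx M ?c") (simp_all add: frep_def split: prod.split del: fx.simps)
  have new: "nrep ?c s3 n"
  proof -
    have a: "s3 KIND n = 2" "s3 LN n = m" "s3 RN n = m'" "s3 MN n = n" "s3 NX 0 = n + 1"
      using s2o by (auto simp: s3_def s1_def)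
    have b: "wrep s3 LB LC n (compw M x x')" "wrep s3 RB RC n (compw M y y')" "wrep s3 MB MC n idw"
      using s2o by (auto simp: s3_def s1_def wrep_def wupd_def)
    have c: "nrep c s3 m" "nrep d s3 m'" using nrep_ext[OF ne] m(1) m'(1) by auto
    have s3f: "s3 FB n = s2 FB n" "s3 FC n = s2 FC n" by (simp_all add: s3_def)
    have "frep s3 n (fx M ?c)" using s2f unfolding frep_cong[of s3 n s2, OF s3f] .
    then show ?thesis using a b c mn n(2) by (simp del: fx.simps)
  qed
  then have "curr s3 (Some (?c, idw))" by (simp add: curr_def rrep_def s3_def del: nrep.simps)
  then have post: "?post s3" using ext tabs by (simp add: s3_def)
  have fin: "wp finish_node ?post s2"
  proof -
    have "s2 NX 0 = n" using s2o n by (auto simp: s1_def)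
    then show ?thesis using post n by (intro wp_finish_node) (auto simp: s3_def)
  qed
  have fx: "wp (Cond (Ar FB (Ar LN (Vr NX))) (fxset LB LC LN)
       (Cond (Ar FB (Ar RN (Vr NX))) (fxset RB RC RN) (Set FB (Vr NX) (Cn 0)))) (wp finish_node ?post) s1"
  proof -
    have e: "s1 LN n = m" "s1 RN n = m'" "s1 NX 0 = n" "s1 FB m = s FB m" "s1 FC m = s FC m" "s1 FB m' = s FB m'" "s1 FC m' = s FC m'"
      using n mn by (auto simp: s1_def)
    have f: "frep s1 m (fx M c)" "frep s1 m' (fx M d)"
      using nrep_frep[OF m(1)] nrep_frep[OF m'(1)] unfolding frep_cong[of s1 m s, OF e(4,5)] frep_cong[of s1 m' s, OF e(6,7)] by auto
    have lw: "wrep s1 LB LC n (compw M x x')" "wrep s1 RB RC n (compw M y y')" by (simp_all add: s1_def wrep_def wupd_def)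
    show ?thesis
    proof (cases "fx M c")
      case None
      then have f0: "s1 FB m = 0" using f(1) by (simp add: frep_def)
      show ?thesis
      proof (cases "fx M d")
        case None
        then have "s1 FB m' = 0" using f(2) by (simp add: frep_def)
        moreover have "s2 = upd FB n 0 s1" using None \<open>fx M c = None\<close> by (simp add: s2_def)
        ultimately show ?thesis using f0 e fin ok mn by simp
      next
        case (Some q)
        then have "s1 FB m' \<noteq> 0" using f(2) by (cases q) (auto simp: frep_def)
        moreover have "s2 = upd FC n (snd (compp M (compw M y y') q)) (upd FB n (eb (fst (compp M (compw M y y') q))) s1)"
          using Some \<open>fx M c = None\<close> by (simp add: s2_def)
        moreover then have "wp (fxset RB RC RN) (wp finish_node ?post) s1"
          by (intro wp_fxset[where n = n and x = "compw M y y'" and p = q]) (use f e lw fin mn Some n in auto)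
        ultimately show ?thesis using f0 e ok mn by simp
      qed
    next
      case (Some q)
      then have "s1 FB m \<noteq> 0" using f(1) by (cases q) (auto simp: frep_def)
      moreover have "s2 = upd FC n (snd (compp M (compw M x x') q)) (upd FB n (eb (fst (compp M (compw M x x') q))) s1)"
        using Some by (simp add: s2_def)
      moreover then have "wp (fxset LB LC LN) (wp finish_node ?post) s1"
        by (intro wp_fxset[where n = n and x = "compw M x x'" and p = q]) (use f e lw fin mn Some n in auto)
      ultimately show ?thesis using e ok mn by simp
    qed
  qed
  show ?thesis
    using fx ok n l r mn m m' w m_def m'_def
    by (auto simp: new_prod_def s1_def intro!: wp_wcomp wp_wid)
qed

end

context mach
begin

lemma wp_load_ref:
  assumes "s L 0 = l" "2 * l + 2 < N" "wrep s B C 0 x" "rrep s (s (TN p) l) (TB p) (TC p) l r"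
    and "L = LV \<and> B = AB \<and> C = AC \<or> L = RV \<and> B = BB \<and> C = BC"
  shows "wp (load_ref p L B C) (\<lambda>s'. build_ext v s s' \<and> s' NX 0 = s NX 0 \<and> curr s' (comp_ref M x r) \<and>
     same_tabs s s') s"
    (is "wp _ ?post _")
proof -
  have ext: "build_ext v s (upd N0 0 n s)" "build_ext v s (wupd WB WC 0 y (upd N0 0 n s))" for n y
    by (auto simp: build_ext_def node_ext_def tab_ext_def names_defs)
  have ne: "node_ext s (wupd WB WC 0 y (upd N0 0 n s))" for n y using ext by (simp add: build_ext_def)
  show ?thesis
  proof (cases r)
    case None
    then have "s (TN p) l = 0" using assms(4) by (simp add: rrep_def)
    moreover have "?post (upd N0 0 0 s)" using ext None by (simp add: curr_def rrep_def comp_ref_def)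
    ultimately show ?thesis using assms by (auto simp: load_ref_def)
  next
    case (Some cy)
    then obtain c y where r: "r = Some (c, y)" by (cases cy) auto
    define m where "m = s (TN p) l"
    have m: "nrep c s m" "wrep s (TB p) (TC p) l y" using assms(4) r by (auto simp: rrep_def m_def)
    have "?post (wupd WB WC 0 (compw M x y) (upd N0 0 m s))"
      using ext r nrep_ext[OF ne m(1)] by (simp add: curr_def rrep_def comp_ref_def)
    then show ?thesis using assms(1-3,5) m nrep_bounds[OF m(1)] m_def
      by (auto simp: load_ref_def intro!: wp_wcomp)
  qed
qed

definition key_ref :: "bool \<Rightarrow> 'a ex \<Rightarrow> 'a ex \<Rightarrow> (nat \<Rightarrow> ref) \<Rightarrow> (nat \<Rightarrow> ref) \<Rightarrow> nat \<times> nat \<times> nat \<Rightarrow> ref" where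
  "key_ref v t u tabl tabr = (\<lambda>(i, p, p').
     if i = 0 then if p' = qe u then comp_ref M (wleft v t u) (tabl p) else None
     else if i = 1 then if p = qe t then comp_ref M (wright v t u) (tabr p') else None
     else prod_ref (comp_ref M (wleft v t u) (tabl p)) (comp_ref M (wright v t u) (tabr p')))"

lemma good_key_ref:
  assumes "wfx (Op v t u)" "table_ok t tabl" "table_ok u tabr" "fst \<kappa> < 3"
  shows "good M (Op v t u) (op_part v t u \<kappa>) (key_ref v t u tabl tabr \<kappa>)"
proof -
  obtain i p p' where k: "\<kappa> = (i, p, p')" by (metis prod_cases3)
  have "i = 0 \<or> i = 1 \<or> i = 2" using assms(4) k by auto
  then show ?thesis
    using good_left[OF assms(1,2)] good_right[OF assms(1,3)] good_both[OF assms(1-3)]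
    unfolding k key_ref_def by (elim disjE) simp_all
qed

lemma wp_key_code:
  assumes n: "s NX 0 = n" "0 < n" "2 * n + 2 < N" and l: "s LV 0 = l" "2 * l + 2 < N" and r: "s RV 0 = r" "2 * r + 2 < N"
    and w: "wrep s AB AC 0 (wleft b t u)" "wrep s BB BC 0 (wright b t u)"
    and t: "tabrep s l tabl" "tabrep s r tabr" and q: "s QE l = qe t" "s QE r = qe u" and Q: "Q < M"
    and k: "\<kappa> \<in> op_keys"
  shows "wp (key_code \<kappa>) (\<lambda>s'. build_ext v s s' \<and> s' NX 0 \<le> n + 1 \<and> curr s' (key_ref b t u tabl tabr \<kappa>) \<and>
     same_tabs s s') s"
proof -
  obtain i p p' where i: "\<kappa> = (i, p, p')" by (metis prod_cases3)
  let ?post = "\<lambda>s'. build_ext v s s' \<and> s' NX 0 \<le> n + 1 \<and> curr s' (key_ref b t u tabl tabr \<kappa>) \<and>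
     same_tabs s s'"
  have p: "i < 3" "p < Q" "p' < Q" using k by (auto simp: op_keys_def i)
  have ok: "0 < N" "l < N" "r < N" using l r by auto
  have none: "?post (upd N0 0 0 s)" if "key_ref b t u tabl tabr \<kappa> = None"
    using that n by (auto simp: curr_def rrep_def build_ext_def node_ext_def tab_ext_def names_defs)
  have tl: "rrep s (s (TN p) l) (TB p) (TC p) l (tabl p)" and tr: "rrep s (s (TN p') r) (TB p') (TC p') r (tabr p')"
    using t p by (auto simp: tabrep_def)
  have qa: "aval (neq (Ar QE (Vr RV)) p') s = 0 \<longleftrightarrow> qe u = p'" "aval (neq (Ar QE (Vr LV)) p) s = 0 \<longleftrightarrow> qe t = p"
    using aval_neq[of "Ar QE (Vr RV)" s p'] aval_neq[of "Ar QE (Vr LV)" s p] q l r p Q qe_less[of t] qe_less[of u] by auto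
  from p(1) consider "i = 0" | "i = 1" | "i = 2" by linarith
  then show ?thesis
  proof cases
    case 1
    show ?thesis
    proof (cases "p' = qe u")
      case True
      have "wp (load_ref p LV AB AC) ?post s"
        by (rule wp_mono[OF wp_load_ref[OF l w(1) tl]]) (use n True in \<open>auto simp: key_ref_def i 1\<close>)
      then show ?thesis using True qa ok l r by (simp add: key_code_def i 1)
    next
      case False
      then show ?thesis using none qa ok l r by (simp add: key_code_def key_ref_def i 1)
    qed
  next
    case 2
    show ?thesis
    proof (cases "p = qe t")
      case True
      have "wp (load_ref p' RV BB BC) ?post s"
        by (rule wp_mono[OF wp_load_ref[OF r w(2) tr]]) (use n True in \<open>auto simp: key_ref_def i 2\<close>)
      then show ?thesis using True qa ok l r by (simp add: key_code_def i 2)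
    next
      case False
      then show ?thesis using none qa ok l r by (simp add: key_code_def key_ref_def i 2)
    qed
  next
    case 3
    show ?thesis
    proof (cases "tabl p = None \<or> tabr p' = None")
      case True
      then have "s (TN p) l = 0 \<or> s (TN p') r = 0" using tl tr by (auto simp: rrep_def)
      moreover have "key_ref b t u tabl tabr \<kappa> = None"
        using True by (auto simp: key_ref_def i 3 prod_ref_def comp_ref_def split: option.splits)
      ultimately show ?thesis using none ok l r by (auto simp: key_code_def i 3)
    next
      case False
      then obtain c x d y where cd: "tabl p = Some (c, x)" "tabr p' = Some (d, y)" by auto
      have "s (TN p) l \<noteq> 0" "s (TN p') r \<noteq> 0"
        using tl tr cd nrep_bounds[of c s "s (TN p) l"] nrep_bounds[of d s "s (TN p') r"] by (auto simp: rrep_def)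
      moreover have "wp (new_prod p p') ?post s"
        by (rule wp_mono[OF wp_new_prod[OF n l r w tl[unfolded cd] tr[unfolded cd]]])
          (use cd in \<open>auto simp: key_ref_def i 3 prod_ref_def comp_ref_def\<close>)
      ultimately show ?thesis using ok l r by (simp add: key_code_def i 3)
    qed
  qed
qed

definition op_code :: "bool \<Rightarrow> nm rcom" where
  "op_code b = seqs (map (\<lambda>\<kappa>. Sq (key_code \<kappa>) (add_code (op_target b \<kappa>)))
     (List.product [0..<3] (List.product [0..<Q] [0..<Q])))"

lemma build_ext_other: "build_ext v s s' \<Longrightarrow> j \<notin> build_names \<Longrightarrow> s' j = s j"
  by (simp add: build_ext_def)

lemma tabrep_node_ext: 
  assumes "node_ext s s'" "\<And>q. s' (TN q) = s (TN q) \<and> s' (TB q) = s (TB q) \<and> s' (TC q) = s (TC q)" "tabrep s v tab"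
  shows "tabrep s' v tab"
proof -
  have "wrep s' (TB q) (TC q) v x = wrep s (TB q) (TC q) v x" "s' (TN q) v = s (TN q) v" for q x
    using assms(2) by (simp_all add: wrep_def)
  then show ?thesis using assms(3) nrep_ext[OF assms(1)]
    by (auto simp: tabrep_def rrep_def split: option.splits)
qed

text \<open>There are \<open>3 * Q * Q\<close> keys, each creating at most two nodes, one for a
  product and one for a union. This is the origin of \<open>6 * Q * Q\<close>.\<close>

lemma wp_op_code:
  assumes n: "s0 NX 0 = n" "0 < n" "2 * (n + 6 * Q * Q) + 2 < N"
    and l: "s0 LV 0 = l" "2 * l + 2 < N" and r: "s0 RV 0 = r" "2 * r + 2 < N" and v: "s0 VV 0 = v" "2 * v + 2 < N"
    and w: "wrep s0 AB AC 0 (wleft b t u)" "wrep s0 BB BC 0 (wright b t u)"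
    and t: "tabrep s0 l tabl" "tabrep s0 r tabr" "table_ok t tabl" "table_ok u tabr" "tabrep s0 v (\<lambda>_. None)"
    and q: "s0 QE l = qe t" "s0 QE r = qe u" and Q: "Q < M" and lr: "l \<noteq> v" "r \<noteq> v" and wf: "wfx (Op b t u)"
  shows "wp (op_code b) (\<lambda>s'. build_ext v s0 s' \<and> s' NX 0 \<le> n + 6 * Q * Q \<and>
     (\<exists>tab. tabrep s' v tab \<and> table_ok (Op b t u) tab)) s0"
proof -
  define keys where "keys = List.product [0..<3] (List.product [0..<Q] [0..<Q])"
  define I where "I = (\<lambda>ks s. build_ext v s0 s \<and> s NX 0 \<le> n + 2 * length ks \<and>
     (\<exists>tab. tabrep s v tab \<and> good_table M (Op b t u) (op_part b t u) (op_target b) (set ks) tab))"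
  have keys: "set keys = op_keys" "distinct keys" "length keys = 3 * Q * Q"
    by (auto simp: keys_def op_keys_def distinct_product)
  show ?thesis unfolding op_code_def keys_def[symmetric]
  proof (rule wp_seqs[of I])
    show "I [] s0" using n t(5) by (auto simp: I_def build_ext_refl intro!: exI[of _ "\<lambda>_. None"] good_table_empty)
  next
    fix xs \<kappa> ys s assume xs: "keys = xs @ \<kappa> # ys" and I: "I xs s"
    have \<kappa>: "\<kappa> \<in> op_keys" "\<kappa> \<notin> set xs" "set xs \<subseteq> op_keys" "length xs < 3 * Q * Q"
      using keys xs by auto
    obtain tab where ext: "build_ext v s0 s" and nx: "s NX 0 \<le> n + 2 * length xs" and tab: "tabrep s v tab"
      "good_table M (Op b t u) (op_part b t u) (op_target b) (set xs) tab" using I by (auto simp: I_def)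
    have same: "s j = s0 j" if "j \<in> {LV, RV, VV, AB, AC, BB, BC, QE}" for j
      using build_ext_other[OF ext, of j] that by (auto simp: names_defs)
    have nb: "n \<le> s NX 0" "2 * (s NX 0 + 1) + 2 < N"
      using ext nx n(1,3) \<kappa>(4) by (auto simp: build_ext_def node_ext_def)
    have wr: "wrep s AB AC 0 (wleft b t u)" "wrep s BB BC 0 (wright b t u)"
      using w same by (simp_all add: wrep_def)
    have tabs: "tabrep s l tabl" "tabrep s r tabr" using tabrep_other[OF ext] lr t by auto
    show "wp (Sq (key_code \<kappa>) (add_code (op_target b \<kappa>))) (I (xs @ [\<kappa>])) s"
    proof (simp, rule wp_mono[OF wp_key_code[where v = v and tabl = tabl and tabr = tabr]])
      show "s NX 0 = s NX 0" "0 < s NX 0" "2 * s NX 0 + 2 < N" using n nb by auto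
      show "s LV 0 = l" "s RV 0 = r" using same l r by auto
    next
      fix s1 assume 1: "build_ext v s s1 \<and> s1 NX 0 \<le> s NX 0 + 1 \<and> curr s1 (key_ref b t u tabl tabr \<kappa>) \<and>
         same_tabs s s1"
      then have ne: "node_ext s s1" by (simp add: build_ext_def)
      have vv: "s1 VV 0 = v" using build_ext_other[of v s s1 VV] 1 same[of VV] v
        by (auto simp: names_defs)
      have tq: "op_target b \<kappa> \<le> Q" using \<kappa>(1) op_less by (fastforce simp: op_keys_def op_target_def intro: less_imp_le)
      have tab1: "tabrep s1 v tab" using tabrep_node_ext[OF ne _ tab(1)] 1 by blast
      have nx1: "s NX 0 \<le> s1 NX 0" using ne by (simp add: node_ext_def)
      show "wp (add_code (op_target b \<kappa>)) (I (xs @ [\<kappa>])) s1"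
      proof (rule wp_mono[OF wp_add_code[OF refl _ _ vv v(2) tq _ tab1]])
        show "0 < s1 NX 0" "2 * s1 NX 0 + 2 < N" using nx1 nb n 1 by auto
        show "curr s1 (key_ref b t u tabl tabr \<kappa>)" using 1 by blast
      next
        fix s2 assume 2: "build_ext v s1 s2 \<and> s2 NX 0 \<le> s1 NX 0 + 1 \<and>
          tabrep s2 v (tab(op_target b \<kappa> := add_ref (key_ref b t u tabl tabr \<kappa>) (tab (op_target b \<kappa>))))"
        have "good_table M (Op b t u) (op_part b t u) (op_target b) (insert \<kappa> (set xs))
           (tab(op_target b \<kappa> := add_ref (key_ref b t u tabl tabr \<kappa>) (tab (op_target b \<kappa>))))"
        proof (rule good_table_insert[OF tab(2) _ \<kappa>(2)])
          show "good M (Op b t u) (op_part b t u \<kappa>) (key_ref b t u tabl tabr \<kappa>)"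
            using good_key_ref[OF wf t(3,4)] \<kappa>(1) by (auto simp: op_keys_def)
          fix \<kappa>' x assume "\<kappa>' \<in> set xs" "validpos M (Op b t u) x"
          moreover then have "\<kappa> \<noteq> \<kappa>'" "\<kappa>' \<in> op_keys" using \<kappa> by auto
          moreover have "fst \<kappa>'' < 3" if "\<kappa>'' \<in> op_keys" for \<kappa>'' using that by (auto simp: op_keys_def)
          ultimately show "op_part b t u \<kappa> x \<inter> op_part b t u \<kappa>' x = {}"
            using op_part_disjoint[OF wf, of x \<kappa> \<kappa>'] \<kappa>(1) by simp
        qed
        moreover have "build_ext v s0 s2" using ext 1 2 build_ext_trans by blast
        ultimately show "I (xs @ [\<kappa>]) s2" using 1 2 nx by (auto simp: I_def)
      qed
    qed (use l r wr tabs q Q \<kappa> same in auto)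
  next
    fix s assume "I keys s"
    then show "build_ext v s0 s \<and> s NX 0 \<le> n + 6 * Q * Q \<and> (\<exists>tab. tabrep s v tab \<and> table_ok (Op b t u) tab)"
      using keys table_ok_Op by (auto simp: I_def)
  qed
qed

section \<open>Processing one vertex of the f-SLP\<close>

definition proc_names :: "nm set" where
  "proc_names = build_names \<union> {CTX, SZL, SZR, QE, AB, AC, BB, BC}"

definition proc_ext :: "nat \<Rightarrow> state \<Rightarrow> state \<Rightarrow> bool" where
  "proc_ext v s s' \<longleftrightarrow> node_ext s s' \<and> tab_ext v s s' \<and> (\<forall>j. j \<notin> proc_names \<longrightarrow> s' j = s j) \<and>
     (\<forall>j\<in>{CTX, SZL, SZR, QE}. \<forall>i. i \<noteq> v \<longrightarrow> s' j i = s j i)"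

lemma proc_ext_trans: "proc_ext v s s' \<Longrightarrow> proc_ext v s' s'' \<Longrightarrow> proc_ext v s s''"
  unfolding proc_ext_def tab_ext_def by (auto intro: node_ext_trans)

lemma build_proc_ext: "build_ext v s s' \<Longrightarrow> proc_ext v s s'"
  by (auto simp: build_ext_def proc_ext_def proc_names_def names_defs)

text \<open>All that the parents need to know about a processed vertex. Its expression, possibly of
  exponential size, is never stored.\<close>

definition vrep :: "state \<Rightarrow> nat \<Rightarrow> 'a ex \<Rightarrow> bool" where
  "vrep s i t \<longleftrightarrow> s CTX i = (if isctx t then 1 else 0) \<and> s SZL i = lsz t \<and> s SZR i = rsz t \<and> s QE i = qe t \<and>
     (\<exists>tab. tabrep s i tab \<and> table_ok t tab)"

lemma tabrep_ext:
  assumes n: "node_ext s s'" and t: "tab_ext v s s'" and "v' \<noteq> v" "tabrep s v' tab" shows "tabrep s' v' tab"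
proof -
  have "wrep s' (TB q) (TC q) v' x = wrep s (TB q) (TC q) v' x" "s' (TN q) v' = s (TN q) v'" for q x
    using t assms(3) by (simp_all add: tab_ext_def wrep_def)
  then show ?thesis using assms(4) nrep_ext[OF n]
    by (auto simp: tabrep_def rrep_def split: option.splits)
qed

lemma vrep_ext: "proc_ext v s s' \<Longrightarrow> i \<noteq> v \<Longrightarrow> vrep s i t \<Longrightarrow> vrep s' i t"
  unfolding vrep_def using tabrep_ext[of s s' v i] by (auto simp: proc_ext_def)

lemma tabrep_upd:
  assumes "i \<notin> build_names" "tabrep s v tab" shows "tabrep (upd i x y s) v tab"
proof (rule tabrep_node_ext[OF _ _ assms(2)])
  have same: "upd i x y s j = s j" if "j \<in> build_names" for j using that assms(1) by (metis upd_simps(2))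
  show "node_ext s (upd i x y s)"
    using same by (simp add: node_ext_def build_names_def)
  show "upd i x y s (TN q) = s (TN q) \<and> upd i x y s (TB q) = s (TB q) \<and> upd i x y s (TC q) = s (TC q)" for q
    using same by (simp add: build_names_def)
qed

definition item_codes :: "nat set list \<Rightarrow> bool \<Rightarrow> 'a \<Rightarrow> nm rcom" where
  "item_codes As c a = seqs (map (\<lambda>A. Sq (new_item k A) (add_code (la c a A))) As)"

lemma wp_item_codes:
  assumes n: "s0 NX 0 = n" "0 < n" "2 * (n + 2 * length As) + 2 < N" and v: "s0 VV 0 = v" "2 * v + 2 < N"
    and t: "tabrep s0 v (\<lambda>_. None)" and As: "distinct As" "set As = {A. A \<subseteq> {..<k} \<and> A \<noteq> {}}"
  shows "wp (item_codes As c a) (\<lambda>s'. build_ext v s0 s' \<and> s' NX 0 \<le> n + 2 * length As \<and>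
     (\<exists>tab. tabrep s' v tab \<and> table_ok (Lf c a) tab)) s0"
proof -
  define I where "I = (\<lambda>ks s. build_ext v s0 s \<and> s NX 0 \<le> n + 2 * length ks \<and>
     (\<exists>tab. tabrep s v tab \<and> good_table M (Lf c a) leaf_part (la c a) (set ks) tab))"
  show ?thesis unfolding item_codes_def
  proof (rule wp_seqs[of I])
    show "I [] s0" using n t by (auto simp: I_def build_ext_refl intro!: exI[of _ "\<lambda>_. None"] good_table_empty)
  next
    fix xs A ys s assume xs: "As = xs @ A # ys" and I: "I xs s"
    have A: "A \<notin> set xs" "length xs < length As" using As(1) xs by auto
    obtain tab where ext: "build_ext v s0 s" and nx: "s NX 0 \<le> n + 2 * length xs" and tab: "tabrep s v tab"
      "good_table M (Lf c a) leaf_part (la c a) (set xs) tab" using I by (auto simp: I_def)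
    have nb: "n \<le> s NX 0" "2 * (s NX 0 + 1) + 2 < N"
      using ext nx n(1,3) A(2) by (auto simp: build_ext_def node_ext_def)
    show "wp (Sq (new_item k A) (add_code (la c a A))) (I (xs @ [A])) s"
    proof (simp only: wp_fun, rule wp_mono[OF wp_new_item[where v = v]])
      show "s NX 0 = s NX 0" "0 < s NX 0" "2 * s NX 0 + 2 < N" using n nb by auto
    next
      fix s1 assume 1: "build_ext v s s1 \<and> s1 NX 0 = s NX 0 + 1 \<and> curr s1 (Some (Item A, idw)) \<and>
         same_tabs s s1"
      then have ne: "node_ext s s1" by (simp add: build_ext_def)
      have vv: "s1 VV 0 = v" using build_ext_other[of v s s1 VV] build_ext_other[OF ext, of VV] 1 v
        by (auto simp: names_defs)
      have tab1: "tabrep s1 v tab" using tabrep_node_ext[OF ne _ tab(1)] 1 by blast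
      show "wp (add_code (la c a A)) (I (xs @ [A])) s1"
      proof (rule wp_mono[OF wp_add_code[OF refl _ _ vv v(2) less_imp_le[OF la_less] _ tab1]])
        show "0 < s1 NX 0" "2 * s1 NX 0 + 2 < N" using nb n 1 by auto
        show "curr s1 (Some (Item A, idw))" using 1 by blast
      next
        fix s2 assume 2: "build_ext v s1 s2 \<and> s2 NX 0 \<le> s1 NX 0 + 1 \<and>
          tabrep s2 v (tab(la c a A := add_ref (Some (Item A, idw)) (tab (la c a A))))"
        have "good_table M (Lf c a) leaf_part (la c a) (insert A (set xs))
           (tab(la c a A := add_ref (Some (Item A, idw)) (tab (la c a A))))"
          by (rule good_table_insert[OF tab(2) good_item A(1)]) (use A(1) in \<open>auto simp: leaf_part_def\<close>)
        moreover have "build_ext v s0 s2" using ext 1 2 build_ext_trans by blast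
        ultimately show "I (xs @ [A]) s2" using 1 2 nx by (auto simp: I_def)
      qed
    qed
  next
    fix s assume "I As s"
    then show "build_ext v s0 s \<and> s NX 0 \<le> n + 2 * length As \<and> (\<exists>tab. tabrep s v tab \<and> table_ok (Lf c a) tab)"
      using As table_ok_Lf[of c a] by (auto simp: I_def)
  qed
qed

definition leaf_code :: "nat set list \<Rightarrow> bool \<Rightarrow> 'a \<Rightarrow> nm rcom" where
  "leaf_code As c a = seqs [Set CTX (Vr VV) (Cn (if c then 1 else 0)), Set SZL (Vr VV) (Cn 1), Set SZR (Vr VV) (Cn 0),
     Set QE (Vr VV) (Cn (la c a {})), item_codes As c a]"

lemma wp_leaf_code:
  assumes n: "s0 NX 0 = n" "0 < n" "2 * (n + 2 * length As) + 2 < N" and v: "s0 VV 0 = v" "2 * v + 2 < N"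
    and t: "tabrep s0 v (\<lambda>_. None)" and As: "distinct As" "set As = {A. A \<subseteq> {..<k} \<and> A \<noteq> {}}"
  shows "wp (leaf_code As c a) (\<lambda>s'. proc_ext v s0 s' \<and> s' NX 0 \<le> n + 2 * length As \<and> vrep s' v (Lf c a)) s0"
proof -
  define s1 where "s1 = upd QE v (la c a {}) (upd SZR v 0 (upd SZL v 1 (upd CTX v (if c then 1 else 0) s0)))"
  have p1: "proc_ext v s0 s1"
    by (auto simp: s1_def proc_ext_def node_ext_def tab_ext_def proc_names_def node_arrays_def weight_arrays_def)
  have "tabrep s1 v (\<lambda>_. None)" unfolding s1_def
    by (intro tabrep_upd t) (auto simp: names_defs)
  then have "wp (item_codes As c a) (\<lambda>s'. build_ext v s1 s' \<and> s' NX 0 \<le> n + 2 * length As \<and>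
     (\<exists>tab. tabrep s' v tab \<and> table_ok (Lf c a) tab)) s1"
    using n v As by (intro wp_item_codes) (auto simp: s1_def)
  then have "wp (item_codes As c a) (\<lambda>s'. proc_ext v s0 s' \<and> s' NX 0 \<le> n + 2 * length As \<and> vrep s' v (Lf c a)) s1"
  proof (rule wp_mono)
    fix s' assume *: "build_ext v s1 s' \<and> s' NX 0 \<le> n + 2 * length As \<and> (\<exists>tab. tabrep s' v tab \<and> table_ok (Lf c a) tab)"
    then have "s' j = s1 j" if "j \<in> {CTX, SZL, SZR, QE}" for j
      using build_ext_other[of v s1 s' j] that by (auto simp: names_defs)
    then have "vrep s' v (Lf c a)" using * by (auto simp: vrep_def s1_def)
    then show "proc_ext v s0 s' \<and> s' NX 0 \<le> n + 2 * length As \<and> vrep s' v (Lf c a)"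
      using * proc_ext_trans[OF p1 build_proc_ext] by blast
  qed
  then show ?thesis using v by (simp add: leaf_code_def s1_def)
qed

text \<open>The algebra does not exist at run time. Its operation is tabulated in the program text,
  with one test for each pair of states.\<close>

definition qe_code :: "bool \<Rightarrow> nm rcom" where
  "qe_code b = seqs (map (\<lambda>(p, p'). Cond (neq (Ar QE (Vr LV)) p) Skip (Cond (neq (Ar QE (Vr RV)) p') Skip
     (Set QE (Vr VV) (Cn (op b p p'))))) (List.product [0..<Q] [0..<Q]))"

lemma wp_qe_code:
  assumes "s0 LV 0 = l" "l < N" "s0 RV 0 = r" "r < N" "s0 VV 0 = v" "v < N" "l \<noteq> v" "r \<noteq> v"
    "s0 QE l < Q" "s0 QE r < Q" "Q < M"
    "R (upd QE v (op b (s0 QE l) (s0 QE r)) s0)"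
  shows "wp (qe_code b) R s0"
proof -
  define s1 where "s1 = upd QE v (op b (s0 QE l) (s0 QE r)) s0"
  define I where "I = (\<lambda>xs s. s = (if (s0 QE l, s0 QE r) \<in> set xs then s1 else s0))"
  show ?thesis unfolding qe_code_def
  proof (rule wp_seqs[of I])
    fix xs x ys s assume xs: "List.product [0..<Q] [0..<Q] = xs @ x # ys" and I: "I xs s"
    obtain p p' where x: "x = (p, p')" by fastforce
    have "x \<in> set (List.product [0..<Q] [0..<Q])" unfolding xs by simp
    then have pq: "p < Q" "p' < Q" by (auto simp: x)
    have s: "s LV 0 = l" "s RV 0 = r" "s VV 0 = v" "s QE l = s0 QE l" "s QE r = s0 QE r"
      using I assms by (auto simp: I_def s1_def)
    have nq: "aval (neq (Ar QE (Vr LV)) p) s = 0 \<longleftrightarrow> s0 QE l = p" "aval (neq (Ar QE (Vr RV)) p') s = 0 \<longleftrightarrow> s0 QE r = p'"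
      using aval_neq[of "Ar QE (Vr LV)" s p] aval_neq[of "Ar QE (Vr RV)" s p'] s assms pq by auto
    show "wp (case x of (p, p') \<Rightarrow> Cond (neq (Ar QE (Vr LV)) p) Skip (Cond (neq (Ar QE (Vr RV)) p') Skip
     (Set QE (Vr VV) (Cn (op b p p'))))) (I (xs @ [x])) s"
      using I nq s assms by (auto simp: x I_def s1_def upd_def fun_eq_iff)
  next
    fix s assume "I (List.product [0..<Q] [0..<Q]) s"
    then show "R s" using assms by (simp add: I_def s1_def)
  qed (simp add: I_def)
qed

text \<open>The four branches are the cases in the definitions of \<open>lsz\<close>,
  \<open>rsz\<close>, \<open>wleft\<close> and \<open>wright\<close>. The sizes stored for the
  children suffice to compute the weights of both edges.\<close>

definition inner_code :: "bool \<Rightarrow> nm rcom" where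
  "inner_code b = (let l = (\<lambda>j. Ar j (Vr LV)); r = (\<lambda>j. Ar j (Vr RV)) in seqs
     [if b then Cond (r CTX)
         (seqs [Set CTX (Vr VV) (Cn 1), Set SZL (Vr VV) (Pl (l SZL) (r SZL)), Set SZR (Vr VV) (Pl (r SZR) (l SZR)),
            wset AB AC (Cn 0) False (Cn 0) True (r SZR), wset BB BC (Cn 0) False (l SZL) True (Cn 0)])
         (seqs [Set CTX (Vr VV) (Cn 0), Set SZL (Vr VV) (Pl (Pl (l SZL) (l SZR)) (r SZL)), Set SZR (Vr VV) (Cn 0),
            wset AB AC (Cn 0) False (Cn 0) False (Pl (l SZL) (r SZL)), wset BB BC (Cn 0) False (l SZL) True (Cn 0)])
      else Cond (l CTX)
         (seqs [Set CTX (Vr VV) (Cn 1), Set SZL (Vr VV) (l SZL), Set SZR (Vr VV) (Pl (l SZR) (r SZL)),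
            wset AB AC (Cn 0) False (Cn 0) True (Cn 0), wset BB BC (Cn 0) True (l SZR) True (Cn 0)])
         (seqs [Set CTX (Vr VV) (r CTX), Set SZL (Vr VV) (Pl (l SZL) (r SZL)), Set SZR (Vr VV) (r SZR),
            wset AB AC (Cn 0) False (Cn 0) True (Cn 0), wset BB BC (Cn 0) False (l SZL) True (Cn 0)]),
      qe_code b, op_code b])"

lemma wp_inner_code:
  assumes n: "s0 NX 0 = n" "0 < n" "2 * (n + 6 * Q * Q) + 2 < N"
    and l: "s0 LV 0 = l" "2 * l + 2 < N" and r: "s0 RV 0 = r" "2 * r + 2 < N" and v: "s0 VV 0 = v" "2 * v + 2 < N"
    and t: "vrep s0 l t" "vrep s0 r u" "tabrep s0 v (\<lambda>_. None)"
    and Q: "Q < M" and lr: "l \<noteq> v" "r \<noteq> v" and wf: "wfx (Op b t u)" and size: "length (leaves (Op b t u)) < M"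
  shows "wp (inner_code b) (\<lambda>s'. proc_ext v s0 s' \<and> s' NX 0 \<le> n + 6 * Q * Q \<and> vrep s' v (Op b t u)) s0"
proof -
  define sa where "sa = upd SZR v (rsz (Op b t u)) (upd SZL v (lsz (Op b t u)) (upd CTX v (if isctx (Op b t u) then 1 else 0) s0))"
  define s1 where "s1 = wupd BB BC 0 (wright b t u) (wupd AB AC 0 (wleft b t u) sa)"
  define s2 where "s2 = upd QE v (op b (qe t) (qe u)) s1"
  have p2: "proc_ext v s0 s2"
    by (auto simp: s2_def s1_def sa_def proc_ext_def node_ext_def tab_ext_def proc_names_def node_arrays_def weight_arrays_def)
  have v2: "vrep s2 l t" "vrep s2 r u" using vrep_ext[OF p2] lr t by auto
  then obtain tabl tabr where tabs: "tabrep s2 l tabl" "table_ok t tabl" "tabrep s2 r tabr" "table_ok u tabr"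
    by (auto simp: vrep_def)
  have nt: "s2 (TN q) = s0 (TN q)" for q by (simp add: s2_def s1_def sa_def)
  have "tabrep s2 v (\<lambda>_. None)" using t(3) nt by (simp add: tabrep_def rrep_def)
  then have "wp (op_code b) (\<lambda>s'. build_ext v s2 s' \<and> s' NX 0 \<le> n + 6 * Q * Q \<and>
     (\<exists>tab. tabrep s' v tab \<and> table_ok (Op b t u) tab)) s2"
    using v2 by (intro wp_op_code[OF _ n(2,3) _ l(2) _ r(2) _ v(2) _ _ tabs(1,3,2,4) _ _ _ Q lr wf])
      (use n l r v in \<open>auto simp: s2_def s1_def sa_def vrep_def\<close>)
  then have 3: "wp (op_code b) (\<lambda>s'. proc_ext v s0 s' \<and> s' NX 0 \<le> n + 6 * Q * Q \<and> vrep s' v (Op b t u)) s2"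
  proof (rule wp_mono)
    fix s' assume *: "build_ext v s2 s' \<and> s' NX 0 \<le> n + 6 * Q * Q \<and> (\<exists>tab. tabrep s' v tab \<and> table_ok (Op b t u) tab)"
    then have "s' j = s2 j" if "j \<in> {CTX, SZL, SZR, QE}" for j
      using build_ext_other[of v s2 s' j] that by (auto simp: names_defs)
    moreover have "s2 CTX v = (if isctx (Op b t u) then 1 else 0)" "s2 SZL v = lsz (Op b t u)"
      "s2 SZR v = rsz (Op b t u)" "s2 QE v = qe (Op b t u)" by (simp_all add: s2_def s1_def sa_def)
    ultimately have "vrep s' v (Op b t u)" using * unfolding vrep_def by (simp del: isctx.simps lsz.simps rsz.simps qe.simps)
    then show "proc_ext v s0 s' \<and> s' NX 0 \<le> n + 6 * Q * Q \<and> vrep s' v (Op b t u)"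
      using * proc_ext_trans[OF p2 build_proc_ext] by blast
  qed
  have 2: "wp (qe_code b) (wp (op_code b) (\<lambda>s'. proc_ext v s0 s' \<and> s' NX 0 \<le> n + 6 * Q * Q \<and> vrep s' v (Op b t u))) s1"
  proof -
    have q: "s1 QE l = qe t" "s1 QE r = qe u" using t by (auto simp: s1_def sa_def vrep_def)
    show ?thesis
      by (rule wp_qe_code[where l = l and r = r and v = v])
        (use q l r v lr Q qe_less 3 in \<open>auto simp: s1_def sa_def s2_def\<close>)
  qed
  have w: "wfx t" "wfx u" using wf by auto
  have sz: "lsz t + rsz t + lsz u + rsz u < M" "lsz t + rsz t = length (leaves t)" "lsz u + rsz u = length (leaves u)"
    using size lsz_rsz[OF w(1)] lsz_rsz[OF w(2)] by auto
  have vl: "s0 CTX l = (if isctx t then 1 else 0)" "s0 SZL l = lsz t" "s0 SZR l = rsz t"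
    and vr: "s0 CTX r = (if isctx u then 1 else 0)" "s0 SZL r = lsz u" "s0 SZR r = rsz u" using t by (auto simp: vrep_def)
  have ok: "0 < N" "2 < N" "l < N" "r < N" "v < N" using l r v by auto
  show ?thesis
  proof (cases b)
    case True
    then have ct: "isctx t" using wf by simp
    show ?thesis
    proof (cases "isctx u")
      case cu: True
      have s1: "s1 = wupd BB BC 0 ((False, lsz t), (True, 0)) (wupd AB AC 0 ((False, 0), (True, rsz u))
          (upd SZR v (rsz u + rsz t) (upd SZL v (lsz t + lsz u) (upd CTX v 1 s0))))"
        using True cu ct by (simp add: s1_def sa_def wleft_def wright_def)
      show ?thesis using 2 True cu ok vl vr l r v lr sz unfolding s1
        by (auto simp: inner_code_def Let_def intro!: wp_wset)
    next
      case cu: False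
      have s1: "s1 = wupd BB BC 0 ((False, lsz t), (True, 0)) (wupd AB AC 0 ((False, 0), (False, lsz t + lsz u))
          (upd SZR v 0 (upd SZL v (lsz t + rsz t + lsz u) (upd CTX v 0 s0))))"
        using True cu ct sz rsz_forest[OF cu] by (simp add: s1_def sa_def wleft_def wright_def)
      show ?thesis using 2 True cu ok vl vr l r v lr sz unfolding s1
        by (auto simp: inner_code_def Let_def intro!: wp_wset)
    qed
  next
    case False
    show ?thesis
    proof (cases "isctx t")
      case ct: True
      have s1: "s1 = wupd BB BC 0 ((True, rsz t), (True, 0)) (wupd AB AC 0 ((False, 0), (True, 0))
          (upd SZR v (rsz t + lsz u) (upd SZL v (lsz t) (upd CTX v 1 s0))))"
        using False ct by (simp add: s1_def sa_def wleft_def wright_def)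
      show ?thesis using 2 False ct ok vl vr l r v lr sz unfolding s1
        by (auto simp: inner_code_def Let_def intro!: wp_wset)
    next
      case ct: False
      have s1: "s1 = wupd BB BC 0 ((False, lsz t), (True, 0)) (wupd AB AC 0 ((False, 0), (True, 0))
          (upd SZR v (rsz u) (upd SZL v (lsz t + lsz u) (upd CTX v (if isctx u then 1 else 0) s0))))"
        using False ct by (simp add: s1_def sa_def wleft_def wright_def)
      show ?thesis using 2 False ct ok vl vr l r v lr sz unfolding s1
        by (auto simp: inner_code_def Let_def intro!: wp_wset)
    qed
  qed
qed

end

section \<open>The traversal of the f-SLP\<close>

abbreviation "LAB \<equiv> Nm 62 0"

context ram_env
begin

text \<open>The variant \<open>m\<close> bounds the number of iterations; each one pays two extra
  steps, for the test and the jump back.\<close>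

lemma runs_Loop:
  assumes "\<And>m s. I m s \<Longrightarrow> ok e s" "\<And>m s. I m s \<Longrightarrow> aval e s \<noteq> 0 \<Longrightarrow> wp c (\<lambda>s'. \<exists>m'<m. I m' s') s"
  shows "I m s \<Longrightarrow> runs (Loop e c) s ((cost c + 2) * m + 1) [] (\<lambda>s'. \<exists>m'. I m' s' \<and> aval e s' = 0)"
proof (induction m arbitrary: s rule: less_induct)
  case (less m)
  let ?R = "\<lambda>s'. \<exists>m'. I m' s' \<and> aval e s' = 0"
  show ?case
  proof (cases "aval e s = 0")
    case True
    have "runs (Loop e c) s 1 [] ?R"
      by (rule runs_LoopF[OF assms(1)[OF less.prems] True]) (use less.prems True in blast)
    then show ?thesis by (rule runs_weaken) auto
  next
    case False
    have w: "wp c (\<lambda>s'. \<exists>m'<m. I m' s') s" by (rule assms(2)[OF less.prems False])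
    \<comment> \<open>The postcondition provides some \<open>m' < m\<close>. Since the code reaches
      a final state, positivity of \<open>m\<close> can be read off there, although it does not
      speak of the state.\<close>
    then have m: "0 < m" using wp_mono[OF w, of "\<lambda>_. 0 < m"]
      by (cases m) (auto dest: wp_runs simp: runs_def)
    have "runs c s (cost c) [] (\<lambda>s'. runs (Loop e c) s' ((cost c + 2) * (m - 1) + 1) [] ?R)"
    proof (rule runs_weaken[OF wp_runs[OF w]])
      fix s' assume "\<exists>m'<m. I m' s'"
      then obtain m' where m': "m' < m" "I m' s'" by blast
      have "(cost c + 2) * m' \<le> (cost c + 2) * (m - 1)" using m' by (intro mult_le_mono2) simp
      then show "runs (Loop e c) s' ((cost c + 2) * (m - 1) + 1) [] ?R"
        by (intro runs_weaken[OF less.IH[OF m']]) auto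
    qed simp
    then have "runs (Loop e c) s (cost c + ((cost c + 2) * (m - 1) + 1) + 2) ([] @ []) ?R"
      by (rule runs_LoopT[OF assms(1)[OF less.prems] False])
    moreover have "cost c + ((cost c + 2) * (m - 1) + 1) + 2 = (cost c + 2) * m + 1"
      using m by (cases m) simp_all
    ultimately show ?thesis by simp
  qed
qed

end

definition pop_done :: "nm rcom" where
  "pop_done = seqs [Set DONE (Vr VV) (Cn 1), SP0 ::= Mi (Vr SP0) (Cn 1)]"

definition push_vertex :: "nm \<Rightarrow> nm rcom" where
  "push_vertex x = seqs [Set STK (Vr SP0) (Vr x), SP0 ::= Pl (Vr SP0) (Cn 1)]"

text \<open>The records of the vertices have three cells each and start at cell 2; tripling is done
  by addition.\<close>

definition vertex_input :: "nat \<Rightarrow> nm rexp" where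
  "vertex_input j = In (Pl (Cn (j + 2)) (Pl (Vr VV) (Pl (Vr VV) (Vr VV))))"

definition leaf_label :: "('a \<Rightarrow> nat) \<Rightarrow> bool \<times> 'a \<Rightarrow> nat" where
  "leaf_label code = (\<lambda>(c, a). 2 + 2 * code a + (if c then 1 else 0))"

text \<open>Vertices are numbered by their positions in the input, and \<open>t i\<close> is the
  expression of vertex \<open>i\<close>. \<open>C\<close> bounds the nodes created per vertex.
  \<open>N_ge\<close> gives room for their weights and, with \<open>N \<le> 2 ^ w\<close>, lets
  input addresses be formed without wrap-around.\<close>

locale slp = mach w N inp k la op Q
  for w N inp k and la :: "bool \<Rightarrow> 'a \<Rightarrow> nat set \<Rightarrow> nat" and op Q +
  fixes n S :: nat and cl cr lab :: "nat \<Rightarrow> nat" and t :: "nat \<Rightarrow> 'a ex" and code :: "'a \<Rightarrow> nat"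
    and As :: "nat set list" and letters :: "'a list" and C :: nat
  assumes leaf_or_inner: "\<And>i. i < n \<Longrightarrow> (\<exists>c a. t i = Lf c a \<and> lab i = leaf_label code (c, a)) \<or>
      (\<exists>b. t i = Op b (t (cl i)) (t (cr i)) \<and> cl i < n \<and> cr i < n \<and> lab i = (if b then 1 else 0))"
    and wf: "\<And>i. i < n \<Longrightarrow> wfx (t i)"
    and leaves: "\<And>i. i < n \<Longrightarrow> length (leaves (t i)) < 2 ^ w"
    and input: "length inp = 2 + 3 * n" "inp ! 0 = n" "inp ! 1 = S" "\<And>i. i < n \<Longrightarrow> inp ! (2 + 3 * i) = lab i \<and>
      inp ! (3 + 3 * i) = cl i \<and> inp ! (4 + 3 * i) = cr i"
    and S: "S < n" and words: "\<And>x. x \<in> set inp \<Longrightarrow> x < 2 ^ w" "\<And>c a. leaf_label code (c, a) < 2 ^ w"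
    and code: "inj code" and As: "distinct As" "set As = {A. A \<subseteq> {..<k} \<and> A \<noteq> {}}"
    and letters: "distinct letters" "set letters = UNIV"
    and C: "6 * Q * Q \<le> C" "2 * length As \<le> C" and QM: "Q < 2 ^ w"
    and N_ge: "2 * (1 + C * n) + 2 < N" "3 * n + 4 < N"
begin

definition leaf_codes :: "nm rcom" where
  "leaf_codes = seqs (map (\<lambda>ca. Cond (neq (Vr LAB) (leaf_label code ca)) Skip (leaf_code As (fst ca) (snd ca)))
     (List.product [False, True] letters))"

lemma leaf_label_inj: "leaf_label code x = leaf_label code y \<longleftrightarrow> x = y"
proof -
  obtain b a b' a' where xy: "x = (b, a)" "y = (b', a')" by fastforce
  have "2 * m + (1 :: nat) \<noteq> 2 * m'" for m m' by presburger
  then show ?thesis using code unfolding xy leaf_label_def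
    by (cases b; cases b') (auto dest: injD, presburger+)
qed

text \<open>The labels are tried one after the other. As processing a leaf does not change
  \<open>LAB\<close>, all tests after the successful one fail.\<close>

lemma wp_leaf_codes:
  assumes lab: "s0 LAB 0 = leaf_label code (c, a)"
    and n: "s0 NX 0 = m" "0 < m" "2 * (m + 2 * length As) + 2 < N" and v: "s0 VV 0 = v" "2 * v + 2 < N"
    and t: "tabrep s0 v (\<lambda>_. None)"
  shows "wp leaf_codes (\<lambda>s'. proc_ext v s0 s' \<and> s' NX 0 \<le> m + 2 * length As \<and> vrep s' v (Lf c a)) s0"
    (is "wp _ ?post _")
proof -
  let ?zs = "List.product [False, True] letters"
  define I where "I = (\<lambda>xs s. if (c, a) \<in> set xs then ?post s else s = s0)"
  have zs: "distinct ?zs" "(c, a) \<in> set ?zs" using letters by (auto simp: distinct_map inj_on_def)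
  show ?thesis unfolding leaf_codes_def
  proof (rule wp_seqs[of I])
    fix xs x ys s assume xs: "?zs = xs @ x # ys" and I: "I xs s"
    have "s LAB = s0 LAB"
      using I by (auto simp: I_def proc_ext_def proc_names_def names_defs split: if_splits)
    then have l: "s LAB 0 = leaf_label code (c, a)" using lab by simp
    have "leaf_label code x < 2 ^ w" using words(2) by (cases x) auto
    then have nq: "aval (neq (Vr LAB) (leaf_label code x)) s = 0 \<longleftrightarrow> (c, a) = x"
      using aval_neq[of "Vr LAB" s "leaf_label code x"] l words(2) leaf_label_inj by simp
    have N: "0 < N" using n by simp
    show "wp (Cond (neq (Vr LAB) (leaf_label code x)) Skip (leaf_code As (fst x) (snd x))) (I (xs @ [x])) s"
    proof (cases "x = (c, a)")
      case True
      then have "(c, a) \<notin> set xs" using zs(1) unfolding xs by simp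
      then have s: "s = s0" using I by (simp add: I_def)
      have "wp (leaf_code As c a) ?post s0" by (rule wp_leaf_code[OF n v t As])
      then have "wp (leaf_code As c a) (I (xs @ [x])) s0" by (rule wp_mono) (simp add: I_def True)
      then show ?thesis using nq True N s by simp
    next
      case False
      then have "I (xs @ [x]) s" using I by (auto simp: I_def split: if_splits)
      then show ?thesis using nq False N by (auto simp: eq_commute[of x])
    qed
  next
    fix s assume "I ?zs s"
    then show "?post s" using zs by (simp add: I_def)
  qed (simp add: I_def)
qed

text \<open>The codes 0 and 1 are the two concatenations, so \<open>LAB - 1\<close> is nonzero
  exactly at leaves. A vertex stays on the stack until it is processed and is looked at again
  whenever a child on top of it is done.\<close>

definition dfs_body :: "nm rcom" where
  "dfs_body = seqs [VV ::= Ar STK (Mi (Vr SP0) (Cn 1)), LAB ::= vertex_input 0, LV ::= vertex_input 1, RV ::= vertex_input 2,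
     Cond (Mi (Vr LAB) (Cn 1)) (Sq leaf_codes pop_done)
       (Cond (Ar DONE (Vr LV)) (Cond (Ar DONE (Vr RV)) (Sq (Cond (Vr LAB) (inner_code True) (inner_code False)) pop_done)
          (push_vertex RV)) (push_vertex LV))]"

definition dfs :: "nm rcom" where
  "dfs = Sq (seqs [NX ::= Cn 1, Set STK (Cn 0) (In (Cn 1)), SP0 ::= Cn 1]) (Loop (Vr SP0) dfs_body)"

text \<open>Only vertices that are not yet processed are on the stack, and their expressions get smaller towards
  its top.  Hence the stack is bounded by the number of these vertices.\<close>

definition stacked :: "state \<Rightarrow> nat list \<Rightarrow> bool" where
  "stacked s st \<longleftrightarrow> s SP0 0 = length st \<and> (\<forall>p<length st. s STK p = rev st ! p)"

text \<open>The clause on \<open>S\<close> yields, once the stack is empty, that the start vertex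
  has been processed.\<close>

definition inv :: "state \<Rightarrow> nat set \<Rightarrow> nat list \<Rightarrow> bool" where
  "inv s D st \<longleftrightarrow> D \<subseteq> {..<n} \<and> set st \<subseteq> {..<n} - D \<and> sorted_wrt (\<lambda>i j. size (t i) < size (t j)) st \<and>
     S \<in> D \<union> set st \<and> stacked s st \<and> (\<forall>i<n. s DONE i = (if i \<in> D then 1 else 0)) \<and>
     (\<forall>i\<in>D. vrep s i (t i)) \<and> (\<forall>i<n. i \<notin> D \<longrightarrow> tabrep s i (\<lambda>_. None)) \<and> 0 < s NX 0 \<and> s NX 0 \<le> 1 + C * card D"

definition idle :: "nm set" where "idle = {VV, LAB, LV, RV, SP0, STK, DONE}"

lemma tabrep_idle:
  assumes "\<And>j. j \<notin> idle \<Longrightarrow> s' j = s j" shows "tabrep s' i tab \<longleftrightarrow> tabrep s i tab"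
proof -
  have "node_ext s s'" "node_ext s' s"
    using assms by (auto simp: node_ext_def idle_def node_arrays_def weight_arrays_def)
  moreover have "s' (TN q) = s (TN q) \<and> s' (TB q) = s (TB q) \<and> s' (TC q) = s (TC q)" for q
    using assms by (simp add: idle_def)
  ultimately show ?thesis using tabrep_node_ext[of s s' i tab] tabrep_node_ext[of s' s i tab] by metis
qed

lemma vrep_idle:
  assumes "\<And>j. j \<notin> idle \<Longrightarrow> s' j = s j" shows "vrep s' i u \<longleftrightarrow> vrep s i u"
  using assms[of CTX] assms[of SZL] assms[of SZR] assms[of QE] tabrep_idle[of s' s i, OF assms]
  by (simp add: vrep_def idle_def)

lemma inv_idle:
  assumes "inv s D st" "\<And>j. j \<notin> {VV, LAB, LV, RV} \<Longrightarrow> s' j = s j" shows "inv s' D st"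
proof -
  have "\<And>j. j \<notin> idle \<Longrightarrow> s' j = s j" using assms(2) by (simp add: idle_def)
  from vrep_idle[of s' s, OF this] tabrep_idle[of s' s, OF this] show ?thesis
    using assms(1) assms(2)[of SP0] assms(2)[of STK] assms(2)[of DONE] assms(2)[of NX]
    by (simp add: inv_def stacked_def)
qed

lemma inv_push:
  assumes inv: "inv s D st" and i: "i < n" "i \<notin> D" and st: "st = v # st'" "size (t i) < size (t v)"
    and s': "s' = upd SP0 0 (length st + 1) (upd STK (length st) i s)"
  shows "inv s' D (i # st)"
proof -
  have "\<And>j. j \<notin> idle \<Longrightarrow> s' j = s j" using s' by (simp add: idle_def)
  note vt = vrep_idle[of s' s, OF this] tabrep_idle[of s' s, OF this]
  have sorted: "sorted_wrt (\<lambda>i j. size (t i) < size (t j)) st" using inv by (simp add: inv_def)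
  have "stacked s' (i # st)"
  proof -
    have "s' STK p = rev (i # st) ! p" if "p < length (i # st)" for p
      using that inv by (cases "p = length st") (auto simp: s' inv_def stacked_def nth_append)
    then show ?thesis by (simp add: stacked_def s')
  qed
  moreover have "sorted_wrt (\<lambda>i j. size (t i) < size (t j)) (i # st)"
    using sorted st by auto
  ultimately show ?thesis using inv vt i unfolding inv_def by (simp add: s')
qed

lemma inv_done:
  assumes inv: "inv s D (v # st)" and ext: "proc_ext v s s1" and nx: "s1 NX 0 \<le> s NX 0 + C" and v: "vrep s1 v (t v)"
    and s': "s' = upd SP0 0 (length st) (upd DONE v 1 s1)"
  shows "inv s' (insert v D) st"
proof -
  have "\<And>j. j \<notin> idle \<Longrightarrow> s' j = s1 j" using s' by (simp add: idle_def)
  note vt = vrep_idle[of s' s1, OF this] tabrep_idle[of s' s1, OF this]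
  have vD: "v \<notin> D" "v < n" "finite D" using inv finite_subset[of D "{..<n}"] by (auto simp: inv_def)
  have e: "s1 STK = s STK" "s1 DONE = s DONE" "s NX 0 \<le> s1 NX 0"
    using ext by (auto simp: proc_ext_def proc_names_def names_defs node_ext_def)
  have "v \<notin> set st" using inv by (auto simp: inv_def)
  then have a: "set st \<subseteq> {..<n} - insert v D" "sorted_wrt (\<lambda>i j. size (t i) < size (t j)) st" "S \<in> insert v D \<union> set st"
    using inv by (auto simp: inv_def)
  have b: "stacked s' st" using inv e by (auto simp: inv_def stacked_def s' nth_append)
  have c: "\<forall>i<n. s' DONE i = (if i \<in> insert v D then 1 else 0)"
    using inv e by (auto simp: inv_def s' upd_def)
  have d: "vrep s' i (t i)" if "i \<in> insert v D" for i
    using that v vrep_ext[OF ext, of i "t i"] inv vD by (cases "i = v") (auto simp: vt inv_def)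
  have f: "tabrep s' i (\<lambda>_. None)" if "i < n" "i \<notin> insert v D" for i
    using that tabrep_ext[of s s1 v i "\<lambda>_. None"] ext inv by (auto simp: vt inv_def proc_ext_def)
  have "s' NX 0 \<le> 1 + C * card (insert v D)" using inv nx vD by (simp add: s' inv_def)
  moreover have "0 < s' NX 0" using inv e by (simp add: s' inv_def)
  ultimately show ?thesis using a b c d f vD inv unfolding inv_def by blast
qed

lemma aval_vertex_input:
  assumes "s VV 0 = v" "v < n"
  shows "aval (vertex_input 0) s = lab v" "aval (vertex_input 1) s = cl v" "aval (vertex_input 2) s = cr v"
proof -
  have M: "3 * n + 4 < 2 ^ w" using N_ge(2) N_le by simp
  have i: "inp ! (2 + 3 * v) \<in> set inp" "inp ! (3 + 3 * v) \<in> set inp" "inp ! (4 + 3 * v) \<in> set inp"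
    using input(1) assms by (auto intro!: nth_mem)
  have three: "v + (v + v) = 3 * v" by simp
  have "aval (vertex_input j) s = inp ! (j + 2 + 3 * v) mod 2 ^ w" if "j < 3" for j
    using that M assms input(1) by (simp add: vertex_input_def three)
  from this[of 0] this[of 1] this[of 2] show "aval (vertex_input 0) s = lab v" "aval (vertex_input 1) s = cl v" "aval (vertex_input 2) s = cr v"
    using input(4)[OF assms(2)] words(1)[OF i(1)] words(1)[OF i(2)] words(1)[OF i(3)] by (simp_all add: numeral_eq_Suc)
qed

text \<open>A push lowers the measure by one. Finishing a vertex lowers its first term by two, while
  the stack loses one entry. Truncated subtraction does no harm because of
  \<open>length st + card D \<le> n\<close>.\<close>

lemma wp_dfs_body:
  assumes inv: "inv s D st" and ne: "s SP0 0 \<noteq> 0"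
  shows "wp dfs_body (\<lambda>s'. \<exists>D' st'. inv s' D' st' \<and> 2 * (n - card D') - length st' < 2 * (n - card D) - length st) s"
    (is "wp _ ?post s")
proof -
  obtain v st0 where st: "st = v # st0" using ne inv by (cases st) (auto simp: inv_def stacked_def)
  have v: "v < n" "v \<notin> D" using inv by (auto simp: inv_def st)
  have fin: "finite D" "finite (set st)" using inv finite_subset[of D "{..<n}"] by (auto simp: inv_def)
  have dist: "distinct st"
  proof -
    have "distinct xs" if "sorted_wrt (\<lambda>i j. size (t i) < size (t j)) xs" for xs using that by (induction xs) auto
    then show ?thesis using inv by (simp add: inv_def)
  qed
  have len: "length st + card D \<le> n"
  proof -
    have "card (set st \<union> D) \<le> card {..<n}" using inv by (intro card_mono) (auto simp: inv_def)
    moreover have "card (set st \<union> D) = card (set st) + card D"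
      using inv fin by (intro card_Un_disjoint) (auto simp: inv_def)
    ultimately show ?thesis using distinct_card[OF dist] by simp
  qed
  have cD: "card D < n" using len by (simp add: st)
  have sp: "s SP0 0 = length st" "s STK (length st - 1) = v" using inv by (auto simp: inv_def stacked_def st nth_append)
  have nN: "n + 2 < N" "0 < N" "2 * v + 2 < N" using N_ge v by auto
  define s1 where "s1 = upd RV 0 (cr v) (upd LV 0 (cl v) (upd LAB 0 (lab v) (upd VV 0 v s)))"
  have inv1: "inv s1 D st" by (rule inv_idle[OF inv]) (simp add: s1_def)
  have s1: "s1 VV 0 = v" "s1 LV 0 = cl v" "s1 RV 0 = cr v" "s1 LAB 0 = lab v" "s1 SP0 0 = length st" using sp by (simp_all add: s1_def)
  have nx: "0 < s1 NX 0" "2 * (s1 NX 0 + C) + 2 < N"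
  proof -
    have "0 < s1 NX 0" "s1 NX 0 \<le> 1 + C * card D" using inv1 by (simp_all add: inv_def)
    moreover have "C * card D + C \<le> C * n" using mult_le_mono2[of "Suc (card D)" n C] cD by simp
    ultimately show "0 < s1 NX 0" "2 * (s1 NX 0 + C) + 2 < N" using N_ge by auto
  qed
  have done1: "wp pop_done ?post s2" if "proc_ext v s1 s2" "s2 NX 0 \<le> s1 NX 0 + C" "vrep s2 v (t v)" for s2
  proof -
    have "VV \<notin> proc_names" "SP0 \<notin> proc_names"
      by (auto simp: proc_names_def names_defs)
    then have e: "s2 VV 0 = v" "s2 SP0 0 = length st" using that(1) s1 by (simp_all add: proc_ext_def)
    have "inv (upd SP0 0 (length st0) (upd DONE v 1 s2)) (insert v D) st0"
      by (rule inv_done[OF inv1[unfolded st] that refl])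
    moreover have "2 * (n - card (insert v D)) - length st0 < 2 * (n - card D) - length st"
      using fin v len by (simp add: st)
    ultimately have "?post (upd SP0 0 (length st0) (upd DONE v 1 s2))" by blast
    then show ?thesis using nN e by (simp add: pop_done_def st)
  qed
  have push: "wp (push_vertex x) ?post s1" if x: "s1 x 0 = i" "i < n" "i \<notin> D" "size (t i) < size (t v)" for i x
  proof -
    have "inv (upd SP0 0 (length st + 1) (upd STK (length st) i s1)) D (i # st)"
      by (rule inv_push[OF inv1 that(2,3) st that(4) refl])
    moreover have "2 * (n - card D) - length (i # st) < 2 * (n - card D) - length st" using len by (simp add: st)
    ultimately have "?post (upd SP0 0 (length st + 1) (upd STK (length st) i s1))" by blast
    moreover have "length st + 1 < 2 ^ w" "length st < N" using len nN N_le by auto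
    ultimately show ?thesis using s1 x nN by (simp add: push_vertex_def)
  qed
  have tv: "tabrep s1 v (\<lambda>_. None)" using inv1 v by (simp add: inv_def)
  have main: "wp (Cond (Mi (Vr LAB) (Cn 1)) (Sq leaf_codes pop_done)
       (Cond (Ar DONE (Vr LV)) (Cond (Ar DONE (Vr RV)) (Sq (Cond (Vr LAB) (inner_code True) (inner_code False)) pop_done)
          (push_vertex RV)) (push_vertex LV))) ?post s1"
    using leaf_or_inner[OF v(1)]
  proof (elim disjE exE conjE)
    fix c a assume t: "t v = Lf c a" "lab v = leaf_label code (c, a)"
    have "wp leaf_codes (wp pop_done ?post) s1"
    proof (rule wp_mono[OF wp_leaf_codes[OF _ refl nx(1) _ s1(1) nN(3) tv]])
      show "s1 LAB 0 = leaf_label code (c, a)" using s1 t by simp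
      show "2 * (s1 NX 0 + 2 * length As) + 2 < N" using nx C by simp
    next
      fix s2 assume "proc_ext v s1 s2 \<and> s2 NX 0 \<le> s1 NX 0 + 2 * length As \<and> vrep s2 v (Lf c a)"
      then show "wp pop_done ?post s2" using C t by (intro done1) auto
    qed
    moreover have "1 < lab v" using t by (simp add: leaf_label_def)
    ultimately show ?thesis using s1 nN by simp
  next
    fix b assume t: "t v = Op b (t (cl v)) (t (cr v))" "cl v < n" "cr v < n" "lab v = (if b then 1 else 0)"
    have sz: "size (t (cl v)) < size (t v)" "size (t (cr v)) < size (t v)" by (subst t(1), simp)+
    have dn: "s1 DONE i = (if i \<in> D then 1 else 0)" if "i < n" for i using inv1 that by (simp add: inv_def)
    have N: "cl v < N" "cr v < N" "2 * cl v + 2 < N" "2 * cr v + 2 < N" using t nN N_ge by auto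
    show ?thesis
    proof (cases "cl v \<in> D \<and> cr v \<in> D")
      case True
      have "wp (inner_code b) (wp pop_done ?post) s1"
      proof (rule wp_mono[OF wp_inner_code[where l = "cl v" and r = "cr v" and v = v and t = "t (cl v)" and u = "t (cr v)" and n = "s1 NX 0"]])
        show "vrep s1 (cl v) (t (cl v))" "vrep s1 (cr v) (t (cr v))" using inv1 True by (auto simp: inv_def)
        show "wfx (Op b (t (cl v)) (t (cr v)))" "length (leaves (Op b (t (cl v)) (t (cr v)))) < M"
          using wf[OF v(1)] leaves[OF v(1)] t(1) by simp_all
        show "2 * (s1 NX 0 + 6 * Q * Q) + 2 < N" using nx C by simp
        show "cl v \<noteq> v" "cr v \<noteq> v" using sz by auto
      next
        fix s2 assume "proc_ext v s1 s2 \<and> s2 NX 0 \<le> s1 NX 0 + 6 * Q * Q \<and> vrep s2 v (Op b (t (cl v)) (t (cr v)))"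
        then show "wp pop_done ?post s2" using C t(1) by (intro done1) auto
      qed (use s1 nx tv QM N nN in auto)
      then show ?thesis using s1 nN N True t dn by (cases b) auto
    next
      case False
      then show ?thesis using s1 nN N t dn sz push[of LV "cl v"] push[of RV "cr v"] by (cases "cl v \<in> D") auto
    qed
  qed
  have avs: "aval (vertex_input 0) (upd VV 0 v s) = lab v"
    "aval (vertex_input 1) (upd LAB 0 (lab v) (upd VV 0 v s)) = cl v"
    "aval (vertex_input 2) (upd LV 0 (cl v) (upd LAB 0 (lab v) (upd VV 0 v s))) = cr v"
    using aval_vertex_input[of _ v] v by auto
  have oks: "ok (vertex_input j) s' \<longleftrightarrow> 0 < N" for j s' by (simp add: vertex_input_def)
  have "length st - 1 < N" using len nN by simp
  then show ?thesis unfolding dfs_body_def using main[unfolded s1_def] avs oks nN sp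
    by (simp del: wp.simps(4))
qed

lemma runs_dfs:
  "runs dfs (\<lambda>_ _. 0) (3 + ((cost dfs_body + 2) * (2 * n) + 1)) [] (\<lambda>s. \<exists>D. inv s D [])"
proof -
  define s1 :: state where "s1 = upd SP0 0 1 (upd STK 0 S (upd NX 0 1 (\<lambda>_ _. 0)))"
  have N: "0 < N" "n < N" using N_ge by auto
  have "tabrep s1 i (\<lambda>_. None)" for i by (simp add: tabrep_def rrep_def s1_def)
  then have inv: "inv s1 {} [S]" using S by (simp add: inv_def s1_def stacked_def)
  define I where "I = (\<lambda>m s. \<exists>D st. inv s D st \<and> m = 2 * (n - card D) - length st)"
  \<comment> \<open>The initial measure: no vertex is processed and one is on the stack.\<close>
  have "runs (Loop (Vr SP0) dfs_body) s1 ((cost dfs_body + 2) * (2 * n - 1) + 1) []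
    (\<lambda>s'. \<exists>m'. I m' s' \<and> aval (Vr SP0) s' = 0)"
  proof (rule runs_Loop)
    show "I (2 * n - 1) s1" using inv by (auto simp: I_def intro!: exI[of _ "{}"] exI[of _ "[S]"])
  next
    fix m s assume "I m s" "aval (Vr SP0) s \<noteq> 0"
    then obtain D st where 1: "inv s D st" "m = 2 * (n - card D) - length st" "s SP0 0 \<noteq> 0" by (auto simp: I_def)
    show "wp dfs_body (\<lambda>s'. \<exists>m'<m. I m' s') s"
      by (rule wp_mono[OF wp_dfs_body[OF 1(1,3)]]) (use 1(2) in \<open>auto simp: I_def\<close>)
  qed (use N in simp)
  then have loop: "runs (Loop (Vr SP0) dfs_body) s1 ((cost dfs_body + 2) * (2 * n) + 1) [] (\<lambda>s. \<exists>D. inv s D [])"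
  proof (rule runs_weaken)
    fix s assume "\<exists>m'. I m' s \<and> aval (Vr SP0) s = 0"
    then obtain D st where 1: "inv s D st" "s SP0 0 = 0" by (auto simp: I_def)
    then have "st = []" by (auto simp: inv_def stacked_def)
    then show "\<exists>D. inv s D []" using 1 by blast
  next
    show "(cost dfs_body + 2) * (2 * n - 1) + 1 \<le> (cost dfs_body + 2) * (2 * n) + 1"
      by (intro add_le_mono1 mult_le_mono2) simp
  qed
  have "inp ! 1 mod 2 ^ w = S" using words(1)[of "inp ! 1"] input by simp
  then have "wp (seqs [NX ::= Cn 1, Set STK (Cn 0) (In (Cn 1)), SP0 ::= Cn 1]) (\<lambda>s. s = s1) (\<lambda>_ _. 0)"
    using N input by (simp add: s1_def)
  from wp_runs[OF this] have "runs (seqs [NX ::= Cn 1, Set STK (Cn 0) (In (Cn 1)), SP0 ::= Cn 1]) (\<lambda>_ _. 0) 3 [] (\<lambda>s. s = s1)"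
    by (simp add: numeral_3_eq_3)
  from runs_Sq[OF this, of "Loop (Vr SP0) dfs_body" "(cost dfs_body + 2) * (2 * n) + 1" "[]" "\<lambda>s. \<exists>D. inv s D []"] loop
  show ?thesis by (simp only: dfs_def append_Nil)
qed

end

section \<open>Enumerating a circuit\<close>

abbreviation "Y1 \<equiv> Nm 63 0"
abbreviation "Y2 \<equiv> Nm 64 0"

section \<open>Goals, choices and the lists still to be output\<close>

type_synonym goal = "circ \<times> pos"
type_synonym choice = "circ \<times> pos \<times> goal list \<times> item list"

primrec expand :: "nat \<Rightarrow> goal list \<Rightarrow> item list list" where
  "expand M [] = [[]]"
| "expand M (g # gs) = cross (E M (fst g) (snd g)) (expand M gs)"

primrec firsts :: "nat \<Rightarrow> goal list \<Rightarrow> item list" where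
  "firsts M [] = []"
| "firsts M (g # gs) = first M (fst g) (snd g) @ firsts M gs"

text \<open>A choice remembers a union whose \<open>Ef\<close> part is being treated, with the goals
  and the partial solution of that moment. What it still owes is its \<open>Er\<close> part,
  continued by those goals. Partial solutions are stored with the newest item first, hence
  \<open>rev\<close>.\<close>

primrec pending :: "nat \<Rightarrow> choice list \<Rightarrow> item list list" where
  "pending M [] = []"
| "pending M (h # hs) = (case h of (u, x, gs, rt) \<Rightarrow>
     map ((@) (rev rt)) (cross (Er M u x) (expand M gs)) @ pending M hs)"

text \<open>The specification of a search state: all lists still to come, in the order of output.
  Expanding goals leaves it unchanged.\<close>

definition remaining :: "nat \<Rightarrow> goal list \<Rightarrow> item list \<Rightarrow> choice list \<Rightarrow> item list list" where
  "remaining M gs rt hs = map ((@) (rev rt)) (expand M gs) @ pending M hs"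

text \<open>Backtracking to a choice frees all cells above it, so the heap never exceeds the number of cells needed
  along a single branch of the search.\<close>

primrec need :: "circ \<Rightarrow> nat" where
  "need (Item A) = 1"
| "need (Alt w1 a w2 b) = Suc (max (need a) (need b))"
| "need (Prd w1 a w2 b) = Suc (need a + need b)"

definition needs :: "goal list \<Rightarrow> nat" where
  "needs gs = sum_list (map (need \<circ> fst) gs)"

lemma needs_simps [simp]: "needs [] = 0" "needs (g # gs) = need (fst g) + needs gs"
  by (simp_all add: needs_def)

text \<open>A list of length \<open>l\<close> comes from \<open>l\<close> items and
  \<open>l - 1\<close> products, so \<open>2 * l - 1\<close> iterations are spent on a goal. Unions
  cost no iteration of their own, being passed together with the step that follows.\<close>

definition work :: "nat \<Rightarrow> goal list \<Rightarrow> nat" where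
  "work M gs = sum_list (map (\<lambda>g. 2 * length (first M (fst g) (snd g)) - 1) gs)"

lemma work_simps [simp]: "work M [] = 0" "work M (g # gs) = 2 * length (first M (fst g) (snd g)) - 1 + work M gs"
  by (simp_all add: work_def)

lemma work_firsts: "work M gs \<le> 2 * length (firsts M gs)"
  by (induction gs) auto

definition norm :: "nat \<Rightarrow> pos \<Rightarrow> bool" where
  "norm M x \<longleftrightarrow> fst x < M \<and> snd x < M"

lemma app_idw: "norm M x \<Longrightarrow> app M idw x = x"
  by (cases x) (auto simp: norm_def app_def follow_def idw_def sel_def)

lemma norm_app: "0 < M \<Longrightarrow> norm M (app M y x)"
  by (simp add: norm_def app_def follow_def)

lemma E_leftmost: "norm M x \<Longrightarrow> E M (fst (leftmost M c)) (app M (snd (leftmost M c)) x) = Ef M c x"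
  using Ef_leftmost[of M c idw x] by (simp add: E_def Er_leftmost app_idw)

lemma need_leftmost: "need (fst (leftmost M c)) \<le> need c"
  by (induction c) auto

lemma first_leftmost: "norm M x \<Longrightarrow> first M (fst (leftmost M c)) (app M (snd (leftmost M c)) x) = first M c x"
proof -
  assume x: "norm M x"
  obtain ys zs where "Ef M c x = first M c x # ys"
    "E M (fst (leftmost M c)) (app M (snd (leftmost M c)) x) = first M (fst (leftmost M c)) (app M (snd (leftmost M c)) x) # zs"
    using Ef_first E_first by metis
  then show ?thesis using E_leftmost[OF x, of c] by simp
qed

lemma expand_firsts: "\<exists>zs. expand M gs = firsts M gs # zs"
proof (induction gs)
  case (Cons g gs)
  obtain zs where "expand M gs = firsts M gs # zs" using Cons by blast
  moreover obtain ys where "E M (fst g) (snd g) = first M (fst g) (snd g) # ys" using E_first by blast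
  ultimately show ?case by simp
qed simp

lemma remaining_first: "\<exists>zs. remaining M gs rt hs = (rev rt @ firsts M gs) # zs"
  using expand_firsts[of M gs] by (auto simp: remaining_def)

lemma remaining_Item: "remaining M ((Item A, x) # gs) rt hs = remaining M gs ((fst x, A) # rt) hs"
  by (simp add: remaining_def E_simps o_def)

lemma remaining_Prd: "remaining M ((Prd w1 a w2 b, x) # gs) rt hs = remaining M ((a, app M w1 x) # (b, app M w2 x) # gs) rt hs"
  by (simp add: remaining_def E_simps cross_assoc)

lemma remaining_Alt:
  assumes "norm M x"
  shows "remaining M ((c, x) # gs) rt hs =
    remaining M ((fst (leftmost M c), app M (snd (leftmost M c)) x) # gs) rt ((c, x, gs, rt) # hs)"
  using assms by (simp add: remaining_def E_leftmost, simp add: E_def)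

definition zrep :: "nat \<Rightarrow> nat \<Rightarrow> nat option \<Rightarrow> bool" where
  "zrep f v z \<longleftrightarrow> (case z of None \<Rightarrow> f = 0 | Some i \<Rightarrow> f \<noteq> 0 \<and> v = i)"

definition heap_arrays :: "nm set" where
  "heap_arrays = {GN, GX1, GX2, GNX, GF, GFV, RN', RX, RNX, RF, RFV, HN, HX1, HX2, HG, HT, HNX}"

text \<open>Cells from \<open>b\<close> on are free for reuse. As heap pointers only lead downwards,
  everything reachable from below \<open>b\<close> survives.\<close>

definition hagree :: "nat \<Rightarrow> state \<Rightarrow> state \<Rightarrow> bool" where
  "hagree b s s' \<longleftrightarrow> (\<forall>j\<in>build_names. s' j = s j) \<and> (\<forall>j\<in>heap_arrays. \<forall>p<b. s' j p = s j p)"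

definition keep :: "state \<Rightarrow> state \<Rightarrow> bool" where
  "keep s s' \<longleftrightarrow> (\<forall>j\<in>build_names \<union> {F0, F1}. s' j = s j)"

lemma keep_trans: "keep s s' \<Longrightarrow> keep s' s'' \<Longrightarrow> keep s s''"
  by (simp add: keep_def)

lemma build_names_iff [simp]: "Nm i x \<in> build_names \<longleftrightarrow> (i, x) \<in> {(10, 0), (11, 0), (12, 0), (17, 0), (20, 0), (21, 0),
   (13, 0), (14, 0), (15, 0), (16, 0), (18, 0), (19, 0), (26, 0), (27, 0), (28, 0), (29, 0)} \<or> i \<in> {7, 8, 9, 22}"
  by (auto simp: names_defs)

lemma heap_arrays_iff [simp]: "Nm i x \<in> heap_arrays \<longleftrightarrow> x = 0 \<and> 42 \<le> i \<and> i \<le> 58"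
proof
  assume "x = 0 \<and> 42 \<le> i \<and> i \<le> 58"
  moreover have "42 \<le> i \<and> i \<le> 58 \<Longrightarrow> i = 42 \<or> i = 43 \<or> i = 44 \<or> i = 45 \<or> i = 46 \<or> i = 47 \<or> i = 48 \<or> i = 49 \<or> i = 50
    \<or> i = 51 \<or> i = 52 \<or> i = 53 \<or> i = 54 \<or> i = 55 \<or> i = 56 \<or> i = 57 \<or> i = 58" by presburger
  ultimately show "Nm i x \<in> heap_arrays" by (auto simp: heap_arrays_def)
qed (auto simp: heap_arrays_def)

lemma hagree_trans: "hagree b s s' \<Longrightarrow> hagree b s' s'' \<Longrightarrow> hagree b s s''"
  by (simp add: hagree_def)

lemma hagree_refl: "hagree b s s"
  by (simp add: hagree_def)

lemma hagree_upd: "hagree b s s' \<Longrightarrow> j \<notin> build_names \<Longrightarrow> j \<notin> heap_arrays \<or> b \<le> i \<Longrightarrow> hagree b s (upd j i v s')"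
  by (auto simp: hagree_def upd_def fun_eq_iff)

lemma keep_upd: "keep s s' \<Longrightarrow> j \<notin> build_names \<union> {F0, F1} \<Longrightarrow> keep s (upd j i v s')"
  by (auto simp: keep_def upd_def fun_eq_iff)

lemma keep_refl: "keep s s"
  by (simp add: keep_def)

section \<open>Machine steps of the search\<close>

definition apply_weight :: "nm \<Rightarrow> nm \<Rightarrow> nm rexp \<Rightarrow> nm rcom" where
  "apply_weight B C i = seqs [X1 ::= Pl (Ar XY (Ar B (ix i (Cn 1)))) (Ar C (ix i (Cn 1))),
     X2 ::= Pl (Ar XY (Ar B (ix i (Cn 2)))) (Ar C (ix i (Cn 2))), Set XY (Cn 1) (Vr X1), Set XY (Cn 2) (Vr X2)]"

definition set_pos :: "pos \<Rightarrow> state \<Rightarrow> state" where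
  "set_pos x s = upd XY 2 (snd x) (upd XY 1 (fst x) (upd X2 0 (snd x) (upd X1 0 (fst x) s)))"

definition push_choice :: "nm rcom" where
  "push_choice = seqs [Set HN (Vr SP) (Vr CUR), Set HX1 (Vr SP) (Ar XY (Cn 1)), Set HX2 (Vr SP) (Ar XY (Cn 2)),
     Set HG (Vr SP) (Vr GP), Set HT (Vr SP) (Vr TP), Set HNX (Vr SP) (Vr CP), CP ::= Vr SP, SP ::= Pl (Vr SP) (Cn 1)]"

definition pushed_choice :: "state \<Rightarrow> state" where
  "pushed_choice s = (let p = s SP 0 in upd SP 0 (p + 1) (upd CP 0 p (upd HNX p (s CP 0) (upd HT p (s TP 0)
     (upd HG p (s GP 0) (upd HX2 p (s XY 2) (upd HX1 p (s XY 1) (upd HN p (s CUR 0) s))))))))"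

definition expand_alt :: "nm rcom" where
  "expand_alt = seqs [push_choice, apply_weight MB MC (Vr CUR), CUR ::= Ar MN (Vr CUR)]"

text \<open>Every cell of the partial solution caches in \<open>RF\<close> and \<open>RFV\<close>
  the first vertex of component 0 among the items up to it: an earlier one takes precedence,
  otherwise the new item may supply it.\<close>

definition step_item :: "nm rcom" where
  "step_item = seqs [Set RN' (Vr SP) (Vr CUR), Set RX (Vr SP) (Ar XY (Cn 1)), Set RNX (Vr SP) (Vr TP),
     Cond (Ar RF (Vr TP)) (seqs [Set RF (Vr SP) (Cn 1), Set RFV (Vr SP) (Ar RFV (Vr TP))])
       (seqs [Set RF (Vr SP) (Ar FB (Vr CUR)), Set RFV (Vr SP) (Ar XY (Cn 1))]),
     TP ::= Vr SP, SP ::= Pl (Vr SP) (Cn 1),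
     Cond (Vr GP) (seqs [CUR ::= Ar GN (Vr GP), Set XY (Cn 1) (Ar GX1 (Vr GP)), Set XY (Cn 2) (Ar GX2 (Vr GP)),
       GP ::= Ar GNX (Vr GP)]) (CUR ::= Cn 0)]"

text \<open>Goal cells have a similar cache: the vertex of component 0 that the first lists of the
  goals from this cell on will supply, taken from the new goal if it has one and otherwise from the
  rest.\<close>

definition store_first :: "nm rcom" where
  "store_first = Cond (Ar FB (Ar RN (Vr CUR)))
       (seqs [Set GF (Vr SP) (Cn 1), Set GFV (Vr SP) (Pl (Ar XY (Ar FB (Ar RN (Vr CUR)))) (Ar FC (Ar RN (Vr CUR))))])
       (seqs [Set GF (Vr SP) (Ar GF (Vr GP)), Set GFV (Vr SP) (Ar GFV (Vr GP))])"

definition enter_left :: "nm rcom" where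
  "enter_left = seqs [GP ::= Vr SP, SP ::= Pl (Vr SP) (Cn 1), Set XY (Cn 1) (Vr Y1), Set XY (Cn 2) (Vr Y2),
     apply_weight LB LC (Vr CUR), CUR ::= Ar LN (Vr CUR)]"

definition step_prod :: "nm rcom" where
  "step_prod = seqs [Y1 ::= Ar XY (Cn 1), Y2 ::= Ar XY (Cn 2), apply_weight RB RC (Vr CUR),
     Set GN (Vr SP) (Ar RN (Vr CUR)), Set GX1 (Vr SP) (Ar XY (Cn 1)), Set GX2 (Vr SP) (Ar XY (Cn 2)), Set GNX (Vr SP) (Vr GP),
     store_first, enter_left]"

text \<open>The leftmost pointer never leads to a union. So after the first conditional an item or a
  product is at hand, and each iteration makes progress.\<close>

definition expand_body :: "nm rcom" where
  "expand_body = Sq (Cond (neq (Ar KIND (Vr CUR)) 1) Skip expand_alt) (Cond (Ar KIND (Vr CUR)) step_prod step_item)"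

text \<open>Resumes the newest choice with the right child of its union. If the left child is itself
  a union, its \<open>Er\<close> part is still owed, so it is pushed as a choice. A chain of unions
  is thus unrolled by one link per solution, in constant time.\<close>

definition backtrack :: "nm rcom" where
  "backtrack = Cond (Vr CP) (seqs [SP ::= Vr CP, CUR ::= Ar HN (Vr SP), Set XY (Cn 1) (Ar HX1 (Vr SP)), Set XY (Cn 2) (Ar HX2 (Vr SP)),
     GP ::= Ar HG (Vr SP), TP ::= Ar HT (Vr SP), CP ::= Ar HNX (Vr SP),
     Cond (neq (Ar KIND (Ar LN (Vr CUR))) 1) Skip (seqs [PP ::= Vr CUR, Y1 ::= Ar XY (Cn 1), Y2 ::= Ar XY (Cn 2),
       apply_weight LB LC (Vr CUR), CUR ::= Ar LN (Vr CUR), push_choice, CUR ::= Vr PP, Set XY (Cn 1) (Vr Y1), Set XY (Cn 2) (Vr Y2)]),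
     apply_weight RB RC (Vr CUR), CUR ::= Ar RN (Vr CUR)]) (CUR ::= Cn 0)"

context mach
begin

lemma wp_apply_weight:
  assumes "ok i s" "2 * aval i s + 2 < N" "2 < N" "wrep s B C (aval i s) y" "{X1, X2, XY} \<inter> ({B, C} \<union> exp_names i) = {}"
    "R (set_pos (app M y (s XY 1, s XY 2)) s)"
  shows "wp (apply_weight B C i) R s"
proof -
  have ne: "B \<noteq> X1" "B \<noteq> X2" "B \<noteq> XY" "C \<noteq> X1" "C \<noteq> X2" "C \<noteq> XY" and ne2: "X1 \<notin> exp_names i" "X2 \<notin> exp_names i" "XY \<notin> exp_names i"
    using assms(5) by auto
  have xy: "s XY (eb b) = sel (s XY 1, s XY 2) b" for b by (cases b) (auto simp: sel_def)
  have lt: "eb b < N" for b using assms(3) by (cases b) auto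
  show ?thesis using assms(1-4,6) ne ne2 ne[THEN not_sym] xy lt
    by (simp add: apply_weight_def wrep_def aval_ix set_pos_def app_def follow_def)
qed

lemma wp_push_choice:
  assumes "2 < N" "s SP 0 + 1 < N" "R (pushed_choice s)"
  shows "wp push_choice R s"
  using assms N_le by (simp add: push_choice_def pushed_choice_def Let_def)

end

locale enum_mach = mach w N inp k la op Q
  for w N inp k and la :: "bool \<Rightarrow> 'a \<Rightarrow> nat set \<Rightarrow> nat" and op Q +
  fixes B :: nat
  assumes B: "B + 2 < N"
begin

text \<open>Pointers strictly descend, so that lists are not affected by writes above them and
  choices can share tails.\<close>

primrec grep :: "state \<Rightarrow> nat \<Rightarrow> goal list \<Rightarrow> bool" where
  "grep s p [] \<longleftrightarrow> p = 0"
| "grep s p (g # gs) \<longleftrightarrow> 0 < p \<and> nrep (fst g) s (s GN p) \<and> s GX1 p = fst (snd g) \<and> s GX2 p = snd (snd g) \<and> norm M (snd g) \<and>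
     s GNX p < p \<and> zrep (s GF p) (s GFV p) (zeroth (firsts M (g # gs))) \<and> grep s (s GNX p) gs"

primrec trep :: "state \<Rightarrow> nat \<Rightarrow> item list \<Rightarrow> bool" where
  "trep s p [] \<longleftrightarrow> p = 0"
| "trep s p (z # rt) \<longleftrightarrow> 0 < p \<and> fst z < M \<and> nrep (Item (snd z)) s (s RN' p) \<and> s RX p = fst z \<and> s RNX p < p \<and>
     zrep (s RF p) (s RFV p) (zeroth (rev (z # rt))) \<and> trep s (s RNX p) rt"

text \<open>The inequality with \<open>B\<close> reserves the cells that will be used when the
  search returns to this choice with \<open>p\<close> as the new end of the heap.\<close>

primrec hrep :: "state \<Rightarrow> nat \<Rightarrow> choice list \<Rightarrow> bool" where
  "hrep s p [] \<longleftrightarrow> p = 0"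
| "hrep s p (h # hs) \<longleftrightarrow> (case h of (u, x, gs, rt) \<Rightarrow> 0 < p \<and> (\<exists>w1 a w2 b. u = Alt w1 a w2 b) \<and> nrep u s (s HN p) \<and>
     s HX1 p = fst x \<and> s HX2 p = snd x \<and> norm M x \<and> s HG p < p \<and> s HT p < p \<and> s HNX p < p \<and>
     grep s (s HG p) gs \<and> trep s (s HT p) rt \<and> p + need u + needs gs \<le> B) \<and> hrep s (s HNX p) hs"

lemma nrep_cong: "(\<And>j. j \<in> build_names \<Longrightarrow> s' j = s j) \<Longrightarrow> nrep c s n \<Longrightarrow> nrep c s' n"
  by (erule nrep_ext[rotated]) (auto simp: node_ext_def build_names_def)

lemma nrep_hagree: "hagree b s s' \<Longrightarrow> nrep c s n \<Longrightarrow> nrep c s' n"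
  by (rule nrep_cong) (auto simp: hagree_def)

lemma grep_hagree: "hagree b s s' \<Longrightarrow> p < b \<Longrightarrow> grep s p gs \<Longrightarrow> grep s' p gs"
proof (induction gs arbitrary: p)
  case (Cons g gs)
  have "s' j p = s j p" if "j \<in> {GN, GX1, GX2, GNX, GF, GFV}" for j
    using Cons.prems(1,2) that by (auto simp: hagree_def)
  then show ?case using Cons.prems Cons.IH[of "s GNX p"] nrep_hagree[OF Cons.prems(1)] by auto
qed simp

lemma trep_hagree: "hagree b s s' \<Longrightarrow> p < b \<Longrightarrow> trep s p rt \<Longrightarrow> trep s' p rt"
proof (induction rt arbitrary: p)
  case (Cons z rt)
  have "s' j p = s j p" if "j \<in> {RN', RX, RNX, RF, RFV}" for j
    using Cons.prems(1,2) that by (auto simp: hagree_def)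
  then show ?case using Cons.prems Cons.IH[of "s RNX p"] nrep_hagree[OF Cons.prems(1), of "Item (snd z)"]
    by (auto simp del: nrep.simps)
qed simp

lemma hrep_hagree: "hagree b s s' \<Longrightarrow> p < b \<Longrightarrow> hrep s p hs \<Longrightarrow> hrep s' p hs"
proof (induction hs arbitrary: p)
  case (Cons h hs)
  obtain u x gs rt where h: "h = (u, x, gs, rt)" by (metis prod_cases4)
  have "s' j p = s j p" if "j \<in> {HN, HX1, HX2, HG, HT, HNX}" for j
    using Cons.prems(1,2) that by (auto simp: hagree_def)
  then show ?case using Cons.prems Cons.IH[of "s HNX p"] nrep_hagree[OF Cons.prems(1), of u]
      grep_hagree[OF Cons.prems(1), of "s HG p" gs] trep_hagree[OF Cons.prems(1), of "s HT p" rt]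
    by (auto simp: h simp del: nrep.simps)
qed simp

definition cells :: "state \<Rightarrow> bool" where
  "cells s \<longleftrightarrow> 0 < s SP 0 \<and> s GF 0 = 0 \<and> s RF 0 = 0 \<and> 2 * s NX 0 + 2 < N"

definition curg :: "state \<Rightarrow> goal list \<Rightarrow> bool" where
  "curg s gs \<longleftrightarrow> (case gs of [] \<Rightarrow> s CUR 0 = 0 | g # gs' \<Rightarrow> nrep (fst g) s (s CUR 0) \<and> s XY 1 = fst (snd g) \<and>
     s XY 2 = snd (snd g) \<and> norm M (snd g) \<and> s GP 0 < s SP 0 \<and> grep s (s GP 0) gs')"

definition est :: "state \<Rightarrow> goal list \<Rightarrow> item list \<Rightarrow> choice list \<Rightarrow> bool" where
  "est s gs rt hs \<longleftrightarrow> cells s \<and> curg s gs \<and> s TP 0 < s SP 0 \<and> trep s (s TP 0) rt \<and> s CP 0 < s SP 0 \<and> hrep s (s CP 0) hs \<and>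
     s SP 0 + needs gs \<le> B"

lemma pushed_choice_simps [simp]:
  "pushed_choice s SP 0 = s SP 0 + 1" "pushed_choice s CP 0 = s SP 0"
  "j \<notin> {SP, CP, HNX, HT, HG, HX2, HX1, HN} \<Longrightarrow> pushed_choice s j = s j"
  by (simp_all add: pushed_choice_def Let_def)

lemma hagree_pushed: "hagree (s SP 0) s (pushed_choice s)"
  unfolding pushed_choice_def Let_def by (intro hagree_upd hagree_refl) auto

lemma hrep_pushed:
  assumes "0 < s SP 0" "nrep (Alt w1 a w2 b) s (s CUR 0)" "norm M x" "s XY 1 = fst x" "s XY 2 = snd x" "s GP 0 < s SP 0" "s TP 0 < s SP 0" "s CP 0 < s SP 0"
    "grep s (s GP 0) gs" "trep s (s TP 0) rt" "hrep s (s CP 0) hs" "s SP 0 + need (Alt w1 a w2 b) + needs gs \<le> B"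
  shows "hrep (pushed_choice s) (s SP 0) ((Alt w1 a w2 b, x, gs, rt) # hs)"
proof -
  note h = hagree_pushed[of s]
  have c: "pushed_choice s HN (s SP 0) = s CUR 0" "pushed_choice s HX1 (s SP 0) = s XY 1" "pushed_choice s HX2 (s SP 0) = s XY 2"
    "pushed_choice s HG (s SP 0) = s GP 0" "pushed_choice s HT (s SP 0) = s TP 0" "pushed_choice s HNX (s SP 0) = s CP 0"
    by (simp_all add: pushed_choice_def Let_def)
  show ?thesis using assms c grep_hagree[OF h assms(6,9)] trep_hagree[OF h assms(7,10)] hrep_hagree[OF h assms(8,11)]
      nrep_hagree[OF h assms(2)] by (simp del: nrep.simps)
qed

lemma set_pos_simps [simp]:
  "set_pos x s XY 1 = fst x" "set_pos x s XY (Suc 0) = fst x" "set_pos x s XY 2 = snd x" "j \<notin> {X1, X2, XY} \<Longrightarrow> set_pos x s j = s j"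
  by (simp_all add: set_pos_def)

lemma hagree_set_pos: "hagree b s s' \<Longrightarrow> hagree b s (set_pos x s')"
  unfolding set_pos_def by (intro hagree_upd) auto

lemma keep_set_pos: "keep s s' \<Longrightarrow> keep s (set_pos x s')"
  unfolding set_pos_def by (intro keep_upd) auto

lemma keep_pushed: "keep s s' \<Longrightarrow> keep s (pushed_choice s')"
  unfolding pushed_choice_def Let_def by (intro keep_upd) auto

lemma wp_expand_alt:
  assumes e: "est s ((Alt w1 a w2 b, x) # gs) rt hs"
  shows "wp expand_alt (\<lambda>s'. est s' ((fst (leftmost M (Alt w1 a w2 b)), app M (snd (leftmost M (Alt w1 a w2 b))) x) # gs) rt
     ((Alt w1 a w2 b, x, gs, rt) # hs) \<and> keep s s') s"
    (is "wp _ ?post _")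
proof -
  let ?c = "Alt w1 a w2 b" let ?lm = "leftmost M ?c"
  have e': "cells s" "nrep ?c s (s CUR 0)" "s XY 1 = fst x" "s XY 2 = snd x" "norm M x" "s GP 0 < s SP 0" "grep s (s GP 0) gs"
    "s TP 0 < s SP 0" "trep s (s TP 0) rt" "s CP 0 < s SP 0" "hrep s (s CP 0) hs" "s SP 0 + need ?c + needs gs \<le> B"
    using e by (auto simp: est_def curg_def simp del: nrep.simps need.simps)
  note lm = nrep_leftmost[OF e'(2)]
  define s1 where "s1 = set_pos (app M (snd ?lm) x) (pushed_choice s)"
  define s2 where "s2 = upd CUR 0 (s MN (s CUR 0)) s1"
  have h: "hagree (s SP 0) s s2" unfolding s2_def s1_def
    by (intro hagree_upd hagree_set_pos hagree_pushed) auto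
  have h': "hagree b' (pushed_choice s) s2" for b' unfolding s2_def s1_def
    by (intro hagree_upd hagree_set_pos hagree_refl) auto
  have k: "keep s s2" unfolding s2_def s1_def by (intro keep_upd keep_set_pos keep_pushed keep_refl) auto
  have sp: "0 < s SP 0" using e'(1) by (simp add: cells_def)
  have hr: "hrep s2 (s SP 0) ((?c, x, gs, rt) # hs)"
    by (rule hrep_hagree[OF h', of _ "Suc (s SP 0)"], simp) (rule hrep_pushed, use e' sp in \<open>simp_all del: nrep.simps need.simps\<close>)
  have v: "s2 SP 0 = s SP 0 + 1" "s2 CP 0 = s SP 0" "s2 TP 0 = s TP 0" "s2 GP 0 = s GP 0" "s2 CUR 0 = s MN (s CUR 0)"
    "s2 XY 1 = fst (app M (snd ?lm) x)" "s2 XY 2 = snd (app M (snd ?lm) x)" "s2 NX = s NX" "s2 GF = s GF" "s2 RF = s RF"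
    by (simp_all add: s2_def s1_def del: leftmost.simps)
  have "cells s2" using e'(1) v by (simp add: cells_def)
  moreover have "curg s2 ((fst ?lm, app M (snd ?lm) x) # gs)"
    using v e' nrep_hagree[OF h, of "fst ?lm"] lm grep_hagree[OF h e'(6,7)] norm_app[of M "snd ?lm" x]
    by (simp add: curg_def del: leftmost.simps nrep.simps)
  moreover have "need (fst ?lm) < need ?c" using need_leftmost[of M a] by simp
  ultimately have post: "?post s2" using k v hr e' trep_hagree[OF h e'(8,9)]
    by (simp add: est_def del: leftmost.simps need.simps hrep.simps)
  have n: "s CUR 0 < s NX 0" using nrep_bounds[OF e'(2)] by simp
  have N: "2 < N" "s SP 0 + 1 < N" "2 * s NX 0 + 2 < N" using B e' by (auto simp: cells_def)
  have "wp (apply_weight MB MC (Vr CUR)) (wp (CUR ::= Ar MN (Vr CUR)) ?post) (pushed_choice s)"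
    by (rule wp_apply_weight[where y = "snd ?lm"])
      (use N n lm e' post in \<open>auto simp: s2_def s1_def wrep_def simp del: leftmost.simps need.simps nrep.simps\<close>)
  then show ?thesis using N by (auto simp: expand_alt_def intro!: wp_push_choice)
qed

lemma zeroth_first: "norm M y \<Longrightarrow> zeroth (first M c y) = map_option (\<lambda>p. follow M p y) (fx M c)"
  using fx_first[of M idw y c] by (simp add: app_idw)

lemma grep_zrep: "grep s p gs \<Longrightarrow> s GF 0 = 0 \<Longrightarrow> zrep (s GF p) (s GFV p) (zeroth (firsts M gs))"
  by (cases gs) (simp_all add: zrep_def)

lemma trep_zrep: "trep s p rt \<Longrightarrow> s RF 0 = 0 \<Longrightarrow> zrep (s RF p) (s RFV p) (zeroth (rev rt))"
  by (cases rt) (simp_all add: zrep_def)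

lemma wp_step_item:
  assumes e: "est s ((Item A, x) # gs) rt hs"
  shows "wp step_item (\<lambda>s'. est s' gs ((fst x, A) # rt) hs \<and> keep s s') s"
    (is "wp _ ?post _")
proof -
  have e': "cells s" "nrep (Item A) s (s CUR 0)" "s XY 1 = fst x" "s XY 2 = snd x" "norm M x" "s GP 0 < s SP 0" "grep s (s GP 0) gs"
    "s TP 0 < s SP 0" "trep s (s TP 0) rt" "s CP 0 < s SP 0" "hrep s (s CP 0) hs" "s SP 0 + 1 + needs gs \<le> B"
    using e by (auto simp: est_def curg_def simp del: nrep.simps)
  define p where "p = s SP 0"
  define f where "f = (if s RF (s TP 0) \<noteq> 0 then 1 else s FB (s CUR 0))"
  define v where "v = (if s RF (s TP 0) \<noteq> 0 then s RFV (s TP 0) else fst x)"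
  define s1 where "s1 = upd SP 0 (p + 1) (upd TP 0 p (upd RFV p v (upd RF p f (upd RNX p (s TP 0) (upd RX p (fst x) (upd RN' p (s CUR 0) s))))))"
  define s2 where "s2 = (if gs = [] then upd CUR 0 0 s1 else upd GP 0 (s GNX (s GP 0)) (upd XY 2 (s GX2 (s GP 0)) (upd XY 1 (s GX1 (s GP 0))
    (upd CUR 0 (s GN (s GP 0)) s1))))"
  have h: "hagree p s s2" unfolding s2_def s1_def by (auto intro!: hagree_upd hagree_refl)
  have k: "keep s s2" unfolding s2_def s1_def by (auto intro!: keep_upd keep_refl)
  have sp: "0 < p" using e'(1) by (simp add: cells_def p_def)
  have fb: "s FB (s CUR 0) = (if 0 \<in> A then 1 else 0)" using e'(2) by (auto simp: frep_def)
  have z: "zrep f v (zeroth (rev rt @ [(fst x, A)]))"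
    using trep_zrep[OF e'(9)] e'(1) fb by (auto simp: cells_def f_def v_def zrep_def zeroth_append split: option.splits)
  have c: "s2 RN' p = s CUR 0" "s2 RX p = fst x" "s2 RNX p = s TP 0" "s2 RF p = f" "s2 RFV p = v" "s2 TP 0 = p" "s2 SP 0 = p + 1"
    "s2 CP = s CP" "s2 NX = s NX" "s2 GF = s GF" "s2 RF 0 = s RF 0"
    using sp by (simp_all add: s2_def s1_def)
  have t: "trep s2 p ((fst x, A) # rt)"
    using c sp z nrep_hagree[OF h e'(2)] trep_hagree[OF h _ e'(9)] e'(5,8) by (simp add: p_def norm_def del: nrep.simps)
  have "curg s2 gs"
  proof (cases gs)
    case Nil
    then show ?thesis by (simp add: curg_def s2_def)
  next
    case (Cons g gs')
    then have g: "nrep (fst g) s (s GN (s GP 0))" "s GX1 (s GP 0) = fst (snd g)" "s GX2 (s GP 0) = snd (snd g)" "norm M (snd g)"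
      "s GNX (s GP 0) < s GP 0" "grep s (s GNX (s GP 0)) gs'" using e'(7) by auto
    have "s GNX (s GP 0) < p" using g(5) e'(6) by (simp add: p_def)
    from grep_hagree[OF h this g(6)] nrep_hagree[OF h g(1)] show ?thesis
      using g Cons \<open>s GNX (s GP 0) < p\<close> unfolding curg_def by (simp add: s2_def s1_def)
  qed
  moreover have "cells s2" using e'(1) c by (simp add: cells_def)
  ultimately have post: "?post s2" using t c k hrep_hagree[OF h _ e'(11)] e'
    by (simp add: est_def p_def del: trep.simps)
  have n: "s CUR 0 < s NX 0" "s GP 0 = 0 \<longleftrightarrow> gs = []" using nrep_bounds[OF e'(2)] e'(7) by (auto, cases gs, auto)
  have N: "2 < N" "p + 1 < N" "2 * s NX 0 + 2 < N" "p < M" "p + 1 < M" "s TP 0 < N" "s GP 0 < N" using B e' N_le by (auto simp: cells_def p_def)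
  have r: "s RF (s TP 0) = upd RNX p (s TP 0) (upd RX p (fst x) (upd RN' p (s CUR 0) s)) RF (s TP 0)" by simp
  have cur: "gs \<noteq> [] \<Longrightarrow> s GP 0 \<noteq> p" using e' by (simp add: p_def)
  show ?thesis
    using post N n sp e'(3,4) p_def[symmetric] cur unfolding s2_def s1_def f_def v_def
    by (simp add: step_item_def split: if_splits)
qed

lemma wp_step_prod:
  assumes e: "est s ((Prd w1 a w2 b, x) # gs) rt hs"
  shows "wp step_prod (\<lambda>s'. est s' ((a, app M w1 x) # (b, app M w2 x) # gs) rt hs \<and> keep s s') s"
    (is "wp _ ?post _")
proof -
  define y where "y = app M w2 x"
  define n where "n = s CUR 0"
  define p where "p = s SP 0"
  have e': "cells s" "s XY 1 = fst x" "s XY 2 = snd x" "norm M x" "s GP 0 < s SP 0" "grep s (s GP 0) gs"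
    "s TP 0 < s SP 0" "trep s (s TP 0) rt" "s CP 0 < s SP 0" "hrep s (s CP 0) hs" "s SP 0 + Suc (need a + need b) + needs gs \<le> B"
    using e by (auto simp: est_def curg_def simp del: nrep.simps)
  have ns: "n < s NX 0" "s LN n < n" "s RN n < n" "wrep s LB LC n w1" "wrep s RB RC n w2" "nrep a s (s LN n)" "nrep b s (s RN n)"
    using e by (auto simp: est_def curg_def n_def)
  define f where "f = (if s FB (s RN n) \<noteq> 0 then 1 else s GF (s GP 0))"
  define v where "v = (if s FB (s RN n) \<noteq> 0 then (sel y (s FB (s RN n) = 2) + s FC (s RN n)) mod M else s GFV (s GP 0))"
  define s0 where "s0 = set_pos y (upd Y2 0 (snd x) (upd Y1 0 (fst x) s))"
  define s1 where "s1 = upd GNX p (s GP 0) (upd GX2 p (snd y) (upd GX1 p (fst y) (upd GN p (s RN n) s0)))"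
  define s2 where "s2 = upd XY 2 (snd x) (upd XY 1 (fst x) (upd SP 0 (p + 1) (upd GP 0 p (upd GFV p v (upd GF p f s1)))))"
  define s3 where "s3 = upd CUR 0 (s LN n) (set_pos (app M w1 x) s2)"
  have h: "hagree p s s3" unfolding s3_def s2_def s1_def s0_def by (auto intro!: hagree_upd hagree_set_pos hagree_refl)
  have k: "keep s s3" unfolding s3_def s2_def s1_def s0_def by (auto intro!: keep_upd keep_set_pos keep_refl)
  have sp: "0 < p" "0 < M" using e'(1) by (simp_all add: cells_def p_def)
  have z: "zrep f v (zeroth (first M b y @ firsts M gs))"
  proof -
    have g: "zrep (s GF (s GP 0)) (s GFV (s GP 0)) (zeroth (firsts M gs))"
      using grep_zrep[OF e'(6)] e'(1) by (simp add: cells_def)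
    have fr: "frep s (s RN n) (fx M b)" by (rule nrep_frep[OF ns(7)])
    have zf: "zeroth (first M b y) = map_option (\<lambda>p. follow M p y) (fx M b)"
      by (rule zeroth_first) (simp add: y_def norm_app sp)
    show ?thesis
    proof (cases "fx M b")
      case None
      then show ?thesis using g fr zf by (simp add: f_def v_def zeroth_append frep_def)
    next
      case (Some q)
      obtain c d where q: "q = (c, d)" by fastforce
      then have "s FB (s RN n) = eb c" "s FC (s RN n) = d" using fr Some by (simp_all add: frep_def)
      moreover have "zeroth (first M b y @ firsts M gs) = Some (follow M (c, d) y)"
        using zf Some q by (simp add: zeroth_append)
      moreover have "eb c = 2 \<longleftrightarrow> c" by (cases c) auto
      ultimately show ?thesis by (simp add: zrep_def f_def v_def follow_def)
    qed
  qed
  have c: "s3 GN p = s RN n" "s3 GX1 p = fst y" "s3 GX2 p = snd y" "s3 GNX p = s GP 0" "s3 GF p = f" "s3 GFV p = v" "s3 TP = s TP" "s3 SP 0 = p + 1"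
    "s3 CP = s CP" "s3 NX = s NX" "s3 GF 0 = s GF 0" "s3 RF = s RF" "s3 GP 0 = p" "s3 CUR 0 = s LN n"
    "s3 XY 1 = fst (app M w1 x)" "s3 XY 2 = snd (app M w1 x)"
    using sp by (simp_all add: s3_def s2_def s1_def s0_def)
  have t: "grep s3 p ((b, y) # gs)"
    using c sp z nrep_hagree[OF h ns(7)] grep_hagree[OF h _ e'(6)] e'(5) norm_app[of M w2 x] by (simp add: p_def y_def)
  have "curg s3 ((a, app M w1 x) # (b, y) # gs)"
    using c t nrep_hagree[OF h ns(6)] norm_app[of M w1 x] sp by (simp add: curg_def del: grep.simps)
  moreover have "cells s3" using e'(1) c by (simp add: cells_def)
  ultimately have post: "?post s3" using c k hrep_hagree[OF h _ e'(10)] trep_hagree[OF h _ e'(8)] e'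
    by (simp add: est_def p_def y_def)
  have N: "2 < N" "p + 1 < N" "2 * s NX 0 + 2 < N" "p < M" "p + 1 < M" "s GP 0 < N" using B e' N_le by (auto simp: cells_def p_def)
  have 4: "wp (apply_weight LB LC (Vr CUR)) (wp (CUR ::= Ar LN (Vr CUR)) ?post) s2"
    by (rule wp_apply_weight[where y = w1])
      (use N ns post in \<open>simp_all add: s3_def s2_def s1_def s0_def wrep_def n_def[symmetric]\<close>)
  let ?push = "seqs [Set GN (Vr SP) (Ar RN (Vr CUR)), Set GX1 (Vr SP) (Ar XY (Cn 1)), Set GX2 (Vr SP) (Ar XY (Cn 2)), Set GNX (Vr SP) (Vr GP),
     store_first, enter_left]"
  have 3: "wp store_first (wp enter_left ?post) s1"
  proof -
    have rn: "s FB (s RN n) = 0 \<or> s FB (s RN n) = 1 \<or> s FB (s RN n) = 2"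
      using nrep_frep[OF ns(7)] by (auto simp: frep_def eb_def split: option.splits if_splits)
    have i: "s0 = set_pos y (upd Y2 0 (snd x) (upd Y1 0 (fst x) s))" by (fact s0_def)
    have v1: "s1 SP 0 = p" "s1 CUR 0 = n" "s1 RN n = s RN n" "s1 FB = s FB" "s1 FC = s FC" "s1 XY 1 = fst y" "s1 XY 2 = snd y"
      "s1 GP 0 = s GP 0" "s1 GF = s GF" "s1 GFV = s GFV" "s1 Y1 0 = fst x" "s1 Y2 0 = snd x"
      by (simp_all add: s1_def s0_def p_def n_def)
    have gp: "s GP 0 \<noteq> p" using e'(5) by (simp add: p_def)
    show ?thesis using 4 rn v1 N ns(1-3) gp unfolding s2_def f_def v_def store_first_def enter_left_def
      by (auto simp: sel_def split: if_splits)
  qed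
  have "wp (apply_weight RB RC (Vr CUR)) (wp (?push) ?post) (upd Y2 0 (snd x) (upd Y1 0 (fst x) s))"
  proof (rule wp_apply_weight[where y = w2])
    have "app M w2 (upd Y2 0 (snd x) (upd Y1 0 (fst x) s) XY 1, upd Y2 0 (snd x) (upd Y1 0 (fst x) s) XY 2) = y"
      using e'(2,3) by (simp add: y_def)
    then show "wp (?push) ?post
      (set_pos (app M w2 (upd Y2 0 (snd x) (upd Y1 0 (fst x) s) XY 1, upd Y2 0 (snd x) (upd Y1 0 (fst x) s) XY 2)) (upd Y2 0 (snd x) (upd Y1 0 (fst x) s)))"
      using 3 N ns unfolding s0_def[symmetric] s1_def
      by (simp add: s0_def p_def[symmetric] n_def[symmetric] del: wp.simps(4))
  qed (use N ns in \<open>simp_all add: n_def[symmetric]\<close>)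
  then show ?thesis using N e'(2,3) by (simp add: step_prod_def)
qed

end

section \<open>Writing a solution\<close>

definition find_first :: "nm rcom" where
  "find_first = Cond (Ar RF (Vr TP)) (seqs [F0 ::= Cn 1, F1 ::= Ar RFV (Vr TP)])
     (Cond (Ar FB (Vr CUR)) (seqs [F0 ::= Cn 1, F1 ::= Pl (Ar XY (Ar FB (Vr CUR))) (Ar FC (Vr CUR))])
        (seqs [F0 ::= Ar GF (Vr GP), F1 ::= Ar GFV (Vr GP)]))"

text \<open>If component 0 is empty, the comma that terminates it is the first symbol of the
  output.\<close>

definition start_output :: "nm rcom" where
  "start_output = Sq find_first (Cond (Vr F0) (Out (Vr F1)) (Emit Comma))"

definition walk :: "nm rexp \<Rightarrow> nm rexp \<Rightarrow> nm rcom" where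
  "walk e1 e2 = Loop (Vr PP) (Sq (Cond e1 (Cond e2 (Out (Ar RX (Vr PP))) Skip) Skip) (PP ::= Ar RNX (Vr PP)))"

text \<open>The vertex in \<open>F1\<close> has already been printed; if \<open>F0\<close> is 0,
  component 0 is empty and its comma has been printed.\<close>

definition rest_component :: "nm rcom" where
  "rest_component = Cond (Vr F0) (seqs [PP ::= Vr TP, walk (Ar (MEM 0) (Ar RN' (Vr PP)))
     (Pl (Mi (Ar RX (Vr PP)) (Vr F1)) (Mi (Vr F1) (Ar RX (Vr PP)))), Emit Comma]) Skip"

definition component :: "nat \<Rightarrow> nm rcom" where
  "component j = seqs [PP ::= Vr TP, walk (Ar (MEM j) (Ar RN' (Vr PP))) (Cn 1), Emit Comma]"

text \<open>The search for the items begins only here, after the first symbol has been written. The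
  final \<open>backtrack\<close> prepares the next solution in constant time and is charged to the
  present one.\<close>

definition finish_output :: "nat \<Rightarrow> nm rcom" where
  "finish_output k = seqs [Loop (Vr CUR) expand_body, rest_component, seqs (map component [1..<k]), Emit Separator, backtrack]"

context ram_env
begin

lemma runs_seqs:
  assumes "\<And>x s. x \<in> set xs \<Longrightarrow> I s \<Longrightarrow> runs (f x) s n (out x) I"
  shows "I s \<Longrightarrow> runs (seqs (map f xs)) s (n * length xs) (concat (map out xs)) I"
  using assms
proof (induction xs arbitrary: s)
  case Nil
  then show ?case unfolding runs_def by (intro exI[of _ "[]"] exI[of _ s]) (auto intro: bs_Skip)
next
  case (Cons x xs)
  have "runs (f x) s n (out x) I" by (rule Cons.prems) (use Cons.prems in auto)
  from runs_Sq[OF this, of "seqs (map f xs)" "n * length xs" "concat (map out xs)" I]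
  show ?case using Cons.IH Cons.prems(2) by simp
qed

lemma runs_Skip: "R s \<Longrightarrow> runs Skip s 0 [] R"
  unfolding runs_def by (intro exI[of _ "[]"] exI[of _ s]) (auto intro: bs_Skip)

lemma runs_Set: "ok i s \<Longrightarrow> ok e s \<Longrightarrow> aval i s < N \<Longrightarrow> R (upd j (aval i s) (aval e s) s) \<Longrightarrow> runs (Set j i e) s 1 [] R"
  using wp_runs[of "Set j i e" R s] by simp

end

context enum_mach
begin

lemma curg_cases: "curg s gs \<Longrightarrow> s CUR 0 = 0 \<longleftrightarrow> gs = []"
  using nrep_bounds by (cases gs) (auto simp: curg_def)

text \<open>An item removes a goal of work 1. A product of lists with \<open>l\<close> and
  \<open>l'\<close> items replaces \<open>2 * (l + l') - 1\<close> by
  \<open>(2 * l - 1) + (2 * l' - 1)\<close>, which is one less.\<close>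

lemma wp_terminal:
  assumes e: "est s ((c, x) # gs) rt hs" and c: "\<And>w1 a w2 b. c \<noteq> Alt w1 a w2 b"
  shows "wp (Cond (Ar KIND (Vr CUR)) step_prod step_item) (\<lambda>s'. \<exists>gs' rt'. est s' gs' rt' hs \<and>
     remaining M gs' rt' hs = remaining M ((c, x) # gs) rt hs \<and> work M gs' < work M ((c, x) # gs) \<and> keep s s') s"
    (is "wp _ ?post s")
proof -
  have n: "nrep c s (s CUR 0)" "2 * s NX 0 + 2 < N" using e by (auto simp: est_def curg_def cells_def simp del: nrep.simps)
  then have N: "s CUR 0 < N" "0 < N" using nrep_bounds[OF n(1)] by auto
  show ?thesis
  proof (cases c)
    case (Item A)
    have "wp step_item ?post s"
    proof (rule wp_mono[OF wp_step_item[OF e[unfolded Item]]])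
      fix s' assume *: "est s' gs ((fst x, A) # rt) hs \<and> keep s s'"
      have "remaining M gs ((fst x, A) # rt) hs = remaining M ((c, x) # gs) rt hs" unfolding Item by (rule remaining_Item[symmetric])
      moreover have "work M gs < work M ((c, x) # gs)" by (simp add: Item)
      ultimately show "?post s'" using * by blast
    qed
    then show ?thesis using n N Item by simp
  next
    case (Prd w1 a w2 b)
    have "wp step_prod ?post s"
    proof (rule wp_mono[OF wp_step_prod[OF e[unfolded Prd]]])
      fix s' assume *: "est s' ((a, app M w1 x) # (b, app M w2 x) # gs) rt hs \<and> keep s s'"
      have "remaining M ((a, app M w1 x) # (b, app M w2 x) # gs) rt hs = remaining M ((c, x) # gs) rt hs"
        unfolding Prd by (rule remaining_Prd[symmetric])
      moreover have "work M ((a, app M w1 x) # (b, app M w2 x) # gs) < work M ((c, x) # gs)"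
        using length_first_pos[of M a "app M w1 x"] length_first_pos[of M b "app M w2 x"]
        by (simp only: Prd work_simps first.simps fst_conv snd_conv length_append) arith
      ultimately show "?post s'" using * by blast
    qed
    then show ?thesis using n N Prd by simp
  qed (use c in blast)
qed

lemma wp_expand_body:
  assumes e: "est s gs rt hs" and ne: "gs \<noteq> []"
  shows "wp expand_body (\<lambda>s'. \<exists>gs' rt' hs'. est s' gs' rt' hs' \<and>
     remaining M gs' rt' hs' = remaining M gs rt hs \<and> work M gs' < work M gs \<and> keep s s') s"
    (is "wp _ ?post s")
proof -
  obtain c x gs0 where gs: "gs = (c, x) # gs0" using ne by (cases gs) auto
  have n: "nrep c s (s CUR 0)" "2 * s NX 0 + 2 < N" "norm M x" using e by (auto simp: est_def curg_def cells_def gs simp del: nrep.simps)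
  then have N: "s CUR 0 < N" "2 < N" using nrep_bounds[OF n(1)] by auto
  have M: "2 < M" using N N_le by simp
  have k: "s KIND (s CUR 0) = (case c of Item _ \<Rightarrow> 0 | Alt _ _ _ _ \<Rightarrow> 1 | Prd _ _ _ _ \<Rightarrow> 2)" using n(1) by (cases c) auto
  have nq: "aval (neq (Ar KIND (Vr CUR)) 1) s = 0 \<longleftrightarrow> s KIND (s CUR 0) = 1"
    using aval_neq[of "Ar KIND (Vr CUR)" s 1] k M by (simp split: circ.splits)
  show ?thesis
  proof (cases "\<exists>w1 a w2 b. c = Alt w1 a w2 b")
    case True
    then obtain w1 a w2 b where c: "c = Alt w1 a w2 b" by blast
    let ?lm = "leftmost M c" let ?gs = "(fst ?lm, app M (snd ?lm) x) # gs0"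
    have "wp expand_alt (wp (Cond (Ar KIND (Vr CUR)) step_prod step_item) ?post) s"
    proof (rule wp_mono[OF wp_expand_alt[OF e[unfolded gs c]]])
      fix s1 assume *: "est s1 ((fst (leftmost M (Alt w1 a w2 b)), app M (snd (leftmost M (Alt w1 a w2 b))) x) # gs0) rt
         ((Alt w1 a w2 b, x, gs0, rt) # hs) \<and> keep s s1"
      then have e1: "est s1 ?gs rt ((c, x, gs0, rt) # hs)" by (simp only: c)
      have r: "remaining M gs rt hs = remaining M ?gs rt ((c, x, gs0, rt) # hs)"
        unfolding gs by (rule remaining_Alt[OF n(3)])
      have w: "work M gs = work M ?gs" using first_leftmost[OF n(3), of c] by (simp add: gs)
      show "wp (Cond (Ar KIND (Vr CUR)) step_prod step_item) ?post s1"
        unfolding r w by (rule wp_mono[OF wp_terminal[OF e1 leftmost_terminal]]) (use * keep_trans in blast)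
    qed
    then show ?thesis using nq k c N by (simp add: expand_body_def del: wp.simps(4) add: wp.simps(4)[of "neq e n" for e n])
  next
    case False
    have "wp (Cond (Ar KIND (Vr CUR)) step_prod step_item) ?post s"
      unfolding gs by (rule wp_mono[OF wp_terminal[OF e[unfolded gs]]]) (use False in blast)+
    moreover have "s KIND (s CUR 0) \<noteq> 1" using False k by (auto split: circ.splits)
    ultimately show ?thesis using nq N by (simp add: expand_body_def del: wp.simps(4) add: wp.simps(4)[of "neq e n" for e n])
  qed
qed

text \<open>When no goal is left, \<open>remaining\<close> shows the finished list followed by what
  the choices still owe.\<close>

lemma runs_expand:
  assumes "est s gs rt hs"
  shows "runs (Loop (Vr CUR) expand_body) s ((cost expand_body + 2) * work M gs + 1) [] (\<lambda>s'. \<exists>rt' hs'. est s' [] rt' hs' \<and>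
     rev rt' # pending M hs' = remaining M gs rt hs \<and> keep s s')"
proof -
  define I where "I = (\<lambda>m s1. \<exists>gs' rt' hs'. est s1 gs' rt' hs' \<and> remaining M gs' rt' hs' = remaining M gs rt hs \<and> work M gs' = m \<and> keep s s1)"
  have "runs (Loop (Vr CUR) expand_body) s ((cost expand_body + 2) * work M gs + 1) []
    (\<lambda>s'. \<exists>m'. I m' s' \<and> aval (Vr CUR) s' = 0)"
  proof (rule runs_Loop)
    show "I (work M gs) s" using assms keep_refl unfolding I_def by blast
  next
    fix m s1 assume "I m s1" "aval (Vr CUR) s1 \<noteq> 0"
    then obtain gs1 rt1 hs1 where 1: "est s1 gs1 rt1 hs1" "remaining M gs1 rt1 hs1 = remaining M gs rt hs" "work M gs1 = m" "keep s s1"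
      "s1 CUR 0 \<noteq> 0" unfolding I_def by auto
    then have "gs1 \<noteq> []" using curg_cases[of s1 gs1] by (simp add: est_def)
    show "wp expand_body (\<lambda>s'. \<exists>m'<m. I m' s') s1"
    proof (rule wp_mono[OF wp_expand_body[OF 1(1) \<open>gs1 \<noteq> []\<close>]])
      fix s2 assume "\<exists>gs' rt' hs'. est s2 gs' rt' hs' \<and> remaining M gs' rt' hs' = remaining M gs1 rt1 hs1 \<and> work M gs' < work M gs1 \<and> keep s1 s2"
      then obtain gs2 rt2 hs2 where 2: "est s2 gs2 rt2 hs2" "remaining M gs2 rt2 hs2 = remaining M gs1 rt1 hs1" "work M gs2 < work M gs1" "keep s1 s2" by blast
      have "I (work M gs2) s2" unfolding I_def using 2(1) trans[OF 2(2) 1(2)] keep_trans[OF 1(4) 2(4)] by blast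
      then show "\<exists>m'<m. I m' s2" using 1(3) 2(3) by blast
    qed
  qed (use B in simp)
  then show ?thesis
  proof (rule runs_weaken)
    fix s' assume "\<exists>m'. I m' s' \<and> aval (Vr CUR) s' = 0"
    then obtain gs1 rt1 hs1 where 1: "est s' gs1 rt1 hs1" "remaining M gs1 rt1 hs1 = remaining M gs rt hs" "keep s s'"
      "s' CUR 0 = 0" unfolding I_def by auto
    then have "gs1 = []" using curg_cases[of s' gs1] by (simp add: est_def)
    then have "rev rt1 # pending M hs1 = remaining M gs rt hs" using 1(2) by (simp add: remaining_def)
    then show "\<exists>rt' hs'. est s' [] rt' hs' \<and> rev rt' # pending M hs' = remaining M gs rt hs \<and> keep s s'"
      using 1 \<open>gs1 = []\<close> by blast
  qed simp
qed

lemma wp_find_first: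
  assumes e: "est s gs rt hs" "gs \<noteq> []"
  shows "wp find_first (\<lambda>s'. est s' gs rt hs \<and> zrep (s' F0 0) (s' F1 0) (zeroth (rev rt @ firsts M gs))) s"
    (is "wp _ ?post s")
proof -
  obtain c x gs0 where gs: "gs = (c, x) # gs0" using e(2) by (cases gs) auto
  have e': "cells s" "nrep c s (s CUR 0)" "s XY 1 = fst x" "s XY 2 = snd x" "norm M x" "s GP 0 < s SP 0" "grep s (s GP 0) gs0"
    "s TP 0 < s SP 0" "trep s (s TP 0) rt" "s CP 0 < s SP 0" "hrep s (s CP 0) hs" "s SP 0 \<le> B"
    using e by (auto simp: est_def curg_def gs simp del: nrep.simps)
  have n: "s CUR 0 < s NX 0" using nrep_bounds[OF e'(2)] by simp
  have N: "2 < N" "2 * s NX 0 + 2 < N" "s TP 0 < N" "s GP 0 < N" using B e' by (auto simp: cells_def)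
  have est: "est (upd F1 0 v (upd F0 0 f s)) gs rt hs" for f v
  proof -
    have h: "hagree b s (upd F1 0 v (upd F0 0 f s))" for b by (auto intro!: hagree_upd hagree_refl)
    show ?thesis using e nrep_hagree[OF h e'(2)] grep_hagree[OF h e'(6,7)] trep_hagree[OF h e'(8,9)] hrep_hagree[OF h e'(10,11)]
      by (simp add: est_def curg_def cells_def gs)
  qed
  have t: "zrep (s RF (s TP 0)) (s RFV (s TP 0)) (zeroth (rev rt))" using trep_zrep[OF e'(9)] e'(1) by (simp add: cells_def)
  have g: "zrep (s GF (s GP 0)) (s GFV (s GP 0)) (zeroth (firsts M gs0))" using grep_zrep[OF e'(7)] e'(1) by (simp add: cells_def)
  have fr: "frep s (s CUR 0) (fx M c)" by (rule nrep_frep[OF e'(2)])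
  have zf: "zeroth (first M c x) = map_option (\<lambda>p. follow M p x) (fx M c)" by (rule zeroth_first[OF e'(5)])
  show ?thesis
  proof (cases "zeroth (rev rt)")
    case (Some i)
    then have "s RF (s TP 0) \<noteq> 0" "zrep 1 (s RFV (s TP 0)) (zeroth (rev rt @ firsts M gs))"
      using t by (auto simp: zrep_def zeroth_append)
    then show ?thesis using est N by (simp add: find_first_def)
  next
    case rt: None
    then have r: "s RF (s TP 0) = 0" using t by (simp add: zrep_def)
    show ?thesis
    proof (cases "fx M c")
      case None
      then have "s FB (s CUR 0) = 0" "zrep (s GF (s GP 0)) (s GFV (s GP 0)) (zeroth (rev rt @ firsts M gs))"
        using g rt zf fr by (simp_all add: zeroth_append gs frep_def)
      then show ?thesis using est N n r by (simp add: find_first_def)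
    next
      case (Some q)
      obtain b d where q: "q = (b, d)" by fastforce
      have f: "s FB (s CUR 0) = eb b" "s FC (s CUR 0) = d" using fr Some by (simp_all add: frep_def q)
      have "zrep 1 ((s XY (eb b) + d) mod M) (zeroth (rev rt @ firsts M gs))"
        using rt zf Some q e'(3,4) by (cases b) (simp_all add: zeroth_append gs zrep_def follow_def sel_def)
      moreover have "eb b < N" using N by (cases b) auto
      ultimately show ?thesis using est N n r f by (simp add: find_first_def)
    qed
  qed
qed

text \<open>Eight steps per cell: at most five for the two tests and the output, one to advance, and
  two for the loop.\<close>

lemma runs_walk:
  assumes items: "\<And>p i A. p \<noteq> 0 \<Longrightarrow> p < b \<Longrightarrow> nrep (Item A) s (s RN' p) \<Longrightarrow> s RX p = i \<Longrightarrow> i < M \<Longrightarrow>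
      ok e1 (upd PP 0 p s) \<and> ok e2 (upd PP 0 p s) \<and> (aval e1 (upd PP 0 p s) \<noteq> 0 \<and> aval e2 (upd PP 0 p s) \<noteq> 0 \<longleftrightarrow> P (i, A))"
    and b: "b \<le> N" "0 < N"
  shows "trep s p rt \<Longrightarrow> p < b \<Longrightarrow> runs (walk e1 e2) (upd PP 0 p s) (8 * length rt + 1) (map (Word \<circ> fst) (filter P rt)) (\<lambda>s'. s' = upd PP 0 0 s)"
proof (induction rt arbitrary: p)
  case Nil
  then have p: "p = 0" by simp
  have "runs (walk e1 e2) (upd PP 0 0 s) 1 [] (\<lambda>s'. s' = upd PP 0 0 s)"
    unfolding walk_def by (rule runs_LoopF) (use b in auto)
  then show ?case by (simp add: p)
next
  case (Cons z rt)
  obtain i A where z: "z = (i, A)" by fastforce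
  have c: "0 < p" "nrep (Item A) s (s RN' p)" "s RX p = i" "s RNX p < p" "trep s (s RNX p) rt" "i < M"
    using Cons.prems by (auto simp: z simp del: nrep.simps)
  define s1 where "s1 = upd PP 0 p s"
  have v: "ok e1 s1" "ok e2 s1" "aval e1 s1 \<noteq> 0 \<and> aval e2 s1 \<noteq> 0 \<longleftrightarrow> P z"
    using items[of p A i] c Cons.prems(2) by (auto simp: s1_def z)
  let ?body = "Sq (Cond e1 (Cond e2 (Out (Ar RX (Vr PP))) Skip) Skip) (PP ::= Ar RNX (Vr PP))"
  have sk: "runs Skip s1 m [] (\<lambda>s'. s' = s1)" for m
    by (rule runs_weaken[OF runs_Skip[where R = "\<lambda>s'. s' = s1"]]) auto
  have o: "runs (Cond e1 (Cond e2 (Out (Ar RX (Vr PP))) Skip) Skip) s1 5 (if P z then [Word i] else []) (\<lambda>s'. s' = s1)"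
  proof (rule runs_weaken[OF runs_Cond[where n = 3, OF v(1)]])
    show "runs (Cond e2 (Out (Ar RX (Vr PP))) Skip) s1 3 (if P z then [Word i] else []) (\<lambda>s'. s' = s1)" if "aval e1 s1 \<noteq> 0"
    proof (rule runs_weaken[OF runs_Cond[where n = 1, OF v(2)]])
      have "runs (Out (Ar RX (Vr PP))) s1 1 [Word (aval (Ar RX (Vr PP)) s1)] (\<lambda>s'. s' = s1)"
        by (rule runs_Out) (use b Cons.prems(2) in \<open>auto simp: s1_def\<close>)
      then show "runs (Out (Ar RX (Vr PP))) s1 1 (if P z then [Word i] else []) (\<lambda>s'. s' = s1)" if "aval e2 s1 \<noteq> 0"
        using v(3) that \<open>aval e1 s1 \<noteq> 0\<close> c by (simp add: s1_def)
      show "runs Skip s1 1 (if P z then [Word i] else []) (\<lambda>s'. s' = s1)" if "aval e2 s1 = 0"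
        using v(3) that sk[of 1] by simp
    qed auto
    show "runs Skip s1 3 (if P z then [Word i] else []) (\<lambda>s'. s' = s1)" if "aval e1 s1 = 0"
      using v(3) that sk[of 3] by simp
  qed auto
  have "runs ?body s1 (5 + 1) ((if P z then [Word i] else []) @ []) (\<lambda>s'. s' = upd PP 0 (s RNX p) s)"
  proof (rule runs_Sq[OF o])
    fix s' assume "s' = s1"
    then show "runs (PP ::= Ar RNX (Vr PP)) s' 1 [] (\<lambda>s'. s' = upd PP 0 (s RNX p) s)"
      using b Cons.prems(2) by (intro runs_Set) (auto simp: s1_def upd_def fun_eq_iff)
  qed
  then have body: "runs ?body s1 6 (if P z then [Word i] else []) (\<lambda>s'. s' = upd PP 0 (s RNX p) s)" by simp
  have ih: "runs (walk e1 e2) (upd PP 0 (s RNX p) s) (8 * length rt + 1) (map (Word \<circ> fst) (filter P rt)) (\<lambda>s'. s' = upd PP 0 0 s)"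
    by (rule Cons.IH[OF c(5)]) (use c(4) Cons.prems(2) in simp)
  have "runs ?body s1 6 (if P z then [Word i] else [])
    (\<lambda>s'. runs (walk e1 e2) s' (8 * length rt + 1) (map (Word \<circ> fst) (filter P rt)) (\<lambda>s'. s' = upd PP 0 0 s))"
    by (rule runs_weaken[OF body]) (use ih in simp_all)
  then have "runs (walk e1 e2) s1 (6 + (8 * length rt + 1) + 2) ((if P z then [Word i] else []) @ map (Word \<circ> fst) (filter P rt)) (\<lambda>s'. s' = upd PP 0 0 s)"
    unfolding walk_def by (intro runs_LoopT) (use b c in \<open>auto simp: s1_def\<close>)
  then show ?case unfolding s1_def by (cases "P z") (simp_all add: z o_def)
qed

lemma wp_backtrack:
  assumes e: "est s [] rt ((u, y, gs, rt1) # hs)"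
  shows "wp backtrack (\<lambda>s'. \<exists>gs' rt' hs'. gs' \<noteq> [] \<and> est s' gs' rt' hs' \<and>
    remaining M gs' rt' hs' = pending M ((u, y, gs, rt1) # hs)) s"
    (is "wp _ ?post s")
proof -
  obtain w1 a w2 b where u: "u = Alt w1 a w2 b" using e by (auto simp: est_def)
  define p where "p = s CP 0"
  define n where "n = s HN p"
  have e': "cells s" "0 < p" "p < s SP 0" "s HX1 p = fst y" "s HX2 p = snd y" "norm M y" "s HG p < p" "s HT p < p" "s HNX p < p"
    "grep s (s HG p) gs" "trep s (s HT p) rt1" "hrep s (s HNX p) hs" "p + need u + needs gs \<le> B" "nrep u s n" "s SP 0 \<le> B"
    using e by (auto simp: est_def p_def n_def u simp del: nrep.simps)
  have ns: "n < s NX 0" "s LN n < n" "s RN n < n" "wrep s LB LC n w1" "wrep s RB RC n w2" "nrep a s (s LN n)" "nrep b s (s RN n)"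
    using e'(14) by (auto simp: u)
  have N: "2 < N" "p + 1 < N" "2 * s NX 0 + 2 < N" "2 < M" "s LN n < N" using B e' ns N_le by (auto simp: cells_def)
  let ?rest = "seqs [apply_weight RB RC (Vr CUR), CUR ::= Ar RN (Vr CUR)]"
  \<comment> \<open>The common end of both branches: once the rest of the left child is among the
    choices, the right child is entered.\<close>
  have rest: "wp ?rest ?post t"
    if h: "hagree p s t" and t: "t CUR 0 = n" "t XY 1 = fst y" "t XY 2 = snd y" "p \<le> t SP 0" "t GP 0 = s HG p" "t TP 0 = s HT p"
      "t CP 0 < t SP 0" "hrep t (t CP 0) hs'" "t SP 0 + need b + needs gs \<le> B"
      and r: "remaining M ((b, app M w2 y) # gs) rt1 hs' = pending M ((u, y, gs, rt1) # hs)" for t hs'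
  proof -
    define t1 where "t1 = upd CUR 0 (t RN n) (set_pos (app M w2 y) t)"
    have h': "hagree b' t t1" for b' unfolding t1_def by (auto intro!: hagree_upd hagree_set_pos hagree_refl)
    note h1 = hagree_trans[OF h h'[of p]]
    have bn: "t j = s j" if "j \<in> build_names" for j using h that by (simp add: hagree_def)
    have g0: "t GF 0 = s GF 0" "t RF 0 = s RF 0" using h e'(2) by (simp_all add: hagree_def)
    have c: "t1 CUR 0 = s RN n" "t1 XY 1 = fst (app M w2 y)" "t1 XY 2 = snd (app M w2 y)" "t1 SP = t SP" "t1 GP = t GP" "t1 TP = t TP"
      "t1 CP = t CP" "t1 GF = t GF" "t1 RF = t RF" "t1 NX = t NX" using bn[of RN] by (simp_all add: t1_def)
    have "est t1 ((b, app M w2 y) # gs) rt1 hs'"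
      using c g0 bn[of NX] e' t nrep_hagree[OF h1 ns(7)] grep_hagree[OF h1 e'(7,10)] trep_hagree[OF h1 e'(8,11)]
        hrep_hagree[OF h', of "t CP 0" "Suc (t CP 0)" hs'] norm_app[of M w2 y]
      by (simp add: est_def curg_def cells_def)
    then have "?post t1" using r by blast
    moreover have "wrep t RB RC n w2" using ns(5) bn[of RB] bn[of RC] by (simp add: wrep_def)
    ultimately have "wp (apply_weight RB RC (Vr CUR)) (wp (CUR ::= Ar RN (Vr CUR)) ?post) t"
      by (intro wp_apply_weight[where y = w2]) (use N ns t bn[of RN] in \<open>simp_all add: t1_def\<close>)
    then show ?thesis by simp
  qed
  define s1 where "s1 = upd CP 0 (s HNX p) (upd TP 0 (s HT p) (upd GP 0 (s HG p) (upd XY 2 (snd y) (upd XY 1 (fst y) (upd CUR 0 n (upd SP 0 p s))))))"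
  have h1: "hagree b' s s1" for b' unfolding s1_def by (auto intro!: hagree_upd hagree_refl)
  have v1: "s1 CP 0 = s HNX p" "s1 TP 0 = s HT p" "s1 GP 0 = s HG p" "s1 XY 1 = fst y" "s1 XY 2 = snd y" "s1 CUR 0 = n" "s1 SP 0 = p"
    by (simp_all add: s1_def)
  have bn1: "s1 j = s j" if "j \<in> build_names" for j using h1 that by (simp add: hagree_def)
  have k: "s KIND (s LN n) = (case a of Item _ \<Rightarrow> 0 | Alt _ _ _ _ \<Rightarrow> 1 | Prd _ _ _ _ \<Rightarrow> 2)" using ns(6) by (cases a) auto
  have nq: "aval (neq (Ar KIND (Ar LN (Vr CUR))) 1) s1 = 0 \<longleftrightarrow> s KIND (s LN n) = 1"
    using aval_neq[of "Ar KIND (Ar LN (Vr CUR))" s1 1] k N v1 bn1[of KIND] bn1[of LN] by (simp split: circ.splits)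
  let ?push = "seqs [PP ::= Vr CUR, Y1 ::= Ar XY (Cn 1), Y2 ::= Ar XY (Cn 2),
       apply_weight LB LC (Vr CUR), CUR ::= Ar LN (Vr CUR), push_choice, CUR ::= Vr PP, Set XY (Cn 1) (Vr Y1), Set XY (Cn 2) (Vr Y2)]"
  have main: "wp (Cond (neq (Ar KIND (Ar LN (Vr CUR))) 1) Skip ?push) (wp ?rest ?post) s1"
  proof (cases "\<exists>v1 c v2 d. a = Alt v1 c v2 d")
    case True
    then obtain v1' c v2' d where a: "a = Alt v1' c v2' d" by blast
    let ?y = "app M w1 y"
    define s2 where "s2 = upd CUR 0 (s LN n) (set_pos ?y (upd Y2 0 (snd y) (upd Y1 0 (fst y) (upd PP 0 n s1))))"
    define s3 where "s3 = upd XY 2 (snd y) (upd XY 1 (fst y) (upd CUR 0 n (pushed_choice s2)))"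
    have h2: "hagree b' s s2" for b' unfolding s2_def s1_def by (auto intro!: hagree_upd hagree_set_pos hagree_refl)
    have h23: "hagree p s2 s3" using hagree_pushed[of s2] unfolding s3_def
      by (intro hagree_upd) (auto simp: s2_def s1_def)
    have h3: "hagree b' (pushed_choice s2) s3" for b' unfolding s3_def by (auto intro!: hagree_upd hagree_refl)
    have v2: "s2 SP 0 = p" "s2 CUR 0 = s LN n" "s2 XY 1 = fst ?y" "s2 XY 2 = snd ?y" "s2 GP 0 = s HG p" "s2 TP 0 = s HT p" "s2 CP 0 = s HNX p"
      "s2 PP 0 = n" "s2 Y1 0 = fst y" "s2 Y2 0 = snd y"
      using v1 by (simp_all add: s2_def)
    have sz: "p + need a + needs gs \<le> B" "p + 1 + need b + needs gs \<le> B" using e'(13) by (auto simp: u)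
    have "hrep (pushed_choice s2) (s2 SP 0) ((a, ?y, gs, rt1) # hs)" unfolding a
    proof (rule hrep_pushed)
      show "nrep (Alt v1' c v2' d) s2 (s2 CUR 0)" using nrep_hagree[OF h2 ns(6)] v2 a by simp
      show "grep s2 (s2 GP 0) gs" "trep s2 (s2 TP 0) rt1" "hrep s2 (s2 CP 0) hs"
        using grep_hagree[OF h2 e'(7,10)] trep_hagree[OF h2 e'(8,11)] hrep_hagree[OF h2 e'(9,12)] v2 by auto
      show "norm M ?y" using N by (intro norm_app) simp
      show "s2 SP 0 + need (Alt v1' c v2' d) + needs gs \<le> B" using sz v2 a by simp
    qed (use v2 e' in auto)
    then have hr: "hrep s3 p ((a, ?y, gs, rt1) # hs)" using hrep_hagree[OF h3, of p "Suc p"] v2(1) by (simp del: hrep.simps)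
    have "wp ?rest ?post s3"
    proof (rule rest)
      show "hagree p s s3" by (rule hagree_trans[OF h2 h23])
      show "hrep s3 (s3 CP 0) ((a, ?y, gs, rt1) # hs)" using hr v2 by (simp add: s3_def)
      show "remaining M ((b, app M w2 y) # gs) rt1 ((a, ?y, gs, rt1) # hs) = pending M ((u, y, gs, rt1) # hs)"
        by (simp add: remaining_def u E_def)
    qed (use v2 sz in \<open>auto simp: s3_def\<close>)
    then have w': "wp (seqs [CUR ::= Vr PP, Set XY (Cn 1) (Vr Y1), Set XY (Cn 2) (Vr Y2)]) (wp ?rest ?post) (pushed_choice s2)"
      using N v2 unfolding s3_def by simp
    have w: "wp (seqs [push_choice, CUR ::= Vr PP, Set XY (Cn 1) (Vr Y1), Set XY (Cn 2) (Vr Y2)]) (wp ?rest ?post) s2"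
      unfolding seqs.simps(2)[of push_choice] wp_fun
      by (rule wp_push_choice) (use N v2(1) w' in simp_all)
    let ?c = "seqs [CUR ::= Ar LN (Vr CUR), push_choice, CUR ::= Vr PP, Set XY (Cn 1) (Vr Y1), Set XY (Cn 2) (Vr Y2)]"
    let ?s = "upd Y2 0 (snd y) (upd Y1 0 (fst y) (upd PP 0 n s1))"
    have "wp (apply_weight LB LC (Vr CUR)) (wp ?c (wp ?rest ?post)) ?s"
    proof (rule wp_apply_weight[where y = w1])
      show "wrep ?s LB LC (aval (Vr CUR) ?s) w1"
        using ns(4) v1 bn1[of LB] bn1[of LC] by (simp add: wrep_def)
      have "app M w1 (?s XY 1, ?s XY 2) = ?y"
        using v1 by simp
      then show "wp ?c (wp ?rest ?post) (set_pos (app M w1 (?s XY 1, ?s XY 2)) ?s)"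
        using w N ns v1 bn1[of LN] unfolding s2_def by simp
    qed (use N ns v1 in auto)
    then have "wp ?push (wp ?rest ?post) s1" using v1 N by simp
    then show ?thesis using nq k a N v1 ns bn1[of LN] by (simp del: seqs.simps wp.simps(4) add: wp.simps(4)[of "neq e n" for e n])
  next
    case False
    have "wp ?rest ?post s1"
    proof (rule rest[OF h1])
      have "Er M a x = []" for x using False by (cases a) auto
      then show "remaining M ((b, app M w2 y) # gs) rt1 hs = pending M ((u, y, gs, rt1) # hs)"
        by (simp add: remaining_def u E_def)
      show "hrep s1 (s1 CP 0) hs" using hrep_hagree[OF h1 e'(9,12)] v1 by simp
    qed (use v1 e' u in auto)
    moreover have "s KIND (s LN n) \<noteq> 1" using False k by (auto split: circ.splits)
    ultimately show ?thesis using nq N v1 ns bn1[of LN]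
      by (simp del: seqs.simps wp.simps(4) add: wp.simps(4)[of "neq e n" for e n])
  qed
  show ?thesis using main N e' unfolding s1_def
    by (simp add: backtrack_def p_def[symmetric] n_def[symmetric] wp.simps(4)[of "Vr CP"] del: wp.simps(4))
qed

end

section \<open>The enumeration loop and its delay\<close>

definition enum_loop :: "nat \<Rightarrow> nm rcom" where
  "enum_loop k = Loop (Vr CUR) (Sq start_output (finish_output k))"

definition valid_items :: "nat \<Rightarrow> item list \<Rightarrow> bool" where
  "valid_items k z \<longleftrightarrow> z \<noteq> [] \<and> distinct (map fst z) \<and> (\<forall>(i, A)\<in>set z. A \<noteq> {} \<and> A \<subseteq> {..<k})"

abbreviation head_output :: "item list \<Rightarrow> osym list" where
  "head_output z \<equiv> case zeroth z of None \<Rightarrow> [Comma] | Some i \<Rightarrow> [Word i]"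

definition shows_items :: "nat \<Rightarrow> item list \<Rightarrow> osym list \<Rightarrow> bool" where
  "shows_items k z out \<longleftrightarrow> (\<exists>nss. length nss = k \<and>
     (\<forall>j<k. distinct (nss ! j) \<and> set (nss ! j) = {i. \<exists>A. (i, A) \<in> set z \<and> j \<in> A}) \<and>
     out = concat (map (\<lambda>ns. map Word ns @ [Comma]) nss) @ [Separator])"

text \<open>Every item belongs to some component, so its vertex is written at least once. This turns
  time linear in the number of items into time linear in the output.\<close>

lemma shows_items_length:
  assumes "valid_items k z" "shows_items k z out" shows "length z \<le> length out"
proof -
  obtain nss where nss: "length nss = k" "\<And>j. j < k \<Longrightarrow> set (nss ! j) = {i. \<exists>A. (i, A) \<in> set z \<and> j \<in> A}"
    "out = concat (map (\<lambda>ns. map Word ns @ [Comma]) nss) @ [Separator]"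
    using assms(2) by (auto simp: shows_items_def)
  have "fst ` set z \<subseteq> set (concat nss)"
  proof
    fix i assume "i \<in> fst ` set z"
    then obtain A where A: "(i, A) \<in> set z" by auto
    then obtain j where "j \<in> A" "j < k" using assms(1) by (fastforce simp: valid_items_def)
    then have "i \<in> set (nss ! j)" "nss ! j \<in> set nss" using A nss by auto
    then show "i \<in> set (concat nss)" by auto
  qed
  then have "card (set (map fst z)) \<le> card (set (concat nss))" by (intro card_mono) auto
  also have "\<dots> \<le> length (concat nss)" by (rule card_length)
  also have "\<dots> \<le> length out" unfolding nss(3) by (induction nss) auto
  finally show ?thesis using assms(1) distinct_card[of "map fst z"] by (simp add: valid_items_def)
qed

lemma zeroth_components:
  assumes "distinct (map fst z)"
  shows "zeroth z = None \<Longrightarrow> {i. \<exists>A. (i, A) \<in> set z \<and> 0 \<in> A} = {}"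
    "zeroth z = Some i \<Longrightarrow> {i. \<exists>A. (i, A) \<in> set z \<and> 0 \<in> A} = insert i {i'. \<exists>A. (i', A) \<in> set z \<and> 0 \<in> A \<and> i' \<noteq> i}"
  using zeroth_None[of z] zeroth_Some[of z i] by auto

lemma distinct_filter_fst: "distinct (map fst z) \<Longrightarrow> distinct (map fst (filter P z))"
  by (induction z) auto

context ram_env
begin

lemma runs_seq:
  assumes "runs a s n o1 R" "\<And>s'. R s' \<Longrightarrow> runs b s' n' o2 R'" "n + n' \<le> m" "out = o1 @ o2"
  shows "runs (Sq a b) s m out R'"
  unfolding assms(4) by (rule runs_weaken[OF runs_Sq[OF assms(1,2)] assms(3)])

lemma runs_last: "runs a s n out R \<Longrightarrow> runs (Sq a Skip) s n out R"
  by (rule runs_seq[OF _ runs_Skip]) auto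

end

context enum_mach
begin

definition out0 :: "nat option \<Rightarrow> item list \<Rightarrow> osym list" where
  "out0 o0 rt = (case o0 of None \<Rightarrow> []
     | Some i \<Rightarrow> map (Word \<circ> fst) (filter (\<lambda>(i', A). 0 \<in> A \<and> i' \<noteq> i) rt) @ [Comma])"

definition outj :: "item list \<Rightarrow> nat \<Rightarrow> osym list" where
  "outj rt j = map (Word \<circ> fst) (filter (\<lambda>(i, A). j \<in> A) rt) @ [Comma]"

text \<open>Components are written in the order of the stored solution, newest item first, except
  that component 0 begins with the vertex given by \<open>zeroth\<close>. Within a component any
  order is admissible.\<close>

lemma shows_output:
  assumes "distinct (map fst rt)" "0 < k"
  shows "shows_items k (rev rt) (head_output (rev rt) @
    out0 (zeroth (rev rt)) rt @ concat (map (outj rt) [1..<k]) @ [Separator])"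
proof -
  define n0 where "n0 = (case zeroth (rev rt) of None \<Rightarrow> [] | Some i \<Rightarrow> i # map fst (filter (\<lambda>(i', A). 0 \<in> A \<and> i' \<noteq> i) rt))"
  define f where "f = (\<lambda>j. map fst (filter (\<lambda>(i, A). j \<in> A) rt))"
  define nss where "nss = n0 # map f [1..<k]"
  have d: "distinct (map fst (rev rt))" using assms(1) by (simp add: rev_map[symmetric])
  have n0: "distinct n0 \<and> set n0 = {i. \<exists>A. (i, A) \<in> set (rev rt) \<and> 0 \<in> A}"
  proof (cases "zeroth (rev rt)")
    case None
    then show ?thesis using zeroth_components(1)[OF d] by (simp add: n0_def)
  next
    case (Some i)
    have "distinct n0" using distinct_filter_fst[OF assms(1)] by (auto simp: n0_def Some)
    moreover have "set n0 = insert i {i'. \<exists>A. (i', A) \<in> set (rev rt) \<and> 0 \<in> A \<and> i' \<noteq> i}"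
      by (force simp: n0_def Some)
    ultimately show ?thesis using zeroth_components(2)[OF d Some] by simp
  qed
  have nj: "distinct (nss ! j) \<and> set (nss ! j) = {i. \<exists>A. (i, A) \<in> set (rev rt) \<and> j \<in> A}" if "j < k" for j
  proof (cases j)
    case (Suc m)
    then have "nss ! j = f j" using that by (simp add: nss_def)
    moreover have "distinct (f j)" unfolding f_def by (rule distinct_filter_fst[OF assms(1)])
    moreover have "set (f j) = {i. \<exists>A. (i, A) \<in> set (rev rt) \<and> j \<in> A}" by (force simp: f_def)
    ultimately show ?thesis by simp
  qed (use n0 in \<open>simp add: nss_def\<close>)
  have "map Word n0 @ [Comma] = head_output (rev rt) @ out0 (zeroth (rev rt)) rt"
    by (simp add: n0_def out0_def split: option.split)
  moreover have "map (\<lambda>ns. map Word ns @ [Comma]) (map f [1..<k]) = map (outj rt) [1..<k]"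
    by (simp add: f_def outj_def)
  ultimately have "concat (map (\<lambda>ns. map Word ns @ [Comma]) nss) @ [Separator] = head_output (rev rt) @
    out0 (zeroth (rev rt)) rt @ concat (map (outj rt) [1..<k]) @ [Separator]"
    unfolding nss_def list.map concat.simps by (metis append.assoc)
  then show ?thesis unfolding shows_items_def using nj assms(2)
    by (intro exI[of _ nss]) (auto simp: nss_def)
qed

lemma est_upd_PP: "est s gs rt hs \<Longrightarrow> est (upd PP 0 v s) gs rt hs"
proof -
  assume e: "est s gs rt hs"
  have h: "hagree b s (upd PP 0 v s)" for b by (auto intro!: hagree_upd hagree_refl)
  have "curg (upd PP 0 v s) gs"
  proof (cases gs)
    case (Cons g gs')
    then show ?thesis using e nrep_hagree[OF h, of "fst g" "s CUR 0"] grep_hagree[OF h, of "s GP 0" "s SP 0" gs']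
      by (auto simp: est_def curg_def simp del: nrep.simps)
  qed (use e in \<open>simp add: est_def curg_def\<close>)
  then show ?thesis using e trep_hagree[OF h, of "s TP 0" "s SP 0" rt] hrep_hagree[OF h, of "s CP 0" "s SP 0" hs]
    by (simp add: est_def cells_def)
qed

lemma runs_component:
  assumes e: "est s [] rt hs" and j: "j < k"
  shows "runs (component j) s (8 * length rt + 3) (outj rt j) (\<lambda>s'. s' = upd PP 0 0 s)"
proof -
  have e': "trep s (s TP 0) rt" "s TP 0 < s SP 0" "s SP 0 \<le> B" "2 * s NX 0 + 2 < N" using e by (auto simp: est_def cells_def)
  have w: "runs (walk (Ar (MEM j) (Ar RN' (Vr PP))) (Cn 1)) (upd PP 0 (s TP 0) s) (8 * length rt + 1)
    (map (Word \<circ> fst) (filter (\<lambda>(i, A). j \<in> A) rt)) (\<lambda>s'. s' = upd PP 0 0 s)"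
  proof (rule runs_walk[OF _ _ _ e'(1,2)])
    fix p i A assume p: "p \<noteq> 0" "p < s SP 0" "nrep (Item A) s (s RN' p)" "s RX p = i"
    then have "s (MEM j) (s RN' p) = (if j \<in> A then 1 else 0)" "s RN' p < s NX 0" using j by auto
    then show "ok (Ar (MEM j) (Ar RN' (Vr PP))) (upd PP 0 p s) \<and> ok (Cn 1) (upd PP 0 p s) \<and>
      (aval (Ar (MEM j) (Ar RN' (Vr PP))) (upd PP 0 p s) \<noteq> 0 \<and> aval (Cn 1) (upd PP 0 p s) \<noteq> 0 \<longleftrightarrow> (\<lambda>(i, A). j \<in> A) (i, A))"
      using p e' B by auto
  qed (use e' B in auto)
  have "runs (PP ::= Vr TP) s 1 [] (\<lambda>s'. s' = upd PP 0 (s TP 0) s)" using B by (intro runs_Set) auto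
  then show ?thesis unfolding component_def seqs.simps
  proof (rule runs_seq)
    fix s' assume "s' = upd PP 0 (s TP 0) s"
    with w have "runs (walk (Ar (MEM j) (Ar RN' (Vr PP))) (Cn 1)) s' (8 * length rt + 1)
      (map (Word \<circ> fst) (filter (\<lambda>(i, A). j \<in> A) rt)) (\<lambda>s'. s' = upd PP 0 0 s)" by simp
    then show "runs (Sq (walk (Ar (MEM j) (Ar RN' (Vr PP))) (Cn 1)) (Sq (Emit Comma) Skip)) s' (8 * length rt + 2) (outj rt j) (\<lambda>s'. s' = upd PP 0 0 s)"
      by (rule runs_seq) (auto intro: runs_last runs_Emit simp: outj_def)
  qed auto
qed

lemma runs_rest_component:
  assumes e: "est s [] rt hs" and k: "0 < k" and z: "zrep (s F0 0) (s F1 0) (zeroth (rev rt))"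
  shows "runs rest_component s (8 * length rt + 5) (out0 (zeroth (rev rt)) rt) (\<lambda>s'. est s' [] rt hs)"
proof (cases "zeroth (rev rt)")
  case None
  then show ?thesis unfolding rest_component_def using z e B
    by (intro runs_weaken[OF runs_Cond[where n = 0 and R = "\<lambda>s'. est s' [] rt hs"]])
      (auto simp: zrep_def out0_def intro: runs_Skip)
next
  case (Some i)
  then have f: "s F0 0 \<noteq> 0" "s F1 0 = i" using z by (auto simp: zrep_def)
  have e': "trep s (s TP 0) rt" "s TP 0 < s SP 0" "s SP 0 \<le> B" "2 * s NX 0 + 2 < N" using e by (auto simp: est_def cells_def)
  have lt: "fst z < M" if "z \<in> set rt" "trep s p rt" for z p
    using that by (induction rt arbitrary: p) auto
  have i: "i < M" using zeroth_Some[OF Some] lt[OF _ e'(1)] by fastforce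
  let ?e1 = "Ar (MEM 0) (Ar RN' (Vr PP))" and ?e2 = "Pl (Mi (Ar RX (Vr PP)) (Vr F1)) (Mi (Vr F1) (Ar RX (Vr PP)))"
  let ?P = "\<lambda>(i', A). 0 \<in> A \<and> i' \<noteq> i"
  have w: "runs (walk ?e1 ?e2) (upd PP 0 (s TP 0) s) (8 * length rt + 1) (map (Word \<circ> fst) (filter ?P rt)) (\<lambda>s'. s' = upd PP 0 0 s)"
  proof (rule runs_walk[OF _ _ _ e'(1,2)])
    fix p i' A assume p: "p \<noteq> 0" "p < s SP 0" "nrep (Item A) s (s RN' p)" "s RX p = i'" "i' < M"
    then have "s (MEM 0) (s RN' p) = (if 0 \<in> A then 1 else 0)" "s RN' p < s NX 0" using k by auto
    moreover have "(i' - i + (i - i')) mod M \<noteq> 0 \<longleftrightarrow> i' \<noteq> i" using i p(5) by (cases i i' rule: linorder_cases) auto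
    ultimately show "ok ?e1 (upd PP 0 p s) \<and> ok ?e2 (upd PP 0 p s) \<and>
      (aval ?e1 (upd PP 0 p s) \<noteq> 0 \<and> aval ?e2 (upd PP 0 p s) \<noteq> 0 \<longleftrightarrow> ?P (i', A))"
      using p e' B f by auto
  qed (use e' B in auto)
  have 1: "runs (PP ::= Vr TP) s 1 [] (\<lambda>s'. s' = upd PP 0 (s TP 0) s)" using B by (intro runs_Set) auto
  have 2: "runs (seqs [PP ::= Vr TP, walk ?e1 ?e2, Emit Comma]) s (8 * length rt + 3) (out0 (zeroth (rev rt)) rt) (\<lambda>s'. s' = upd PP 0 0 s)"
    unfolding seqs.simps
  proof (rule runs_seq[OF 1])
    fix s' assume "s' = upd PP 0 (s TP 0) s"
    with w have "runs (walk ?e1 ?e2) s' (8 * length rt + 1) (map (Word \<circ> fst) (filter ?P rt)) (\<lambda>s'. s' = upd PP 0 0 s)" by simp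
    then show "runs (Sq (walk ?e1 ?e2) (Sq (Emit Comma) Skip)) s' (8 * length rt + 2) (out0 (zeroth (rev rt)) rt) (\<lambda>s'. s' = upd PP 0 0 s)"
      by (rule runs_seq) (auto intro: runs_last runs_Emit simp: out0_def Some)
  qed auto
  have "runs rest_component s (8 * length rt + 3 + 2) (out0 (zeroth (rev rt)) rt) (\<lambda>s'. s' = upd PP 0 0 s)"
    unfolding rest_component_def by (rule runs_Cond) (use f B 2 in auto)
  then show ?thesis by (rule runs_weaken) (use est_upd_PP[OF e] in auto)
qed

text \<open>\<open>Ca\<close> bounds the steps up to the first symbol, including the loop test.
  \<open>Cb\<close> is the factor per item for the rest: its summands pay for the search, the
  \<open>k\<close> components and the backtracking, each generously rounded up.\<close>

definition Ca :: nat where "Ca = cost find_first + 4"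
definition Cb :: nat where "Cb = 4 * (cost expand_body + 2) + 11 * k + 25 + cost backtrack"

lemma runs_start_output:
  assumes e: "est s gs rt hs" "gs \<noteq> []" and z: "z = rev rt @ firsts M gs"
  shows "runs start_output s (Ca - 1) (head_output z)
    (\<lambda>s'. est s' gs rt hs \<and> zrep (s' F0 0) (s' F1 0) (zeroth z))"
  unfolding start_output_def z
proof (rule runs_seq[OF wp_runs[OF wp_find_first[OF e]]])
  fix s' assume *: "est s' gs rt hs \<and> zrep (s' F0 0) (s' F1 0) (zeroth (rev rt @ firsts M gs))"
  let ?R = "\<lambda>s'. est s' gs rt hs \<and> zrep (s' F0 0) (s' F1 0) (zeroth (rev rt @ firsts M gs))"
  have o: "runs (Out (Vr F1)) s' 1 [Word (aval (Vr F1) s')] ?R" by (rule runs_Out) (use B * in auto)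
  have c: "runs (Emit Comma) s' 1 [Comma] ?R" by (rule runs_Emit) (rule *)
  show "runs (Cond (Vr F0) (Out (Vr F1)) (Emit Comma)) s' 3 (head_output (rev rt @ firsts M gs)) ?R"
  proof (rule runs_weaken[OF runs_Cond[where n = 1]])
    show "runs (Out (Vr F1)) s' 1 (head_output (rev rt @ firsts M gs)) ?R" if "aval (Vr F0) s' \<noteq> 0"
      using o that * by (auto simp: zrep_def split: option.splits)
    show "runs (Emit Comma) s' 1 (head_output (rev rt @ firsts M gs)) ?R" if "aval (Vr F0) s' = 0"
      using c that * by (auto simp: zrep_def split: option.splits)
  qed (use B in auto)
qed (auto simp: Ca_def)

abbreviation continues :: "state \<Rightarrow> item list list \<Rightarrow> bool" where
  "continues s zs \<equiv> if zs = [] then s CUR 0 = 0 else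
     \<exists>gs rt hs. gs \<noteq> [] \<and> est s gs rt hs \<and> remaining M gs rt hs = zs"

lemma runs_finish_output:
  assumes e: "est s gs rt hs" and r: "remaining M gs rt hs = z # zs" and v: "valid_items k z"
    and z: "zrep (s F0 0) (s F1 0) (zeroth z)"
  shows "\<exists>out. runs (finish_output k) s (Cb * length z - 3) out (\<lambda>s'. continues s' zs) \<and>
    shows_items k z (head_output z @ out)"
proof -
  let ?R = "\<lambda>s'. continues s' zs"
  let ?out = "out0 (zeroth z) (rev z) @ concat (map (outj (rev z)) [1..<k]) @ [Separator]"
  let ?n = "length z"
  have n: "0 < ?n" using v by (auto simp: valid_items_def)
  have k: "0 < k"
  proof -
    obtain i A where "(i, A) \<in> set z" using n by (cases z) auto
    then show ?thesis using v by (fastforce simp: valid_items_def)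
  qed
  have w: "work M gs \<le> 2 * ?n"
    using work_firsts[of M gs] remaining_first[of M gs rt hs] r by auto
  have ex: "runs (Loop (Vr CUR) expand_body) s ((cost expand_body + 2) * (2 * ?n) + 1) []
     (\<lambda>s'. \<exists>hs'. est s' [] (rev z) hs' \<and> pending M hs' = zs \<and> zrep (s' F0 0) (s' F1 0) (zeroth z))"
  proof (rule runs_weaken[OF runs_expand[OF e]])
    show "(cost expand_body + 2) * work M gs + 1 \<le> (cost expand_body + 2) * (2 * ?n) + 1"
      using w by (intro add_le_mono1 mult_le_mono2)
    fix s' assume "\<exists>rt' hs'. est s' [] rt' hs' \<and> rev rt' # pending M hs' = remaining M gs rt hs \<and> keep s s'"
    then obtain rt' hs' where 1: "est s' [] rt' hs'" "rev rt' = z" "pending M hs' = zs" "keep s s'" using r by auto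
    then have "rt' = rev z" by auto
    then show "\<exists>hs'. est s' [] (rev z) hs' \<and> pending M hs' = zs \<and> zrep (s' F0 0) (s' F1 0) (zeroth z)"
      using 1 z by (auto simp: keep_def)
  qed
  have "runs (finish_output k) s (Cb * ?n - 3) ?out ?R" unfolding finish_output_def seqs.simps
  proof (rule runs_seq[OF ex])
    fix s1 assume "\<exists>hs'. est s1 [] (rev z) hs' \<and> pending M hs' = zs \<and> zrep (s1 F0 0) (s1 F1 0) (zeroth z)"
    then obtain hs' where 1: "est s1 [] (rev z) hs'" "pending M hs' = zs" "zrep (s1 F0 0) (s1 F1 0) (zeroth z)" by blast
    have bt: "wp backtrack ?R s2" if e2: "est s2 [] (rev z) hs'" for s2
    proof (cases hs')
      case Nil
      then have "s2 CP 0 = 0" "zs = []" using e2 1(2) by (auto simp: est_def)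
      then show ?thesis using B by (simp add: backtrack_def wp.simps(4)[of "Vr CP"])
    next
      case (Cons h hs1)
      obtain u y gs1 rt1 where h: "h = (u, y, gs1, rt1)" by (metis prod_cases4)
      show ?thesis
      proof (rule wp_mono[OF wp_backtrack[OF e2[unfolded Cons h]]])
        fix s' assume *: "\<exists>gs' rt' hs'. gs' \<noteq> [] \<and> est s' gs' rt' hs' \<and> remaining M gs' rt' hs' = pending M ((u, y, gs1, rt1) # hs1)"
        have p: "pending M ((u, y, gs1, rt1) # hs1) = zs" using 1(2) by (simp only: Cons h)
        from * obtain gs' rt' hs2 where 2: "gs' \<noteq> []" "est s' gs' rt' hs2" "remaining M gs' rt' hs2 = zs" unfolding p by blast
        have "zs \<noteq> []" using remaining_first[of M gs' rt' hs2] 2(3) by auto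
        then show "?R s'" using 2 by auto
      qed
    qed
    have rc: "runs rest_component s1 (8 * ?n + 5) (out0 (zeroth z) (rev z)) (\<lambda>s'. est s' [] (rev z) hs')"
      using runs_rest_component[OF 1(1) k] 1(3) by simp
    show "runs (Sq rest_component (Sq (seqs (map component [1..<k])) (Sq (Emit Separator) (Sq backtrack Skip)))) s1
      ((8 * ?n + 5) + ((8 * ?n + 3) * k + (1 + cost backtrack))) ?out ?R"
    proof (rule runs_seq[OF rc])
      fix s2 assume e2: "est s2 [] (rev z) hs'"
      have "runs (seqs (map component [1..<k])) s2 ((8 * ?n + 3) * length [1..<k]) (concat (map (outj (rev z)) [1..<k])) (\<lambda>s'. est s' [] (rev z) hs')"
      proof (rule runs_seqs[where I = "\<lambda>s'. est s' [] (rev z) hs'", OF _ e2])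
        fix j s' assume j: "j \<in> set [1..<k]" and e3: "est s' [] (rev z) hs'"
        have "runs (component j) s' (8 * length (rev z) + 3) (outj (rev z) j) (\<lambda>s''. s'' = upd PP 0 0 s')"
          by (rule runs_component[OF e3]) (use j in simp)
        then show "runs (component j) s' (8 * ?n + 3) (outj (rev z) j) (\<lambda>s'. est s' [] (rev z) hs')"
          by (rule runs_weaken) (use est_upd_PP[OF e3] in auto)
      qed
      then show "runs (Sq (seqs (map component [1..<k])) (Sq (Emit Separator) (Sq backtrack Skip))) s2
        ((8 * ?n + 3) * k + (1 + cost backtrack)) (concat (map (outj (rev z)) [1..<k]) @ [Separator]) ?R"
      proof (rule runs_seq)
        fix s3 assume e3: "est s3 [] (rev z) hs'"
        have "runs (Emit Separator) s3 1 [Separator] (\<lambda>s'. est s' [] (rev z) hs')" by (rule runs_Emit[where R = "\<lambda>s'. est s' [] (rev z) hs'", OF e3])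
        then show "runs (Sq (Emit Separator) (Sq backtrack Skip)) s3 (1 + cost backtrack) [Separator] ?R"
          by (rule runs_seq[OF _ runs_last[OF wp_runs[OF bt]]]) auto
      qed auto
    qed auto
  next
    have "8 * ?n + 5 + ((8 * ?n + 3) * k + (1 + cost backtrack)) + ((cost expand_body + 2) * (2 * ?n) + 1) + 3 \<le> Cb * ?n"
    proof -
      have n1: "1 \<le> ?n" using n by linarith
      have a: "8 * ?n + 10 \<le> 18 * ?n" using n1 by linarith
      have "(8 * ?n + 3) * k \<le> (11 * ?n) * k" using n1 by (intro mult_le_mono1) linarith
      then have b: "(8 * ?n + 3) * k \<le> 11 * k * ?n" by (simp only: ac_simps)
      have c: "cost backtrack \<le> cost backtrack * ?n" using mult_le_mono2[OF n1, of "cost backtrack"] by simp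
      have d: "(cost expand_body + 2) * (2 * ?n) \<le> 4 * (cost expand_body + 2) * ?n" by (simp add: algebra_simps)
      have "Cb * ?n = 4 * (cost expand_body + 2) * ?n + 11 * k * ?n + 25 * ?n + cost backtrack * ?n"
        unfolding Cb_def by (simp only: add_mult_distrib)
      then show ?thesis using a b c d by linarith
    qed
    then show "(cost expand_body + 2) * (2 * ?n) + 1 + (8 * ?n + 5 + ((8 * ?n + 3) * k + (1 + cost backtrack))) \<le> Cb * ?n - 3" by linarith
  qed auto
  moreover have "shows_items k z (head_output z @ ?out)"
    using shows_output[of "rev z"] k v by (simp add: valid_items_def rev_map[symmetric])
  ultimately show ?thesis by blast
qed

definition segment :: "item list \<Rightarrow> osym option list \<times> osym option list \<Rightarrow> bool" where
  "segment z = (\<lambda>(a, b). outs a \<noteq> [] \<and> length a \<le> Ca \<and> length a + length b \<le> (Ca + Cb) * length (outs a @ outs b) \<and>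
     shows_items k z (outs a @ outs b))"

lemma iteration:
  assumes e: "est s gs rt hs" "gs \<noteq> []" and r: "remaining M gs rt hs = z # zs" and v: "valid_items k z"
  shows "\<exists>a b s'. bs (Sq start_output (finish_output k)) s (a @ b) s' \<and> segment z (None # a, b @ [None]) \<and>
    continues s' zs"
proof -
  have z: "z = rev rt @ firsts M gs" using remaining_first[of M gs rt hs] r by auto
  obtain a s1 where 1: "bs start_output s a s1" "length a \<le> Ca - 1" "outs a = head_output z"
    "est s1 gs rt hs" "zrep (s1 F0 0) (s1 F1 0) (zeroth z)"
    using runs_start_output[OF e z] unfolding runs_def by blast
  obtain b s' where 2: "bs (finish_output k) s1 b s'" "length b \<le> Cb * length z - 3" "shows_items k z (outs a @ outs b)"
    "continues s' zs"
    using runs_finish_output[OF 1(4) r v 1(5)] unfolding runs_def 1(3)[symmetric] by blast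
  have n: "0 < length z" using v by (auto simp: valid_items_def)
  have len: "length z \<le> length (outs a @ outs b)" by (rule shows_items_length[OF v 2(3)])
  have "0 < Ca" "3 \<le> Cb" by (simp_all add: Ca_def Cb_def)
  then have "3 \<le> Cb * length z" using n by (cases "length z") auto
  then have "length (None # a) + length (b @ [None]) \<le> Ca + Cb * length z" using 1(2) 2(2) \<open>0 < Ca\<close> by simp
  also have "\<dots> \<le> (Ca + Cb) * length z" using n by (cases "length z") (auto simp: algebra_simps)
  also have "\<dots> \<le> (Ca + Cb) * length (outs a @ outs b)" using len by (rule mult_le_mono2)
  finally have "segment z (None # a, b @ [None])"
    using 1(2,3) 2(3) \<open>0 < Ca\<close> by (auto simp: segment_def split: option.splits)
  then show ?thesis using bs_Sq[OF 1(1) 2(1)] 2(4) by blast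
qed

text \<open>Induction over the lists still to come rather than over search states: each iteration
  removes the head of the list.\<close>

lemma enum_loop:
  assumes "est s gs rt hs" "gs \<noteq> []" "\<And>z. z \<in> set (remaining M gs rt hs) \<Longrightarrow> valid_items k z"
  shows "\<exists>segs s'. bs (enum_loop k) s (joined segs @ [None]) s' \<and> list_all2 segment (remaining M gs rt hs) segs"
proof -
  have "\<exists>segs s'. bs (enum_loop k) s (joined segs @ [None]) s' \<and> list_all2 segment zs segs"
    if "\<forall>z\<in>set zs. valid_items k z"
      "continues s zs" for zs s
    using that
  proof (induction zs arbitrary: s)
    case Nil
    have "bs (enum_loop k) s [None] s" unfolding enum_loop_def by (rule bs_LoopF) (use Nil B in auto)
    then show ?case by (intro exI[of _ "[]"] exI[of _ s]) simp
  next
    case (Cons z zs)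
    then obtain gs rt hs where 1: "gs \<noteq> []" "est s gs rt hs" "remaining M gs rt hs = z # zs" by auto
    obtain a b s1 where 2: "bs (Sq start_output (finish_output k)) s (a @ b) s1" "segment z (None # a, b @ [None])"
      "continues s1 zs"
      using iteration[OF 1(2,1,3)] Cons.prems(1) by auto
    obtain segs s' where 3: "bs (enum_loop k) s1 (joined segs @ [None]) s'" "list_all2 segment zs segs"
      using Cons.IH[OF _ 2(3)] Cons.prems(1) by auto
    have "s CUR 0 \<noteq> 0" using 1 curg_cases[of s gs] by (simp add: est_def)
    then have "bs (enum_loop k) s (None # (a @ b) @ None # joined segs @ [None]) s'"
      unfolding enum_loop_def by (intro bs_LoopT[OF _ _ 2(1) 3(1)[unfolded enum_loop_def]]) (use B in auto)
    then show ?case using 2(2) 3(2)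
      by (intro exI[of _ "(None # a, b @ [None]) # segs"] exI[of _ s']) simp
  qed
  moreover have "remaining M gs rt hs \<noteq> []" using remaining_first[of M gs rt hs] by auto
  ultimately show ?thesis using assms by (metis (no_types, lifting))
qed

end

section \<open>The complete program\<close>

definition flag_code :: "nat list \<Rightarrow> nm rcom" where
  "flag_code accs = seqs (map (\<lambda>q. Cond (neq (Ar QE (Vr VV)) q) Skip (F0 ::= Cn 1)) accs)"

definition emit_empty :: "nat \<Rightarrow> nm rcom" where
  "emit_empty k = seqs (replicate k (Emit Comma) @ [Emit Separator])"

lemma (in ram_env) bs_emit_empty: "bs (emit_empty k) s (replicate k (Some Comma) @ [Some Separator]) s"
proof -
  have "bs (Sq (Emit Separator) Skip) s ([Some Separator] @ []) s" by (rule bs_Sq[OF bs_Emit bs_Skip])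
  then have "bs (seqs (replicate k (Emit Comma) @ [Emit Separator])) s (replicate k (Some Comma) @ [Some Separator]) s"
  proof (induction k)
    case (Suc k)
    from bs_Sq[OF bs_Emit Suc.IH[OF Suc.prems]] show ?case by simp
  qed simp
  then show ?thesis by (simp add: emit_empty_def)
qed

text \<open>Node numbers decrease along every path below \<open>m\<close>, so a path has at most
  \<open>m\<close> nodes. A list is produced along one path per item, and there are at most
  \<open>mx c\<close> items.\<close>

lemma (in mach) need_nrep: "nrep c s m \<Longrightarrow> need c \<le> m * mx c"
proof (induction c arbitrary: m)
  case (Item A)
  then show ?case by simp
next
  case (Alt w1 a w2 b)
  then have l: "s LN m \<le> m - 1" "s RN m \<le> m - 1" and m: "0 < m" by auto
  have "need a \<le> (m - 1) * mx a" "need b \<le> (m - 1) * mx b"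
    using le_trans[OF Alt.IH(1)[of "s LN m"] mult_le_mono1[OF l(1)]] le_trans[OF Alt.IH(2)[of "s RN m"] mult_le_mono1[OF l(2)]] Alt.prems
    by (simp_all del: One_nat_def)
  moreover have "(m - 1) * mx a \<le> (m - 1) * max (mx a) (mx b)" "(m - 1) * mx b \<le> (m - 1) * max (mx a) (mx b)"
    by (intro mult_le_mono2; simp)+
  ultimately have "max (need a) (need b) \<le> (m - 1) * max (mx a) (mx b)" by linarith
  moreover have "1 \<le> max (mx a) (mx b)" using mx_pos[of a] by linarith
  moreover have "m * max (mx a) (mx b) = (m - 1) * max (mx a) (mx b) + max (mx a) (mx b)" using m by (cases m) auto
  ultimately show ?case unfolding need.simps mx.simps by linarith
next
  case (Prd w1 a w2 b)
  then have l: "s LN m \<le> m - 1" "s RN m \<le> m - 1" and m: "0 < m" by auto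
  have "need a \<le> (m - 1) * mx a" "need b \<le> (m - 1) * mx b"
    using le_trans[OF Prd.IH(1)[of "s LN m"] mult_le_mono1[OF l(1)]] le_trans[OF Prd.IH(2)[of "s RN m"] mult_le_mono1[OF l(2)]] Prd.prems
    by (simp_all del: One_nat_def)
  moreover have "m * (mx a + mx b) = (m - 1) * mx a + (m - 1) * mx b + (mx a + mx b)" using m by (cases m) (auto simp: algebra_simps)
  moreover have "1 \<le> mx a + mx b" using mx_pos[of a] by linarith
  ultimately show ?case by simp
qed

context mach
begin

text \<open>Row \<open>Q\<close> collects the references of the accepting rows, read through the
  identity weight. The sets stay disjoint because a list has only one state.\<close>

definition root_code :: "nat list \<Rightarrow> nm rcom" where
  "root_code accs = seqs [VV ::= In (Cn 1), LV ::= Vr VV, wid AB AC (Cn 0),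
     seqs (map (\<lambda>q. Sq (load_ref q LV AB AC) (add_code Q)) accs)]"

definition start_code :: "nm rcom" where
  "start_code = seqs [CUR ::= Ar (TN Q) (Vr VV), Set XY (Cn 1) (Cn 0), Set XY (Cn 2) (Cn 0),
     Cond (Vr CUR) (apply_weight (TB Q) (TC Q) (Vr VV)) Skip, SP ::= Cn 1, GP ::= Cn 0, TP ::= Cn 0, CP ::= Cn 0,
     GF ::= Cn 0, RF ::= Cn 0, F0 ::= Cn 0]"

end

text \<open>\<open>B_ge\<close> is the bound of \<open>need_nrep\<close>: the number of nodes, where
  the summand \<open>Q\<close> is for the unions made at the start vertex, times the largest
  possible length of a solution.\<close>

locale slp_enum = slp w N inp k la op Q n S cl cr lab t code As letters C + enum_mach w N inp k la op Q B
  for w N inp k and la :: "bool \<Rightarrow> 'a \<Rightarrow> nat set \<Rightarrow> nat" and op Q n S cl cr lab and t :: "nat \<Rightarrow> 'a ex" and code As letters C B +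
  fixes accs :: "nat list"
  assumes accs: "distinct accs" "\<And>q. q \<in> set accs \<Longrightarrow> q < Q"
    and forest: "\<not> isctx (t S)"
    and B_ge: "1 + (1 + C * n + Q) * length (leaves (t S)) \<le> B"
    and N_ge2: "2 * (1 + C * n + Q) + 2 < N"
begin

lemma valid0: "validpos M (t S) (0, 0)"
  using forest leaves[OF S] lsz_rsz[OF wf[OF S]] by (simp add: validpos_def)

lemma length_accs: "length accs \<le> Q"
proof -
  have "card (set accs) \<le> card {..<Q}" using accs(2) by (intro card_mono) auto
  then show ?thesis using distinct_card[OF accs(1)] by simp
qed

definition sols :: "item list set" where "sols = (\<Union>q\<in>set accs. RR (t S) (0, 0) q)"

lemma valid_sols: "z \<in> sols \<Longrightarrow> valid_items k z \<and> length z \<le> length (leaves (t S))"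
  unfolding sols_def valid_items_def
  using RR_ids[OF wf[OF S] valid0] RR_distinct[OF wf[OF S] valid0] RR_item[OF wf[OF S] valid0] by blast

definition rooted :: "state \<Rightarrow> ref \<Rightarrow> bool" where
  "rooted s r \<longleftrightarrow> rrep s (s (TN Q) S) (TB Q) (TC Q) S r \<and> distinct (refE M r (0, 0)) \<and> set (refE M r (0, 0)) = sols \<and>
     s VV 0 = S \<and> s QE S = qe (t S) \<and> s NX 0 \<le> 1 + C * n + Q"

lemma refE_idw: "refE M r (app M idw (0, 0)) = refE M r (0, 0)"
  by (simp add: app_def follow_def idw_def sel_def)

lemma wp_root_code:
  assumes inv: "inv s D []"
  shows "wp (root_code accs) (\<lambda>s'. \<exists>r. rooted s' r) s"
proof -
  have SD: "S \<in> D" and D: "D \<subseteq> {..<n}" using inv by (auto simp: inv_def)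
  obtain tab0 where tab0: "tabrep s S tab0" "table_ok (t S) tab0" and qeS: "s QE S = qe (t S)"
    using inv SD by (auto simp: inv_def vrep_def)
  have nx: "0 < s NX 0" "s NX 0 \<le> 1 + C * n"
  proof -
    have "C * card D \<le> C * n" using card_mono[OF _ D] by (intro mult_le_mono2) simp
    moreover have "0 < s NX 0" "s NX 0 \<le> 1 + C * card D" using inv by (simp_all add: inv_def)
    ultimately show "0 < s NX 0" "s NX 0 \<le> 1 + C * n" by linarith+
  qed
  have N: "2 < N" "2 * S + 2 < N" using N_ge S by auto
  have set0: "set (refE M (tab0 q) (0, 0)) = RR (t S) (0, 0) q" "distinct (refE M (tab0 q) (0, 0))" for q
    using tab0(2) valid0 by (auto simp: table_ok_def good_def)
  \<comment> \<open>A circuit in this row would yield a list leading to state \<open>Q\<close>, but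
    all runs end in states below \<open>Q\<close>.\<close>
  have "tab0 Q = None"
  proof (rule ccontr)
    assume "tab0 Q \<noteq> None"
    then obtain c y where "tab0 Q = Some (c, y)" by auto
    then have "refE M (tab0 Q) (0, 0) \<noteq> []" using E_first[of M c "app M y (0, 0)"] by (auto simp: refE_def)
    then obtain z where "z \<in> RR (t S) (0, 0) Q" using set0(1)[of Q] by (metis ex_in_conv set_empty)
    then show False using RR_less by blast
  qed
  define s1 where "s1 = wupd AB AC 0 idw (upd LV 0 S (upd VV 0 S s))"
  have e1: "s1 j = s j" if "j \<notin> {AB, AC, LV, VV}" for j using that by (simp add: s1_def)
  have t1: "tabrep s1 S tab0"
    by (rule tabrep_node_ext[OF _ _ tab0(1)]) (auto simp: node_ext_def s1_def node_arrays_def weight_arrays_def)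
  define I where "I = (\<lambda>xs s'. \<exists>tab. tabrep s' S tab \<and> (\<forall>q<Q. tab q = tab0 q) \<and> distinct (refE M (tab Q) (0, 0)) \<and>
     set (refE M (tab Q) (0, 0)) = (\<Union>q\<in>set xs. RR (t S) (0, 0) q) \<and> 0 < s' NX 0 \<and> s' NX 0 \<le> 1 + C * n + length xs \<and>
     s' VV 0 = S \<and> s' LV 0 = S \<and> s' QE S = qe (t S) \<and> wrep s' AB AC 0 idw)"
  have "wp (seqs (map (\<lambda>q. Sq (load_ref q LV AB AC) (add_code Q)) accs)) (\<lambda>s'. \<exists>r. rooted s' r) s1"
  proof (rule wp_seqs[of I])
    have "s1 VV 0 = S" "s1 LV 0 = S" "wrep s1 AB AC 0 idw" "s1 NX = s NX" "s1 QE = s QE" by (simp_all add: s1_def)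
    then show "I [] s1" unfolding I_def using t1 nx qeS \<open>tab0 Q = None\<close>
      by (intro exI[of _ tab0]) (simp add: refE_def)
  next
    fix xs q ys s2 assume xs: "accs = xs @ q # ys" and I: "I xs s2"
    obtain tab where tab: "tabrep s2 S tab" "\<forall>q<Q. tab q = tab0 q" "distinct (refE M (tab Q) (0, 0))"
      "set (refE M (tab Q) (0, 0)) = (\<Union>q\<in>set xs. RR (t S) (0, 0) q)" "0 < s2 NX 0" "s2 NX 0 \<le> 1 + C * n + length xs"
      "s2 VV 0 = S" "s2 LV 0 = S" "s2 QE S = qe (t S)" "wrep s2 AB AC 0 idw"
      using I unfolding I_def by blast
    have q: "q < Q" "q \<notin> set xs" "length xs < Q" using accs xs length_accs by auto
    have "tab q = tab0 q" "q \<le> Q" using tab(2) q(1) by auto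
    then have rr: "rrep s2 (s2 (TN q) S) (TB q) (TC q) S (tab0 q)" using tab(1) unfolding tabrep_def by metis
    have "wp (load_ref q LV AB AC) (wp (add_code Q) (I (xs @ [q]))) s2"
    proof (rule wp_mono[OF wp_load_ref[OF tab(8) N(2) tab(10) rr, where v = S]])
      fix s3 assume 3: "build_ext S s2 s3 \<and> s3 NX 0 = s2 NX 0 \<and> curr s3 (comp_ref M idw (tab0 q)) \<and>
        same_tabs s2 s3"
      have o3: "s3 j = s2 j" if "j \<notin> build_names" for j using build_ext_other[of S s2 s3] 3 that by blast
      have "node_ext s2 s3" using 3 by (simp add: build_ext_def)
      then have t3: "tabrep s3 S tab" by (rule tabrep_node_ext) (use 3 tab(1) in auto)
      have v3: "s3 VV 0 = S" using o3[of VV] tab(7) by simp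
      have n3: "s3 NX 0 = s2 NX 0" "curr s3 (comp_ref M idw (tab0 q))" using 3 by auto
      show "wp (add_code Q) (I (xs @ [q])) s3"
      proof (rule wp_mono[OF wp_add_code[OF n3(1) _ _ v3 N(2) order_refl n3(2) t3]])
        fix s4 assume 4: "build_ext S s3 s4 \<and> s4 NX 0 \<le> s2 NX 0 + 1 \<and>
          tabrep s4 S (tab(Q := add_ref (comp_ref M idw (tab0 q)) (tab Q)))"
        have o4: "s4 j = s2 j" if "j \<notin> build_names" for j using build_ext_other[of S s3 s4] 4 o3 that by simp
        let ?r = "add_ref (comp_ref M idw (tab0 q)) (tab Q)"
        have set1: "set (refE M (comp_ref M idw (tab0 q)) (0, 0)) = RR (t S) (0, 0) q" "distinct (refE M (comp_ref M idw (tab0 q)) (0, 0))"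
          unfolding refE_comp refE_idw using set0 by auto
        have disj: "RR (t S) (0, 0) q \<inter> (\<Union>q\<in>set xs. RR (t S) (0, 0) q) = {}"
          using RR_det[OF wf[OF S] valid0] q(2) by blast
        have a: "set (refE M ?r (0, 0)) = (\<Union>q\<in>set (xs @ [q]). RR (t S) (0, 0) q)"
          using refE_add(1)[of M "comp_ref M idw (tab0 q)" "tab Q" "(0, 0)"] unfolding set1 tab(4) by auto
        have b: "distinct (refE M ?r (0, 0))"
          using refE_add(2)[of M "comp_ref M idw (tab0 q)" "tab Q" "(0, 0)"] disj set1(2) tab(3) unfolding set1 tab(4) by blast
        have c: "0 < s4 NX 0" using 4 n3 tab(5) by (auto simp: build_ext_def node_ext_def)
        have "s4 VV 0 = S" "s4 LV 0 = S" "s4 QE S = qe (t S)" using o4[of VV] o4[of LV] o4[of QE] tab(7-9) by simp_all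
        moreover have "wrep s4 AB AC 0 idw" using o4[of AB] o4[of AC] tab(10) by (simp add: wrep_def)
        ultimately show "I (xs @ [q]) s4" unfolding I_def
          using 4 a b c tab(2,6) by (intro exI[of _ "tab(Q := ?r)"]) simp
      qed (use tab(5,6) q N_ge2 in auto)
    qed simp
    then show "wp (Sq (load_ref q LV AB AC) (add_code Q)) (I (xs @ [q])) s2" by simp
  next
    fix s' assume "I accs s'"
    then obtain tab where tab: "tabrep s' S tab" "distinct (refE M (tab Q) (0, 0))"
      "set (refE M (tab Q) (0, 0)) = (\<Union>q\<in>set accs. RR (t S) (0, 0) q)" "s' NX 0 \<le> 1 + C * n + length accs"
      "s' VV 0 = S" "s' QE S = qe (t S)"
      unfolding I_def by blast
    have "rrep s' (s' (TN Q) S) (TB Q) (TC Q) S (tab Q)" using tab(1) unfolding tabrep_def by simp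
    then have "rooted s' (tab Q)" using tab(2-6) length_accs unfolding rooted_def sols_def by simp
    then show "\<exists>r. rooted s' r" ..
  qed
  moreover have "inp ! 1 mod M = S" using words(1)[of "inp ! 1"] input by simp
  ultimately show ?thesis unfolding root_code_def
    using N input by (auto intro!: wp_wid simp: s1_def)
qed

lemma wp_start_code:
  assumes r: "rooted s r"
  shows "wp start_code (\<lambda>s'. s' F0 0 = 0 \<and> s' VV 0 = S \<and> s' QE S = qe (t S) \<and> (case r of None \<Rightarrow> s' CUR 0 = 0
     | Some (c, y) \<Rightarrow> est s' [(c, app M y (0, 0))] [] [])) s"
proof -
  have N: "2 < N" "2 * S + 2 < N" using N_ge S by auto
  have s: "rrep s (s (TN Q) S) (TB Q) (TC Q) S r" "s VV 0 = S" "s QE S = qe (t S)" "s NX 0 \<le> 1 + C * n + Q"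
    using r by (auto simp: rooted_def)
  define s1 where "s1 = upd XY 2 0 (upd XY 1 0 (upd CUR 0 (s (TN Q) S) s))"
  define fin where "fin = (\<lambda>s. upd F0 0 0 (upd RF 0 0 (upd GF 0 0 (upd CP 0 0 (upd TP 0 0 (upd GP 0 0 (upd SP 0 1 s)))))))"
  show ?thesis
  proof (cases r)
    case None
    then have "s (TN Q) S = 0" using s by (simp add: rrep_def)
    then show ?thesis using N s None by (simp add: start_code_def)
  next
    case (Some cy)
    then obtain c y where r: "r = Some (c, y)" by (cases cy) auto
    define s2 where "s2 = fin (set_pos (app M y (0, 0)) s1)"
    have n: "nrep c s (s (TN Q) S)" "wrep s (TB Q) (TC Q) S y" using s(1) by (auto simp: r rrep_def)
    have nz: "s (TN Q) S \<noteq> 0" "s (TN Q) S < s NX 0" using nrep_bounds[OF n(1)] by auto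
    have bn: "s2 j = s j" if "j \<in> build_names" for j
    proof -
      have "j \<noteq> Nm i 0" if "i \<in> {35, 36, 37, 34, 59, 51, 46, 40, 39, 38, 41}" for i using that \<open>j \<in> build_names\<close> by auto
      then show ?thesis by (simp add: s2_def fin_def s1_def)
    qed
    have nr: "nrep c s2 (s (TN Q) S)" by (rule nrep_cong[OF bn n(1)])
    \<comment> \<open>A longest list of the circuit is a solution, so \<open>mx c\<close> is at most
      the number of vertices of the forest.\<close>
    have "need c + 1 \<le> B"
    proof -
      obtain z where z: "z \<in> set (E M c (app M y (0, 0)))" "length z = mx c" using mx_attained by blast
      then have "z \<in> sols" using \<open>rooted s r\<close> by (simp add: rooted_def r refE_def)
      then have "mx c \<le> length (leaves (t S))" using valid_sols[of z] z(2) by simp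
      then have "s (TN Q) S * mx c \<le> (1 + C * n + Q) * length (leaves (t S))"
        using nz s(4) by (intro mult_le_mono) auto
      then show ?thesis using need_nrep[OF n(1)] B_ge by simp
    qed
    moreover have "norm M (app M y (0, 0))" by (rule norm_app) simp
    ultimately have est: "est s2 [(c, app M y (0, 0))] [] []"
      using nr bn[of NX] s(4) N_ge2 by (simp add: est_def cells_def curg_def) (simp add: s2_def fin_def s1_def)
    have "wp (apply_weight (TB Q) (TC Q) (Vr VV)) (\<lambda>s'. s' = set_pos (app M y (0, 0)) s1) s1"
      by (rule wp_apply_weight[where y = y]) (use N s n in \<open>simp_all add: s1_def wrep_def\<close>)
    then have "wp (apply_weight (TB Q) (TC Q) (Vr VV)) (wp (seqs [SP ::= Cn 1, GP ::= Cn 0, TP ::= Cn 0, CP ::= Cn 0,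
     GF ::= Cn 0, RF ::= Cn 0, F0 ::= Cn 0]) (\<lambda>s'. s' F0 0 = 0 \<and> s' VV 0 = S \<and> s' QE S = qe (t S) \<and> est s' [(c, app M y (0, 0))] [] [])) s1"
    proof (rule wp_mono)
      fix s' assume s': "s' = set_pos (app M y (0, 0)) s1"
      have "fin s' F0 0 = 0 \<and> fin s' VV 0 = S \<and> fin s' QE S = qe (t S) \<and> est (fin s') [(c, app M y (0, 0))] [] []"
        using est s unfolding s2_def s' by (simp add: fin_def s1_def)
      then show "wp (seqs [SP ::= Cn 1, GP ::= Cn 0, TP ::= Cn 0, CP ::= Cn 0,
        GF ::= Cn 0, RF ::= Cn 0, F0 ::= Cn 0]) (\<lambda>s'. s' F0 0 = 0 \<and> s' VV 0 = S \<and> s' QE S = qe (t S) \<and> est s' [(c, app M y (0, 0))] [] []) s'"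
        using N by (simp add: fin_def)
    qed
    then show ?thesis using N s nz by (simp add: start_code_def s1_def r)
  qed
qed

lemma wp_flag_code:
  assumes "s VV 0 = S" "s QE S = qe (t S)" "s F0 0 = 0"
  shows "wp (flag_code accs) (\<lambda>s'. s' = (if qe (t S) \<in> set accs then upd F0 0 1 s else s)) s"
proof -
  define I where "I = (\<lambda>xs s'. s' = (if qe (t S) \<in> set xs then upd F0 0 1 s else s))"
  have N: "0 < N" "S < N" using N_ge S by auto
  show ?thesis unfolding flag_code_def
  proof (rule wp_seqs[of I])
    fix xs q ys s' assume xs: "accs = xs @ q # ys" and I: "I xs s'"
    have v: "s' VV 0 = S" "s' QE S = qe (t S)" using I assms by (auto simp: I_def)
    have "q < M" using accs(2)[of q] xs QM by auto
    then have "aval (neq (Ar QE (Vr VV)) q) s' = 0 \<longleftrightarrow> qe (t S) = q"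
      using aval_neq[of "Ar QE (Vr VV)" s' q] v qe_less[of "t S"] QM by simp
    then show "wp (Cond (neq (Ar QE (Vr VV)) q) Skip (F0 ::= Cn 1)) (I (xs @ [q])) s'"
      using I N v by (auto simp: I_def upd_def fun_eq_iff)
  qed (simp_all add: I_def)
qed

definition program :: "nm rcom" where
  "program = Sq dfs (Sq (root_code accs) (Sq start_code (Sq (flag_code accs) (Sq (Cond (Vr F0) (emit_empty k) Skip)
     (Sq (enum_loop k) (Emit EndOfEnum))))))"

definition pre_cost :: nat where
  "pre_cost = 3 + ((cost dfs_body + 2) * 2 + 1) + cost (root_code accs) + cost start_code + cost (flag_code accs) + 2"

lemma est_upd_F0: "est s gs [] [] \<Longrightarrow> est (upd F0 0 v s) gs [] []"
proof -
  assume e: "est s gs [] []"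
  have h: "hagree b s (upd F0 0 v s)" for b by (auto intro!: hagree_upd hagree_refl)
  have "curg (upd F0 0 v s) gs"
  proof (cases gs)
    case (Cons g gs')
    then show ?thesis using e nrep_hagree[OF h, of "fst g" "s CUR 0"] grep_hagree[OF h, of "s GP 0" "s SP 0" gs']
      by (auto simp: est_def curg_def simp del: nrep.simps)
  qed (use e in \<open>simp add: est_def curg_def\<close>)
  then show ?thesis using e by (simp add: est_def cells_def)
qed

text \<open>The tuple of empty sets, if it is a result, comes first and has its own piece of the
  trace, so that it can be treated as one more segment. Otherwise the two steps of the failed test
  are counted as preprocessing.\<close>

theorem program_trace:
  "\<exists>pre segs zs s'. bs program (\<lambda>_ _. 0) (pre @ (if qe (t S) \<in> set accs then None # replicate k (Some Comma) @ [Some Separator, None] else []) @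
      joined segs @ [None, Some EndOfEnum]) s' \<and>
    outs pre = [] \<and> length pre \<le> pre_cost * n \<and> distinct zs \<and> set zs = sols \<and> list_all2 segment zs segs"
proof -
  obtain tr1 s1 D where 1: "bs dfs (\<lambda>_ _. 0) tr1 s1" "length tr1 \<le> 3 + ((cost dfs_body + 2) * (2 * n) + 1)" "outs tr1 = []" "inv s1 D []"
    using runs_dfs unfolding runs_def by blast
  obtain tr2 s2 r where 2: "bs (root_code accs) s1 tr2 s2" "length tr2 \<le> cost (root_code accs)" "outs tr2 = []" "rooted s2 r"
    using wp_runs[OF wp_root_code[OF 1(4)]] unfolding runs_def by blast
  obtain tr3 s3 where 3: "bs start_code s2 tr3 s3" "length tr3 \<le> cost start_code" "outs tr3 = []"
    "s3 F0 0 = 0" "s3 VV 0 = S" "s3 QE S = qe (t S)" "case r of None \<Rightarrow> s3 CUR 0 = 0 | Some (c, y) \<Rightarrow> est s3 [(c, app M y (0, 0))] [] []"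
    using wp_runs[OF wp_start_code[OF 2(4)]] unfolding runs_def by blast
  define s4 where "s4 = (if qe (t S) \<in> set accs then upd F0 0 1 s3 else s3)"
  obtain tr4 where 4: "bs (flag_code accs) s3 tr4 s4" "length tr4 \<le> cost (flag_code accs)" "outs tr4 = []"
    using wp_runs[OF wp_flag_code[OF 3(5,6,4)]] unfolding runs_def s4_def by blast
  let ?e = "if qe (t S) \<in> set accs then None # replicate k (Some Comma) @ [Some Separator, None] else []"
  define tr5 :: "osym option list" where "tr5 = (if qe (t S) \<in> set accs then [] else [None, None])"
  have 5: "bs (Cond (Vr F0) (emit_empty k) Skip) s4 (tr5 @ ?e) s4"
  proof (cases "qe (t S) \<in> set accs")
    case True
    have "bs (Cond (Vr F0) (emit_empty k) Skip) s4 (None # (replicate k (Some Comma) @ [Some Separator]) @ [None]) s4"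
      by (rule bs_CondT[OF _ _ bs_emit_empty]) (use True B in \<open>auto simp: s4_def\<close>)
    then show ?thesis using True by (simp add: tr5_def)
  next
    case False
    have "bs (Cond (Vr F0) (emit_empty k) Skip) s4 (None # [] @ [None]) s4"
      by (rule bs_CondF[OF _ _ bs_Skip]) (use False B 3(4) in \<open>auto simp: s4_def\<close>)
    then show ?thesis using False by (simp add: tr5_def)
  qed
  have zs: "distinct (refE M r (0, 0))" "set (refE M r (0, 0)) = sols" using 2(4) by (auto simp: rooted_def)
  have "\<exists>segs s'. bs (enum_loop k) s4 (joined segs @ [None]) s' \<and> list_all2 segment (refE M r (0, 0)) segs"
  proof (cases r)
    case None
    have "bs (enum_loop k) s4 [None] s4" unfolding enum_loop_def
      by (rule bs_LoopF) (use None 3(7) B in \<open>auto simp: s4_def\<close>)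
    then show ?thesis using None by (intro exI[of _ "[]"] exI[of _ s4]) (simp add: refE_def)
  next
    case (Some cy)
    then obtain c y where r: "r = Some (c, y)" by (cases cy) auto
    have e: "est s4 [(c, app M y (0, 0))] [] []" using 3(7) est_upd_F0 by (simp add: r s4_def)
    have rem: "remaining M [(c, app M y (0, 0))] [] [] = refE M r (0, 0)"
    proof -
      have "cross X [[]] = X" for X :: "item list list" by (induction X) auto
      then show ?thesis by (simp add: remaining_def r refE_def map_idI)
    qed
    show ?thesis by (rule enum_loop[OF e, unfolded rem]) (use valid_sols zs(2) in auto)
  qed
  then obtain segs s6 where 6: "bs (enum_loop k) s4 (joined segs @ [None]) s6" "list_all2 segment (refE M r (0, 0)) segs" by blast
  define pre where "pre = tr1 @ tr2 @ tr3 @ tr4 @ tr5"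
  have "bs program (\<lambda>_ _. 0) (tr1 @ tr2 @ tr3 @ tr4 @ (tr5 @ ?e) @ (joined segs @ [None]) @ [Some EndOfEnum]) s6"
    unfolding program_def by (intro bs_Sq[OF 1(1)] bs_Sq[OF 2(1)] bs_Sq[OF 3(1)] bs_Sq[OF 4(1)] bs_Sq[OF 5] bs_Sq[OF 6(1)] bs_Emit)
  then have b: "bs program (\<lambda>_ _. 0) (pre @ ?e @ joined segs @ [None, Some EndOfEnum]) s6"
    by (simp add: pre_def)
  have n: "1 \<le> n" using S by simp
  have len: "length pre \<le> pre_cost * n"
  proof -
    define x where "x = 4 + cost (root_code accs) + cost start_code + cost (flag_code accs) + 2"
    have "length pre \<le> (cost dfs_body + 2) * (2 * n) + x"
      using 1(2) 2(2) 3(2) 4(2) by (simp add: pre_def tr5_def x_def)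
    moreover have "x \<le> x * n" using n by simp
    moreover have "pre_cost * n = (cost dfs_body + 2) * (2 * n) + x * n"
      by (simp add: pre_cost_def x_def algebra_simps)
    ultimately show ?thesis by linarith
  qed
  have o: "outs pre = []" using 1(3) 2(3) 3(3) 4(3) by (simp add: pre_def tr5_def)
  show ?thesis
    by (rule exI[of _ pre], rule exI[of _ segs], rule exI[of _ "refE M r (0, 0)"], rule exI[of _ s6])
      (use b o len zs 6(2) in blast)
qed

end

section \<open>From f-SLPs to arrays\<close>

lemma nth_triples:
  "i < length vs \<Longrightarrow> concat (map (\<lambda>v. [f v, g v, h v]) vs) ! (3 * i) = f (vs ! i) \<and>
    concat (map (\<lambda>v. [f v, g v, h v]) vs) ! Suc (3 * i) = g (vs ! i) \<and>
    concat (map (\<lambda>v. [f v, g v, h v]) vs) ! Suc (Suc (3 * i)) = h (vs ! i)"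
proof (induction vs arbitrary: i)
  case (Cons v vs)
  then show ?case by (cases i) auto
qed simp

lemma index_of_member: "x \<in> set xs \<Longrightarrow> index_of xs x < length xs \<and> xs ! index_of xs x = x"
  by (induction xs) (auto simp: index_of_def)

lemma dag_child_unique:
  assumes "binary_dag G" "(v, d', u') \<in> dag_edges G"
  shows "v \<in> dag_verts G" "u' \<in> dag_verts G" "\<not> is_leaf G v" "\<exists>!u. (v, d, u) \<in> dag_edges G"
proof -
  show v: "v \<in> dag_verts G" and "u' \<in> dag_verts G" and l: "\<not> is_leaf G v"
    using assms by (auto simp: binary_dag_def is_leaf_def)
  have "\<forall>v\<in>dag_verts G. is_leaf G v \<or> (\<forall>d. \<exists>!u. (v, d, u) \<in> dag_edges G)"
    using assms(1) unfolding binary_dag_def by blast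
  then show "\<exists>!u. (v, d, u) \<in> dag_edges G" using v l by blast
qed

lemma unfolds_det:
  assumes "binary_dag G" shows "unfolds_to G v t \<Longrightarrow> unfolds_to G v t' \<Longrightarrow> t = t'"
proof (induction arbitrary: t' rule: unfolds_to.induct)
  case (unfolds_leaf v)
  from unfolds_leaf(3) show ?case by cases (use unfolds_leaf(2) in \<open>auto simp: is_leaf_def\<close>)
next
  case (unfolds_branch v u1 u2 t1 t2)
  note v = dag_child_unique(1,3)[OF assms unfolds_branch(1)] and unique = dag_child_unique(4)[OF assms unfolds_branch(1)]
  from unfolds_branch(7) show ?case
  proof cases
    case unfolds_leaf
    then show ?thesis using v by simp
  next
    case *: (unfolds_branch u1' u2' t1' t2')
    have "u1' = u1" "u2' = u2" using unique *(2,3) unfolds_branch(1,2) by blast+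
    then show ?thesis using * unfolds_branch(5,6) by auto
  qed
qed

lemma slp_vertex:
  assumes G: "binary_dag G" and t: "unfolds_to G v t" and e: "expr_value t \<noteq> None" and vs: "set vs = dag_verts G"
  shows "(\<exists>c a. ex_of t = Lf c a \<and> symb_code code (dag_label G v) = leaf_label code (c, a)) \<or>
    (\<exists>b u1 u2 t1 t2. ex_of t = Op b (ex_of t1) (ex_of t2) \<and> unfolds_to G u1 t1 \<and> unfolds_to G u2 t2 \<and>
       u1 \<in> dag_verts G \<and> u2 \<in> dag_verts G \<and> child_code G vs LeftSide v = index_of vs u1 \<and>
       child_code G vs RightSide v = index_of vs u2 \<and> symb_code code (dag_label G v) = (if b then 1 else 0))"
  using t
proof cases
  case unfolds_leaf
  then obtain a where "dag_label G v = Letter a \<or> dag_label G v = LetterCtx a"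
    using e by (cases "dag_label G v") auto
  then show ?thesis using unfolds_leaf by (auto simp: leaf_label_def)
next
  case (unfolds_branch u1 u2 t1 t2)
  have v: "v \<in> dag_verts G" "\<not> is_leaf G v" "u1 \<in> dag_verts G" "u2 \<in> dag_verts G"
    using dag_child_unique(1-3)[OF G unfolds_branch(2)] dag_child_unique(2)[OF G unfolds_branch(3)] by auto
  note unique = dag_child_unique(4)[OF G unfolds_branch(2)]
  have "(THE u. (v, LeftSide, u) \<in> dag_edges G) = u1" "(THE u. (v, RightSide, u) \<in> dag_edges G) = u2"
    using unique unfolds_branch(2,3) by (auto intro!: the1_equality)
  then have c: "child_code G vs LeftSide v = index_of vs u1" "child_code G vs RightSide v = index_of vs u2"
    using v(2) by (simp_all add: child_code_def)
  have "dag_label G v = HConcat \<or> dag_label G v = VConcat"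
    using e unfolds_branch(1) by (cases "dag_label G v") auto
  then have "\<exists>b. ex_of t = Op b (ex_of t1) (ex_of t2) \<and> symb_code code (dag_label G v) = (if b then 1 else 0)"
  proof
    assume "dag_label G v = HConcat"
    then show ?thesis using unfolds_branch(1) by (intro exI[of _ False]) simp
  next
    assume "dag_label G v = VConcat"
    then show ?thesis using unfolds_branch(1) by (intro exI[of _ True]) simp
  qed
  then show ?thesis using c v(3,4) unfolds_branch(4,5) by blast
qed

text \<open>Ranks vertices by the size of their expressions. Children have smaller rank, so the
  number of leaves at most doubles per rank; no topological order of the DAG is required.\<close>

lemma leaves_bound:
  assumes "\<And>i. i < (n::nat) \<Longrightarrow> (\<exists>c a. t i = Lf c a) \<or> (\<exists>b l r. t i = Op b (t l) (t r) \<and> l < n \<and> r < n)"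
  shows "i < n \<Longrightarrow> length (leaves (t i)) \<le> 2 ^ card {j. j < n \<and> size (t j) < size (t i)}"
proof (induction "size (t i)" arbitrary: i rule: less_induct)
  case less
  define D where "D = (\<lambda>i. {j. j < n \<and> size (t j) < size (t i)})"
  have fin: "finite (D i)" for i by (simp add: D_def)
  from assms[OF less.prems] show ?case
  proof (elim disjE exE conjE)
    fix b l r assume t: "t i = Op b (t l) (t r)" "l < n" "r < n"
    have sz: "size (t l) < size (t i)" "size (t r) < size (t i)" by (subst t(1), simp)+
    have "card (D j) < card (D i)" if "j < n" "size (t j) < size (t i)" for j
      by (rule psubset_card_mono[OF fin]) (use that in \<open>auto simp: D_def\<close>)
    then have c: "card (D j) \<le> card (D i) - 1" if "j < n" "size (t j) < size (t i)" for j using that by fastforce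
    have "length (leaves (t j)) \<le> 2 ^ (card (D i) - 1)" if "j < n" "size (t j) < size (t i)" for j
    proof -
      have "length (leaves (t j)) \<le> 2 ^ card (D j)" using less.hyps[OF that(2,1)] unfolding D_def .
      also have "\<dots> \<le> 2 ^ (card (D i) - 1)" using c[OF that] by (intro power_increasing) auto
      finally show ?thesis .
    qed
    moreover have "0 < card (D i)" using t(2) sz(1) fin by (auto simp: card_gt_0_iff D_def)
    then have "(2 :: nat) ^ card (D i) = 2 ^ (card (D i) - 1) + 2 ^ (card (D i) - 1 :: nat)" by (cases "card (D i)") auto
    ultimately have "length (leaves (t i)) \<le> 2 ^ card (D i)" using t sz by (simp add: t(1) add_mono)
    then show ?thesis unfolding D_def .
  qed simp
qed

lemma holes_Some: "holes (map_tree Some t) = 0"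
  by (induction t) simp

text \<open>The choice is determined: unfoldings exist in an f-SLP and are unique by
  \<open>unfolds_det\<close>.\<close>

definition expression :: "('v, 'a symb) bdag \<Rightarrow> 'v list \<Rightarrow> nat \<Rightarrow> 'a ex" where
  "expression G vs i = ex_of (SOME t. unfolds_to G (vs ! i) t)"

lemma fslp_arrays:
  fixes code :: "'a \<Rightarrow> nat"
  assumes F: "fslp_for G S F" and vs: "set vs = dag_verts G"
    and t_def: "t = expression G vs" and lab_def: "lab = (\<lambda>i. symb_code code (dag_label G (vs ! i)))"
    and cl_def: "cl = (\<lambda>i. child_code G vs LeftSide (vs ! i))" and cr_def: "cr = (\<lambda>i. child_code G vs RightSide (vs ! i))"
    and inp_def: "inp = encode_fslp code vs G S" and n_def: "n = length vs" and s_def: "s = index_of vs S"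
  shows "i < n \<Longrightarrow> (\<exists>c a. t i = Lf c a \<and> lab i = leaf_label code (c, a)) \<or>
      (\<exists>b. t i = Op b (t (cl i)) (t (cr i)) \<and> cl i < n \<and> cr i < n \<and> lab i = (if b then 1 else 0))"
    and "i < n \<Longrightarrow> wfx (t i)"
    and "length inp = 2 + 3 * n" "inp ! 0 = n" "inp ! 1 = s"
    and "i < n \<Longrightarrow> inp ! (2 + 3 * i) = lab i \<and> inp ! (3 + 3 * i) = cl i \<and> inp ! (4 + 3 * i) = cr i"
    and "s < n" and "val (t s) = map (map_tree Some) F" and "\<not> isctx (t s)"
    and "x \<in> set inp \<Longrightarrow> x \<le> n \<or> (\<exists>y. x = symb_code code y)"
    and "i < n \<Longrightarrow> length (leaves (t i)) \<le> 2 ^ n"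
proof -
  have G: "binary_dag G" using F by (simp add: fslp_for_def fslp_def)
  have ti: "\<exists>T. unfolds_to G (vs ! i) T \<and> expr_value T \<noteq> None \<and> t i = ex_of T" if "i < n" for i
  proof -
    have "vs ! i \<in> dag_verts G" using that vs nth_mem[of i vs] by (simp add: n_def)
    moreover have "\<forall>v\<in>dag_verts G. \<exists>t. unfolds_to G v t \<and> expr_value t \<noteq> None" using F unfolding fslp_for_def fslp_def by blast
    ultimately obtain T where T: "unfolds_to G (vs ! i) T" "expr_value T \<noteq> None" by blast
    then have "(SOME t. unfolds_to G (vs ! i) t) = T" by (intro some_equality unfolds_det[OF G])
    then show ?thesis using T by (intro exI[of _ T]) (simp add: t_def expression_def)
  qed
  have tu: "t (index_of vs u) = ex_of T" "index_of vs u < n" if "unfolds_to G u T" "u \<in> dag_verts G" for u T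
  proof -
    have u: "index_of vs u < n" "vs ! index_of vs u = u" using index_of_member[of u vs] that(2) vs by (simp_all add: n_def)
    have "(SOME t. unfolds_to G u t) = T" using that(1) by (intro some_equality unfolds_det[OF G])
    then show "t (index_of vs u) = ex_of T" "index_of vs u < n" using u by (simp_all add: t_def expression_def)
  qed
  show inner: "(\<exists>c a. t i = Lf c a \<and> lab i = leaf_label code (c, a)) \<or>
      (\<exists>b. t i = Op b (t (cl i)) (t (cr i)) \<and> cl i < n \<and> cr i < n \<and> lab i = (if b then 1 else 0))" if "i < n" for i
  proof -
    obtain T where T: "unfolds_to G (vs ! i) T" "expr_value T \<noteq> None" "t i = ex_of T" using ti[OF \<open>i < n\<close>] by blast
    from slp_vertex[OF G T(1,2) vs, of code] show ?thesis
    proof (elim disjE exE conjE)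
      fix b u1 u2 t1 t2 assume *: "ex_of T = Op b (ex_of t1) (ex_of t2)" "unfolds_to G u1 t1" "unfolds_to G u2 t2"
       "u1 \<in> dag_verts G" "u2 \<in> dag_verts G" "child_code G vs LeftSide (vs ! i) = index_of vs u1"
       "child_code G vs RightSide (vs ! i) = index_of vs u2" "symb_code code (dag_label G (vs ! i)) = (if b then 1 else 0)"
      show ?thesis using tu[OF *(2,4)] tu[OF *(3,5)] * T(3)
        by (intro disjI2 exI[of _ b]) (simp add: cl_def cr_def lab_def)
    next
      fix c a assume "ex_of T = Lf c a" "symb_code code (dag_label G (vs ! i)) = leaf_label code (c, a)"
      then show ?thesis using T(3) by (intro disjI1 exI[of _ c] exI[of _ a]) (simp add: lab_def)
    qed
  qed
  show "wfx (t i)" if "i < n" for i using ti[OF that] by (auto dest: expr_value_ex)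
  have inp: "inp = n # s # concat (map (\<lambda>v. [symb_code code (dag_label G v), child_code G vs LeftSide v, child_code G vs RightSide v]) vs)"
    by (simp add: inp_def encode_fslp_def n_def s_def)
  have "length (concat (map (\<lambda>v. [f v, g v, h v]) xs)) = 3 * length xs" for f g h :: "'c \<Rightarrow> nat" and xs by (induction xs) auto
  then show "length inp = 2 + 3 * n" "inp ! 0 = n" "inp ! 1 = s" by (simp_all add: inp n_def)
  show "inp ! (2 + 3 * i) = lab i \<and> inp ! (3 + 3 * i) = cl i \<and> inp ! (4 + 3 * i) = cr i" if "i < n" for i
    using nth_triples[of i vs "\<lambda>v. symb_code code (dag_label G v)" "child_code G vs LeftSide" "child_code G vs RightSide"] that
    by (simp add: inp n_def lab_def cl_def cr_def numeral_eq_Suc)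
  have S: "S \<in> dag_verts G" using F by (simp add: fslp_for_def)
  obtain T where T: "unfolds_to G S T" "expr_value T = Some (map (map_tree Some) F)" using F by (auto simp: fslp_for_def)
  have ts: "t s = ex_of T" "s < n" using tu[OF T(1) S] by (simp_all add: s_def)
  then show "s < n" "val (t s) = map (map_tree Some) F" using expr_value_ex[OF T(2)] by simp_all
  moreover have "hcount (map (map_tree Some) F) = 0" by (simp add: hcount_def holes_Some o_def)
  ultimately show "\<not> isctx (t s)" using val_holes[of "t s"] expr_value_ex[OF T(2)] ts(1) by (simp split: if_splits)
  show "x \<le> n \<or> (\<exists>y. x = symb_code code y)" if "x \<in> set inp"
  proof -
    have "child_code G vs d v \<le> n" if "v \<in> dag_verts G" for d v
    proof (cases "is_leaf G v")
      case False
      then obtain d' u' where "(v, d', u') \<in> dag_edges G" by (auto simp: is_leaf_def)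
      from dag_child_unique(4)[OF G this, of d] have "(v, d, THE u. (v, d, u) \<in> dag_edges G) \<in> dag_edges G" by (rule theI')
      then have "(THE u. (v, d, u) \<in> dag_edges G) \<in> set vs" using G vs by (auto simp: binary_dag_def)
      from index_of_member[OF this] show ?thesis using False by (simp add: child_code_def n_def)
    qed (simp add: child_code_def)
    then show ?thesis using that ts(2) vs unfolding inp by auto
  qed
  show "length (leaves (t i)) \<le> 2 ^ n" if "i < n" for i
  proof -
    have "length (leaves (t i)) \<le> 2 ^ card {j. j < n \<and> size (t j) < size (t i)}"
      by (rule leaves_bound[OF _ that]) (use inner in blast)
    also have "card {j. j < n \<and> size (t j) < size (t i)} \<le> card {..<n}" by (intro card_mono) auto
    then have "2 ^ card {j. j < n \<and> size (t j) < size (t i)} \<le> (2 :: nat) ^ n" by (intro power_increasing) auto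
    finally show ?thesis .
  qed
qed

text \<open>Everything is absorbed into powers of two. One factor \<open>2 ^ n\<close> stems from
  the number of leaves, the other one from the factor linear in \<open>n\<close>, and
  \<open>2 ^ e\<close> covers the constants.\<close>

lemma power_bound:
  fixes n m K C Q e c :: nat
  assumes "1 \<le> n" "n \<le> m" "(K + 1) * (2 * C + 2 * Q + 16) \<le> 2 ^ e" "c \<ge> e + 2"
  shows "(K + 1) * ((2 * (1 + C * n + Q) + 3 * n + 10) * 2 ^ n + 1) \<le> 2 ^ (c * m :: nat)"
proof -
  define x y where xy: "x = Q * n" "y = C * n"
  have n: "Q \<le> x" using assms(1) by (simp add: xy)
  have "2 * (1 + C * n + Q) + 3 * n + 11 \<le> 2 * (C * n) + 2 * (Q * n) + 16 * n"
    unfolding xy[symmetric] using assms(1) n by simp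
  also have "\<dots> = (2 * C + 2 * Q + 16) * n" by (simp add: algebra_simps)
  also have "\<dots> \<le> (2 * C + 2 * Q + 16) * 2 ^ n" by (intro mult_le_mono2 less_imp_le less_exp)
  finally have "(2 * (1 + C * n + Q) + 3 * n + 11) * 2 ^ n \<le> (2 * C + 2 * Q + 16) * 2 ^ n * 2 ^ n" by (rule mult_le_mono1)
  moreover have "(2 * (1 + C * n + Q) + 3 * n + 10) * 2 ^ n + 1 \<le> (2 * (1 + C * n + Q) + 3 * n + 11) * 2 ^ n" by (simp add: algebra_simps)
  ultimately have "(K + 1) * ((2 * (1 + C * n + Q) + 3 * n + 10) * 2 ^ n + 1) \<le> (K + 1) * ((2 * C + 2 * Q + 16) * 2 ^ n * 2 ^ n)"
    by (intro mult_le_mono2) linarith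
  also have "\<dots> = ((K + 1) * (2 * C + 2 * Q + 16)) * 2 ^ n * 2 ^ n" by (simp only: ac_simps)
  also have "\<dots> \<le> 2 ^ e * 2 ^ n * 2 ^ n" using assms(3) by (intro mult_le_mono1)
  also have "\<dots> = 2 ^ (e + 2 * n)" by (simp add: power_add mult_2)
  also have "e + 2 * n \<le> c * m"
  proof -
    have "e \<le> e * m" using assms(1,2) by simp
    then have "e + 2 * n \<le> e * m + 2 * m" using assms(2) by (intro add_mono) auto
    also have "\<dots> = (e + 2) * m" by (simp add: algebra_simps)
    also have "\<dots> \<le> c * m" using assms(4) by (rule mult_le_mono1)
    finally show ?thesis .
  qed
  then have "2 ^ (e + 2 * n) \<le> (2 :: nat) ^ (c * m)" by (intro power_increasing) auto
  finally show ?thesis .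
qed

theorem theorem1p1:
  fixes \<Psi> :: "'a::finite mso" and k :: nat and code :: "'a \<Rightarrow> nat"
  assumes "mso_query k \<Psi>" and "inj code"
  shows "\<exists>(P :: program) (cw :: nat) (cp :: nat) (cd :: nat).
    \<forall>(G :: (nat, 'a symb) bdag) (vs :: nat list) (S :: nat) (F :: 'a forest).
      fslp_for G S F \<and> distinct vs \<and> set vs = dag_verts G \<longrightarrow>
      enumerates (cw * dag_size G) P (encode_fslp code vs G S)
        (tuple_output F) (query_result k \<Psi> F) (cp * dag_size G) cd"
proof -
  have "recognizable (\<lambda>(t :: ('a \<times> nat) ex) s. msat t s \<Psi>)" by (rule recognizable_msat)
  then obtain Q lf op acc where alg: "closed_alg {..<Q::nat} lf op"
    and rec: "\<And>(T :: ('a \<times> nat) ex) s. wfx T \<Longrightarrow> distinct (leaves T) \<Longrightarrow> msat T s \<Psi> \<longleftrightarrow> run lf op T s \<in> acc"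
    unfolding recognizable_def by blast
  define la where "la = (\<lambda>c a A. lf c (a :: 'a) (case_sum (\<lambda>_. False) (\<lambda>j. j \<in> A)))"
  have la: "la c a A < Q" for c a A using alg by (auto simp: closed_alg_def la_def)
  have op: "op v p q < Q" if "p < Q" "q < Q" for v p q using alg that by (auto simp: closed_alg_def)
  obtain As where As: "distinct As" "set As = {A. A \<subseteq> {..<k} \<and> A \<noteq> {}}"
    using finite_distinct_list[of "{A. A \<subseteq> {..<k} \<and> A \<noteq> {}}"] by auto
  obtain letters :: "'a list" where letters: "distinct letters" "set letters = UNIV"
    using finite_distinct_list[of "UNIV :: 'a set"] by auto
  define accs where "accs = filter (\<lambda>q. q \<in> acc) [0..<Q]"
  define C where "C = 6 * Q * Q + 2 * length As"
  \<comment> \<open>Exported from the locale, the program depends on the algebra, the query and the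
    coding of letters, but not on word length, input or f-SLP. So a single machine program is
    compiled for all inputs.\<close>
  define prog where "prog = slp_enum.program k la op Q code As letters accs"
  obtain P K where comp: "\<And>w N inp tr s'. K * (N + 1) \<le> 2 ^ w \<Longrightarrow> ram_env.bs w N inp prog (\<lambda>_ _. 0) tr s' \<Longrightarrow>
    \<exists>tr'. dilated K tr tr' \<and> halted P (config_at w P inp (length tr')) \<and> tr' = map (output_at w P inp) [0..<length tr']"
    using compilation[of prog] by blast
  \<comment> \<open>Used as an exponent later: by \<open>x \<le> 2 ^ x\<close> no logarithm has to
    be taken.\<close>
  define e where "e = (K + 1) * (2 * C + 2 * Q + 16)"
  define m0 where "m0 = 2 + Max (range (leaf_label code))"
  \<comment> \<open>\<open>e + 2\<close> makes the memory addressable; \<open>m0\<close> and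
    \<open>Q\<close> make the codes of labels and the states fit into a word.\<close>
  define cw where "cw = e + 2 + m0 + Q"
  define p0 where "p0 = slp_enum.pre_cost k la op Q code As letters accs"
  define c0 where "c0 = enum_mach.Ca + k + 3"
  define d0 where "d0 = enum_mach.Ca + enum_mach.Cb k + k + 3"
  have "enumerates (cw * dag_size G) P (encode_fslp code vs G S) (tuple_output F) (query_result k \<Psi> F)
      ((K * p0 + K * c0) * dag_size G) (K * d0 + K * c0)"
    if G: "fslp_for G S F" "distinct vs" "set vs = dag_verts G" for G :: "(nat, 'a symb) bdag" and vs S and F :: "'a forest"
  proof -
    define n where "n = length vs"
    define t where "t = expression G vs"
    define lab where "lab = (\<lambda>i. symb_code code (dag_label G (vs ! i)))"
    define cl where "cl = (\<lambda>i. child_code G vs LeftSide (vs ! i))"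
    define cr where "cr = (\<lambda>i. child_code G vs RightSide (vs ! i))"
    define inp where "inp = encode_fslp code vs G S"
    define r where "r = index_of vs S"
    define w where "w = cw * dag_size G"
    \<comment> \<open>The factor \<open>2 ^ n\<close> bounds the number of leaves, on which the heap
      depends; the linear factor covers nodes, stack and input addresses.\<close>
    define N where "N = (2 * (1 + C * n + Q) + 3 * n + 10) * 2 ^ n"
    define B where "B = 1 + (1 + C * n + Q) * length (leaves (t r))"
    note arr = fslp_arrays[OF G(1,3) t_def lab_def cl_def cr_def inp_def n_def r_def]
    have n1: "1 \<le> n" "n \<le> dag_size G"
      using arr(7) distinct_card[OF G(2)] G(3) by (auto simp: n_def dag_size_def)
    have KN: "(K + 1) * (N + 1) \<le> 2 ^ w" unfolding N_def w_def
      by (rule power_bound[OF n1]) (auto simp: e_def cw_def intro: less_imp_le less_exp)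
    then have NM: "N + 1 \<le> 2 ^ w" "K * (N + 1) \<le> 2 ^ w" by (auto simp: algebra_simps)
    have w: "m0 \<le> w" "Q \<le> w"
      using n1 mult_le_mono2[of 1 "dag_size G" cw] by (auto simp: w_def cw_def)
    have lw: "leaf_label code x < 2 ^ w" "symb_code code y < 2 ^ w" for x y
    proof -
      have m: "leaf_label code x \<le> m0" for x
      proof -
        have "leaf_label code x \<le> Max (range (leaf_label code))" by (rule Max_ge) simp_all
        then show ?thesis unfolding m0_def by linarith
      qed
      have "symb_code code y \<le> m0"
        using m[of "(False, case y of Letter a \<Rightarrow> a | LetterCtx a \<Rightarrow> a)"] m[of "(True, case y of Letter a \<Rightarrow> a | LetterCtx a \<Rightarrow> a)"]
        by (cases y) (auto simp: leaf_label_def m0_def)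
      moreover have "m0 < 2 ^ w" using w(1) less_exp[of w] by linarith
      ultimately show "leaf_label code x < 2 ^ w" "symb_code code y < 2 ^ w" using m[of x] by auto
    qed
    have two: "1 \<le> (2::nat) ^ n" by simp
    have Nb: "2 * (1 + C * n + Q) + 3 * n + 10 \<le> N" unfolding N_def using mult_le_mono2[OF two] by simp
    have leaves_n: "length (leaves (t i)) \<le> 2 ^ n" if "i < n" for i by (rule arr(11)[OF that])
    have lN: "2 ^ n < N" unfolding N_def by (simp add: two)
    have BN: "B + 2 < N"
    proof -
      have "(1 + C * n + Q) * length (leaves (t r)) \<le> (1 + C * n + Q) * 2 ^ n"
        using leaves_n[OF arr(7)] by (rule mult_le_mono2)
      moreover have "N = (1 + C * n + Q) * 2 ^ n + (1 + C * n + Q + 3 * n + 10) * 2 ^ n"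
        unfolding N_def add_mult_distrib[symmetric] by simp
      moreover have "10 \<le> (1 + C * n + Q + 3 * n + 10) * 2 ^ n"
        using mult_le_mono[OF _ two, of 10 "1 + C * n + Q + 3 * n + 10"] by simp
      ultimately show ?thesis unfolding B_def by linarith
    qed
    have qM: "Q < 2 ^ w" using Nb NM(1) by simp
    have lM: "length (leaves (t i)) < 2 ^ w" if "i < n" for i using leaves_n[OF that] lN NM(1) by simp
    interpret E: slp_enum w N inp k la op Q n r cl cr lab t code As letters C B accs
    proof unfold_locales
      show "x < 2 ^ w" if "x \<in> set inp" for x
      proof -
        have "n < 2 ^ w" using Nb NM(1) by simp
        then show ?thesis using arr(10)[OF that] lw(2) by auto
      qed
      show "N \<le> 2 ^ w" "Q < 2 ^ w" using NM qM by auto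
      show "2 * (1 + C * n) + 2 < N" "3 * n + 4 < N" "2 * (1 + C * n + Q) + 2 < N" using Nb by auto
      show "inp ! (2 + 3 * i) = lab i \<and> inp ! (3 + 3 * i) = cl i \<and> inp ! (4 + 3 * i) = cr i" if "i < n" for i
        by (rule arr(6)[OF that])
      show "(\<exists>c a. t i = Lf c a \<and> lab i = leaf_label code (c, a)) \<or>
        (\<exists>b. t i = Op b (t (cl i)) (t (cr i)) \<and> cl i < n \<and> cr i < n \<and> lab i = (if b then 1 else 0))" if "i < n" for i
        by (rule arr(1)[OF that])
    qed (use la op arr(2-5,7,9) As letters assms(2) lw lM BN in \<open>auto simp: C_def accs_def B_def\<close>)
    interpret T: query_forest F "t r" "2 ^ w" k lf op \<Psi> acc
      by unfold_locales (use arr(2,7-9) lM assms(1) rec in auto)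
    have sols: "E.sols = T.solutions"
    proof -
      have "q \<in> set accs" if "q \<in> acc" "z \<in> E.RR (t r) (0, 0) q" for q z
        using that E.RR_less[OF that(2)] by (simp add: accs_def)
      then have "E.sols = (\<Union>q\<in>acc. E.RR (t r) (0, 0) q)" unfolding E.sols_def by (auto simp: accs_def)
      then show ?thesis unfolding T.solutions_def la_def .
    qed
    have qacc: "E.qe (t r) \<in> set accs \<longleftrightarrow> E.qe (t r) \<in> acc" using E.qe_less[of "t r"] by (simp add: accs_def)
    obtain pre segs zs s' where tr: "E.bs prog (\<lambda>_ _. 0) (pre @ (if E.qe (t r) \<in> set accs then None # replicate k (Some Comma) @ [Some Separator, None] else []) @
        joined segs @ [None, Some EndOfEnum]) s'"
      and pre: "outs pre = []" "length pre \<le> p0 * n" and zs: "distinct zs" "set zs = E.sols" and segs: "list_all2 E.segment zs segs"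
      using E.program_trace unfolding prog_def p0_def by blast
    define b where "b \<longleftrightarrow> E.qe (t r) \<in> acc"
    define segs' where "segs' = (if b then [(None # replicate k (Some Comma) @ [Some Separator, None], [])] else []) @ segs"
    define xs where "xs = (if b then [replicate k {}] else []) @ map (decode F k) zs"
    have outs_rep: "outs (None # replicate k (Some Comma) @ [Some Separator, None]) = replicate k Comma @ [Separator]"
      by (induction k) (simp_all add: outs_def)
    obtain tr' where tr': "dilated K (pre @ joined segs' @ [None, Some EndOfEnum]) tr'"
      "halted P (config_at w P inp (length tr'))" "tr' = map (output_at w P inp) [0..<length tr']"
      using comp[OF NM(2) tr] unfolding segs'_def b_def qacc by (auto split: if_splits)
    have "p0 * n \<le> p0 * dag_size G" using n1(2) by (rule mult_le_mono2)
    \<comment> \<open>\<open>enumeratesI\<close> adds one more \<open>c0\<close>. With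
      \<open>dag_size G - 1\<close> copies as slack, the total becomes a multiple of
      \<open>dag_size G\<close>.\<close>
    then have pre': "length pre \<le> p0 * dag_size G + c0 * (dag_size G - 1)" using pre(2) by linarith
    have "enumerates w P inp (tuple_output F) (query_result k \<Psi> F)
      (K * (p0 * dag_size G + c0 * (dag_size G - 1)) + K * c0) (K * d0 + K * c0)"
    proof (rule enumeratesI[OF tr'(2,3,1) refl pre(1) pre'])
      fix a1 b1 assume "(a1, b1) \<in> set segs'"
      then consider "(a1, b1) \<in> set segs" | "a1 = None # replicate k (Some Comma) @ [Some Separator, None]" "b1 = []"
        unfolding segs'_def by (auto split: if_splits)
      then show "outs a1 \<noteq> [] \<and> length a1 \<le> c0 \<and> length a1 + length b1 \<le> d0 * length (outs a1 @ outs b1)"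
      proof cases
        case 1
        then obtain i where i: "i < length segs" "segs ! i = (a1, b1)" by (auto simp: in_set_conv_nth)
        then have "E.segment (zs ! i) (a1, b1)" using list_all2_nthD2[OF segs, of i] by simp
        then have *: "outs a1 \<noteq> []" "length a1 \<le> E.Ca" "length a1 + length b1 \<le> (E.Ca + E.Cb) * length (outs a1 @ outs b1)"
          by (auto simp: E.segment_def)
        have "(E.Ca + E.Cb) * length (outs a1 @ outs b1) \<le> d0 * length (outs a1 @ outs b1)"
          by (rule mult_le_mono1) (simp add: d0_def)
        then have "length a1 + length b1 \<le> d0 * length (outs a1 @ outs b1)" using *(3) by (rule le_trans[rotated])
        then show ?thesis using *(1,2) by (simp add: c0_def)
      next
        case 2
        have "d0 * 1 \<le> d0 * (k + 1)" by (intro mult_le_mono2) simp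
        then show ?thesis unfolding 2 outs_rep by (simp add: c0_def d0_def)
      qed
    next
      show "outs [None, Some EndOfEnum] = [EndOfEnum]" "length [None, Some EndOfEnum] \<le> c0" by (simp_all add: c0_def)
    next
      have zsol: "set zs = T.solutions" using zs(2) sols by simp
      have "distinct (map (decode F k) zs)" using zs(1) T.decode_inj zsol by (simp add: distinct_map)
      moreover have "replicate k {} \<notin> decode F k ` T.solutions" using T.decode_nonempty by force
      ultimately show "distinct xs" using zsol by (simp add: xs_def)
      show "set xs = query_result k \<Psi> F" unfolding T.query_result_solutions xs_def b_def la_def
        using zsol by auto
      have "list_all2 (tuple_output F) (map (decode F k) zs) (map (\<lambda>(a, b). outs a @ outs b) segs)"
        unfolding list_all2_map1 list_all2_map2
      proof (rule list.rel_mono_strong[OF segs])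
        fix z ab assume "z \<in> set zs" "E.segment z ab"
        then show "tuple_output F (decode F k z) (case ab of (a, b) \<Rightarrow> outs a @ outs b)"
          using T.decode_output zsol by (fastforce simp: E.segment_def shows_items_def)
      qed
      then show "list_all2 (tuple_output F) xs (map (\<lambda>(a, b). outs a @ outs b) segs')"
        using T.empty_output outs_rep by (simp add: xs_def segs'_def)
    qed
    moreover have "K * (p0 * dag_size G + c0 * (dag_size G - 1)) + K * c0 = (K * p0 + K * c0) * dag_size G"
      using n1 by (cases "dag_size G") (auto simp: algebra_simps)
    ultimately show ?thesis by (simp add: w_def inp_def)
  qed
  then show ?thesis by blast
qed

end
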